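(* Let $D$ be a v-alternating virtual link diagram. Then $D$ is not equivalent to a classical link diagram.
   Context: An (oriented) virtual link diagram is a (nonempty) closed oriented 1-manifold generically immersed in $\mathbf{R}^2$, each double point being labeled either a real crossing (with over/under information, as in classical knot theory) or a virtual crossing (no over/under information). A classical link diagram is a virtual link diagram without virtual crossings. Two diagrams are equivalent if related by a finite sequence of generalized Reidemeister moves: planar isotopy, the classical Reidemeister moves I, II, III on real crossings, the analogous moves I, II, III with all crossings virtual, and the mixed move III in which an arc with two virtual crossings is moved across a real crossing. A diagram is alternating if, travelling along each component, over- and under-passes at real crossings alternate (virtual crossings ignored). The abstract link diagram $\phi(D)=(\Sigma,\mathcal D)$ associated with $D$ consists of a compact oriented surface $\Sigma$ and a link diagram $\mathcal D$ in $\Sigma$, obtained by thickening $D$ to a planar regular neighborhood at real crossings and along arcs, while at each virtual crossing the two bands pass one over the other without meeting. A real crossing $p$ of $D$ is proper if the four boundary arcs of $\Sigma$ in the neighborhood of the corresponding crossing of $\mathcal D$ belong to four distinct connected components of $\partial\Sigma$; $D$ is proper if every real crossing is proper. A diagram is v-alternating if it is obtained from a proper alternating virtual link diagram by virtualizing one real crossing, i.e. by replacing one real crossing with a virtual crossing. *)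

theory Defs
  imports "HOL-Analysis.Analysis"
begin

text \<open>
  The plane is \<^typ>\<open>complex\<close>. The source 1-manifold of a diagram is a disjoint union of
  finitely many oriented circles, each presented as \<^typ>\<open>real\<close> modulo 1: a point of it is given
  by a pair \<open>(i, x)\<close>, and \<open>(i, x)\<close>, \<open>(i, x + 1)\<close> are the same point. The immersion and the
  crossing labels are stored as 1-periodic functions of \<open>x\<close>. Immersions and diffeomorphisms are
  of class \<open>C\<^sup>1\<close>.
\<close>

type_synonym point = "nat \<times> real"

definition same_point :: "point \<Rightarrow> point \<Rightarrow> bool" where
  "same_point p q \<longleftrightarrow> fst p = fst q \<and> snd p - snd q \<in> \<int>"

text \<open>
  The label of a double point is recorded at its two preimages: \<open>Over\<close> and \<open>Under\<close> at a real
  crossing, \<open>Virt\<close> at both preimages of a virtual crossing. Labels at other points of the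
  1-manifold carry no information.
\<close>

datatype passage = Over | Under | Virt

record diagram =
  comps :: nat
  curve :: "nat \<Rightarrow> real \<Rightarrow> complex"
  label :: "nat \<Rightarrow> real \<Rightarrow> passage"

definition plane_at :: "diagram \<Rightarrow> point \<Rightarrow> complex" where
  "plane_at D p = curve D (fst p) (snd p)"

definition velocity :: "diagram \<Rightarrow> point \<Rightarrow> complex" where
  "velocity D p = vector_derivative (curve D (fst p)) (at (snd p))"

definition label_at :: "diagram \<Rightarrow> point \<Rightarrow> passage" where
  "label_at D p = label D (fst p) (snd p)"

definition cross :: "complex \<Rightarrow> complex \<Rightarrow> real" where
  "cross v w = Re v * Im w - Im v * Re w"

definition double_pair :: "diagram \<Rightarrow> point \<Rightarrow> point \<Rightarrow> bool" where
  "double_pair D p q \<longleftrightarrow> fst p < comps D \<and> fst q < comps D \<and>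
     \<not> same_point p q \<and> plane_at D p = plane_at D q"

definition double_preimage :: "diagram \<Rightarrow> point \<Rightarrow> bool" where
  "double_preimage D p \<longleftrightarrow> (\<exists>q. double_pair D p q)"

definition virtual_link_diagram :: "diagram \<Rightarrow> bool" where
  "virtual_link_diagram D \<longleftrightarrow>
     0 < comps D \<and>
     (\<forall>i < comps D.
        curve D i C1_differentiable_on UNIV \<and>
        (\<forall>x. velocity D (i, x) \<noteq> 0) \<and>
        (\<forall>x. curve D i (x + 1) = curve D i x) \<and>
        (\<forall>x. label D i (x + 1) = label D i x)) \<and>
     finite {p. 0 \<le> snd p \<and> snd p < 1 \<and> double_preimage D p} \<and>
     (\<forall>p q r. double_pair D p q \<longrightarrow> double_pair D p r \<longrightarrow> same_point q r) \<and>
     (\<forall>p q. double_pair D p q \<longrightarrow> cross (velocity D p) (velocity D q) \<noteq> 0) \<and>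
     (\<forall>p q. double_pair D p q \<longrightarrow>
        (label_at D p, label_at D q) \<in> {(Over, Under), (Under, Over), (Virt, Virt)})"

definition real_pair :: "diagram \<Rightarrow> point \<Rightarrow> point \<Rightarrow> bool" where
  "real_pair D p q \<longleftrightarrow> double_pair D p q \<and> label_at D p \<noteq> Virt \<and> label_at D q \<noteq> Virt"

definition real_preimage :: "diagram \<Rightarrow> point \<Rightarrow> bool" where
  "real_preimage D p \<longleftrightarrow> (\<exists>q. real_pair D p q)"

definition classical_link_diagram :: "diagram \<Rightarrow> bool" where
  "classical_link_diagram D \<longleftrightarrow> virtual_link_diagram D \<and>
     (\<forall>p. double_preimage D p \<longrightarrow> label_at D p \<noteq> Virt)"

text \<open>
  Since \<open>x\<close> and \<open>y\<close> range over all reals, the alternation is cyclic along each component; a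
  component with an odd number of passages through real crossings is not alternating.
\<close>

definition alternating :: "diagram \<Rightarrow> bool" where
  "alternating D \<longleftrightarrow>
     (\<forall>i x y. x < y \<longrightarrow> real_preimage D (i, x) \<longrightarrow> real_preimage D (i, y) \<longrightarrow>
        (\<forall>z. x < z \<and> z < y \<longrightarrow> \<not> real_preimage D (i, z)) \<longrightarrow>
        label D i x \<noteq> label D i y)"


section \<open>Generalized Reidemeister moves\<close>

definition C1_map :: "(complex \<Rightarrow> complex) \<Rightarrow> bool" where
  "C1_map h \<longleftrightarrow> (\<exists>h' :: complex \<Rightarrow> complex \<Rightarrow>\<^sub>L complex.
     (\<forall>z. (h has_derivative blinfun_apply (h' z)) (at z)) \<and> continuous_on UNIV h')"

definition C1_diffeo :: "(complex \<Rightarrow> complex) \<Rightarrow> bool" where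
  "C1_diffeo h \<longleftrightarrow> bij h \<and> C1_map h \<and> C1_map (inv h)"

text \<open>
  Two presentations of the same oriented labelled immersed 1-manifold: they differ by renumbering
  the circles and by orientation-preserving diffeomorphisms of the circles.
\<close>

definition reparametrized :: "diagram \<Rightarrow> diagram \<Rightarrow> bool" where
  "reparametrized D D' \<longleftrightarrow> comps D' = comps D \<and>
     (\<exists>\<sigma> \<phi>. bij_betw \<sigma> {..<comps D} {..<comps D} \<and>
        (\<forall>i < comps D.
           \<phi> i C1_differentiable_on UNIV \<and>
           (\<forall>x. \<exists>d > 0. (\<phi> i has_real_derivative d) (at x)) \<and>
           (\<forall>x. \<phi> i (x + 1) = \<phi> i x + 1) \<and>
           (\<forall>x. curve D' i x = curve D (\<sigma> i) (\<phi> i x)) \<and>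
           (\<forall>x. double_preimage D' (i, x) \<longrightarrow> label D' i x = label D (\<sigma> i) (\<phi> i x))))"

definition ambient_isotopy :: "(real \<Rightarrow> complex \<Rightarrow> complex) \<Rightarrow> bool" where
  "ambient_isotopy H \<longleftrightarrow>
     H 0 = id \<and> (\<forall>t \<in> {0..1}. C1_diffeo (H t)) \<and>
     continuous_on ({0..1} \<times> UNIV) (\<lambda>(t, z). H t z) \<and>
     (\<exists>H' :: real \<times> complex \<Rightarrow> complex \<Rightarrow>\<^sub>L complex.
        (\<forall>t \<in> {0..1}. \<forall>z. (H t has_derivative blinfun_apply (H' (t, z))) (at z)) \<and>
        continuous_on ({0..1} \<times> UNIV) H')"

definition planar_isotopic :: "diagram \<Rightarrow> diagram \<Rightarrow> bool" where
  "planar_isotopic D D' \<longleftrightarrow> comps D' = comps D \<and>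
     (\<exists>H. ambient_isotopy H \<and>
        (\<forall>i < comps D. \<forall>x. curve D' i x = H 1 (curve D i x) \<and>
           (double_preimage D (i, x) \<longrightarrow> label D' i x = label D i x)))"

text \<open>
  A local move takes place in a disc \<open>h ` model_disc\<close> of the plane. Before the move the diagram
  meets the disc in \<open>k\<close> arcs, the images under \<open>h\<close> of the model arcs \<open>t \<mapsto> \<alpha> m t\<close> for
  \<open>t \<in> {-1..1}\<close>; after the move it meets the disc in the images of \<open>\<beta> m\<close>. Outside the disc nothing
  changes. The set \<open>J m\<close> is the interval of the 1-manifold mapped to the \<open>m\<close>-th arc. The
  diffeomorphism \<open>h\<close> may reverse the orientation of the plane and \<open>\<tau> m\<close> may be decreasing, so
  that all mirror images and all orientations of the arcs are covered. The model arcs used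
  below start and end on the boundary of the model disc, and \<open>\<alpha> m\<close>, \<open>\<beta> m\<close> agree to first
  order at \<open>-1\<close> and \<open>1\<close>.
\<close>

definition model_disc :: "complex set" where
  "model_disc = {z. \<bar>Re z\<bar> \<le> 1 \<and> \<bar>Im z\<bar> \<le> 1}"

definition local_move ::
  "nat \<Rightarrow> (nat \<Rightarrow> real \<Rightarrow> complex) \<Rightarrow> (nat \<Rightarrow> real \<Rightarrow> complex) \<Rightarrow> (nat \<Rightarrow> point set) \<Rightarrow>
   diagram \<Rightarrow> diagram \<Rightarrow> bool" where
  "local_move k \<alpha> \<beta> J D D' \<longleftrightarrow> comps D' = comps D \<and>
     (\<exists>h c a b \<tau>. C1_diffeo h \<and>
        (\<forall>m < k. c m < comps D \<and> a m < b m \<and> J m = {c m} \<times> {a m..b m} \<and>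
           continuous_on {a m..b m} (\<tau> m) \<and> bij_betw (\<tau> m) {a m..b m} {-1..1} \<and>
           (\<forall>x \<in> {a m..b m}. curve D (c m) x = h (\<alpha> m (\<tau> m x)) \<and>
                             curve D' (c m) x = h (\<beta> m (\<tau> m x)))) \<and>
        (\<forall>m < k. \<forall>m' < k. \<forall>p \<in> J m. \<forall>q \<in> J m'. same_point p q \<longrightarrow> m = m' \<and> p = q) \<and>
        (\<forall>p. fst p < comps D \<longrightarrow> (\<forall>m < k. \<forall>q \<in> J m. \<not> same_point p q) \<longrightarrow>
           plane_at D' p = plane_at D p \<and> plane_at D p \<notin> h ` model_disc \<and>
           (double_preimage D p \<longrightarrow> label_at D' p = label_at D p)))"

text \<open>
  Move I creates a kink, whose crossing may be real or virtual.
\<close>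

definition move_I :: "diagram \<Rightarrow> diagram \<Rightarrow> bool" where
  "move_I D D' \<longleftrightarrow> (\<exists>J. local_move 1
     (\<lambda>_ t. Complex t 0)
     (\<lambda>_ t. Complex (t - 4 * t * (1 - t\<^sup>2)\<^sup>2) ((1 - t\<^sup>2)\<^sup>2 / 2))
     J D D')"

text \<open>
  Move II creates a bigon between two arcs. As the label is constant along arc \<open>0\<close>, either both
  crossings are virtual, or both are real and the same arc is the upper one at both.
\<close>

definition move_II :: "diagram \<Rightarrow> diagram \<Rightarrow> bool" where
  "move_II D D' \<longleftrightarrow> (\<exists>J s. local_move 2
     (\<lambda>m t. if m = 0 then Complex t 0 else Complex t (1/2))
     (\<lambda>m t. if m = 0 then Complex t 0 else Complex t (1/2 - (1 - t\<^sup>2)\<^sup>2))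
     J D D' \<and>
     (\<forall>p \<in> J 0. double_preimage D' p \<longrightarrow> label_at D' p = s))"

text \<open>
  In move III the label on arc \<open>m\<close> at its crossing with arc \<open>m'\<close> is \<open>l m m'\<close>, before and after
  the move. The three alternatives are the classical move (a top, a middle and a bottom arc), the
  virtual move, and the mixed move (arc \<open>v\<close> has two virtual crossings and is moved across the
  real crossing of the other two).
\<close>

definition move_III_labels :: "(nat \<Rightarrow> nat \<Rightarrow> passage) \<Rightarrow> bool" where
  "move_III_labels l \<longleftrightarrow>
     (\<exists>height :: nat \<Rightarrow> nat. inj_on height {..<3} \<and>
        (\<forall>m < 3. \<forall>m' < 3. m \<noteq> m' \<longrightarrow> l m m' = (if height m' < height m then Over else Under))) \<or>
     (\<forall>m < 3. \<forall>m' < 3. m \<noteq> m' \<longrightarrow> l m m' = Virt) \<or>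
     (\<exists>v < 3. \<forall>m < 3. \<forall>m' < 3. m \<noteq> m' \<longrightarrow> (l m m' = Virt \<longleftrightarrow> m = v \<or> m' = v))"

definition move_III :: "diagram \<Rightarrow> diagram \<Rightarrow> bool" where
  "move_III D D' \<longleftrightarrow> (\<exists>J l. local_move 3
     (\<lambda>m t. if m = 0 then Complex t (t/2) else if m = 1 then Complex t (- t/2)
            else Complex t ((1 - t\<^sup>2)\<^sup>2 / 2))
     (\<lambda>m t. if m = 0 then Complex t (t/2) else if m = 1 then Complex t (- t/2)
            else Complex t (- (1 - t\<^sup>2)\<^sup>2 / 2))
     J D D' \<and>
     move_III_labels l \<and>
     (\<forall>m < 3. \<forall>m' < 3. m \<noteq> m' \<longrightarrow> (\<forall>p \<in> J m. \<forall>q \<in> J m'.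
        (plane_at D p = plane_at D q \<longrightarrow> label_at D p = l m m') \<and>
        (plane_at D' p = plane_at D' q \<longrightarrow> label_at D' p = l m m'))))"

definition elementary_move :: "diagram \<Rightarrow> diagram \<Rightarrow> bool" where
  "elementary_move D D' \<longleftrightarrow> virtual_link_diagram D \<and> virtual_link_diagram D' \<and>
     (reparametrized D D' \<or> planar_isotopic D D' \<or> move_I D D' \<or> move_II D D' \<or> move_III D D')"

definition equivalent_diagrams :: "diagram \<Rightarrow> diagram \<Rightarrow> bool" where
  "equivalent_diagrams = equivclp elementary_move"


section \<open>The abstract link diagram and proper diagrams\<close>

text \<open>
  The surface \<open>\<Sigma>\<close> is obtained from the union of bands \<open>M \<times> {-1..1}\<close> over the 1-manifold \<open>M\<close>. In
  \<open>(i, x, s)\<close> the coordinate \<open>s\<close> increases to the left of the oriented curve. At each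
  real crossing the two squares of the bands of half-length \<open>\<epsilon>\<close> are identified, as in a planar
  neighborhood of the crossing in which the strand at \<open>(i, a)\<close> runs in the direction of the first
  axis and the strand at \<open>(j, b)\<close> in the direction of the second. Nothing is identified at virtual
  crossings. The core curve \<open>s = 0\<close>, with its labels at the real crossings, is the link diagram
  in \<open>\<Sigma>\<close>.
\<close>

inductive band_glue ::
  "diagram \<Rightarrow> real \<Rightarrow> nat \<times> real \<times> real \<Rightarrow> nat \<times> real \<times> real \<Rightarrow> bool" for D \<epsilon> where
  period: "band_glue D \<epsilon> (i, x, s) (i, x + 1, s)"
| square: "\<lbrakk>real_pair D (i, a) (j, b); cross (velocity D (i, a)) (velocity D (j, b)) > 0;
     \<bar>u\<bar> \<le> 1; \<bar>v\<bar> \<le> 1\<rbrakk> \<Longrightarrow> band_glue D \<epsilon> (i, a + \<epsilon> * u, v) (j, b + \<epsilon> * v, - u)"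

text \<open>Small enough for the squares on each band to be disjoint.\<close>

definition band_width :: "diagram \<Rightarrow> real \<Rightarrow> bool" where
  "band_width D \<epsilon> \<longleftrightarrow> 0 < \<epsilon> \<and>
     (\<forall>i x y. real_preimage D (i, x) \<longrightarrow> real_preimage D (i, y) \<longrightarrow> x \<noteq> y \<longrightarrow> 2 * \<epsilon> < \<bar>x - y\<bar>)"

definition band_class ::
  "diagram \<Rightarrow> real \<Rightarrow> nat \<times> real \<times> real \<Rightarrow> (nat \<times> real \<times> real) set" where
  "band_class D \<epsilon> P = {Q. equivclp (band_glue D \<epsilon>) P Q}"

definition quotient_topology :: "'a topology \<Rightarrow> ('a \<Rightarrow> 'b) \<Rightarrow> 'b topology" where
  "quotient_topology X f =
     topology (\<lambda>U. U \<subseteq> f ` topspace X \<and> openin X {x \<in> topspace X. f x \<in> U})"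

lemma openin_quotient_topology:
  "openin (quotient_topology X f) U \<longleftrightarrow>
     U \<subseteq> f ` topspace X \<and> openin X {x \<in> topspace X. f x \<in> U}"
proof -
  let ?P = "\<lambda>U. U \<subseteq> f ` topspace X \<and> openin X {x \<in> topspace X. f x \<in> U}"
  have "istopology ?P"
    unfolding istopology_def
  proof (intro conjI allI impI)
    fix S T assume S: "?P S" and T: "?P T"
    then show "S \<inter> T \<subseteq> f ` topspace X" by blast
    have "{x \<in> topspace X. f x \<in> S \<inter> T} =
        {x \<in> topspace X. f x \<in> S} \<inter> {x \<in> topspace X. f x \<in> T}" by blast
    then show "openin X {x \<in> topspace X. f x \<in> S \<inter> T}" using S T by auto
  next
    fix K assume K: "\<forall>S\<in>K. ?P S"
    then show "\<Union>K \<subseteq> f ` topspace X" by blast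
    have "{x \<in> topspace X. f x \<in> \<Union>K} = \<Union>((\<lambda>S. {x \<in> topspace X. f x \<in> S}) ` K)" by blast
    then show "openin X {x \<in> topspace X. f x \<in> \<Union>K}" using K by auto
  qed
  then show ?thesis
    by (simp add: quotient_topology_def)
qed

lemma quotient_map_quotient_topology: "quotient_map X (quotient_topology X f) f"
proof -
  have "topspace (quotient_topology X f) = f ` topspace X"
  proof
    show "topspace (quotient_topology X f) \<subseteq> f ` topspace X"
      using openin_quotient_topology[of X f "topspace (quotient_topology X f)"] by simp
    have "{x \<in> topspace X. f x \<in> f ` topspace X} = topspace X" by blast
    then have "openin (quotient_topology X f) (f ` topspace X)"
      by (simp add: openin_quotient_topology)
    then show "f ` topspace X \<subseteq> topspace (quotient_topology X f)"
      by (rule openin_subset)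
  qed
  then show ?thesis
    by (auto simp: quotient_map_def openin_quotient_topology)
qed

definition abstract_surface :: "diagram \<Rightarrow> real \<Rightarrow> (nat \<times> real \<times> real) set topology" where
  "abstract_surface D \<epsilon> =
     quotient_topology (top_of_set ({..<comps D} \<times> UNIV \<times> {-1..1})) (band_class D \<epsilon>)"

text \<open>The points \<open>(i, x, \<plusminus>1)\<close> lying over the interior of a square are interior points of \<open>\<Sigma>\<close>.\<close>

definition surface_boundary :: "diagram \<Rightarrow> real \<Rightarrow> (nat \<times> real \<times> real) set set" where
  "surface_boundary D \<epsilon> = band_class D \<epsilon> `
     {(i, x, s). i < comps D \<and> s \<in> {-1, 1} \<and> (\<forall>y. real_preimage D (i, y) \<longrightarrow> \<epsilon> \<le> \<bar>x - y\<bar>)}"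

text \<open>
  The four boundary arcs of \<open>\<Sigma>\<close> near the real crossing at \<open>p\<close> pass through the four corners
  \<open>(\<sigma>, \<tau>)\<close> of its square.
\<close>

definition corner :: "diagram \<Rightarrow> real \<Rightarrow> point \<Rightarrow> real \<times> real \<Rightarrow> (nat \<times> real \<times> real) set" where
  "corner D \<epsilon> p c = band_class D \<epsilon> (fst p, snd p + \<epsilon> * fst c, snd c)"

definition proper_crossing :: "diagram \<Rightarrow> real \<Rightarrow> point \<Rightarrow> bool" where
  "proper_crossing D \<epsilon> p \<longleftrightarrow>
     (\<forall>c \<in> {-1, 1} \<times> {-1, 1}. \<forall>d \<in> {-1, 1} \<times> {-1, 1}. c \<noteq> d \<longrightarrow>
        \<not> connected_component_of (subtopology (abstract_surface D \<epsilon>) (surface_boundary D \<epsilon>))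
            (corner D \<epsilon> p c) (corner D \<epsilon> p d))"

text \<open>Up to homeomorphism \<open>\<Sigma>\<close> does not depend on \<open>\<epsilon>\<close>.\<close>

definition proper_diagram :: "diagram \<Rightarrow> bool" where
  "proper_diagram D \<longleftrightarrow>
     (\<exists>\<epsilon>. band_width D \<epsilon> \<and> (\<forall>p. real_preimage D p \<longrightarrow> proper_crossing D \<epsilon> p))"


section \<open>v-alternating diagrams\<close>

definition virtualized :: "diagram \<Rightarrow> diagram \<Rightarrow> bool" where
  "virtualized E D \<longleftrightarrow> comps D = comps E \<and>
     (\<forall>i < comps E. curve D i = curve E i) \<and>
     (\<exists>p q. real_pair E p q \<and>
        (\<forall>r. double_preimage E r \<longrightarrow>
           label_at D r = (if same_point r p \<or> same_point r q then Virt else label_at E r)))"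

definition v_alternating :: "diagram \<Rightarrow> bool" where
  "v_alternating D \<longleftrightarrow> virtual_link_diagram D \<and>
     (\<exists>E. virtual_link_diagram E \<and> proper_diagram E \<and> alternating E \<and> virtualized E D)"

end

theory Submission
  imports Defs "HOL-Complex_Analysis.Complex_Analysis"
begin

text \<open>
  The Kauffman bracket ignores virtual crossings and changes only by powers of \<open>- A^3\<close> under the
  generalized Reidemeister moves. Each diagram is a pattern of chords (its real crossings) on the
  circles, and its states are counted by gluing germs at the chords. For a classical diagram, winding
  numbers modulo 2 give a checkerboard orientation of the germs that every smoothing respects, so
  that switching the smoothing of one crossing always changes the number of circles by exactly one.
  Then all exponents in the bracket are congruent modulo 4, that is, replacing \<open>A\<close> by \<open>\<i> * A\<close>
  multiplies the bracket by a constant. This property is preserved by equivalence.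
  Virtualizing a crossing of a proper alternating diagram replaces the number of circles of a state by
  the smaller of the numbers for the two smoothings at that crossing. By properness the all-A and
  all-B states are adequate, so the extreme terms of the bracket survive, and their exponents fall
  into different classes modulo 4.
\<close>

section \<open>Counting the classes of a generated equivalence relation\<close>

text \<open>The contradiction is a count modulo 4. For the diagram \<open>E\<close> with c crossings
  and a, b circles in the all-A and all-B states, the extreme exponents are c + 2a and -(c + 2b).
  Virtualizing lowers c, a and b by one each, so the span changes by 6, whereas the rule that
  adjacent states of \<open>E\<close> differ by one circle forces c + a + b to be even. The smaller
  count arises because a source-sink orientation splits the four germs at a crossing two against
  two: both smoothings join opposite germs, the virtual passage joins equal ones, and this always
  gives the lower of the two counts. The bracket is kept as a complex function of A, so that
  congruence of exponents becomes a functional equation, tested as A tends to infinity and to 0;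
  powers of -A^3 on both sides take the place of the writhe. For invariance the difficulty is that
  circles are global but moves are local: the outside of a disc enters only as an arbitrary relation
  between the end germs, which leaves finitely many tangle patterns to compare by
  computation.\<close>

definition ncls :: "'a set \<Rightarrow> ('a \<Rightarrow> 'a \<Rightarrow> bool) \<Rightarrow> nat" where
  "ncls V R = card ((\<lambda>v. Collect (equivclp R v)) ` V)"

definition fin_cls :: "'a set \<Rightarrow> ('a \<Rightarrow> 'a \<Rightarrow> bool) \<Rightarrow> bool" where
  "fin_cls V R \<longleftrightarrow> finite ((\<lambda>v. Collect (equivclp R v)) ` V)"

lemma cls_eq_iff: "Collect (equivclp R u) = Collect (equivclp R v) \<longleftrightarrow> equivclp R u v"
  by (auto intro: equivclp_trans equivclp_sym)

lemma equivclp_map: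
  assumes "equivclp R u v" "\<And>u v. R u v \<Longrightarrow> equivclp R' (f u) (f v)"
  shows "equivclp R' (f u) (f v)"
  using assms(1)
proof (induction rule: equivclp_induct)
  case (step y z)
  then show ?case using assms(2) by (metis equivclp_trans equivclp_sym)
qed simp

lemma equivclp_le:
  assumes "equivclp R u v" "\<And>u v. R u v \<Longrightarrow> equivclp R' u v"
  shows "equivclp R' u v"
  using equivclp_map[of R u v R' "\<lambda>x. x"] assms by blast

lemma equivclp_cong:
  assumes "\<And>u v. R u v \<Longrightarrow> equivclp R' u v" "\<And>u v. R' u v \<Longrightarrow> equivclp R u v"
  shows "equivclp R = equivclp R'"
  by (intro ext iffI) (meson assms equivclp_le)+

lemma ncls_cong:
  assumes "\<And>u v. R u v \<Longrightarrow> equivclp R' u v" "\<And>u v. R' u v \<Longrightarrow> equivclp R u v"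
  shows "ncls V R = ncls V R'"
  unfolding ncls_def using equivclp_cong[OF assms] by simp

text \<open>The two maps have to be mutually inverse only up to the relations. This allows an
  uncountable set of germs to be compared with a finite one, and one tangle with another that has
  the same ends.\<close>

lemma
  assumes f: "\<And>v. v \<in> V \<Longrightarrow> f v \<in> V'" and g: "\<And>v. v \<in> V' \<Longrightarrow> g v \<in> V"
    and Rf: "\<And>u v. R u v \<Longrightarrow> equivclp R' (f u) (f v)"
    and Rg: "\<And>u v. R' u v \<Longrightarrow> equivclp R (g u) (g v)"
    and gf: "\<And>v. v \<in> V \<Longrightarrow> equivclp R (g (f v)) v"
    and fg: "\<And>v. v \<in> V' \<Longrightarrow> equivclp R' (f (g v)) v"
  shows ncls_transfer: "ncls V R = ncls V' R'"
    and fin_cls_transfer: "fin_cls V R \<longleftrightarrow> fin_cls V' R'"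
proof -
  let ?c = "\<lambda>v. Collect (equivclp R v)" and ?c' = "\<lambda>v. Collect (equivclp R' v)"
  define F where "F C = ?c' (f (SOME v. v \<in> V \<and> C = ?c v))" for C
  have iff: "equivclp R u v \<longleftrightarrow> equivclp R' (f u) (f v)" if "u \<in> V" "v \<in> V" for u v
  proof
    assume "equivclp R' (f u) (f v)"
    then have "equivclp R (g (f u)) (g (f v))" using equivclp_map Rg by metis
    then show "equivclp R u v" using gf that by (meson equivclp_trans equivclp_sym)
  qed (use equivclp_map Rf in metis)
  have F: "F (?c v) = ?c' (f v)" if "v \<in> V" for v
  proof -
    define u where "u = (SOME u. u \<in> V \<and> ?c v = ?c u)"
    have "u \<in> V \<and> ?c v = ?c u"
      unfolding u_def by (rule someI[of _ v]) (simp add: that)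
    then have "equivclp R v u" "u \<in> V" by (auto simp: cls_eq_iff)
    then show ?thesis unfolding F_def u_def[symmetric]
      by (subst cls_eq_iff) (metis iff that equivclp_sym)
  qed
  have "bij_betw F (?c ` V) (?c' ` V')"
    unfolding bij_betw_def
  proof
    show "inj_on F (?c ` V)"
    proof (rule inj_onI)
      fix C C' assume "C \<in> ?c ` V" "C' \<in> ?c ` V" and eq: "F C = F C'"
      then obtain u v where uv: "u \<in> V" "v \<in> V" "C = ?c u" "C' = ?c v" by blast
      then have "equivclp R' (f u) (f v)" using eq F by (simp add: cls_eq_iff)
      then show "C = C'" using uv iff cls_eq_iff by metis
    qed
    have "F ` ?c ` V = (\<lambda>v. ?c' (f v)) ` V" using F by (auto simp: image_iff)
    also have "\<dots> = ?c' ` V'"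
    proof (intro equalityI subsetI)
      fix C assume "C \<in> ?c' ` V'"
      then obtain v where v: "v \<in> V'" "C = ?c' v" by blast
      then have "C = ?c' (f (g v))" using fg cls_eq_iff equivclp_sym by metis
      then show "C \<in> (\<lambda>v. ?c' (f v)) ` V" using g v by blast
    qed (use f in blast)
    finally show "F ` ?c ` V = ?c' ` V'" .
  qed
  then show "ncls V R = ncls V' R'" "fin_cls V R \<longleftrightarrow> fin_cls V' R'"
    unfolding ncls_def fin_cls_def using bij_betw_same_card bij_betw_finite by blast+
qed

definition add_pair :: "('a \<Rightarrow> 'a \<Rightarrow> bool) \<Rightarrow> 'a \<Rightarrow> 'a \<Rightarrow> 'a \<Rightarrow> 'a \<Rightarrow> bool" where
  "add_pair R a b u v \<longleftrightarrow> R u v \<or> u = a \<and> v = b"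

text \<open>A path that uses the new pair several times can be shortened until it uses it
  once.\<close>

lemma equivclp_add_pair:
  "equivclp (add_pair R a b) u v \<longleftrightarrow>
     equivclp R u v \<or> equivclp R u a \<and> equivclp R b v \<or> equivclp R u b \<and> equivclp R a v"
  (is "?l \<longleftrightarrow> ?r")
proof
  assume ?l
  then show ?r
  proof (induction rule: equivclp_induct)
    case (step y z)
    have "equivclp R y z \<or> y = a \<and> z = b \<or> y = b \<and> z = a"
      using step(2) unfolding add_pair_def by (auto intro: equivclp_sym)
    then show ?case using step(3) by (metis equivclp_trans equivclp_sym equivclp_refl)
  qed simp
next
  have m: "equivclp (add_pair R a b) x y" if "equivclp R x y" for x y
    using that by (rule equivclp_le) (auto simp: add_pair_def)
  have "equivclp (add_pair R a b) a b" by (auto simp: add_pair_def)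
  then show ?l if ?r using that m by (metis equivclp_trans equivclp_sym)
qed

lemma ncls_add_pair_related: "equivclp R a b \<Longrightarrow> ncls V (add_pair R a b) = ncls V R"
  by (rule ncls_cong) (auto simp: add_pair_def)

text \<open>The classes of \<open>a\<close> and \<open>b\<close> are fused into one, and every other
  class survives unchanged.\<close>

lemma
  assumes fin: "fin_cls V R" and "a \<in> V" "b \<in> V" and ab: "\<not> equivclp R a b"
  shows ncls_add_pair: "ncls V R = Suc (ncls V (add_pair R a b))"
    and fin_cls_add_pair: "fin_cls V (add_pair R a b)"
proof -
  let ?c = "\<lambda>v. Collect (equivclp R v)" and ?c' = "\<lambda>v. Collect (equivclp (add_pair R a b) v)"
  let ?X = "?c ` V - {?c a, ?c b}"
  have c': "?c' v = (if equivclp R v a \<or> equivclp R v b then ?c a \<union> ?c b else ?c v)" for v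
    by (auto simp: equivclp_add_pair dest: equivclp_sym intro: equivclp_trans)
       (metis equivclp_trans equivclp_sym)+
  have "?c' ` V = insert (?c a \<union> ?c b) ?X"
  proof (intro equalityI subsetI)
    fix C assume "C \<in> ?c' ` V"
    then show "C \<in> insert (?c a \<union> ?c b) ?X"
      unfolding image_iff c' using cls_eq_iff by (auto split: if_splits)
  next
    fix C assume "C \<in> insert (?c a \<union> ?c b) ?X"
    then show "C \<in> ?c' ` V"
    proof
      assume "C = ?c a \<union> ?c b"
      then have "C = ?c' a" unfolding c' by simp
      then show ?thesis using \<open>a \<in> V\<close> by blast
    next
      assume "C \<in> ?X"
      then obtain v where v: "v \<in> V" "C = ?c v" "?c v \<noteq> ?c a" "?c v \<noteq> ?c b" by auto
      then have "C = ?c' v" unfolding c' cls_eq_iff by auto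
      then show ?thesis using v by blast
    qed
  qed
  moreover have "?c a \<union> ?c b \<notin> ?X"
  proof
    assume "?c a \<union> ?c b \<in> ?X"
    then obtain v where v: "v \<in> V" "?c a \<union> ?c b = ?c v" "?c v \<noteq> ?c a" by blast
    have "a \<in> ?c v" using v(2) by (metis UnI1 equivclp_refl mem_Collect_eq)
    then show False using v(3) cls_eq_iff[of R v a] by simp
  qed
  moreover have "?c a \<noteq> ?c b" using ab by (simp add: cls_eq_iff)
  moreover have "card ?X = card (?c ` V) - card {?c a, ?c b}"
    by (rule card_Diff_subset) (use assms(2,3) in auto)
  moreover have "card {?c a, ?c b} \<le> card (?c ` V)"
    by (rule card_mono) (use assms(2,3) fin in \<open>auto simp: fin_cls_def\<close>)
  ultimately show "ncls V R = Suc (ncls V (add_pair R a b))" "fin_cls V (add_pair R a b)"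
    using fin unfolding ncls_def fin_cls_def by simp_all
qed

text \<open>The forest inequality: each edge lowers the number of components by at most one. Applied
  to a connected class it bounds the size of the class by the number of its edges.\<close>

lemma card_le_ncls_add_edges:
  assumes "finite E" "finite V" "E \<subseteq> V \<times> V"
  shows "card V \<le> ncls V (\<lambda>u v. (u, v) \<in> E) + card E"
  using assms(1,3)
proof (induction E rule: finite_induct)
  case empty
  have e: "equivclp (\<lambda>u v. False) x y \<longleftrightarrow> x = y" for x y :: 'a
  proof
    show "equivclp (\<lambda>u v. False) x y \<Longrightarrow> x = y"
      by (induction rule: equivclp_induct) auto
  qed simp
  have "inj_on (\<lambda>v. Collect (equivclp (\<lambda>u v. False) v)) V"
    by (auto simp: inj_on_def e)
  then show ?case by (simp add: ncls_def card_image)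
next
  case (insert e E)
  obtain a b where e: "e = (a, b)" by force
  have eq: "(\<lambda>u v. (u, v) \<in> insert e E) = add_pair (\<lambda>u v. (u, v) \<in> E) a b"
    unfolding add_pair_def e by (intro ext) auto
  have "ncls V (\<lambda>u v. (u, v) \<in> E) \<le> Suc (ncls V (add_pair (\<lambda>u v. (u, v) \<in> E) a b))"
    using ncls_add_pair[of V "\<lambda>u v. (u, v) \<in> E" a b] ncls_add_pair_related[of "\<lambda>u v. (u, v) \<in> E" a b V]
      insert.prems assms(2) unfolding e fin_cls_def by fastforce
  then show ?case using insert unfolding eq by simp
qed

section \<open>Pairs of matchings with four free ends\<close>

text \<open>
  The union of two matchings between \<open>I\<close> and \<open>P\<close> of which the second one leaves out \<open>UI\<close> and
  \<open>UP\<close> is a disjoint union of cycles and of paths with ends in \<open>UI \<union> UP\<close>.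
\<close>

definition two_matchings :: "'a set \<Rightarrow> 'a set \<Rightarrow> ('a \<Rightarrow> 'a) \<Rightarrow> ('a \<Rightarrow> 'a) \<Rightarrow> 'a \<Rightarrow> 'a \<Rightarrow> bool" where
  "two_matchings I UI a b u v \<longleftrightarrow> u \<in> I \<and> v = a u \<or> u \<in> I - UI \<and> v = b u"

lemma bij_betw_restrict_closed:
  assumes "bij_betw f A B" "\<And>u. u \<in> A \<Longrightarrow> f u \<in> C \<longleftrightarrow> u \<in> C"
  shows "bij_betw f (C \<inter> A) (C \<inter> B)"
proof (rule bij_betw_subset[OF assms(1)])
  have "B = f ` A" using assms(1) by (simp add: bij_betw_def)
  then show "f ` (C \<inter> A) = C \<inter> B" using assms(2) by auto
qed auto

text \<open>Both matchings restrict to bijections on a class, and comparing cardinalities shows that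
  it has as many free ends in \<open>UI\<close> as in \<open>UP\<close>. A class with two free ends
  in \<open>UI\<close> would have too few edges to be connected.\<close>

lemma two_matchings_class:
  assumes fin: "finite I" and disj: "I \<inter> P = {}" and a: "bij_betw a I P"
    and b: "bij_betw b (I - UI) (P - UP)" and "UI \<subseteq> I" "UP \<subseteq> P"
    and C: "C = {v \<in> I \<union> P. equivclp (two_matchings I UI a b) v0 v}" and "v0 \<in> I \<union> P"
  shows "card (C \<inter> UI) = card (C \<inter> UP)" "card (C \<inter> UI) \<le> 1"
proof -
  let ?R = "two_matchings I UI a b"
  have finP: "finite P" using a fin bij_betw_finite by blast
  have finC: "finite C" using C fin finP by simp
  have aP: "a u \<in> P" if "u \<in> I" for u using a that bij_betwE by blast
  have bP: "b u \<in> P - UP" if "u \<in> I - UI" for u using b that bij_betwE by blast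
  have Ca: "a u \<in> C \<longleftrightarrow> u \<in> C" if "u \<in> I" for u
  proof -
    have "equivclp ?R u (a u)" using that by (auto simp: two_matchings_def)
    then show ?thesis unfolding C using aP[OF that] that
      by (auto intro: equivclp_trans equivclp_sym)
  qed
  have Cb: "b u \<in> C \<longleftrightarrow> u \<in> C" if "u \<in> I - UI" for u
  proof -
    have "equivclp ?R u (b u)" using that by (auto simp: two_matchings_def)
    then show ?thesis unfolding C using bP[OF that] that
      by (auto intro: equivclp_trans equivclp_sym)
  qed
  have "bij_betw a (C \<inter> I) (C \<inter> P)" using bij_betw_restrict_closed[OF a] Ca by blast
  then have cI: "card (C \<inter> I) = card (C \<inter> P)" by (rule bij_betw_same_card)
  have "bij_betw b (C \<inter> (I - UI)) (C \<inter> (P - UP))" using bij_betw_restrict_closed[OF b] Cb by blast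
  then have cb: "card (C \<inter> (I - UI)) = card (C \<inter> (P - UP))" by (rule bij_betw_same_card)
  have spl: "card (C \<inter> I) = card (C \<inter> (I - UI)) + card (C \<inter> UI)"
    by (subst card_Un_disjoint[symmetric]) (use finC \<open>UI \<subseteq> I\<close> in \<open>auto intro!: arg_cong[of _ _ card]\<close>)
  have splP: "card (C \<inter> P) = card (C \<inter> (P - UP)) + card (C \<inter> UP)"
    by (subst card_Un_disjoint[symmetric]) (use finC \<open>UP \<subseteq> P\<close> in \<open>auto intro!: arg_cong[of _ _ card]\<close>)
  show "card (C \<inter> UI) = card (C \<inter> UP)" using spl splP cI cb by simp
  \<comment> \<open>The edges of both matchings inside the class already connect it, so the forest
    inequality gives \<open>card C\<close> at most \<open>1 + card E\<close>. As
    \<open>card C\<close> is twice the number of points in \<open>I\<close>, this leaves room for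
    one free end.\<close>
  define E where "E = (\<lambda>u. (u, a u)) ` (C \<inter> I) \<union> (\<lambda>u. (u, b u)) ` (C \<inter> (I - UI))"
  have E: "E \<subseteq> C \<times> C" "finite E"
    unfolding E_def using Ca Cb finC by auto
  have cardE: "card E \<le> card (C \<inter> I) + card (C \<inter> (I - UI))"
    unfolding E_def by (intro order.trans[OF card_Un_le] add_mono card_image_le) (use finC in auto)
  have conn: "equivclp (\<lambda>u v. (u, v) \<in> E) v0 v" if "equivclp ?R v0 v" for v
    using that
  proof (induction rule: equivclp_induct)
    case (step y z)
    then have y: "y \<in> C \<or> z \<in> C \<longrightarrow> y \<in> C \<and> z \<in> C"
      unfolding two_matchings_def using Ca Cb by auto
    have "y \<in> I \<union> P \<or> y = v0 \<Longrightarrow> y \<in> C"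
      using step(1) C assms(8) by auto
    moreover have "y \<in> I \<union> P" using step(2) aP bP unfolding two_matchings_def by auto
    ultimately have "y \<in> C" "z \<in> C" using y by auto
    then have "(y, z) \<in> E \<or> (z, y) \<in> E"
      using step(2) unfolding E_def two_matchings_def by auto
    then show ?case by (rule equivclp_into_equivclp[OF step(3)])
  qed simp
  have v0C: "v0 \<in> C" unfolding C using assms(8) by simp
  have "(\<lambda>v. Collect (equivclp (\<lambda>u v. (u, v) \<in> E) v)) ` C = {Collect (equivclp (\<lambda>u v. (u, v) \<in> E) v0)}"
  proof -
    have "Collect (equivclp (\<lambda>u v. (u, v) \<in> E) v) = Collect (equivclp (\<lambda>u v. (u, v) \<in> E) v0)" if "v \<in> C" for v
      unfolding cls_eq_iff
    proof (rule equivclp_sym, rule conn)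
      show "equivclp ?R v0 v" using that unfolding C by simp
    qed
    from image_cong[OF refl this, of C "\<lambda>v. v"] show ?thesis
      by (simp only: image_constant[OF v0C])
  qed
  then have "ncls C (\<lambda>u v. (u, v) \<in> E) = 1" unfolding ncls_def by simp
  then have "card C \<le> 1 + card E" using card_le_ncls_add_edges[OF E(2) finC E(1)] by simp
  moreover have "card C = card (C \<inter> I) + card (C \<inter> P)"
  proof -
    have "C = (C \<inter> I) \<union> (C \<inter> P)" using C by auto
    moreover have "card ((C \<inter> I) \<union> (C \<inter> P)) = card (C \<inter> I) + card (C \<inter> P)"
      by (rule card_Un_disjoint) (use finC disj in auto)
    ultimately show ?thesis by simp
  qed
  ultimately show "card (C \<inter> UI) \<le> 1" using spl cI cardE by linarith
qed

text \<open>The two open paths each run from some \<open>p\<close> to some \<open>q\<close>. Closing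
  every path on itself keeps all classes; the other two ways of pairing the four ends fuse both
  paths into one class and lose one. Pairing \<open>p1\<close> with \<open>p2\<close> never closes a
  path on itself, so it always gives the lower count. The last clause records that in the lower case
  \<open>p1\<close> and \<open>p2\<close> lie on one circle; adequacy is the contrapositive.\<close>

lemma two_matchings_switch:
  assumes fin: "finite I" and disj: "I \<inter> P = {}" and a: "bij_betw a I P"
    and b: "bij_betw b (I - {p1, p2}) (P - {q1, q2})" and p: "{p1, p2} \<subseteq> I" "p1 \<noteq> p2"
    and q: "{q1, q2} \<subseteq> P" "q1 \<noteq> q2"
  defines "R \<equiv> two_matchings I {p1, p2} a b"
  defines "N \<equiv> \<lambda>x y z w. ncls (I \<union> P) (add_pair (add_pair R x y) z w)"
  shows "N p1 q1 p2 q2 = Suc (N p1 q2 p2 q1) \<and> N p1 p2 q1 q2 = N p1 q2 p2 q1 \<or>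
         N p1 q2 p2 q1 = Suc (N p1 q1 p2 q2) \<and> N p1 p2 q1 q2 = N p1 q1 p2 q2 \<and>
         equivclp (add_pair (add_pair R p1 q1) p2 q2) p1 p2"
proof -
  let ?V = "I \<union> P"
  define C where "C v0 = {v \<in> ?V. equivclp R v0 v}" for v0
  have C: "card (C v \<inter> {p1, p2}) = card (C v \<inter> {q1, q2})" "card (C v \<inter> {p1, p2}) \<le> 1" if "v \<in> ?V" for v
    using two_matchings_class[OF fin disj a b p(1) q(1), of "C v" v] that
    unfolding C_def R_def by blast+
  have inC: "x \<in> C v \<longleftrightarrow> equivclp R v x" if "x \<in> {p1, p2, q1, q2}" for x v
    using that p q unfolding C_def by blast
  have dj: "{p1, p2} \<inter> {q1, q2} = {}" using p q disj by blast
  have V: "p1 \<in> ?V" "p2 \<in> ?V" "q1 \<in> ?V" "q2 \<in> ?V" using p q by auto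
  have fV: "finite ?V" using fin a bij_betw_finite by blast
  have fc: "fin_cls ?V R'" for R' using fV unfolding fin_cls_def by blast
  have p12: "\<not> equivclp R p1 p2"
  proof
    assume "equivclp R p1 p2"
    then have "C p1 \<inter> {p1, p2} = {p1, p2}" using inC by auto
    then show False using C(2)[OF V(1)] p(2) by simp
  qed
  have one: "card (C v \<inter> {q1, q2}) = 1" if "v \<in> {p1, p2}" for v
  proof -
    have "v \<in> C v \<inter> {p1, p2}" using that inC by auto
    then have "card (C v \<inter> {p1, p2}) = 1"
      using C(2)[of v] V that card_gt_0_iff[of "C v \<inter> {p1, p2}"] by fastforce
    then show ?thesis using C(1) V that by auto
  qed
  have ex: "equivclp R v q1 \<longleftrightarrow> \<not> equivclp R v q2" if "v \<in> {p1, p2}" for v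
  proof -
    have "C v \<inter> {q1, q2} = (if equivclp R v q1 then {q1} else {}) \<union> (if equivclp R v q2 then {q2} else {})"
      using inC by auto
    then show ?thesis using one[OF that] q(2) by (auto split: if_splits)
  qed
  note eq = equivclp_add_pair
  have sy: "equivclp R x y \<longleftrightarrow> equivclp R y x" for x y by (auto intro: equivclp_sym)
  show ?thesis
  proof (cases "equivclp R p1 q1")
    case True
    then have n: "\<not> equivclp R p1 q2" using ex by blast
    have p2q1: "\<not> equivclp R p2 q1" using True p12 by (meson equivclp_trans equivclp_sym)
    then have p2q2: "equivclp R p2 q2" using ex by blast
    have "N p1 q1 p2 q2 = ncls ?V R" unfolding N_def
      using True p2q2 by (simp add: ncls_add_pair_related eq)
    moreover have "ncls ?V R = Suc (ncls ?V (add_pair R p1 q2))"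
      using ncls_add_pair[OF fc V(1,4) n] .
    moreover have "N p1 q2 p2 q1 = ncls ?V (add_pair R p1 q2)" unfolding N_def
      by (rule ncls_add_pair_related) (use True p2q2 in \<open>simp add: eq sy\<close>)
    moreover have "ncls ?V R = Suc (ncls ?V (add_pair R p1 p2))"
      using ncls_add_pair[OF fc V(1,2) p12] .
    moreover have "N p1 p2 q1 q2 = ncls ?V (add_pair R p1 p2)" unfolding N_def
      by (rule ncls_add_pair_related) (use True p2q2 in \<open>simp add: eq sy\<close>)
    ultimately show ?thesis by linarith
  next
    case False
    then have p1q2: "equivclp R p1 q2" using ex by blast
    have "\<not> equivclp R p2 q2" using p1q2 p12 by (meson equivclp_trans equivclp_sym)
    then have p2q1: "equivclp R p2 q1" using ex by blast
    have "N p1 q2 p2 q1 = ncls ?V R" unfolding N_def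
      using p1q2 p2q1 by (simp add: ncls_add_pair_related eq)
    moreover have "ncls ?V R = Suc (ncls ?V (add_pair R p1 q1))"
      using ncls_add_pair[OF fc V(1,3) False] .
    moreover have "N p1 q1 p2 q2 = ncls ?V (add_pair R p1 q1)" unfolding N_def
      by (rule ncls_add_pair_related) (use p1q2 p2q1 in \<open>simp add: eq sy\<close>)
    moreover have "ncls ?V R = Suc (ncls ?V (add_pair R p1 p2))"
      using ncls_add_pair[OF fc V(1,2) p12] .
    moreover have "N p1 p2 q1 q2 = ncls ?V (add_pair R p1 p2)" unfolding N_def
      by (rule ncls_add_pair_related) (use p1q2 p2q1 in \<open>simp add: eq sy\<close>)
    moreover have "equivclp (add_pair (add_pair R p1 q1) p2 q2) p1 p2"
      using p1q2 p2q1 by (simp add: eq sy)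
    ultimately show ?thesis by linarith
  qed
qed

section \<open>Chord diagrams and their smoothings\<close>

type_synonym germ = "point \<times> bool"

definition chorded :: "(point \<Rightarrow> point \<Rightarrow> bool) \<Rightarrow> point \<Rightarrow> bool" where
  "chorded C p \<longleftrightarrow> (\<exists>q. C p q)"

lemma chordedI: "C p q \<Longrightarrow> chorded C p"
  unfolding chorded_def by blast

text \<open>
  A point \<open>p\<close> of the 1-manifold has an incoming germ \<open>(p, False)\<close> and an outgoing germ \<open>(p, True)\<close>.
  The crossings form the relation \<open>C\<close>; those with \<open>Q\<close> are smoothed along the orientation, the
  others against it.
\<close>

inductive smooth_rel :: "nat \<Rightarrow> (point \<Rightarrow> point \<Rightarrow> bool) \<Rightarrow> (point \<Rightarrow> bool) \<Rightarrow> germ \<Rightarrow> germ \<Rightarrow> bool"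
  for n C Q where
  period: "i < n \<Longrightarrow> smooth_rel n C Q ((i, x), e) ((i, x + 1), e)"
| seg: "\<lbrakk>i < n; x < y; \<And>z. x < z \<Longrightarrow> z < y \<Longrightarrow> \<not> chorded C (i, z)\<rbrakk> \<Longrightarrow>
    smooth_rel n C Q ((i, x), True) ((i, y), False)"
| thr: "\<lbrakk>fst p < n; \<not> chorded C p\<rbrakk> \<Longrightarrow> smooth_rel n C Q (p, False) (p, True)"
| ori: "\<lbrakk>C p q; Q p\<rbrakk> \<Longrightarrow> smooth_rel n C Q (p, False) (q, True)"
| uno: "\<lbrakk>C p q; \<not> Q p\<rbrakk> \<Longrightarrow> smooth_rel n C Q (p, e) (q, e)"

definition germs :: "nat \<Rightarrow> germ set" where
  "germs n = {g. fst (fst g) < n}"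

definition loops :: "nat \<Rightarrow> (point \<Rightarrow> point \<Rightarrow> bool) \<Rightarrow> (point \<Rightarrow> bool) \<Rightarrow> nat" where
  "loops n C Q = ncls (germs n) (smooth_rel n C Q)"

definition rep :: "point \<Rightarrow> point" where
  "rep p = (fst p, frac (snd p))"

definition base :: "point \<Rightarrow> bool" where
  "base p \<longleftrightarrow> 0 \<le> snd p \<and> snd p < 1"

lemma same_point_refl [simp]: "same_point p p"
  by (simp add: same_point_def)

lemma same_point_sym: "same_point p q \<Longrightarrow> same_point q p"
  unfolding same_point_def by (metis Ints_minus minus_diff_eq)

lemma same_point_trans: "same_point p q \<Longrightarrow> same_point q r \<Longrightarrow> same_point p r"
  unfolding same_point_def by (metis Ints_add add_diff_eq diff_add_cancel)

lemma base_rep [simp]: "base (rep p)"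
  by (simp add: base_def rep_def frac_ge_0 frac_lt_1)

lemma rep_base [simp]: "base p \<Longrightarrow> rep p = p"
  by (simp add: base_def rep_def frac_eq prod_eq_iff)

lemma same_point_rep [simp]: "same_point p (rep p)"
  by (simp add: same_point_def rep_def frac_def)

lemma rep_eq_iff: "rep p = rep q \<longleftrightarrow> same_point p q"
proof
  assume "rep p = rep q"
  then show "same_point p q" using same_point_rep same_point_sym same_point_trans by metis
next
  assume "same_point p q"
  then obtain k where "snd p = snd q + of_int k" "fst p = fst q"
    unfolding same_point_def by (metis Ints_cases add.commute diff_add_cancel)
  then show "rep p = rep q" by (simp add: rep_def frac_def)
qed

lemma fst_rep [simp]: "fst (rep p) = fst p"
  by (simp add: rep_def)

lemma base_same_point: "base p \<Longrightarrow> base q \<Longrightarrow> same_point p q \<Longrightarrow> p = q"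
  by (metis rep_base rep_eq_iff)

lemma same_point_shift: "same_point (i, x) (i, x + of_int k)"
  by (simp add: same_point_def)

lemma same_pointE:
  assumes "same_point (i, x) q"
  obtains k where "q = (i, x + of_int k)"
proof -
  obtain k where "x - snd q = of_int k" "fst q = i"
    using assms unfolding same_point_def by (auto elim: Ints_cases)
  then have "q = (i, x + of_int (- k))" by (simp add: prod_eq_iff)
  then show ?thesis by (rule that)
qed

locale chords =
  fixes n :: nat and C :: "point \<Rightarrow> point \<Rightarrow> bool"
  assumes C_sym: "C p q \<Longrightarrow> C q p"
    and C_dom: "C p q \<Longrightarrow> fst p < n"
    and C_irr: "C p q \<Longrightarrow> \<not> same_point p q"
    and C_per: "C p q \<Longrightarrow> same_point p p' \<Longrightarrow> same_point q q' \<Longrightarrow> C p' q'"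
    and C_fun: "C p q \<Longrightarrow> C p r \<Longrightarrow> same_point q r"
    and C_fin: "finite {p. base p \<and> chorded C p}"
begin

lemma C_ex_same: "same_point p p' \<Longrightarrow> chorded C p \<longleftrightarrow> chorded C p'"
  unfolding chorded_def using C_per same_point_sym same_point_refl by meson

definition state :: "(point \<Rightarrow> bool) \<Rightarrow> bool" where
  "state Q \<longleftrightarrow> (\<forall>p q. C p q \<longrightarrow> Q p = Q q) \<and> (\<forall>p q. same_point p q \<longrightarrow> Q p = Q q)"

end

text \<open>\<open>T\<close> makes the germs finite modulo the period. It contains all chord ends
  and at least one point of each circle, so that circles without chords are counted too. Its freedom
  is used later: a tangle contributes its own marked positions, whether or not there is a real
  crossing at them.\<close>

locale marked = chords +
  fixes T :: "point set"
  assumes T_dom: "p \<in> T \<Longrightarrow> fst p < n"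
    and T_per: "p \<in> T \<Longrightarrow> same_point p q \<Longrightarrow> q \<in> T"
    and T_fin: "finite {p \<in> T. base p}"
    and T_ne: "i < n \<Longrightarrow> \<exists>x. (i, x) \<in> T"
    and T_C: "C p q \<Longrightarrow> p \<in> T"
begin

lemma T_chorded: "chorded C p \<Longrightarrow> p \<in> T"
  unfolding chorded_def using T_C by blast

text \<open>The next marked point. A window of one period suffices because \<open>T\<close> is
  periodic and meets every circle; the window is half-open so that a circle with a single marked
  point has that point as its own successor.\<close>

definition nx :: "nat \<Rightarrow> real \<Rightarrow> real" where
  "nx i x = Min {y. x < y \<and> y \<le> x + 1 \<and> (i, y) \<in> T}"

lemma T_window_finite: "finite {y. x < y \<and> y \<le> x + 1 \<and> (i, y) \<in> T}" (is "finite ?A")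
proof (rule finite_imageD)
  show "finite ((\<lambda>y. rep (i, y)) ` ?A)"
    by (rule finite_subset[OF _ T_fin]) (auto intro: T_per same_point_rep)
  show "inj_on (\<lambda>y. rep (i, y)) ?A"
  proof (rule inj_onI)
    fix y z assume yz: "y \<in> ?A" "z \<in> ?A" "rep (i, y) = rep (i, z)"
    then obtain k where k: "y - z = of_int k"
      by (auto simp: rep_eq_iff same_point_def elim: Ints_cases)
    then have "\<bar>real_of_int k\<bar> < 1" using yz by (auto simp: abs_if)
    then have "k = 0" by linarith
    then show "y = z" using k by simp
  qed
qed

lemma T_window_ne: "i < n \<Longrightarrow> {y. x < y \<and> y \<le> x + 1 \<and> (i, y) \<in> T} \<noteq> {}"
proof -
  assume "i < n"
  then obtain z where z: "(i, z) \<in> T" using T_ne by blast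
  let ?y = "z + of_int (\<lfloor>x - z\<rfloor> + 1)"
  have "(i, ?y) \<in> T" using T_per[OF z same_point_shift] by blast
  moreover have "x < ?y" "?y \<le> x + 1" by linarith+
  ultimately show ?thesis by blast
qed

lemma
  assumes "i < n"
  shows nx_gt: "x < nx i x" and nx_le: "nx i x \<le> x + 1" and nx_T: "(i, nx i x) \<in> T"
    and nx_gap: "x < z \<Longrightarrow> z < nx i x \<Longrightarrow> (i, z) \<notin> T"
proof -
  note fin = T_window_finite[of x i] and ne = T_window_ne[OF assms, of x]
  have "nx i x \<in> {y. x < y \<and> y \<le> x + 1 \<and> (i, y) \<in> T}"
    unfolding nx_def using Min_in[OF fin ne] .
  then show *: "x < nx i x" "nx i x \<le> x + 1" "(i, nx i x) \<in> T" by auto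
  show "(i, z) \<notin> T" if "x < z" "z < nx i x"
  proof
    assume "(i, z) \<in> T"
    then have "nx i x \<le> z" unfolding nx_def using that * by (intro Min_le fin) auto
    then show False using that by simp
  qed
qed

lemma nx_unique:
  assumes "i < n" "x < y" "(i, y) \<in> T" "\<And>z. x < z \<Longrightarrow> z < y \<Longrightarrow> (i, z) \<notin> T"
  shows "nx i x = y"
  using nx_gt[OF assms(1), of x] nx_T[OF assms(1), of x] nx_gap[OF assms(1), of x y] assms
  by (metis linorder_neqE_linordered_idom)

lemma T_shift: "(i, x + of_int k) \<in> T \<longleftrightarrow> (i, x) \<in> T"
  using T_per same_point_shift same_point_sym by metis

lemma nx_shift: "i < n \<Longrightarrow> nx i (x + of_int k) = nx i x + of_int k"
proof (rule nx_unique)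
  assume i: "i < n"
  show "x + of_int k < nx i x + of_int k" using nx_gt[OF i] by simp
  show "(i, nx i x + of_int k) \<in> T" using nx_T[OF i] T_shift by blast
  fix z assume "x + of_int k < z" "z < nx i x + of_int k"
  then have "(i, z - of_int k) \<notin> T" using nx_gap[OF i, of x "z - of_int k"] by simp
  then show "(i, z) \<notin> T" using T_shift[of i "z - of_int k" k] by simp
qed simp

definition PT :: "point set" where
  "PT = {p \<in> T. base p}"

definition nxt :: "point \<Rightarrow> point" where
  "nxt p = rep (fst p, nx (fst p) (snd p))"

lemma finite_PT: "finite PT"
  using T_fin unfolding PT_def .

lemma PT_dom: "p \<in> PT \<Longrightarrow> fst p < n"
  using T_dom unfolding PT_def by blast

lemma rep_PT: "p \<in> T \<Longrightarrow> rep p \<in> PT"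
  unfolding PT_def using T_per same_point_rep by auto

lemma nxt_rep: "fst p < n \<Longrightarrow> nxt (rep p) = nxt p"
proof -
  assume p: "fst p < n"
  have "nx (fst p) (frac (snd p)) = nx (fst p) (snd p) + of_int (- \<lfloor>snd p\<rfloor>)"
    using nx_shift[OF p, of "snd p" "- \<lfloor>snd p\<rfloor>"] by (simp add: frac_def)
  then show ?thesis unfolding nxt_def by (simp add: rep_def) (simp add: frac_def)
qed

text \<open>Injectivity is enough on a finite set. If two points have the same successor up to a
  period, shift one of them: then the successors coincide as reals, and no marked point may lie
  strictly between a point and its successor.\<close>

lemma bij_nxt: "bij_betw nxt PT PT"
proof -
  have "inj_on nxt PT"
  proof (rule inj_onI)
    fix p q assume p: "p \<in> PT" and q: "q \<in> PT" and eq: "nxt p = nxt q"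
    define i x y where "i = fst p" "x = snd p" "y = snd q"
    have i: "i < n" using PT_dom[OF p] i_x_y_def by simp
    have "same_point (fst p, nx (fst p) (snd p)) (fst q, nx (fst q) (snd q))"
      using eq unfolding nxt_def rep_eq_iff .
    then have fq: "fst q = i" and "nx i x - nx i y \<in> \<int>"
      unfolding same_point_def i_x_y_def by auto
    then obtain k where "nx i x - nx i y = of_int k" by (auto elim: Ints_cases)
    then have k: "nx i x = nx i (y + of_int k)" using nx_shift[OF i, of y k] by simp
    have "(i, x) \<in> T" "(i, y + of_int k) \<in> T"
      using p q fq unfolding PT_def i_x_y_def T_shift by (metis mem_Collect_eq prod.collapse)+
    then have "x = y + of_int k"
      using nx_gap[OF i, of x "y + of_int k"] nx_gap[OF i, of "y + of_int k" x] k
        nx_gt[OF i, of x] nx_gt[OF i, of "y + of_int k"] by (metis linorder_neqE_linordered_idom)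
    then have "same_point p q" using fq unfolding same_point_def i_x_y_def by simp
    then show "p = q" using p q base_same_point unfolding PT_def by blast
  qed
  moreover have "nxt ` PT \<subseteq> PT"
    unfolding nxt_def using nx_T PT_dom rep_PT by blast
  ultimately show ?thesis
    using finite_PT by (simp add: bij_betw_def endo_inj_surj)
qed

definition prv :: "point \<Rightarrow> point" where
  "prv = inv_into PT nxt"

definition partner :: "point \<Rightarrow> point" where
  "partner p = (SOME q. base q \<and> C p q)"

definition along :: "germ \<Rightarrow> germ" where
  "along g = (if snd g then (nxt (fst g), False) else (prv (fst g), True))"

definition link :: "(point \<Rightarrow> bool) \<Rightarrow> germ \<Rightarrow> germ" where
  "link Q g = (if chorded C (fst g) then (partner (fst g), if Q (fst g) then \<not> snd g else snd g)
     else (fst g, \<not> snd g))"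

definition VT :: "germ set" where
  "VT = PT \<times> UNIV"

definition tree_rel :: "(point \<Rightarrow> bool) \<Rightarrow> germ \<Rightarrow> germ \<Rightarrow> bool" where
  "tree_rel Q u v \<longleftrightarrow> u \<in> VT \<and> (v = along u \<or> v = link Q u)"

lemma finite_VT: "finite VT"
  using finite_PT unfolding VT_def by simp

lemma fin_cls_VT: "fin_cls VT R"
  using finite_VT unfolding fin_cls_def by blast

lemma nxt_PT: "p \<in> PT \<Longrightarrow> nxt p \<in> PT" and prv_PT: "p \<in> PT \<Longrightarrow> prv p \<in> PT"
  and prv_nxt: "p \<in> PT \<Longrightarrow> prv (nxt p) = p" and nxt_prv: "p \<in> PT \<Longrightarrow> nxt (prv p) = p"
  using bij_nxt unfolding prv_def bij_betw_def
  by (auto simp: inv_into_into f_inv_into_f inv_into_f_f intro: inv_into_into)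

lemma partner:
  assumes "C p q"
  shows "partner p \<in> PT" "C p (partner p)" "same_point q (partner p)" "partner p = rep q"
proof -
  have "\<exists>q. base q \<and> C p q" using C_per[OF assms same_point_refl same_point_rep] base_rep by blast
  then have *: "base (partner p) \<and> C p (partner p)"
    unfolding partner_def by (rule someI_ex)
  then show "C p (partner p)" "partner p \<in> PT"
    unfolding PT_def using T_C C_sym by blast+
  show s: "same_point q (partner p)" using C_fun[OF assms] * by blast
  then show "partner p = rep q" using * rep_eq_iff rep_base by metis
qed

lemma along_VT: "g \<in> VT \<Longrightarrow> along g \<in> VT" and along_along: "g \<in> VT \<Longrightarrow> along (along g) = g"
  unfolding VT_def along_def by (auto simp: nxt_PT prv_PT prv_nxt nxt_prv)

lemma link_VT: "g \<in> VT \<Longrightarrow> link Q g \<in> VT"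
  unfolding VT_def link_def chorded_def using partner(1) by (auto simp del: split_paired_Ex)

lemma partner_partner: "C p q \<Longrightarrow> p \<in> PT \<Longrightarrow> partner (partner p) = p"
  using partner[of p q] partner(4)[of "partner p" p] C_sym rep_base[of p] unfolding PT_def by auto

lemma link_link:
  assumes "g \<in> VT" "state Q"
  shows "link Q (link Q g) = g"
proof (cases "chorded C (fst g)")
  case True
  then obtain q where q: "C (fst g) q" unfolding chorded_def by blast
  have g: "fst g \<in> PT" using assms unfolding VT_def by auto
  have c: "C (fst g) (partner (fst g))" "C (partner (fst g)) (fst g)"
    using partner(2)[OF q] C_sym by auto
  have "Q (partner (fst g)) = Q (fst g)" using c(1) assms(2) unfolding state_def by metis
  then show ?thesis using chordedI[of C, OF c(1)] chordedI[of C, OF c(2)] partner_partner[OF q g]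
    unfolding link_def by (auto simp: prod_eq_iff)
qed (auto simp: link_def)

text \<open>Pushes germs to marked points. At an unmarked point both germs lie on one circle with
  the incoming germ at the next marked point, so both are sent there.\<close>

definition retract :: "germ \<Rightarrow> germ" where
  "retract g = (if fst g \<in> T then (rep (fst g), snd g)
     else (rep (fst (fst g), nx (fst (fst g)) (snd (fst g))), False))"

lemma tree_rel_next:
  assumes "(i, x) \<in> T"
  shows "equivclp (tree_rel Q) (rep (i, x), True) (rep (i, nx i x), False)"
proof -
  have "along (rep (i, x), True) = (rep (i, nx i x), False)"
    using nxt_rep[of "(i, x)"] T_dom[OF assms] unfolding along_def nxt_def by simp
  moreover have "(rep (i, x), True) \<in> VT" using rep_PT[OF assms] unfolding VT_def by simp
  ultimately show ?thesis by (intro r_into_equivclp) (simp add: tree_rel_def)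
qed

lemma tree_rel_thr:
  assumes "p \<in> T" "\<not> chorded C p"
  shows "equivclp (tree_rel Q) (rep p, False) (rep p, True)"
proof -
  have "link Q (rep p, False) = (rep p, True)"
    using assms(2) C_ex_same[OF same_point_rep, of p] unfolding link_def by auto
  moreover have "(rep p, False) \<in> VT" using rep_PT[OF assms(1)] unfolding VT_def by simp
  ultimately show ?thesis by (intro r_into_equivclp) (simp add: tree_rel_def)
qed

lemma tree_rel_chord:
  assumes "C p q" "state Q"
  shows "equivclp (tree_rel Q) (rep p, e) (rep q, if Q p then \<not> e else e)"
proof -
  have "C (rep p) q" using C_per[OF assms(1)] same_point_rep same_point_refl by blast
  moreover have "Q (rep p) = Q p" using assms(2) same_point_rep unfolding state_def by metis
  ultimately have "link Q (rep p, e) = (rep q, if Q p then \<not> e else e)"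
    using partner(4) chordedI unfolding link_def by auto
  moreover have "(rep p, e) \<in> VT" using rep_PT T_C[OF assms(1)] unfolding VT_def by simp
  ultimately show ?thesis by (intro r_into_equivclp) (simp add: tree_rel_def)
qed

lemma tree_rel_seg_gap:
  assumes "i < n" "x < y" "\<And>z. x < z \<Longrightarrow> z < y \<Longrightarrow> (i, z) \<notin> T"
  shows "equivclp (tree_rel Q) (retract ((i, x), True)) (retract ((i, y), False))"
proof -
  have y: "nx i x = y" if "(i, y) \<in> T" using nx_unique assms that by blast
  have y': "nx i x = nx i y" if "(i, y) \<notin> T"
  proof (rule nx_unique[OF assms(1)])
    show "x < nx i y" using nx_gt[OF assms(1), of y] assms(2) by simp
    fix z assume "x < z" "z < nx i y"
    then show "(i, z) \<notin> T" using assms(3) that nx_gap[OF assms(1), of y z]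
      by (metis linorder_neqE_linordered_idom)
  qed (rule nx_T[OF assms(1)])
  have r: "retract ((i, y), False) = (rep (i, nx i x), False)"
    unfolding retract_def using y y' by auto
  show ?thesis
  proof (cases "(i, x) \<in> T")
    case True
    then show ?thesis unfolding r using tree_rel_next by (simp add: retract_def)
  qed (simp add: r, simp add: retract_def)
qed

lemma T_between_finite: "finite {z. x < z \<and> z < y \<and> (i, z) \<in> T}"
proof -
  have "{z. x < z \<and> z < y \<and> (i, z) \<in> T}
      \<subseteq> (\<Union>k\<in>{0..nat \<lceil>y - x\<rceil>}. {z. x + real k < z \<and> z \<le> x + real k + 1 \<and> (i, z) \<in> T})"
  proof
    fix z assume z: "z \<in> {z. x < z \<and> z < y \<and> (i, z) \<in> T}"
    define k where "k = nat (\<lceil>z - x\<rceil> - 1)"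
    have "x + real k < z" "z \<le> x + real k + 1" "k \<le> nat \<lceil>y - x\<rceil>"
      using z unfolding k_def by (auto; linarith)+
    then show "z \<in> (\<Union>k\<in>{0..nat \<lceil>y - x\<rceil>}. {z. x + real k < z \<and> z \<le> x + real k + 1 \<and> (i, z) \<in> T})"
      using z by auto
  qed
  then show ?thesis by (rule finite_subset) (auto intro: T_window_finite)
qed

text \<open>Induction on the number of marked points inside the segment. Such a point carries no
  chord, so the finite graph passes straight through it.\<close>

lemma tree_rel_seg:
  assumes "i < n" "x < y" "\<And>z. x < z \<Longrightarrow> z < y \<Longrightarrow> \<not> chorded C (i, z)"
  shows "equivclp (tree_rel Q) (retract ((i, x), True)) (retract ((i, y), False))"
  using assms(2,3)
proof (induction "card {z. x < z \<and> z < y \<and> (i, z) \<in> T}" arbitrary: x rule: less_induct)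
  case less
  show ?case
  proof (cases "nx i x < y")
    case False
    then show ?thesis using tree_rel_seg_gap[OF assms(1) less.prems(1)] nx_gap[OF assms(1), of x] by auto
  next
    case True
    let ?u = "nx i x"
    have u: "x < ?u" "(i, ?u) \<in> T" using nx_gt nx_T assms(1) by auto
    have "equivclp (tree_rel Q) (retract ((i, x), True)) (retract ((i, ?u), False))"
      using tree_rel_seg_gap[OF assms(1) u(1)] nx_gap[OF assms(1)] by blast
    also have "equivclp (tree_rel Q) (retract ((i, ?u), False)) (retract ((i, ?u), True))"
      using tree_rel_thr[OF u(2)] u True less.prems(2)[OF u(1) True] by (simp add: retract_def)
    also have "equivclp (tree_rel Q) (retract ((i, ?u), True)) (retract ((i, y), False))"
    proof (rule less.hyps)
      show "card {z. ?u < z \<and> z < y \<and> (i, z) \<in> T} < card {z. x < z \<and> z < y \<and> (i, z) \<in> T}"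
        by (rule psubset_card_mono[OF T_between_finite]) (use u True in auto)
    qed (use True u less.prems in auto)
    finally show ?thesis .
  qed
qed

lemma smooth_rel_shift:
  assumes "i < n"
  shows "equivclp (smooth_rel n C Q) ((i, x), e) ((i, x + of_int k), e)"
proof (induction k rule: int_induct[where k = 0])
  case (step1 k)
  have "smooth_rel n C Q ((i, x + of_int k), e) ((i, x + of_int k + 1), e)"
    using smooth_rel.period[OF assms] .
  then show ?case using step1 by (metis add.assoc equivclp_into_equivclp of_int_1 of_int_add)
next
  case (step2 k)
  have "smooth_rel n C Q ((i, x + of_int (k - 1)), e) ((i, x + of_int (k - 1) + 1), e)"
    using smooth_rel.period[OF assms] .
  then show ?case using step2(2) equivclp_into_equivclp[of _ _ "((i, x + of_int k), e)"]
    by (simp add: algebra_simps)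
qed simp

lemma smooth_rel_same:
  assumes "fst p < n" "same_point p q"
  shows "equivclp (smooth_rel n C Q) (p, e) (q, e)"
proof -
  obtain k where "q = (fst p, snd p + of_int k)"
    using same_pointE[of "fst p" "snd p" q] assms(2) by auto
  then show ?thesis using smooth_rel_shift[OF assms(1), of Q "snd p" e k] by simp
qed

text \<open>\<open>retract\<close> and the inclusion of \<open>VT\<close> are inverse up to the
  relations, which is the situation of \<open>ncls_transfer\<close>. From here on circles are
  counted in a finite graph in which every germ has one \<open>along\<close> edge and one
  \<open>link\<close> edge.\<close>

lemma
  assumes Q: "state Q"
  shows loops_VT: "loops n C Q = ncls VT (tree_rel Q)"
    and fin_cls_loops: "fin_cls (germs n) (smooth_rel n C Q)"
    and smooth_rel_VT: "u \<in> VT \<Longrightarrow> v \<in> VT \<Longrightarrow>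
      equivclp (smooth_rel n C Q) u v \<longleftrightarrow> equivclp (tree_rel Q) u v"
proof -
  let ?S = "smooth_rel n C Q" and ?R = "tree_rel Q"
  have f: "retract g \<in> VT" if "g \<in> germs n" for g
    using that rep_PT nx_T unfolding retract_def VT_def germs_def by auto
  have g: "g \<in> germs n" if "g \<in> VT" for g
    using that PT_dom unfolding VT_def germs_def by auto
  have Rf: "equivclp ?R (retract u) (retract v)" if "?S u v" for u v
    using that
  proof cases
    case (period i x e)
    have r: "rep (i, y + 1) = rep (i, y)" for y
      using same_point_shift[of i y 1] rep_eq_iff by (metis of_int_1)
    have "retract u = retract v"
      unfolding period(1,2) retract_def
      using r nx_shift[OF period(3), of x 1] T_shift[of i x 1] by simp
    then show ?thesis by simp
  next
    case (seg i x y)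
    then show ?thesis using tree_rel_seg by blast
  next
    case (thr p)
    then show ?thesis using tree_rel_thr[of p] by (auto simp: retract_def)
  next
    case (ori p q)
    then have "p \<in> T" "q \<in> T" using T_C C_sym by blast+
    then show ?thesis using tree_rel_chord[OF ori(3) Q, of False] ori by (simp add: retract_def)
  next
    case (uno p q e)
    then have "p \<in> T" "q \<in> T" using T_C C_sym by blast+
    then show ?thesis using tree_rel_chord[OF uno(3) Q, of e] uno by (simp add: retract_def)
  qed
  have al: "equivclp ?S (p, True) (nxt p, False)" if "p \<in> PT" for p
  proof -
    have i: "fst p < n" using PT_dom[OF that] .
    have "?S ((fst p, snd p), True) ((fst p, nx (fst p) (snd p)), False)"
      by (rule smooth_rel.seg[OF i nx_gt[OF i]]) (use nx_gap[OF i] T_chorded in blast)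
    moreover have "equivclp ?S ((fst p, nx (fst p) (snd p)), False) (nxt p, False)"
      unfolding nxt_def by (rule smooth_rel_same) (use i in auto)
    ultimately show ?thesis by (metis equivclp_trans prod.collapse r_into_equivclp)
  qed
  have Rg: "equivclp ?S u v" if "?R u v" for u v
  proof -
    have u: "fst u \<in> PT" using that unfolding tree_rel_def VT_def by auto
    have i: "fst (fst u) < n" using PT_dom[OF u] .
    have "v = along u \<or> v = link Q u" using that unfolding tree_rel_def by blast
    then consider "v = along u" | "v = link Q u" by blast
    then show ?thesis
    proof cases
      case 1
      then show ?thesis using al[OF u] al[OF prv_PT[OF u]] nxt_prv[OF u]
        unfolding along_def by (cases u) (auto intro: equivclp_sym split: if_splits)
    next
      case 2
      show ?thesis
      proof (cases "chorded C (fst u)")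
        case True
        then obtain q where "C (fst u) q" unfolding chorded_def by blast
        then have c: "C (fst u) (partner (fst u))" using partner by blast
        then have c': "C (partner (fst u)) (fst u)" by (rule C_sym)
        have cQ: "Q (partner (fst u)) = Q (fst u)" using c Q unfolding state_def by metis
        show ?thesis
          using True smooth_rel.ori[of C "fst u" "partner (fst u)" Q n] smooth_rel.ori[of C "partner (fst u)" "fst u" Q n]
            smooth_rel.uno[of C "fst u" "partner (fst u)" Q n] c c' cQ 2
          unfolding link_def by (cases u; cases "snd u"; cases "Q (fst u)") auto
      next
        case False
        then show ?thesis
          using smooth_rel.thr[of "fst u" n C Q, OF i False] 2
          unfolding link_def by (cases u; cases "snd u") auto
      qed
    qed
  qed
  have gf: "equivclp ?S (retract v) v" if v: "v \<in> germs n" for v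
  proof -
    obtain i x e where ve: "v = ((i, x), e)" by (metis prod.exhaust)
    have i: "i < n" using v ve unfolding germs_def by simp
    have same: "equivclp ?S (rep (i, y), e') ((i, y), e')" for y e'
      by (rule smooth_rel_same) (use i same_point_sym[OF same_point_rep] in auto)
    show ?thesis
    proof (cases "(i, x) \<in> T")
      case True
      then show ?thesis unfolding retract_def ve using same by simp
    next
      case False
      have "?S ((i, x), True) ((i, nx i x), False)"
        by (rule smooth_rel.seg[OF i nx_gt[OF i]]) (use nx_gap[OF i] T_chorded in blast)
      moreover have "?S ((i, x), False) ((i, x), True)"
        by (rule smooth_rel.thr) (use i False T_chorded in auto)
      ultimately have "equivclp ?S ((i, nx i x), False) ((i, x), e)"
        by (cases e) (auto intro: equivclp_trans)
      then show ?thesis unfolding retract_def ve using False same[of "nx i x" False] 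
        by (auto intro: equivclp_trans)
    qed
  qed
  have fg: "retract v = v" if "v \<in> VT" for v
    using that unfolding VT_def retract_def PT_def by auto
  show "loops n C Q = ncls VT (tree_rel Q)"
    unfolding loops_def by (rule ncls_transfer[where f = retract and g = "\<lambda>g. g"]) (use f g Rf Rg gf fg in auto)
  have "fin_cls (germs n) ?S \<longleftrightarrow> fin_cls VT ?R"
    by (rule fin_cls_transfer[where f = retract and g = "\<lambda>g. g"]) (use f g Rf Rg gf fg in auto)
  then show "fin_cls (germs n) ?S" using fin_cls_VT by blast
  show "equivclp ?S u v \<longleftrightarrow> equivclp ?R u v" if "u \<in> VT" "v \<in> VT"
    using equivclp_map[of ?S u v ?R retract, OF _ Rf] equivclp_le[of ?R u v ?S, OF _ Rg] fg that by auto
qed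

end

section \<open>Source-sink orientations\<close>

lemma equivclp_add_pair_cong:
  "equivclp R = equivclp R' \<Longrightarrow> equivclp (add_pair R a b) = equivclp (add_pair R' a b)"
  by (intro ext) (simp add: equivclp_add_pair)

text \<open>Two involutions that reverse \<iota> are matchings between the germs with \<iota> and
  those without it, so \<open>two_matchings_switch\<close> applies; \<open>b\<close> leaves the four
  germs of \<open>U\<close> free.\<close>

lemma matching_switch:
  fixes \<iota> :: "'a \<Rightarrow> bool"
  assumes fin: "finite V"
    and a: "\<And>v. v \<in> V \<Longrightarrow> a v \<in> V \<and> a (a v) = v \<and> \<iota> (a v) \<noteq> \<iota> v"
    and b: "\<And>v. v \<in> V - U \<Longrightarrow> b v \<in> V - U \<and> b (b v) = v \<and> \<iota> (b v) \<noteq> \<iota> v"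
    and U: "U = {p1, p2, q1, q2}" "U \<subseteq> V" "p1 \<noteq> p2" "q1 \<noteq> q2"
    and io: "\<iota> p1" "\<iota> p2" "\<not> \<iota> q1" "\<not> \<iota> q2"
  defines "R \<equiv> \<lambda>u v. u \<in> V \<and> v = a u \<or> u \<in> V - U \<and> v = b u"
  defines "N \<equiv> \<lambda>x y z w. ncls V (add_pair (add_pair R x y) z w)"
  shows "N p1 q1 p2 q2 = Suc (N p1 q2 p2 q1) \<and> N p1 p2 q1 q2 = N p1 q2 p2 q1 \<or>
         N p1 q2 p2 q1 = Suc (N p1 q1 p2 q2) \<and> N p1 p2 q1 q2 = N p1 q1 p2 q2 \<and>
         equivclp (add_pair (add_pair R p1 q1) p2 q2) p1 p2"
proof -
  define I P where "I = {v \<in> V. \<iota> v}" "P = {v \<in> V. \<not> \<iota> v}"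
  let ?M = "two_matchings I {p1, p2} a b"
  have IP: "I - {p1, p2} = {v \<in> V - U. \<iota> v}" "P - {q1, q2} = {v \<in> V - U. \<not> \<iota> v}"
    unfolding I_P_def U(1) using io by auto
  have ba: "bij_betw a I P"
    by (rule bij_betw_byWitness[where f' = a]) (use a in \<open>auto simp: I_P_def\<close>)
  have bb: "bij_betw b (I - {p1, p2}) (P - {q1, q2})"
    unfolding IP by (rule bij_betw_byWitness[where f' = b]) (use b in auto)
  have V: "V = I \<union> P" unfolding I_P_def by auto
  have eq: "equivclp R = equivclp ?M"
  proof (rule equivclp_cong)
    fix u v assume "?M u v"
    then have "R u v" unfolding two_matchings_def R_def IP(1) by (auto simp: I_P_def)
    then show "equivclp R u v" by blast
  next
    fix u v assume R: "R u v"
    show "equivclp ?M u v"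
    proof (cases "u \<in> V \<and> v = a u")
      case True
      then have "?M u v \<or> ?M v u" using a[of u] unfolding two_matchings_def I_P_def by auto
      then show ?thesis by blast
    next
      case False
      then have u: "u \<in> V - U" "v = b u" using R unfolding R_def by auto
      then have "?M u v \<or> ?M v u" using b[of u] IP(1) unfolding two_matchings_def by auto
      then show ?thesis by blast
    qed
  qed
  have eq2: "equivclp (add_pair (add_pair R x y) z w) = equivclp (add_pair (add_pair ?M x y) z w)" for x y z w
    using equivclp_add_pair_cong[OF equivclp_add_pair_cong[OF eq]] .
  have N: "N x y z w = ncls V (add_pair (add_pair ?M x y) z w)" for x y z w
    unfolding N_def ncls_def eq2 ..
  show ?thesis unfolding N eq2 unfolding V
    by (rule two_matchings_switch[OF _ _ ba bb]) (use fin U io in \<open>auto simp: I_P_def\<close>)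
qed

text \<open>A source-sink orientation, where \<iota> tells whether the edge at a germ points towards
  the point. It is consistent along edges and through points without chords; at a crossing both
  germs of one strand point in and both germs of the other point out. Hence each smoothing joins an
  inward germ to an outward one.\<close>

definition coherent :: "nat \<Rightarrow> (point \<Rightarrow> point \<Rightarrow> bool) \<Rightarrow> (germ \<Rightarrow> bool) \<Rightarrow> bool" where
  "coherent n C \<iota> \<longleftrightarrow>
     (\<forall>i < n. \<forall>x e. \<iota> ((i, x + 1), e) = \<iota> ((i, x), e)) \<and>
     (\<forall>i < n. \<forall>x y. x < y \<longrightarrow> (\<forall>z. x < z \<and> z < y \<longrightarrow> \<not> chorded C (i, z)) \<longrightarrow>
        \<iota> ((i, x), True) \<noteq> \<iota> ((i, y), False)) \<and>
     (\<forall>p. fst p < n \<longrightarrow> \<not> chorded C p \<longrightarrow> \<iota> (p, False) \<noteq> \<iota> (p, True)) \<and>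
     (\<forall>p q. C p q \<longrightarrow> \<iota> (p, False) = \<iota> (p, True) \<and> (\<forall>e e'. \<iota> (p, e) \<noteq> \<iota> (q, e')))"

lemma coherent_same:
  assumes "coherent n C \<iota>" "fst p < n" "same_point p q"
  shows "\<iota> (p, e) = \<iota> (q, e)"
proof -
  obtain k where k: "q = (fst p, snd p + of_int k)"
    using same_pointE[of "fst p" "snd p" q] assms(3) by auto
  have s: "\<iota> ((fst p, x + 1), e) = \<iota> ((fst p, x), e)" for x
    using assms(1,2) unfolding coherent_def by blast
  have "\<iota> ((fst p, snd p + of_int k), e) = \<iota> ((fst p, snd p), e)"
  proof (induction k rule: int_induct[where k = 0])
    case (step1 i)
    then show ?case using s[of "snd p + of_int i"] by (simp add: algebra_simps)
  next
    case (step2 i)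
    then show ?case using s[of "snd p + of_int (i - 1)"] by (simp add: algebra_simps)
  qed simp
  then show ?thesis using k by simp
qed

text \<open>The chord diagram in which the strands at \<open>p\<close> and \<open>q\<close> pass through each other.\<close>

definition cut_chord :: "(point \<Rightarrow> point \<Rightarrow> bool) \<Rightarrow> point \<Rightarrow> point \<Rightarrow> point \<Rightarrow> point \<Rightarrow> bool" where
  "cut_chord C p q r s \<longleftrightarrow> C r s \<and> \<not> same_point r p \<and> \<not> same_point r q"

context chords
begin

lemma cut_chord_iff:
  assumes "C p q"
  shows "cut_chord C p q r s \<longleftrightarrow> C r s \<and> \<not> same_point r p \<and> \<not> same_point r q \<and> \<not> same_point s p \<and> \<not> same_point s q"
  unfolding cut_chord_def using C_fun C_per C_sym assms same_point_sym same_point_refl by meson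

lemma chords_cut:
  assumes "C p q"
  shows "chords n (cut_chord C p q)"
proof
  fix r s t r' s'
  show "cut_chord C p q r s \<Longrightarrow> cut_chord C p q s r" unfolding cut_chord_iff[OF assms] using C_sym by blast
  show "cut_chord C p q r s \<Longrightarrow> fst r < n" unfolding cut_chord_def using C_dom by blast
  show "cut_chord C p q r s \<Longrightarrow> \<not> same_point r s" unfolding cut_chord_def using C_irr by blast
  show "cut_chord C p q r s \<Longrightarrow> same_point r r' \<Longrightarrow> same_point s s' \<Longrightarrow> cut_chord C p q r' s'"
    unfolding cut_chord_def using C_per same_point_trans by blast
  show "cut_chord C p q r s \<Longrightarrow> cut_chord C p q r t \<Longrightarrow> same_point s t" unfolding cut_chord_def using C_fun by blast
  show "finite {p'. base p' \<and> chorded (cut_chord C p q) p'}"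
    by (rule finite_subset[OF _ C_fin]) (auto simp: cut_chord_def chorded_def)
qed

lemma coherent_opp:
  assumes "coherent n C \<iota>" "i < n" "x < y" "\<And>z. x < z \<Longrightarrow> z < y \<Longrightarrow> \<not> chorded C (i, z)"
  shows "\<iota> ((i, y), False) = (\<not> \<iota> ((i, x), True))"
  using assms unfolding coherent_def by blast

end

context marked
begin

lemma marked_cut: "C p q \<Longrightarrow> marked n (cut_chord C p q) T"
  unfolding marked_def marked_axioms_def
  using chords_cut T_dom T_per T_fin T_ne T_C unfolding cut_chord_def by blast

lemma along_flip:
  assumes "coherent n C \<iota>" "g \<in> VT"
  shows "\<iota> (along g) \<noteq> \<iota> g"
proof -
  have *: "\<iota> (nxt p, False) = (\<not> \<iota> (p, True))" if "p \<in> PT" for p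
  proof -
    have i: "fst p < n" using PT_dom[OF that] .
    have "\<iota> ((fst p, nx (fst p) (snd p)), False) = (\<not> \<iota> ((fst p, snd p), True))"
      by (rule coherent_opp[OF assms(1) i nx_gt[OF i]]) (use nx_gap[OF i] T_chorded in blast)
    moreover have "\<iota> ((fst p, nx (fst p) (snd p)), False) = \<iota> (nxt p, False)"
      unfolding nxt_def by (rule coherent_same[OF assms(1)]) (use i in auto)
    ultimately show ?thesis by simp
  qed
  show ?thesis
    using *[of "fst g"] *[of "prv (fst g)"] assms(2) nxt_prv[of "fst g"] prv_PT[of "fst g"]
    unfolding along_def VT_def by (cases g; cases "snd g") auto
qed

lemma link_flip:
  assumes "coherent n C \<iota>" "g \<in> VT"
  shows "\<iota> (link Q g) \<noteq> \<iota> g"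
proof (cases "chorded C (fst g)")
  case True
  then have "C (fst g) (partner (fst g))" unfolding chorded_def using partner by blast
  then have "\<iota> (fst g, snd g) \<noteq> \<iota> (partner (fst g), e')" for e'
    using assms(1) unfolding coherent_def by blast
  then show ?thesis unfolding link_def using True by auto
next
  case False
  have "fst (fst g) < n" using assms(2) PT_dom unfolding VT_def by auto
  then have "\<iota> (fst g, False) \<noteq> \<iota> (fst g, True)"
    using False assms(1) unfolding coherent_def by blast
  then show ?thesis unfolding link_def using False by (cases g; cases "snd g") auto
qed

text \<open>All the smoothings at the crossing of \<open>p\<close> and \<open>q\<close> arise from this relation by adding two pairs.\<close>

definition open_rel :: "(point \<Rightarrow> bool) \<Rightarrow> point \<Rightarrow> point \<Rightarrow> germ \<Rightarrow> germ \<Rightarrow> bool" where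
  "open_rel Q p q u v \<longleftrightarrow> u \<in> VT \<and> v = along u \<or> u \<in> VT - {p, q} \<times> UNIV \<and> v = link Q u"

lemma partner_PT: "C p q \<Longrightarrow> q \<in> PT \<Longrightarrow> partner p = q"
  using partner(4) unfolding PT_def by simp

lemma link_chord:
  "C p q \<Longrightarrow> q \<in> PT \<Longrightarrow> link Q (p, e) = (q, if Q p then \<not> e else e)"
  unfolding link_def using chordedI[of C] partner_PT by simp

lemma tree_rel_open_rel:
  assumes "C p q" "p \<in> PT" "q \<in> PT" "Q p = Q q"
  shows "equivclp (tree_rel Q) =
    equivclp (add_pair (add_pair (open_rel Q p q) (p, False) (q, Q p)) (p, True) (q, \<not> Q p))"
    (is "_ = equivclp ?A")
proof (rule equivclp_cong)
  have l: "link Q (p, e) = (q, if Q p then \<not> e else e)" "link Q (q, e) = (p, if Q p then \<not> e else e)" for e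
    using link_chord assms C_sym by auto
  have V: "(p, e) \<in> VT" "(q, e) \<in> VT" for e using assms unfolding VT_def by auto
  fix u v
  show "equivclp ?A u v" if "tree_rel Q u v"
  proof (cases "v = along u \<or> fst u \<notin> {p, q}")
    case True
    then have "?A u v" using that unfolding tree_rel_def open_rel_def add_pair_def
      by (cases u) auto
    then show ?thesis by blast
  next
    case False
    then have "v = link Q u" "fst u = p \<or> fst u = q" using that unfolding tree_rel_def by auto
    then have "?A u v \<or> ?A v u" unfolding add_pair_def
      using l by (cases u; cases "snd u"; cases "Q p") auto
    then show ?thesis by blast
  qed
  show "equivclp (tree_rel Q) u v" if "?A u v"
  proof -
    have "tree_rel Q u v"
      using that V l unfolding add_pair_def tree_rel_def open_rel_def by auto
    then show ?thesis by blast
  qed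
qed

lemma open_rel_cong:
  assumes "\<And>r. chorded C r \<Longrightarrow> r \<noteq> p \<Longrightarrow> r \<noteq> q \<Longrightarrow> r \<in> PT \<Longrightarrow> Q r = Q' r"
  shows "open_rel Q p q = open_rel Q' p q"
  unfolding open_rel_def link_def using assms by (intro ext) (auto simp: VT_def)

text \<open>After cutting the chord its two ends are ordinary marked points that are passed straight
  through. This is the third way of pairing the four open germs, joining \<open>p\<close> to itself
  and \<open>q\<close> to itself.\<close>

lemma tree_rel_cut:
  assumes "C p q" "p \<in> PT" "q \<in> PT"
    and Q: "\<And>r. chorded C r \<Longrightarrow> r \<noteq> p \<Longrightarrow> r \<noteq> q \<Longrightarrow> r \<in> PT \<Longrightarrow> Q r = Q' r"
  shows "equivclp (marked.tree_rel (cut_chord C p q) T Q') =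
    equivclp (add_pair (add_pair (open_rel Q p q) (p, False) (p, True)) (q, False) (q, True))"
    (is "equivclp ?B = equivclp ?A")
proof -
  interpret c: marked n "cut_chord C p q" T using marked_cut assms(1) .
  have ch: "chorded (cut_chord C p q) r \<longleftrightarrow> chorded C r \<and> r \<noteq> p \<and> r \<noteq> q" if "r \<in> PT" for r
  proof -
    have "same_point r s \<longleftrightarrow> r = s" if "s \<in> PT" for s
      using base_same_point[of r s] that \<open>r \<in> PT\<close> unfolding PT_def by auto
    then show ?thesis using assms(2,3) unfolding chorded_def cut_chord_def by auto
  qed
  have V: "(p, e) \<in> VT" "(q, e) \<in> VT" for e using assms unfolding VT_def by auto
  have pa: "c.partner r = partner r" if "chorded (cut_chord C p q) r" for r
  proof -
    from that obtain s where s: "cut_chord C p q r s" unfolding chorded_def by blast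
    then have "C r s" unfolding cut_chord_def by blast
    then show ?thesis using c.partner(4)[OF s] partner(4) by simp
  qed
  have l: "c.link Q' g = (if fst g = p \<or> fst g = q then (fst g, \<not> snd g) else link Q g)" if "g \<in> VT" for g
    using that ch[of "fst g"] pa[of "fst g"] Q[of "fst g"] unfolding c.link_def link_def VT_def by auto
  show ?thesis
  proof (rule equivclp_cong)
    fix u v
    show "equivclp ?A u v" if "?B u v"
    proof (cases "v = along u \<or> fst u \<notin> {p, q}")
      case True
      then have "?A u v" using that l[of u] unfolding c.tree_rel_def open_rel_def add_pair_def
        by (cases u) auto
      then show ?thesis by blast
    next
      case False
      then have "v = (fst u, \<not> snd u)" "fst u = p \<or> fst u = q" using that l[of u] unfolding c.tree_rel_def by auto
      then have "?A u v \<or> ?A v u" unfolding add_pair_def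
        by (cases u; cases "snd u") auto
      then show ?thesis by blast
    qed
    show "equivclp ?B u v" if "?A u v"
    proof -
      have "?B u v"
        using that V l[of u] l[of "(p, False)"] l[of "(q, False)"]
        unfolding add_pair_def c.tree_rel_def open_rel_def
        by (auto simp: mem_Times_iff)
      then show ?thesis by blast
    qed
  qed
qed

text \<open>The three ways to close \<open>open_rel\<close> at the crossing are the three pairings
  of four ends in \<open>two_matchings_switch\<close>. The germs of \<open>p\<close> lie on one side
  of the bipartition given by \<iota> and those of \<open>q\<close> on the other, so the two
  smoothings are the pairings across and the virtual passage is the pairing within the sides. The
  two conclusions are the same statement seen from either smoothing.\<close>

lemma tree_rel_switch:
  assumes coh: "coherent n C \<iota>" and C: "C p q" "p \<in> PT" "q \<in> PT"
    and Q: "state Q1" "state Q0" "Q1 p" "\<not> Q0 p"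
    and agree: "\<And>r. chorded C r \<Longrightarrow> r \<noteq> p \<Longrightarrow> r \<noteq> q \<Longrightarrow> r \<in> PT \<Longrightarrow> Q1 r = Q0 r \<and> Q1 r = Q' r"
  defines "N1 \<equiv> ncls VT (tree_rel Q1)" and "N0 \<equiv> ncls VT (tree_rel Q0)"
    and "N' \<equiv> ncls VT (marked.tree_rel (cut_chord C p q) T Q')"
  shows "N1 = Suc N0 \<and> N' = N0 \<or> N0 = Suc N1 \<and> N' = N1 \<and> equivclp (tree_rel Q1) (p, False) (p, True)"
    "N0 = Suc N1 \<and> N' = N1 \<or> N1 = Suc N0 \<and> N' = N0 \<and> equivclp (tree_rel Q0) (p, False) (p, True)"
proof -
  let ?R = "open_rel Q1 p q"
  have pq: "Q1 q" "\<not> Q0 q" using C(1) Q unfolding state_def by metis+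
  have R0: "open_rel Q0 p q = ?R" by (rule open_rel_cong) (use agree in metis)
  have e1: "equivclp (tree_rel Q1) = equivclp (add_pair (add_pair ?R (p, False) (q, True)) (p, True) (q, False))"
    using tree_rel_open_rel[OF C, of Q1] pq Q by simp
  have e0: "equivclp (tree_rel Q0) = equivclp (add_pair (add_pair ?R (p, False) (q, False)) (p, True) (q, True))"
    using tree_rel_open_rel[OF C, of Q0] pq Q by (simp add: R0)
  have e': "equivclp (marked.tree_rel (cut_chord C p q) T Q') =
     equivclp (add_pair (add_pair ?R (p, False) (p, True)) (q, False) (q, True))"
    by (rule tree_rel_cut[OF C]) (use agree in metis)
  have sw: "add_pair (add_pair R a b) c d = add_pair (add_pair R c d) a b" for R :: "germ \<Rightarrow> germ \<Rightarrow> bool" and a b c d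
    unfolding add_pair_def by (intro ext) auto
  have fl: "equivclp (add_pair R a b) = equivclp (add_pair R b a)" for R :: "germ \<Rightarrow> germ \<Rightarrow> bool" and a b
    by (intro ext) (auto simp: equivclp_add_pair)
  have fl2: "equivclp (add_pair (add_pair R a b) c d) = equivclp (add_pair (add_pair R b a) d c)"
    for R :: "germ \<Rightarrow> germ \<Rightarrow> bool" and a b c d
    using fl[of "add_pair R a b" c d] equivclp_add_pair_cong[OF fl[of R a b], of d c] by simp
  have e'2: "equivclp (marked.tree_rel (cut_chord C p q) T Q') =
     equivclp (add_pair (add_pair ?R (p, False) (p, True)) (q, True) (q, False))"
    unfolding e' by (rule fl)
  define U where "U = {(p, False), (p, True), (q, True), (q, False)}"
  have U: "U = {p, q} \<times> UNIV" unfolding U_def using UNIV_bool by auto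
  have U': "U = {(q, True), (q, False), (p, False), (p, True)}"
      "U = {(q, False), (q, True), (p, False), (p, True)}" "U = {(p, False), (p, True), (q, False), (q, True)}"
    unfolding U_def by auto
  have UV: "U \<subseteq> VT" using C unfolding U VT_def by auto
  have cq: "C q p" using C_sym C(1) .
  have a: "along v \<in> VT \<and> along (along v) = v \<and> \<iota> (along v) \<noteq> \<iota> v" if "v \<in> VT" for v
    using that along_VT along_along along_flip[OF coh] by blast
  have lU: "link Q1 v \<in> U" if "v \<in> U" for v
    using that link_chord[OF C(1,3)] link_chord[OF cq C(2)] unfolding U by auto
  have b: "link Q1 v \<in> VT - U \<and> link Q1 (link Q1 v) = v \<and> \<iota> (link Q1 v) \<noteq> \<iota> v" if "v \<in> VT - U" for v
  proof -
    have "link Q1 (link Q1 v) = v" using link_link[OF _ Q(1)] that by blast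
    moreover have "link Q1 v \<notin> U"
    proof
      assume "link Q1 v \<in> U"
      then show False using lU[of "link Q1 v"] calculation that by simp
    qed
    ultimately show ?thesis using that link_VT[of v Q1] link_flip[OF coh, of v Q1] by blast
  qed
  have R: "?R = (\<lambda>u v. u \<in> VT \<and> v = along u \<or> u \<in> VT - U \<and> v = link Q1 u)"
    unfolding open_rel_def U by (intro ext) simp
  let ?N = "\<lambda>x y z w. ncls VT (add_pair (add_pair ?R x y) z w)"
  have ms: "?N p1 q1 p2 q2 = Suc (?N p1 q2 p2 q1) \<and> ?N p1 p2 q1 q2 = ?N p1 q2 p2 q1 \<or>
      ?N p1 q2 p2 q1 = Suc (?N p1 q1 p2 q2) \<and> ?N p1 p2 q1 q2 = ?N p1 q1 p2 q2 \<and>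
      equivclp (add_pair (add_pair ?R p1 q1) p2 q2) p1 p2"
    if h: "U = {p1, p2, q1, q2}" "p1 \<noteq> p2" "q1 \<noteq> q2" "\<iota> p1" "\<iota> p2" "\<not> \<iota> q1" "\<not> \<iota> q2" for p1 p2 q1 q2
    unfolding R
    by (rule matching_switch[where \<iota> = \<iota> and U = U, OF finite_VT _ _ h(1) UV h(2-)]) (erule a, erule b)
  have io: "\<iota> (p, False) = \<iota> (p, True)" "\<iota> (q, False) = \<iota> (q, True)" "\<iota> (p, False) \<noteq> \<iota> (q, True)"
    using coh C(1) cq unfolding coherent_def by blast+
  have rel: "equivclp (tree_rel Q1) (p, False) (p, True)" if "equivclp (tree_rel Q1) (q, True) (q, False)"
  proof -
    have "equivclp (tree_rel Q1) (p, False) (q, True)" "equivclp (tree_rel Q1) (q, False) (p, True)"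
      unfolding e1 by (auto simp: equivclp_add_pair)
    then show ?thesis using that by (meson equivclp_trans)
  qed
  have rel0: "equivclp (tree_rel Q0) (p, False) (p, True)" if "equivclp (tree_rel Q0) (q, False) (q, True)"
  proof -
    have "equivclp (tree_rel Q0) (p, False) (q, False)" "equivclp (tree_rel Q0) (q, True) (p, True)"
      unfolding e0 by (auto simp: equivclp_add_pair)
    then show ?thesis using that by (meson equivclp_trans)
  qed
  have "(N1 = Suc N0 \<and> N' = N0 \<or> N0 = Suc N1 \<and> N' = N1 \<and> equivclp (tree_rel Q1) (p, False) (p, True)) \<and>
    (N0 = Suc N1 \<and> N' = N1 \<or> N1 = Suc N0 \<and> N' = N0 \<and> equivclp (tree_rel Q0) (p, False) (p, True))"
  \<comment> \<open>\<iota> decides which strand plays the role of \<open>p1\<close>,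
    \<open>p2\<close>. If it is the strand of \<open>q\<close>, the connection is obtained for the
    germs of \<open>q\<close> and carried over to those of \<open>p\<close> by \<open>rel\<close>
    and \<open>rel0\<close>.\<close>
  proof (cases "\<iota> (p, False)")
    case True
    have "N1 = Suc N0 \<and> N' = N0 \<or> N0 = Suc N1 \<and> N' = N1 \<and> equivclp (tree_rel Q1) (p, False) (p, True)"
      using ms[OF U_def] True io unfolding N1_def N0_def N'_def ncls_def e1 e0 e'2 by simp
    moreover have "N0 = Suc N1 \<and> N' = N1 \<or> N1 = Suc N0 \<and> N' = N0 \<and> equivclp (tree_rel Q0) (p, False) (p, True)"
      using ms[OF U'(3)] True io unfolding N1_def N0_def N'_def ncls_def e1 e0 e' by simp
    ultimately show ?thesis ..
  next
    case False
    have "N1 = Suc N0 \<and> N' = N0 \<or> N0 = Suc N1 \<and> N' = N1 \<and> equivclp (tree_rel Q1) (q, True) (q, False)"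
      using ms[OF U'(1)] False io
      unfolding N1_def N0_def N'_def ncls_def e1 e0 e'2
        fl2[of ?R "(p, False)"] sw[of ?R "(p, False)" "(p, True)"] sw[of ?R "(q, False)" "(p, False)"]
      by simp
    moreover have "N0 = Suc N1 \<and> N' = N1 \<or> N1 = Suc N0 \<and> N' = N0 \<and> equivclp (tree_rel Q0) (q, False) (q, True)"
      using ms[OF U'(2)] False io
      unfolding N1_def N0_def N'_def ncls_def e1 e0 e'
        fl2[of ?R "(p, False)" "(q, False)"]  fl2[of ?R "(p, False)" "(q, True)"] sw[of ?R "(p, False)" "(p, True)"] sw[of ?R "(q, True)" "(p, False)"]
      by simp
    ultimately show ?thesis using rel rel0 by blast
  qed
  then show "N1 = Suc N0 \<and> N' = N0 \<or> N0 = Suc N1 \<and> N' = N1 \<and> equivclp (tree_rel Q1) (p, False) (p, True)"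
    "N0 = Suc N1 \<and> N' = N1 \<or> N1 = Suc N0 \<and> N' = N0 \<and> equivclp (tree_rel Q0) (p, False) (p, True)" by blast+
qed

text \<open>The connectivity clause is the source of adequacy: when the two germs of
  \<open>p\<close> lie on different circles of a state, switching the smoothing there must lose a
  circle.\<close>

theorem loops_switch:
  assumes coh: "coherent n C \<iota>" and C: "C p q"
    and Q: "state Q1" "state Q0" "state Q'" "Q1 p" "\<not> Q0 p"
    and agree: "\<And>r. chorded C r \<Longrightarrow> \<not> same_point r p \<Longrightarrow> \<not> same_point r q \<Longrightarrow> Q1 r = Q0 r \<and> Q1 r = Q' r"
  defines "N1 \<equiv> loops n C Q1" and "N0 \<equiv> loops n C Q0" and "N' \<equiv> loops n (cut_chord C p q) Q'"
  shows "N1 = Suc N0 \<and> N' = N0 \<or> N0 = Suc N1 \<and> N' = N1 \<and> equivclp (smooth_rel n C Q1) (p, False) (p, True)"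
    "N0 = Suc N1 \<and> N' = N1 \<or> N1 = Suc N0 \<and> N' = N0 \<and> equivclp (smooth_rel n C Q0) (p, False) (p, True)"
proof -
  have C': "C (rep p) (rep q)" using C_per[OF C same_point_rep same_point_rep] .
  have PT: "rep p \<in> PT" "rep q \<in> PT" using rep_PT T_C C C_sym by blast+
  have ct: "cut_chord C p q = cut_chord C (rep p) (rep q)"
    unfolding cut_chord_def by (intro ext) (meson same_point_rep same_point_sym same_point_trans)
  interpret c: marked n "cut_chord C p q" T using marked_cut C .
  have sQ': "c.state Q'" using Q(3) unfolding c.state_def state_def cut_chord_def by blast
  have Qr: "Q1 (rep p)" "\<not> Q0 (rep p)" using Q same_point_rep unfolding state_def by metis+
  have ag: "Q1 r = Q0 r \<and> Q1 r = Q' r" if "chorded C r" "r \<noteq> rep p" "r \<noteq> rep q" "r \<in> PT" for r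
  proof (rule agree[OF that(1)])
    show "\<not> same_point r p" "\<not> same_point r q"
      using that rep_eq_iff rep_base unfolding PT_def by (metis mem_Collect_eq)+
  qed
  have i: "fst p < n" using C_dom[OF C] .
  have r: "equivclp (smooth_rel n C Q) (p, False) (p, True)"
    if "equivclp (tree_rel Q) (rep p, False) (rep p, True)" "state Q" for Q
  proof -
    have "equivclp (smooth_rel n C Q) (rep p, False) (rep p, True)"
      using smooth_rel_VT[OF that(2)] that(1) PT unfolding VT_def by simp
    moreover have "equivclp (smooth_rel n C Q) (p, e) (rep p, e)" for e
      by (rule smooth_rel_same[OF i same_point_rep])
    ultimately show ?thesis by (meson equivclp_sym equivclp_trans)
  qed
  have N: "N1 = ncls VT (tree_rel Q1)" "N0 = ncls VT (tree_rel Q0)"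
    "N' = ncls VT (marked.tree_rel (cut_chord C (rep p) (rep q)) T Q')"
    unfolding N1_def N0_def N'_def
    using loops_VT[OF Q(1)] loops_VT[OF Q(2)] c.loops_VT[OF sQ'] by (simp_all add: ct)
  note * = tree_rel_switch[OF coh C' PT Q(1,2) Qr ag, folded N]
  show "N1 = Suc N0 \<and> N' = N0 \<or> N0 = Suc N1 \<and> N' = N1 \<and> equivclp (smooth_rel n C Q1) (p, False) (p, True)"
    using *(1) r[OF _ Q(1)] by blast
  show "N0 = Suc N1 \<and> N' = N1 \<or> N1 = Suc N0 \<and> N' = N0 \<and> equivclp (smooth_rel n C Q0) (p, False) (p, True)"
    using *(2) r[OF _ Q(2)] by blast
qed

end

section \<open>State sums\<close>

text \<open>\<open>S\<close> is the set of crossings smoothed along the orientation. At a positive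
  crossing this is the A-smoothing and at a negative one the B-smoothing, which explains the test in
  the weight. All circles are counted, without the usual shift by one.\<close>

definition state_sum :: "'z set \<Rightarrow> ('z \<Rightarrow> bool) \<Rightarrow> ('z set \<Rightarrow> nat) \<Rightarrow> complex \<Rightarrow> complex" where
  "state_sum X pos L A =
     (\<Sum>S\<in>Pow X. (\<Prod>z\<in>X. if (z \<in> S) = pos z then A else 1 / A) * (- (A\<^sup>2) - 1 / A\<^sup>2) ^ L S)"

lemma state_sum_cong:
  assumes "\<And>S. S \<subseteq> X \<Longrightarrow> L S = L' S" "\<And>z. z \<in> X \<Longrightarrow> pos z = pos' z"
  shows "state_sum X pos L A = state_sum X pos' L' A"
  unfolding state_sum_def using assms by (intro sum.cong arg_cong2[of _ _ _ _ times] prod.cong) auto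

lemma state_sum_reindex:
  assumes "bij_betw h X X'" "\<And>S. S \<subseteq> X \<Longrightarrow> L S = L' (h ` S)" "\<And>z. z \<in> X \<Longrightarrow> pos z = pos' (h z)"
  shows "state_sum X pos L A = state_sum X' pos' L' A"
proof -
  have inj: "inj_on h X" and im: "h ` X = X'" using assms(1) by (auto simp: bij_betw_def)
  have "bij_betw ((`) h) (Pow X) (Pow X')"
    using bij_betw_Pow[OF assms(1)] .
  then have "state_sum X' pos' L' A =
      (\<Sum>S\<in>Pow X. (\<Prod>z\<in>X'. if (z \<in> h ` S) = pos' z then A else 1 / A) * (- (A\<^sup>2) - 1 / A\<^sup>2) ^ L' (h ` S))"
    unfolding state_sum_def by (rule sum.reindex_bij_betw[symmetric])
  also have "\<dots> = state_sum X pos L A"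
    unfolding state_sum_def
  proof (intro sum.cong arg_cong2[of _ _ _ _ times])
    fix S assume S: "S \<in> Pow X"
    have "(\<Prod>z\<in>X'. if (z \<in> h ` S) = pos' z then A else 1 / A) =
        (\<Prod>z\<in>X. if (h z \<in> h ` S) = pos' (h z) then A else 1 / A)"
      by (rule prod.reindex_bij_betw[OF assms(1), symmetric])
    also have "\<dots> = (\<Prod>z\<in>X. if (z \<in> S) = pos z then A else 1 / A)"
      by (rule prod.cong) (use S assms(3) inj_on_image_mem_iff[OF inj] in auto)
    finally show "(\<Prod>z\<in>X'. if (z \<in> h ` S) = pos' z then A else 1 / A) =
        (\<Prod>z\<in>X. if (z \<in> S) = pos z then A else 1 / A)" .
  qed (use assms(2) in auto)
  finally show ?thesis ..
qed

lemma state_sum_inverse: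
  assumes "A \<noteq> 0"
  shows "state_sum X pos L (1 / A) = state_sum X (\<lambda>z. \<not> pos z) L A"
proof -
  have "- ((1 / A)\<^sup>2) - 1 / (1 / A)\<^sup>2 = - (A\<^sup>2) - 1 / A\<^sup>2" by (simp add: power_divide)
  then show ?thesis unfolding state_sum_def
    by (intro sum.cong arg_cong2[of _ _ _ _ times] prod.cong) auto
qed

text \<open>All the exponents of \<open>A\<close> are congruent modulo 4.\<close>

lemma state_sum_rotate:
  assumes fin: "finite X"
    and step: "\<And>S z. S \<subseteq> X \<Longrightarrow> z \<in> X \<Longrightarrow> z \<notin> S \<Longrightarrow> L (insert z S) = Suc (L S) \<or> L S = Suc (L (insert z S))"
  shows "\<exists>\<kappa>. \<forall>A. A \<noteq> 0 \<longrightarrow> state_sum X pos L (\<i> * A) = \<kappa> * state_sum X pos L A"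
proof -
  \<comment> \<open>The factor by which the term of \<open>S\<close> changes when A becomes iA: each
    weight A gains i, each weight 1/A gains -i, and each circle gains -1.\<close>
  define \<kappa> where "\<kappa> S = (\<Prod>z\<in>X. if (z \<in> S) = pos z then \<i> else - \<i>) * (- 1) ^ L S" for S
  \<comment> \<open>Switching one crossing exchanges one factor i with -i and changes the parity of
    the number of circles, so the two signs cancel.\<close>
  have ins: "\<kappa> (insert z S) = \<kappa> S" if "S \<subseteq> X" "z \<in> X" "z \<notin> S" for z S
  proof -
    have "(\<Prod>y\<in>X. if (y \<in> insert z S) = pos y then \<i> else - \<i>) =
        (if pos z then \<i> else - \<i>) * (\<Prod>y\<in>X - {z}. if (y \<in> S) = pos y then \<i> else - \<i>)"
      by (subst prod.remove[OF fin that(2)]) (auto intro!: prod.cong)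
    moreover have "(\<Prod>y\<in>X. if (y \<in> S) = pos y then \<i> else - \<i>) =
        - (if pos z then \<i> else - \<i>) * (\<Prod>y\<in>X - {z}. if (y \<in> S) = pos y then \<i> else - \<i>)"
      by (subst prod.remove[OF fin that(2)]) (use that(3) in auto)
    moreover have "(- 1) ^ L (insert z S) = - ((- 1) ^ L S :: complex)"
      using step[OF that] by auto
    ultimately show ?thesis unfolding \<kappa>_def by simp
  qed
  have \<kappa>: "\<kappa> S = \<kappa> {}" if "S \<subseteq> X" for S
    using finite_subset[OF that fin] that
    by (induction S rule: finite_induct) (use ins in auto)
  have "state_sum X pos L (\<i> * A) = \<kappa> {} * state_sum X pos L A" if "A \<noteq> 0" for A
    unfolding state_sum_def sum_distrib_left
  proof (rule sum.cong)
    fix S assume "S \<in> Pow X"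
    have p: "(\<Prod>z\<in>X. if (z \<in> S) = pos z then \<i> * A else 1 / (\<i> * A)) =
       (\<Prod>z\<in>X. if (z \<in> S) = pos z then \<i> else - \<i>) * (\<Prod>z\<in>X. if (z \<in> S) = pos z then A else 1 / A)"
      unfolding prod.distrib[symmetric] by (rule prod.cong) (auto simp: divide_simps)
    have q: "(- ((\<i> * A)\<^sup>2) - 1 / (\<i> * A)\<^sup>2) ^ L S = (- 1) ^ L S * (- (A\<^sup>2) - 1 / A\<^sup>2) ^ L S"
    proof -
      have "- ((\<i> * A)\<^sup>2) - 1 / (\<i> * A)\<^sup>2 = - 1 * (- (A\<^sup>2) - 1 / A\<^sup>2)"
        by (simp add: power_mult_distrib)
      then show ?thesis by (simp only: power_mult_distrib)
    qed
    show "(\<Prod>z\<in>X. if (z \<in> S) = pos z then \<i> * A else 1 / (\<i> * A)) * (- ((\<i> * A)\<^sup>2) - 1 / (\<i> * A)\<^sup>2) ^ L S =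
        \<kappa> {} * ((\<Prod>z\<in>X. if (z \<in> S) = pos z then A else 1 / A) * (- (A\<^sup>2) - 1 / A\<^sup>2) ^ L S)"
      unfolding p q \<kappa>[of S, OF PowD[OF \<open>S \<in> Pow X\<close>], symmetric] by (simp add: \<kappa>_def)
  qed simp
  then show ?thesis by blast
qed

text \<open>By \<open>low\<close> the state with only A-smoothings is the only one that reaches the
  top exponent \<open>card X + 2 * L T\<close>. Comparing leading terms of both sides of
  \<open>rot\<close> as A tends to infinity determines the constant.\<close>

lemma state_sum_top:
  fixes X :: "'z set"
  assumes fin: "finite X"
    and low: "\<And>S. S \<subseteq> X \<Longrightarrow> S \<noteq> {z \<in> X. pos z} \<Longrightarrow>
      Suc (L S) \<le> L {z \<in> X. pos z} + card {z \<in> X. (z \<in> S) \<noteq> pos z}"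
    and rot: "\<And>A. A \<noteq> 0 \<Longrightarrow> state_sum X pos L (\<i> * A) = \<kappa> * state_sum X pos L A"
  shows "\<i> ^ (card X + 2 * L {z \<in> X. pos z}) = \<kappa>"
proof -
  define T where "T = {z \<in> X. pos z}"
  define k where "k S = card {z \<in> X. (z \<in> S) \<noteq> pos z}" for S
  define M where "M = card X + 2 * L T"
  \<comment> \<open>The sum divided by its top power of A, written as a polynomial in y = 1/A. The
    subtraction in the exponent is never truncated, by \<open>le\<close>; every exponent is positive
    except that of \<open>T\<close>, so \<open>G 0\<close> is a sign.\<close>
  define G where "G y = (\<Sum>S\<in>Pow X. (- 1) ^ L S * (1 + y ^ 4) ^ L S * y ^ (2 * (k S + L T - L S)))" for y :: complex
  have kT: "k T = 0"
  proof -
    have "{z \<in> X. (z \<in> T) \<noteq> pos z} = {}" unfolding T_def by auto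
    then show ?thesis unfolding k_def by (simp only: card.empty)
  qed
  have le: "L S \<le> k S + L T" if "S \<subseteq> X" for S
    using low[OF that] kT unfolding k_def T_def by (cases "S = {z \<in> X. pos z}") auto
  have pr: "(\<Prod>z\<in>X. if (z \<in> S) = pos z then A else 1 / A) = A ^ card X * (1 / A) ^ (2 * k S)"
    if A: "A \<noteq> 0" for S and A :: complex
  proof -
    have "(\<Prod>z\<in>X. if (z \<in> S) = pos z then A else 1 / A) =
        (\<Prod>z\<in>X. A) * (\<Prod>z\<in>X. if (z \<in> S) \<noteq> pos z then (1 / A)\<^sup>2 else 1)"
      unfolding prod.distrib[symmetric]
      by (rule prod.cong) (use A in \<open>auto simp: power2_eq_square\<close>)
    also have "(\<Prod>z\<in>X. if (z \<in> S) \<noteq> pos z then (1 / A)\<^sup>2 else 1) = (\<Prod>z\<in>{z\<in>X. (z \<in> S) \<noteq> pos z}. (1 / A)\<^sup>2)"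
      using fin by (simp add: prod.If_cases Int_def)
    finally show ?thesis by (simp add: k_def power_mult)
  qed
  have ss: "state_sum X pos L A = A ^ M * G (1 / A)" if A: "A \<noteq> 0" for A
    unfolding state_sum_def G_def sum_distrib_left
  proof (rule sum.cong)
    fix S assume S: "S \<in> Pow X"
    have "- (A\<^sup>2) - 1 / A\<^sup>2 = - 1 * (1 + (1 / A) ^ 4) * A\<^sup>2"
      using A by (simp add: field_simps power_divide power_numeral_reduce)
    then have d: "(- (A\<^sup>2) - 1 / A\<^sup>2) ^ L S = (- 1) ^ L S * (1 + (1 / A) ^ 4) ^ L S * A ^ (2 * L S)"
      by (simp only: power_mult_distrib power_mult)
    have "A ^ (2 * L T) * (1 / A) ^ (2 * (k S + L T - L S)) = (1 / A) ^ (2 * k S) * A ^ (2 * L S)"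
    proof -
      have e: "2 * (k S + L T - L S) + 2 * L S = 2 * k S + 2 * L T" using le[OF PowD[OF S]] by simp
      have "(1 / A) ^ (2 * (k S + L T - L S)) = (1 / A) ^ (2 * (k S + L T - L S) + 2 * L S) * A ^ (2 * L S)"
        using A by (simp add: power_add field_simps)
      then show ?thesis unfolding e using A by (simp add: power_add field_simps)
    qed
    then show "(\<Prod>z\<in>X. if (z \<in> S) = pos z then A else 1 / A) * (- (A\<^sup>2) - 1 / A\<^sup>2) ^ L S =
        A ^ M * ((- 1) ^ L S * (1 + (1 / A) ^ 4) ^ L S * (1 / A) ^ (2 * (k S + L T - L S)))"
      unfolding pr[OF A] d M_def power_add by (simp add: mult.assoc mult.left_commute)
  qed simp
  \<comment> \<open>This is \<open>rot\<close> at A = 1/y. It makes sense only for nonzero y and is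
    extended to 0 by continuity.\<close>
  have eq: "\<i> ^ M * G (- \<i> * y) = \<kappa> * G y" if "y \<noteq> 0" for y
  proof -
    have "(\<i> / y) ^ M * G (1 / (\<i> / y)) = \<kappa> * ((1 / y) ^ M * G (1 / (1 / y)))"
      using rot[of "1 / y"] ss[of "\<i> / y"] ss[of "1 / y"] that by simp
    moreover have "1 / (\<i> / y) = - \<i> * y" using that by (simp add: field_simps)
    ultimately show ?thesis using that by (simp add: power_divide)
  qed
  have cont: "continuous (at 0) (\<lambda>y. \<i> ^ M * G (- \<i> * y))" "continuous (at 0) (\<lambda>y. \<kappa> * G y)"
    unfolding G_def by (intro continuous_intros)+
  have "((\<lambda>y. \<i> ^ M * G (- \<i> * y)) \<longlongrightarrow> \<i> ^ M * G (- \<i> * 0)) (at 0)"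
    using cont(1) by (simp add: continuous_within)
  moreover have "((\<lambda>y. \<i> ^ M * G (- \<i> * y)) \<longlongrightarrow> \<kappa> * G 0) (at 0)"
  proof (rule Lim_transform_eventually)
    show "((\<lambda>y. \<kappa> * G y) \<longlongrightarrow> \<kappa> * G 0) (at 0)" using cont(2) by (simp add: continuous_within)
    show "\<forall>\<^sub>F y in at 0. \<kappa> * G y = \<i> ^ M * G (- \<i> * y)"
      using eq by (auto simp: eventually_at_filter)
  qed
  ultimately have "\<i> ^ M * G (- \<i> * 0) = \<kappa> * G 0" by (rule tendsto_unique[rotated]) simp
  then have "\<i> ^ M * G 0 = \<kappa> * G 0" by simp
  moreover have "G 0 = (- 1) ^ L T"
  proof -
    have "G 0 = (\<Sum>S\<in>Pow X. if S = T then (- 1) ^ L T else 0)"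
      unfolding G_def
    proof (rule sum.cong)
      fix S assume S: "S \<in> Pow X"
      show "(- 1) ^ L S * (1 + 0 ^ 4) ^ L S * 0 ^ (2 * (k S + L T - L S)) = (if S = T then (- 1) ^ L T else (0::complex))"
      proof (cases "S = T")
        case False
        then have "Suc (L S) \<le> k S + L T" using low[of S] S unfolding T_def k_def by auto
        then have "2 * (k S + L T - L S) > 0" by simp
        then show ?thesis using False by simp
      qed (simp add: kT)
    qed simp
    also have "\<dots> = (- 1) ^ L T" using fin unfolding T_def by (subst sum.delta) auto
    finally show ?thesis .
  qed
  ultimately show ?thesis unfolding M_def T_def by simp
qed

text \<open>\<open>state_sum_top\<close> is applied at infinity and, after replacing A by 1/A, at 0.
  There the rotation runs backwards, so the constant is inverted, and the product of the two powers
  of i must be 1.\<close>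

lemma state_sum_span:
  assumes fin: "finite X"
    and lowA: "\<And>S. S \<subseteq> X \<Longrightarrow> S \<noteq> {z \<in> X. pos z} \<Longrightarrow>
      Suc (L S) \<le> L {z \<in> X. pos z} + card {z \<in> X. (z \<in> S) \<noteq> pos z}"
    and lowB: "\<And>S. S \<subseteq> X \<Longrightarrow> S \<noteq> {z \<in> X. \<not> pos z} \<Longrightarrow>
      Suc (L S) \<le> L {z \<in> X. \<not> pos z} + card {z \<in> X. (z \<in> S) = pos z}"
    and rot: "\<And>A. A \<noteq> 0 \<Longrightarrow> state_sum X pos L (\<i> * A) = \<kappa> * state_sum X pos L A"
  shows "even (card X + L {z \<in> X. pos z} + L {z \<in> X. \<not> pos z})"
proof -
  let ?a = "L {z \<in> X. pos z}" and ?b = "L {z \<in> X. \<not> pos z}"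
  have k: "\<i> ^ (card X + 2 * ?a) = \<kappa>" by (rule state_sum_top[OF fin lowA rot])
  then have k0: "\<kappa> \<noteq> 0" by auto
  have "\<i> ^ (card X + 2 * ?b) = 1 / \<kappa>"
  proof (rule state_sum_top[OF fin])
    fix A :: complex assume A: "A \<noteq> 0"
    have e: "\<i> * (1 / (\<i> * A)) = 1 / A" by simp
    have "state_sum X pos L (1 / A) = \<kappa> * state_sum X pos L (1 / (\<i> * A))"
      using rot[of "1 / (\<i> * A)"] A unfolding e by simp
    then show "state_sum X (\<lambda>z. \<not> pos z) L (\<i> * A) = 1 / \<kappa> * state_sum X (\<lambda>z. \<not> pos z) L A"
      using state_sum_inverse[of A X pos L] state_sum_inverse[of "\<i> * A" X pos L] A k0 by simp
  qed (use lowB in simp)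
  then have "\<i> ^ (card X + 2 * ?a) * \<i> ^ (card X + 2 * ?b) = 1" using k k0 by simp
  moreover have "\<i> ^ (card X + 2 * ?a) * \<i> ^ (card X + 2 * ?b) = \<i> ^ (2 * (card X + ?a + ?b))"
    by (simp add: power_add[symmetric] algebra_simps)
  ultimately have "(- 1 :: complex) ^ (card X + ?a + ?b) = 1" by (simp add: power_mult)
  then show ?thesis by (metis neg_one_odd_power one_neq_neg_one)
qed

text \<open>Walk from \<open>T\<close> to \<open>S\<close> one crossing at a time. Adequacy makes
  the first step lose a circle and each later step gains at most one, so the bound is two better
  than the distance alone. The extra unit pays for the circle lost in virtualizing.\<close>

lemma adequate_low:
  assumes fin: "finite X" and S: "S \<subseteq> X" "T \<subseteq> X" "S \<noteq> T"
    and step: "\<And>S z. S \<subseteq> X \<Longrightarrow> z \<in> X \<Longrightarrow> z \<notin> S \<Longrightarrow> L (insert z S) = Suc (L S) \<or> L S = Suc (L (insert z S))"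
    and adq: "\<And>z. z \<in> X \<Longrightarrow> Suc (L (if z \<in> T then T - {z} else insert z T)) = L T"
  shows "Suc (Suc (L S)) \<le> L T + card {z \<in> X. (z \<in> S) \<noteq> (z \<in> T)}"
  using S(1,3)
proof (induction "card {z \<in> X. (z \<in> S) \<noteq> (z \<in> T)}" arbitrary: S)
  case 0
  then have "{z \<in> X. (z \<in> S) \<noteq> (z \<in> T)} = {}" using fin by simp
  then show ?case using 0 S(2) by blast
next
  case (Suc k)
  then obtain z where z: "z \<in> X" "(z \<in> S) \<noteq> (z \<in> T)" using S(2) by blast
  define S' where "S' = (if z \<in> S then S - {z} else insert z S)"
  have S': "S' \<subseteq> X" using Suc.prems z unfolding S'_def by auto
  have "{z \<in> X. (z \<in> S) \<noteq> (z \<in> T)} = insert z {z \<in> X. (z \<in> S') \<noteq> (z \<in> T)}"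
    "z \<notin> {z \<in> X. (z \<in> S') \<noteq> (z \<in> T)}"
    using z unfolding S'_def by (auto split: if_splits)
  then have c: "card {z \<in> X. (z \<in> S) \<noteq> (z \<in> T)} = Suc (card {z \<in> X. (z \<in> S') \<noteq> (z \<in> T)})"
    using fin by simp
  show ?case
  proof (cases "S' = T")
    case True
    then have "S = (if z \<in> T then T - {z} else insert z T)" using z unfolding S'_def by (auto split: if_splits)
    then have "Suc (L S) = L T" using adq[OF z(1)] by simp
    then show ?thesis using c by simp
  next
    case False
    have "Suc (Suc (L S')) \<le> L T + card {z \<in> X. (z \<in> S') \<noteq> (z \<in> T)}"
      using Suc.hyps(1)[of S'] Suc.hyps(2) c S' False by simp
    moreover have "L S \<le> Suc (L S')"
      using step[of S z] step[of S' z] Suc.prems z S' unfolding S'_def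
      by (cases "z \<in> S") (auto simp: insert_absorb)
    ultimately show ?thesis using c by simp
  qed
qed

text \<open>Each added crossing changes the parity of \<open>L\<close>.\<close>

lemma step_parity:
  assumes "finite S" "S \<subseteq> X"
    and step: "\<And>S z. S \<subseteq> X \<Longrightarrow> z \<in> X \<Longrightarrow> z \<notin> S \<Longrightarrow> L (insert z S) = Suc (L S) \<or> L S = Suc (L (insert z S))"
  shows "even (L S + L {} + card S)"
  using assms(1,2)
proof (induction S rule: finite_induct)
  case (insert z S)
  then have "L (insert z S) = Suc (L S) \<or> L S = Suc (L (insert z S))" using step by simp
  then show ?case using insert by auto
qed simp

text \<open>
  Virtualizing one crossing of an adequate source-sink diagram shifts the span of the state sum by
  2 modulo 4.
\<close>

lemma virtualized_not_rotating:
  assumes fin: "finite X" and z0: "z0 \<in> X"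
    and step: "\<And>S z. S \<subseteq> X \<Longrightarrow> z \<in> X \<Longrightarrow> z \<notin> S \<Longrightarrow> L (insert z S) = Suc (L S) \<or> L S = Suc (L (insert z S))"
    and L': "\<And>S. S \<subseteq> X - {z0} \<Longrightarrow> L' S = min (L S) (L (insert z0 S))"
    and adqA: "\<And>z. z \<in> X \<Longrightarrow> Suc (L (if pos z then {z \<in> X. pos z} - {z} else insert z {z \<in> X. pos z})) = L {z \<in> X. pos z}"
    and adqB: "\<And>z. z \<in> X \<Longrightarrow> Suc (L (if \<not> pos z then {z \<in> X. \<not> pos z} - {z} else insert z {z \<in> X. \<not> pos z})) = L {z \<in> X. \<not> pos z}"
    and rot: "\<And>A. A \<noteq> 0 \<Longrightarrow> state_sum (X - {z0}) pos L' (\<i> * A) = \<kappa> * state_sum (X - {z0}) pos L' A"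
  shows False
proof -
  let ?Y = "X - {z0}"
  \<comment> \<open>Stated for a general predicate so as to serve the all-A and the all-B state
    alike. By adequacy at \<open>z0\<close> the other smoothing there has one circle less, and that
    is the minimum which \<open>L'\<close> takes.\<close>
  have main: "Suc (L' {z \<in> ?Y. P z}) = L {z \<in> X. P z} \<and>
     (\<forall>S\<subseteq>?Y. S \<noteq> {z \<in> ?Y. P z} \<longrightarrow> Suc (L' S) \<le> L' {z \<in> ?Y. P z} + card {z \<in> ?Y. (z \<in> S) \<noteq> P z})"
    if adq: "\<And>z. z \<in> X \<Longrightarrow> Suc (L (if P z then {z \<in> X. P z} - {z} else insert z {z \<in> X. P z})) = L {z \<in> X. P z}" for P
  proof -
    let ?T = "{z \<in> X. P z}" and ?U = "{z \<in> ?Y. P z}"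
    have U: "?U = ?T - {z0}" "insert z0 ?U = insert z0 ?T" by auto
    have 1: "Suc (L' ?U) = L ?T"
    proof (cases "P z0")
      case True
      then have "insert z0 ?U = ?T" using z0 by auto
      moreover have "L' ?U = min (L ?U) (L (insert z0 ?U))" by (rule L') auto
      moreover have "Suc (L ?U) = L ?T" using adq[OF z0] True U by simp
      ultimately show ?thesis by simp
    next
      case False
      then have "?U = ?T" using z0 by auto
      moreover have "L' ?U = min (L ?U) (L (insert z0 ?U))" by (rule L') auto
      moreover have "Suc (L (insert z0 ?U)) = L ?T" using adq[OF z0] False U by simp
      ultimately show ?thesis by simp
    qed
    have 2: "Suc (L' S) \<le> L' ?U + card {z \<in> ?Y. (z \<in> S) \<noteq> P z}" if S: "S \<subseteq> ?Y" "S \<noteq> ?U" for S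
    proof -
      \<comment> \<open>\<open>S\<close> is extended to a state that agrees with the extreme state
        at \<open>z0\<close>. This leaves the distance to the extreme state unchanged.\<close>
      define S' where "S' = (if P z0 then insert z0 S else S)"
      have "L' S \<le> L S'" using L'[OF S(1)] unfolding S'_def by auto
      moreover have "Suc (Suc (L S')) \<le> L ?T + card {z \<in> X. (z \<in> S') \<noteq> (z \<in> ?T)}"
        by (rule adequate_low[OF fin _ _ _ step]) (use S z0 adq in \<open>auto simp: S'_def split: if_splits\<close>)
      moreover have "{z \<in> X. (z \<in> S') \<noteq> (z \<in> ?T)} = {z \<in> ?Y. (z \<in> S) \<noteq> P z}"
        using S(1) z0 unfolding S'_def by (auto split: if_splits)
      ultimately show ?thesis using 1 by simp
    qed
    show ?thesis using 1 2 by blast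
  qed
  note A = main[of pos, OF adqA] and B = main[of "\<lambda>z. \<not> pos z", OF adqB]
  have ev: "even (card ?Y + L' {z \<in> ?Y. pos z} + L' {z \<in> ?Y. \<not> pos z})"
    by (rule state_sum_span[OF _ _ _ rot]) (use fin A B in auto)
  \<comment> \<open>Adding these two facts shows that the number of crossings plus both extreme
    circle counts is even before virtualizing. Afterwards all three numbers are smaller by one, so
    their sum is odd, against \<open>ev\<close>.\<close>
  have "even (L {z \<in> X. pos z} + L {} + card {z \<in> X. pos z})" "even (L {z \<in> X. \<not> pos z} + L {} + card {z \<in> X. \<not> pos z})"
    by (rule step_parity[OF _ _ step]; use fin in auto)+
  moreover have "card X = card {z \<in> X. pos z} + card {z \<in> X. \<not> pos z}"
    by (subst card_Un_disjoint[symmetric]) (use fin in \<open>auto intro!: arg_cong[of _ _ card]\<close>)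
  moreover have "card X = Suc (card ?Y)" by (rule card.remove[OF fin z0])
  moreover have "Suc (L' {z \<in> ?Y. pos z}) = L {z \<in> X. pos z}" "Suc (L' {z \<in> ?Y. \<not> pos z}) = L {z \<in> X. \<not> pos z}"
    using A B by blast+
  ultimately show False using ev by presburger
qed

section \<open>The bracket of a diagram\<close>

text \<open>The chord ends, together with the integer points of the circles that carry no
  chord.\<close>

lemma (in chords) marked_exists:
  "marked n C {p. fst p < n \<and> (chorded C p \<or> (\<forall>x. \<not> chorded C (fst p, x)) \<and> snd p \<in> \<int>)}"
    (is "marked n C ?T")
proof
  fix p q i
  show "p \<in> ?T \<Longrightarrow> fst p < n" by simp
  show "q \<in> ?T" if "p \<in> ?T" "same_point p q"
  proof -
    have "fst q = fst p" "snd p - snd q \<in> \<int>" using that(2) unfolding same_point_def by auto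
    moreover have "snd q \<in> \<int>" if "snd p \<in> \<int>"
      using Ints_diff[OF that \<open>snd p - snd q \<in> \<int>\<close>] by simp
    ultimately show ?thesis using that C_ex_same[OF that(2)] by auto
  qed
  have "{p \<in> ?T. base p} \<subseteq> {p. base p \<and> chorded C p} \<union> (\<lambda>i. (i, 0)) ` {..<n}"
  proof
    fix p assume p: "p \<in> {p \<in> ?T. base p}"
    have "snd p = 0" if "snd p \<in> \<int>" using that p unfolding base_def by (auto elim!: Ints_cases)
    then show "p \<in> {p. base p \<and> chorded C p} \<union> (\<lambda>i. (i, 0)) ` {..<n}"
      using p by (cases p) auto
  qed
  then show "finite {p \<in> ?T. base p}" by (rule finite_subset) (simp add: C_fin)
  show "\<exists>x. (i, x) \<in> ?T" if "i < n"
  proof (cases "\<exists>x. chorded C (i, x)")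
    case False
    then have "(i, 0) \<in> ?T" using that by auto
    then show ?thesis by blast
  qed (use that in auto)
  show "C p q \<Longrightarrow> p \<in> ?T" using C_dom chordedI[of C] by blast
qed

lemma real_preimage_chorded: "real_preimage D p = chorded (real_pair D) p"
  by (simp add: real_preimage_def chorded_def)

locale diag =
  fixes D :: diagram
  assumes vld: "virtual_link_diagram D"
begin

abbreviation n :: nat where "n \<equiv> comps D"

lemma C1: "i < n \<Longrightarrow> curve D i C1_differentiable_on UNIV"
  and velocity_nz: "fst p < n \<Longrightarrow> velocity D p \<noteq> 0"
  and curve_period: "i < n \<Longrightarrow> curve D i (x + 1) = curve D i x"
  and label_period: "i < n \<Longrightarrow> label D i (x + 1) = label D i x"
  using vld unfolding virtual_link_diagram_def by (metis surjective_pairing)+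

lemma triple_free: "double_pair D p q \<Longrightarrow> double_pair D p r \<Longrightarrow> same_point q r"
  and transverse: "double_pair D p q \<Longrightarrow> cross (velocity D p) (velocity D q) \<noteq> 0"
  and labels: "double_pair D p q \<Longrightarrow>
    (label_at D p, label_at D q) \<in> {(Over, Under), (Under, Over), (Virt, Virt)}"
  and finite_double: "finite {p. base p \<and> double_preimage D p}"
  using vld unfolding virtual_link_diagram_def base_def by (blast, blast, blast, simp add: conj_assoc)

lemma curve_deriv: "i < n \<Longrightarrow> (curve D i has_vector_derivative velocity D (i, x)) (at x)"
  using C1[of i] unfolding velocity_def C1_differentiable_on_eq
  by (simp add: vector_derivative_works[symmetric])

lemma curve_continuous: "i < n \<Longrightarrow> continuous_on S (curve D i)"
  using curve_deriv has_vector_derivative_continuous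
  by (meson continuous_at_imp_continuous_on)

lemma velocity_continuous: "i < n \<Longrightarrow> continuous_on UNIV (\<lambda>x. velocity D (i, x))"
  using C1[of i] unfolding velocity_def C1_differentiable_on_eq by simp

lemma shift_int:
  assumes "\<And>x. f (x + 1) = (f x :: 'a)"
  shows "f (x + of_int k) = f (x :: real)"
proof (induction k rule: int_induct[where k = 0])
  case (step1 i)
  then show ?case using assms[of "x + of_int i"] by (simp add: algebra_simps)
next
  case (step2 i)
  then show ?case using assms[of "x + of_int (i - 1)"] by (simp add: algebra_simps)
qed simp

lemma plane_at_same: "fst p < n \<Longrightarrow> same_point p q \<Longrightarrow> plane_at D p = plane_at D q"
  and label_at_same: "fst p < n \<Longrightarrow> same_point p q \<Longrightarrow> label_at D p = label_at D q"
proof -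
  assume p: "fst p < n" and "same_point p q"
  then obtain k where "q = (fst p, snd p + of_int k)" using same_pointE by (metis prod.collapse)
  then show "plane_at D p = plane_at D q" "label_at D p = label_at D q"
    unfolding plane_at_def label_at_def
    using shift_int[of "curve D (fst p)"] shift_int[of "label D (fst p)"] curve_period[OF p] label_period[OF p]
    by auto
qed

lemma velocity_same: "fst p < n \<Longrightarrow> same_point p q \<Longrightarrow> velocity D p = velocity D q"
proof -
  assume p: "fst p < n" and "same_point p q"
  then obtain k where k: "q = (fst p, snd p + of_int k)" using same_pointE by (metis prod.collapse)
  have f: "curve D (fst p) = curve D (fst p) \<circ> (\<lambda>x. x + of_int k)"
    using shift_int[of "curve D (fst p)"] curve_period[OF p] by auto
  have "(curve D (fst p) has_vector_derivative velocity D q) (at (snd p + of_int k))"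
    using curve_deriv[OF p] k by simp
  moreover have "((\<lambda>x. x + of_int k) has_vector_derivative 1) (at (snd p))"
    by (auto intro!: derivative_eq_intros)
  ultimately have "(curve D (fst p) \<circ> (\<lambda>x. x + of_int k) has_vector_derivative 1 *\<^sub>R velocity D q) (at (snd p))"
    by (intro vector_diff_chain_at) auto
  then have "(curve D (fst p) has_vector_derivative velocity D q) (at (snd p))" using f by simp
  then show ?thesis unfolding velocity_def[of D p] by (simp add: vector_derivative_at)
qed

lemma double_pair_sym: "double_pair D p q \<Longrightarrow> double_pair D q p"
  unfolding double_pair_def using same_point_sym by metis

lemma double_pair_same:
  assumes "double_pair D p q" "same_point p p'" "same_point q q'"
  shows "double_pair D p' q'"
proof -
  have "fst p' = fst p" "fst q' = fst q" using assms unfolding same_point_def by auto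
  then show ?thesis
    using assms plane_at_same unfolding double_pair_def
    by (metis same_point_sym same_point_trans)
qed

lemma real_pairD: "real_pair D p q \<Longrightarrow> double_pair D p q"
  and real_pair_dom: "real_pair D p q \<Longrightarrow> fst p < n"
  and real_pair_plane: "real_pair D p q \<Longrightarrow> plane_at D p = plane_at D q"
  unfolding real_pair_def double_pair_def by blast+

sublocale chords n "real_pair D"
proof
  fix p q r p' q'
  show "real_pair D p q \<Longrightarrow> real_pair D q p" unfolding real_pair_def using double_pair_sym by blast
  show "real_pair D p q \<Longrightarrow> fst p < n" "real_pair D p q \<Longrightarrow> \<not> same_point p q"
    unfolding real_pair_def double_pair_def by blast+
  show "real_pair D p q \<Longrightarrow> same_point p p' \<Longrightarrow> same_point q q' \<Longrightarrow> real_pair D p' q'"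
    unfolding real_pair_def using double_pair_same label_at_same double_pair_def by metis
  show "real_pair D p q \<Longrightarrow> real_pair D p r \<Longrightarrow> same_point q r"
    unfolding real_pair_def using triple_free by blast
  show "finite {p. base p \<and> chorded (real_pair D) p}"
    by (rule finite_subset[OF _ finite_double]) (auto simp: chorded_def real_pair_def double_preimage_def)
qed

lemma real_pair_labels: "real_pair D p q \<Longrightarrow>
    label_at D p = Over \<and> label_at D q = Under \<or> label_at D p = Under \<and> label_at D q = Over"
  using labels[of p q] unfolding real_pair_def by auto

lemma real_preimage_iff: "chorded (real_pair D) p \<longleftrightarrow> double_preimage D p \<and> label_at D p \<noteq> Virt"
  using labels unfolding chorded_def real_pair_def double_preimage_def by fastforce

text \<open>Crossings are named by their points in the plane, so that one set of complex numbers
  describes a state simultaneously at both ends of every chord.\<close>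

definition crossings :: "complex set" where
  "crossings = plane_at D ` {p. chorded (real_pair D) p}"

definition positive :: "complex \<Rightarrow> bool" where
  "positive z \<longleftrightarrow> (\<exists>p q. real_pair D p q \<and> plane_at D p = z \<and> label_at D p = Over \<and>
     cross (velocity D p) (velocity D q) > 0)"

definition smoothed :: "complex set \<Rightarrow> point \<Rightarrow> bool" where
  "smoothed S p \<longleftrightarrow> fst p < n \<and> plane_at D p \<in> S"

definition circles :: "complex set \<Rightarrow> nat" where
  "circles S = loops n (real_pair D) (smoothed S)"

text \<open>The Kauffman bracket without writhe correction, normalized so that a circle without
  crossings has the value \<open>- (A^2) - 1 / A^2\<close>.\<close>

definition bracket :: "complex \<Rightarrow> complex" where
  "bracket = state_sum crossings positive circles"

lemma finite_crossings: "finite crossings"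
proof -
  have "crossings \<subseteq> plane_at D ` {p. base p \<and> chorded (real_pair D) p}"
  proof
    fix z assume "z \<in> crossings"
    then obtain p where p: "chorded (real_pair D) p" "z = plane_at D p" unfolding crossings_def by blast
    then have "plane_at D p = plane_at D (rep p)"
      using plane_at_same[OF _ same_point_rep] C_dom unfolding chorded_def by blast
    then show "z \<in> plane_at D ` {p. base p \<and> chorded (real_pair D) p}"
      using p C_ex_same[OF same_point_rep, of p] by auto
  qed
  then show ?thesis using C_fin by (meson finite_imageI finite_subset)
qed

lemma real_pair_same_plane:
  assumes "real_pair D p q" "fst r < n" "plane_at D r = plane_at D p"
  shows "same_point r p \<or> same_point r q"
proof (cases "same_point p r")
  case False
  then have "double_pair D p r"
    using assms unfolding double_pair_def real_pair_def by auto
  then show ?thesis using triple_free[OF real_pairD[OF assms(1)]] same_point_sym by blast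
qed (simp add: same_point_sym)

lemma cross_swap: "cross w v = - cross v w"
  by (simp add: cross_def)

lemma positive_iff:
  assumes "real_pair D p q" "label_at D p = Over"
  shows "positive (plane_at D p) \<longleftrightarrow> cross (velocity D p) (velocity D q) > 0"
proof
  assume "positive (plane_at D p)"
  then obtain p' q' where *: "real_pair D p' q'" "plane_at D p' = plane_at D p" "label_at D p' = Over"
    "cross (velocity D p') (velocity D q') > 0" unfolding positive_def by blast
  have "same_point p' p \<or> same_point p' q" using real_pair_same_plane[OF assms(1)] C_dom[OF *(1)] *(2) by blast
  moreover have "\<not> same_point p' q"
    using label_at_same[OF C_dom[OF *(1)], of q] *(3) real_pair_labels[OF assms(1)] assms(2) by auto
  ultimately have s: "same_point p' p" by blast
  have "real_pair D p q'" using C_per[OF *(1) s same_point_refl] .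
  then have "same_point q' q" using C_fun assms(1) by blast
  then show "cross (velocity D p) (velocity D q) > 0"
    using *(4) velocity_same[OF C_dom[OF *(1)] s] velocity_same[OF C_dom[OF C_sym[OF *(1)]]] by simp
qed (use assms positive_def in blast)

lemma state_smoothed: "state (smoothed S)"
  unfolding state_def
proof (intro conjI allI impI)
  fix p q
  show "smoothed S p = smoothed S q" if "real_pair D p q"
    unfolding smoothed_def using C_dom[OF that] C_dom[OF C_sym[OF that]] real_pair_plane[OF that] by simp
  show "smoothed S p = smoothed S q" if "same_point p q"
  proof -
    have "fst p = fst q" using that unfolding same_point_def by simp
    then show ?thesis unfolding smoothed_def using plane_at_same[OF _ that] by auto
  qed
qed

lemma in_crossings: "real_pair D p q \<Longrightarrow> plane_at D p \<in> crossings"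
  unfolding crossings_def using chordedI[of "real_pair D"] by blast

lemma crossingsE:
  assumes "z \<in> crossings"
  obtains p q where "real_pair D p q" "plane_at D p = z" "label_at D p = Over"
proof -
  obtain p q where pq: "real_pair D p q" "plane_at D p = z"
    using assms unfolding crossings_def chorded_def by blast
  then have "label_at D p = Over \<or> label_at D q = Over"
    using real_pair_labels by blast
  then show ?thesis using that[of p q] that[of q p] pq C_sym[of p q] real_pair_plane[of p q] by auto
qed

lemma circles_switch:
  assumes "coherent n (real_pair D) \<iota>" "real_pair D p q" "plane_at D p = z" "z \<notin> S"
  defines "N' \<equiv> loops n (cut_chord (real_pair D) p q) (smoothed S)"
  shows "circles (insert z S) = Suc (circles S) \<and> N' = circles S \<or>
         circles S = Suc (circles (insert z S)) \<and> N' = circles (insert z S)"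
    and "\<not> equivclp (smooth_rel n (real_pair D) (smoothed (insert z S))) (p, False) (p, True) \<Longrightarrow>
      circles (insert z S) = Suc (circles S)"
    and "\<not> equivclp (smooth_rel n (real_pair D) (smoothed S)) (p, False) (p, True) \<Longrightarrow>
      circles S = Suc (circles (insert z S))"
proof -
  interpret m: marked n "real_pair D"
    "{p. fst p < n \<and> (chorded (real_pair D) p \<or> (\<forall>x. \<not> chorded (real_pair D) (fst p, x)) \<and> snd p \<in> \<int>)}"
    by (rule marked_exists)
  interpret c: chords n "cut_chord (real_pair D) p q" by (rule chords_cut[OF assms(2)])
  have q: "plane_at D q = z" "fst q < n" using assms(2,3) real_pair_plane C_dom C_sym by metis+
  have p: "fst p < n" using assms(2) C_dom by blast
  have ag: "smoothed (insert z S) r = smoothed S r"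
    if "chorded (real_pair D) r" "\<not> same_point r p" "\<not> same_point r q" for r
    using real_pair_same_plane[OF assms(2), of r] that assms(3) unfolding smoothed_def by auto
  have sp: "smoothed (insert z S) p" "\<not> smoothed S p" using p assms(3,4) unfolding smoothed_def by auto
  note * = m.loops_switch[OF assms(1,2) state_smoothed state_smoothed state_smoothed sp]
  have "circles (insert z S) = Suc (circles S) \<and> N' = circles S \<or>
      circles S = Suc (circles (insert z S)) \<and> N' = circles (insert z S) \<and>
        equivclp (smooth_rel n (real_pair D) (smoothed (insert z S))) (p, False) (p, True)"
    unfolding circles_def N'_def by (rule *(1)) (use ag in auto)
  moreover have "circles S = Suc (circles (insert z S)) \<and> N' = circles (insert z S) \<or>
      circles (insert z S) = Suc (circles S) \<and> N' = circles S \<and>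
        equivclp (smooth_rel n (real_pair D) (smoothed S)) (p, False) (p, True)"
    unfolding circles_def N'_def by (rule *(2)) (use ag in auto)
  ultimately show "circles (insert z S) = Suc (circles S) \<and> N' = circles S \<or>
         circles S = Suc (circles (insert z S)) \<and> N' = circles (insert z S)"
    "\<not> equivclp (smooth_rel n (real_pair D) (smoothed (insert z S))) (p, False) (p, True) \<Longrightarrow>
      circles (insert z S) = Suc (circles S)"
    "\<not> equivclp (smooth_rel n (real_pair D) (smoothed S)) (p, False) (p, True) \<Longrightarrow>
      circles S = Suc (circles (insert z S))" by linarith+
qed

lemma coherent_step:
  assumes "coherent n (real_pair D) \<iota>" "z \<in> crossings" "z \<notin> S"
  shows "circles (insert z S) = Suc (circles S) \<or> circles S = Suc (circles (insert z S))"
proof -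
  obtain p q where "real_pair D p q" "plane_at D p = z" using crossingsE[OF assms(2)] by metis
  then show ?thesis using circles_switch(1)[OF assms(1) _ _ assms(3)] by blast
qed

lemma coherent_rotate:
  assumes "coherent n (real_pair D) \<iota>"
  shows "\<exists>\<kappa>. \<forall>A. A \<noteq> 0 \<longrightarrow> bracket (\<i> * A) = \<kappa> * bracket A"
  unfolding bracket_def
  by (rule state_sum_rotate[OF finite_crossings]) (rule coherent_step[OF assms])

end

section \<open>Proper alternating diagrams\<close>

locale alt_diag = diag E for E +
  fixes \<epsilon> :: real
  assumes alt: "alternating E" and width: "band_width E \<epsilon>"
    and prp: "\<And>p. real_preimage E p \<Longrightarrow> proper_crossing E \<epsilon> p"
begin

abbreviation C where "C \<equiv> real_pair E"

definition T0 :: "point set" where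
  "T0 = {p. fst p < n \<and> (chorded C p \<or> (\<forall>x. \<not> chorded C (fst p, x)) \<and> snd p \<in> \<int>)}"

sublocale marked n C T0
  unfolding T0_def by (rule marked_exists)

definition over :: "point \<Rightarrow> bool" where
  "over p \<longleftrightarrow> label_at E p = Over"

text \<open>Alternation yields the source-sink orientation: over-passages attract and under-passages
  repel, so every edge from one to the other gets one direction. At a point that is not a crossing
  the value is read off from the next crossing; a circle without crossings follows its
  orientation.\<close>

definition io :: "germ \<Rightarrow> bool" where
  "io g = (if chorded C (fst g) then over (fst g)
     else if \<exists>y. chorded C (fst (fst g), y) then snd g \<noteq> over (fst (fst g), nx (fst (fst g)) (snd (fst g)))
     else snd g)"

lemma nx_chorded:
  assumes "i < n" "chorded C (i, y)"
  shows "chorded C (i, nx i x)" "x < z \<Longrightarrow> z < nx i x \<Longrightarrow> \<not> chorded C (i, z)"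
  using nx_T[OF assms(1), of x] nx_gap[OF assms(1), of x z] T_chorded assms(2) unfolding T0_def by auto

lemma over_same: "fst p < n \<Longrightarrow> same_point p q \<Longrightarrow> over p = over q"
  unfolding over_def using label_at_same by simp

lemma over_alternates:
  assumes "x < y" "chorded C (i, x)" "chorded C (i, y)" "\<And>z. x < z \<Longrightarrow> z < y \<Longrightarrow> \<not> chorded C (i, z)"
  shows "over (i, x) \<noteq> over (i, y)"
proof -
  have "label E i x \<noteq> label E i y"
    using alt assms unfolding alternating_def real_preimage_chorded by blast
  moreover have "label E i x \<in> {Over, Under}" "label E i y \<in> {Over, Under}"
    using assms(2,3) real_preimage_iff unfolding label_at_def by (metis fst_conv insertCI passage.exhaust snd_conv)+
  ultimately show ?thesis unfolding over_def label_at_def by auto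
qed

lemma coherent_io: "coherent n C io"
  unfolding coherent_def
proof (intro conjI allI impI)
  fix i x e assume i: "i < n"
  have s: "same_point (i, x + 1) (i, x)" using same_point_sym[OF same_point_shift[of i x 1]] by simp
  have "nx i (x + 1) = nx i x + 1" using nx_shift[OF i, of x 1] by simp
  moreover have "over (i, nx i x + 1) = over (i, nx i x)"
    using over_same[OF _ same_point_shift[of i "nx i x" 1]] i by simp
  ultimately show "io ((i, x + 1), e) = io ((i, x), e)"
    using C_ex_same[OF s] over_same[OF _ s] i unfolding io_def by simp
next
  fix i x y assume i: "i < n" and xy: "x < y" and free: "\<forall>z. x < z \<and> z < y \<longrightarrow> \<not> chorded C (i, z)"
  show "io ((i, x), True) \<noteq> io ((i, y), False)"
  proof (cases "\<exists>u. chorded C (i, u)")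
    case False
    then show ?thesis unfolding io_def by auto
  next
    case True
    then obtain u where u: "chorded C (i, u)" by blast
    \<comment> \<open>The first crossing at or after \<open>y\<close>. Both germs of the segment are
      compared with it.\<close>
    define y' where "y' = (if chorded C (i, y) then y else nx i y)"
    have y': "y \<le> y'" "chorded C (i, y')" "\<And>z. x < z \<Longrightarrow> z < y' \<Longrightarrow> \<not> chorded C (i, z)"
      using free nx_chorded[OF i u, of y] nx_gt[OF i, of y] unfolding y'_def
      by (auto split: if_splits) (metis linorder_neqE_linordered_idom)+
    have "io ((i, y), False) = over (i, y')" using True unfolding io_def y'_def by auto
    moreover have "io ((i, x), True) = (\<not> over (i, y'))"
    proof (cases "chorded C (i, x)")
      case True
      then show ?thesis using over_alternates[of x y' i] y' xy unfolding io_def by auto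
    next
      case False
      have "nx i x = y'"
      proof (rule nx_unique[OF i])
        show "(i, y') \<in> T0" using T_chorded y'(2) by blast
        show "(i, z) \<notin> T0" if "x < z" "z < y'" for z
          using y'(3)[OF that] u unfolding T0_def by auto
      qed (use xy y' in auto)
      then show ?thesis using False True unfolding io_def by auto
    qed
    ultimately show ?thesis by simp
  qed
next
  fix p assume "fst p < n" "\<not> chorded C p"
  then show "io (p, False) \<noteq> io (p, True)" unfolding io_def by auto
next
  fix p q e e' assume "C p q"
  then have "chorded C p" "chorded C q" "over p \<noteq> over q"
    using chordedI[of C] C_sym[of p q] real_pair_labels[of p q] unfolding over_def by auto
  then show "io (p, False) = io (p, True)" "io (p, e) \<noteq> io (q, e')" unfolding io_def by auto
qed

lemma eps_sep: "chorded C (i, x) \<Longrightarrow> chorded C (i, y) \<Longrightarrow> x \<noteq> y \<Longrightarrow> 2 * \<epsilon> < \<bar>x - y\<bar>"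
  using width unfolding band_width_def real_preimage_chorded by auto

lemma band_class_eq: "band_class E \<epsilon> P = band_class E \<epsilon> Q \<longleftrightarrow> equivclp (band_glue E \<epsilon>) P Q"
  unfolding band_class_def cls_eq_iff ..

lemma band_class_shift: "band_class E \<epsilon> (i, x + of_int k, s) = band_class E \<epsilon> (i, x, s)"
  by (rule shift_int[of "\<lambda>x. band_class E \<epsilon> (i, x, s)"])
     (auto simp: band_class_eq intro: band_glue.period)

section \<open>Circles of the extreme states and boundary components\<close>

text \<open>
  When all crossings are smoothed in the same way, a circle follows a boundary component of the
  surface: the one on its left if \<open>b\<close> and it is run through with \<open>io\<close> meaning "towards the crossing".
\<close>

definition side :: "bool \<Rightarrow> germ \<Rightarrow> real" where
  "side b g = (if (io g \<noteq> snd g) = b then 1 else - 1)"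

text \<open>A germ at a crossing is represented at a corner of its square, because the edge of the
  band over the interior of the square is not part of the boundary of the surface.\<close>

definition step_off :: "germ \<Rightarrow> real" where
  "step_off g = (if chorded C (fst g) then if snd g then \<epsilon> else - \<epsilon> else 0)"

definition edge_point :: "bool \<Rightarrow> germ \<Rightarrow> (nat \<times> real \<times> real) set" where
  "edge_point b g = band_class E \<epsilon> (fst (fst g), snd (fst g) + step_off g, side b g)"

abbreviation Bd where "Bd \<equiv> subtopology (abstract_surface E \<epsilon>) (surface_boundary E \<epsilon>)"

text \<open>The band classes form a quotient space, so the image of a segment is connected; away
  from the open squares it stays in the boundary.\<close>

lemma segment_connected:
  assumes "i < n" "s \<in> {- 1, 1}" "x \<le> y"
    "\<And>t z. x \<le> t \<Longrightarrow> t \<le> y \<Longrightarrow> chorded C (i, z) \<Longrightarrow> \<epsilon> \<le> \<bar>t - z\<bar>"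
  shows "connected_component_of Bd (band_class E \<epsilon> (i, x, s)) (band_class E \<epsilon> (i, y, s))"
proof -
  let ?X = "top_of_set ({..<n} \<times> (UNIV :: real set) \<times> {- 1..1 :: real})"
  let ?S = "(\<lambda>t. (i, t, s)) ` {x..y}"
  let ?f = "band_class E \<epsilon>"
  have "continuous_map ?X (abstract_surface E \<epsilon>) ?f"
    unfolding abstract_surface_def by (rule quotient_imp_continuous_map[OF quotient_map_quotient_topology])
  moreover have "connected ?S"
    by (intro connected_continuous_image continuous_intros) auto
  then have "connectedin ?X ?S"
    unfolding connectedin_subtopology using assms(1,2) by auto
  ultimately have "connectedin (abstract_surface E \<epsilon>) (?f ` ?S)"
    by (rule connectedin_continuous_map_image)
  moreover have "?f ` ?S \<subseteq> surface_boundary E \<epsilon>"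
    unfolding surface_boundary_def real_preimage_chorded using assms by auto
  ultimately have "connectedin Bd (?f ` ?S)" by (simp add: connectedin_subtopology)
  moreover have "?f (i, x, s) \<in> ?f ` ?S" "?f (i, y, s) \<in> ?f ` ?S" using assms(3) by auto
  ultimately show ?thesis unfolding connected_component_of_def by blast
qed

lemma side_in: "side b g \<in> {- 1, 1}"
  unfolding side_def by auto

lemma edge_point_along:
  assumes "p \<in> PT"
  shows "connected_component_of Bd (edge_point b (p, True)) (edge_point b (nxt p, False))"
proof -
  obtain i x where p: "p = (i, x)" by force
  have i: "i < n" using PT_dom[OF assms] p by simp
  let ?y = "nx i x"
  have "io ((i, ?y), False) = (\<not> io ((i, x), True))"
    by (rule coherent_opp[OF coherent_io i nx_gt[OF i]]) (use nx_gap[OF i] T_chorded in blast)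
  \<comment> \<open>From an outgoing germ to the next incoming one both \<open>io\<close> and the
    direction flag are reversed, so the circle stays on the same side of the band.\<close>
  then have s: "side b ((i, ?y), False) = side b ((i, x), True)" unfolding side_def by auto
  have xT: "(i, x) \<in> T0" using assms p unfolding PT_def by simp
  have no: "\<not> chorded C (i, z)" if "x < z" "z < ?y" for z using nx_gap[OF i that] T_chorded by blast
  have ch: "chorded C (i, x) \<longleftrightarrow> (\<exists>z. chorded C (i, z))" "chorded C (i, ?y) \<longleftrightarrow> (\<exists>z. chorded C (i, z))"
    using xT nx_T[OF i, of x] unfolding T0_def by auto
  let ?a = "x + step_off ((i, x), True)" and ?b = "?y + step_off ((i, ?y), False)"
  \<comment> \<open>The squares of two consecutive crossings are disjoint by
    \<open>band_width\<close>, so their corners appear in the expected order.\<close>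
  have ab: "?a \<le> ?b"
  proof (cases "\<exists>z. chorded C (i, z)")
    case True
    then have "2 * \<epsilon> < \<bar>x - ?y\<bar>" using ch eps_sep[of i x ?y] nx_gt[OF i, of x] by auto
    then show ?thesis using True ch nx_gt[OF i, of x] unfolding step_off_def by (simp add: abs_if)
  qed (use ch nx_gt[OF i, of x] in \<open>simp add: step_off_def\<close>)
  have far: "\<epsilon> \<le> \<bar>t - z\<bar>" if t: "?a \<le> t" "t \<le> ?b" and z: "chorded C (i, z)" for t z
  proof -
    have "chorded C (i, x)" "chorded C (i, ?y)" using ch z by blast+
    then have "x + \<epsilon> \<le> t" "t \<le> ?y - \<epsilon>" using t unfolding step_off_def by auto
    moreover have "z \<le> x \<or> ?y \<le> z" using no z by (meson not_le)
    ultimately show ?thesis by (auto simp: abs_if)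
  qed
  have "connected_component_of Bd (band_class E \<epsilon> (i, ?a, side b ((i, x), True)))
      (band_class E \<epsilon> (i, ?b, side b ((i, x), True)))"
    by (rule segment_connected[OF i side_in ab]) (rule far)
  moreover have "edge_point b (p, True) = band_class E \<epsilon> (i, ?a, side b ((i, x), True))"
    unfolding edge_point_def p by simp
  moreover have "edge_point b (nxt p, False) = band_class E \<epsilon> (i, ?b, side b ((i, x), True))"
  proof -
    have sm: "same_point (i, ?y) (nxt p)" unfolding nxt_def p by simp
    then obtain k where k: "nxt p = (i, ?y + of_int k)" by (rule same_pointE)
    have "step_off (nxt p, False) = step_off ((i, ?y), False)"
      using C_ex_same[OF sm] unfolding step_off_def by simp
    moreover have "side b (nxt p, False) = side b ((i, ?y), False)"
      using coherent_same[OF coherent_io _ sm] i unfolding side_def by simp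
    ultimately show ?thesis
      using band_class_shift[of i ?b k "side b ((i, x), True)"] s unfolding edge_point_def
      by (simp add: k algebra_simps)
  qed
  ultimately show ?thesis by simp
qed

definition uniform :: "bool \<Rightarrow> complex set" where
  "uniform b = {z \<in> crossings. positive z = b}"

lemma smoothed_uniform:
  assumes "C p q" "over p"
  shows "smoothed (uniform b) p = ((cross (velocity E p) (velocity E q) > 0) = b)"
    "smoothed (uniform b) q = ((cross (velocity E p) (velocity E q) > 0) = b)"
proof -
  have "positive (plane_at E p) \<longleftrightarrow> cross (velocity E p) (velocity E q) > 0"
    using positive_iff assms unfolding over_def by blast
  then show "smoothed (uniform b) p = ((cross (velocity E p) (velocity E q) > 0) = b)"
    unfolding smoothed_def uniform_def using in_crossings[OF assms(1)] C_dom[OF assms(1)] by auto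
  then show "smoothed (uniform b) q = ((cross (velocity E p) (velocity E q) > 0) = b)"
    using assms(1) state_smoothed unfolding state_def by metis
qed

text \<open>The gluing identifies the corner (u, v) of the square on one band with the corner (v,
  -u) on the other. In a uniform state the crossing is smoothed along the orientation exactly if
  \<open>over p = b\<close>, and with \<open>io\<close> equal to \<open>over\<close> at crossings
  the germ joined to \<open>(p, e)\<close> is the one that has this corner.\<close>

lemma edge_point_square:
  assumes C: "C p q" and pos: "cross (velocity E p) (velocity E q) > 0"
  shows "edge_point b (p, e) = edge_point b (q, if smoothed (uniform b) p then \<not> e else e)"
proof -
  have ch: "chorded C p" "chorded C q" using C C_sym chordedI[of C] by blast+
  have ov: "over q = (\<not> over p)" using real_pair_labels[OF C] unfolding over_def by auto
  have neg: "\<not> cross (velocity E q) (velocity E p) > 0" using pos cross_swap[of "velocity E q"] by simp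
  have sm: "smoothed (uniform b) p = (over p = b)"
    using smoothed_uniform(1)[OF C] smoothed_uniform(2)[OF C_sym[OF C]] pos neg ov by (cases "over p") auto
  let ?u = "if e then 1 else - 1 :: real" and ?v = "side b (p, e)"
  have glue: "band_glue E \<epsilon> (fst p, snd p + \<epsilon> * ?u, ?v) (fst q, snd q + \<epsilon> * ?v, - ?u)"
    by (rule band_glue.square) (use C pos side_in[of b "(p, e)"] in auto)
  have "edge_point b (p, e) = band_class E \<epsilon> (fst p, snd p + \<epsilon> * ?u, ?v)"
    unfolding edge_point_def step_off_def using ch by auto
  also have "\<dots> = band_class E \<epsilon> (fst q, snd q + \<epsilon> * ?v, - ?u)"
    unfolding band_class_eq using glue by blast
  also have "\<dots> = edge_point b (q, if smoothed (uniform b) p then \<not> e else e)"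
    unfolding edge_point_def step_off_def side_def io_def sm using ch ov by auto
  finally show ?thesis .
qed

lemma edge_point_chord:
  assumes C: "C p q"
  shows "edge_point b (p, e) = edge_point b (q, if smoothed (uniform b) p then \<not> e else e)"
proof (cases "cross (velocity E p) (velocity E q) > 0")
  case False
  then have "cross (velocity E q) (velocity E p) > 0"
    using cross_swap[of "velocity E q" "velocity E p"] transverse[OF real_pairD[OF C]] by auto
  then have "edge_point b (q, e') = edge_point b (p, if smoothed (uniform b) q then \<not> e' else e')" for e'
    using edge_point_square[OF C_sym[OF C]] by blast
  moreover have "smoothed (uniform b) q = smoothed (uniform b) p"
    using C state_smoothed unfolding state_def by metis
  ultimately show ?thesis by simp
qed (rule edge_point_square[OF C])

lemma edge_point_refl:
  assumes "g \<in> VT"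
  shows "connected_component_of Bd (edge_point b g) (edge_point b g)"
  using edge_point_along[of "fst g" b] edge_point_along[of "prv (fst g)" b] assms
    prv_PT[of "fst g"] nxt_prv[of "fst g"]
  unfolding VT_def connected_component_of_def by (cases g; cases "snd g") auto

lemma edge_point_tree_rel:
  assumes "tree_rel (smoothed (uniform b)) u v"
  shows "connected_component_of Bd (edge_point b u) (edge_point b v)"
proof -
  have u: "fst u \<in> PT" "u \<in> VT" and uv: "v = along u \<or> v = link (smoothed (uniform b)) u"
    using assms unfolding tree_rel_def VT_def by auto
  show ?thesis
  proof (cases "v = along u")
    case True
    then show ?thesis
      using edge_point_along[OF u(1), of b] edge_point_along[OF prv_PT[OF u(1)], of b] nxt_prv[OF u(1)]
        connected_component_of_sym[of Bd]
      unfolding along_def by (cases u; cases "snd u") auto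
  next
    case False
    then have v: "v = link (smoothed (uniform b)) u" using uv by blast
    have "edge_point b v = edge_point b u"
    proof (cases "chorded C (fst u)")
      case True
      then have "C (fst u) (partner (fst u))" unfolding chorded_def using partner by blast
      then show ?thesis
        using edge_point_chord[of "fst u" "partner (fst u)" b "snd u"] True v unfolding link_def by simp
    next
      case False
      have "fst (fst u) < n" using u PT_dom by blast
      then have "io (fst u, False) = (\<not> io (fst u, True))"
        using coherent_io False unfolding coherent_def by blast
      then show ?thesis
        using False v unfolding link_def edge_point_def step_off_def side_def by (cases u; cases "snd u") auto
    qed
    then show ?thesis using edge_point_refl[OF u(2)] by simp
  qed
qed

text \<open>If the two germs of \<open>p\<close> were on one circle of the state, following this
  circle would connect two corners of the square at \<open>p\<close> inside the boundary of the
  surface. Properness excludes this.\<close>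

lemma uniform_separates:
  assumes "C p q"
  shows "\<not> equivclp (smooth_rel n C (smoothed (uniform b))) (p, False) (p, True)"
proof
  assume rel: "equivclp (smooth_rel n C (smoothed (uniform b))) (p, False) (p, True)"
  let ?p = "rep p"
  have i: "fst p < n" using C_dom[OF assms] .
  have ch: "chorded C ?p" using C_ex_same[OF same_point_rep] chordedI[of C, OF assms] by blast
  have V: "(?p, e) \<in> VT" for e using rep_PT[OF T_C[OF assms]] unfolding VT_def by simp
  have "equivclp (smooth_rel n C (smoothed (uniform b))) (p, e) (?p, e)" for e
    by (rule smooth_rel_same[OF i same_point_rep])
  then have "equivclp (smooth_rel n C (smoothed (uniform b))) (?p, False) (?p, True)"
    using rel by (meson equivclp_sym equivclp_trans)
  then have "equivclp (tree_rel (smoothed (uniform b))) (?p, False) (?p, True)"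
    using smooth_rel_VT[OF state_smoothed V V] by blast
  then have "connected_component_of Bd (edge_point b (?p, False)) (edge_point b (?p, True))"
  proof (induction rule: equivclp_induct)
    case base
    then show ?case using edge_point_refl[OF V] .
  next
    case (step y z)
    have "connected_component_of Bd (edge_point b y) (edge_point b z)"
      using step(2) edge_point_tree_rel[of b y z] edge_point_tree_rel[of b z y]
        connected_component_of_sym[of Bd] by blast
    with step(3) show ?case by (rule connected_component_of_trans)
  qed
  \<comment> \<open>The two corners are distinct whatever the sides are, since they lie at opposite
    ends of the square in the first coordinate.\<close>
  moreover have "edge_point b (?p, False) = corner E \<epsilon> ?p (- 1, side b (?p, False))"
    "edge_point b (?p, True) = corner E \<epsilon> ?p (1, side b (?p, True))"
    unfolding edge_point_def corner_def step_off_def using ch by auto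
  moreover have "proper_crossing E \<epsilon> ?p" using prp ch real_preimage_chorded by blast
  ultimately show False
    unfolding proper_crossing_def using side_in[of b "(?p, False)"] side_in[of b "(?p, True)"] by force
qed

lemma adequate:
  assumes "z \<in> crossings"
  shows "Suc (circles (if positive z = b then uniform b - {z} else insert z (uniform b))) = circles (uniform b)"
proof -
  obtain p q where pq: "C p q" "plane_at E p = z" using crossingsE[OF assms] by metis
  note sep = uniform_separates[OF pq(1), of b]
  show ?thesis
  proof (cases "positive z = b")
    case True
    then have "insert z (uniform b - {z}) = uniform b" using assms unfolding uniform_def by auto
    then show ?thesis
      using circles_switch(2)[OF coherent_io pq, of "uniform b - {z}"] sep True by auto
  next
    case False
    then have "z \<notin> uniform b" unfolding uniform_def by auto
    then show ?thesis using circles_switch(3)[OF coherent_io pq] sep False by auto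
  qed
qed

end

text \<open>Everything about \<open>D\<close> is expressed through the proper alternating diagram
  \<open>E\<close>: the crossings lose one point, the signs agree, and the circles are given by the
  minimum. Then \<open>virtualized_not_rotating\<close> applies with adequacy from
  \<open>uniform_separates\<close>.\<close>

lemma v_alternating_not_rotating:
  assumes "v_alternating D" "\<And>A. A \<noteq> 0 \<Longrightarrow> diag.bracket D (\<i> * A) = \<kappa> * diag.bracket D A"
  shows False
proof -
  obtain E \<epsilon> p0 q0 where D: "virtual_link_diagram D" and E: "virtual_link_diagram E" "alternating E"
    and eps: "band_width E \<epsilon>" "\<And>p. real_preimage E p \<Longrightarrow> proper_crossing E \<epsilon> p"
    and n: "comps D = comps E" and cv: "\<And>i. i < comps E \<Longrightarrow> curve D i = curve E i"
    and pq: "real_pair E p0 q0"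
    and lb: "\<And>r. double_preimage E r \<Longrightarrow>
        label_at D r = (if same_point r p0 \<or> same_point r q0 then Virt else label_at E r)"
    using assms(1) unfolding v_alternating_def proper_diagram_def virtualized_def by metis
  interpret d: diag D by (rule diag.intro[OF D])
  interpret alt_diag E \<epsilon> using E eps unfolding alt_diag_def alt_diag_axioms_def diag_def by blast
  have pl: "plane_at D p = plane_at E p" "velocity D p = velocity E p" if "fst p < n" for p
    using that cv unfolding plane_at_def velocity_def by auto
  have dp: "double_pair D = double_pair E"
    unfolding double_pair_def n using pl by (intro ext) (metis n)
  then have dpi: "double_preimage D = double_preimage E" unfolding double_preimage_def by auto
  have rp: "real_pair D = cut_chord C p0 q0"
  proof (intro ext)
    fix p q
    show "real_pair D p q = cut_chord C p0 q0 p q"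
    proof (cases "double_pair E p q")
      case True
      then have dpi': "double_preimage E p" "double_preimage E q"
        using double_pair_sym unfolding double_preimage_def by blast+
      have v: "label_at E p = Virt \<longleftrightarrow> label_at E q = Virt"
        using labels[OF True] by auto
      have v': "label_at D p = Virt \<longleftrightarrow> label_at D q = Virt"
        using d.labels[of p q] True dp by auto
      show ?thesis
        using lb[OF dpi'(1)] v v' True unfolding real_pair_def[of D] cut_chord_def real_pair_def[of E] dp
        by (auto split: if_splits)
    qed (simp add: real_pair_def cut_chord_def dp)
  qed
  define z0 where "z0 = plane_at E p0"
  have z0: "z0 \<in> crossings" using in_crossings[OF pq] z0_def by simp
  have sub: "real_pair D p q \<Longrightarrow> C p q" for p q unfolding rp cut_chord_def by blast
  have same_z0: "plane_at E r = z0 \<longleftrightarrow> same_point r p0 \<or> same_point r q0" if "fst r < n" for r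
    using real_pair_same_plane[OF pq that] plane_at_same[OF that, of p0] plane_at_same[OF that, of q0]
      real_pair_plane[OF pq] unfolding z0_def by auto
  have cr: "d.crossings = crossings - {z0}"
  proof (intro equalityI subsetI)
    fix z assume "z \<in> d.crossings"
    then obtain p q where p: "real_pair D p q" "plane_at D p = z" unfolding d.crossings_def chorded_def by blast
    then have "plane_at E p = z" using pl(1) C_dom sub by metis
    then show "z \<in> crossings - {z0}"
      using p same_z0[of p] in_crossings[OF sub[OF p(1)]] C_dom[OF sub[OF p(1)]] unfolding rp cut_chord_def by auto
  next
    fix z assume "z \<in> crossings - {z0}"
    then obtain p q where p: "C p q" "plane_at E p = z" "z \<noteq> z0" unfolding crossings_def chorded_def by blast
    then have "real_pair D p q" unfolding rp cut_chord_def using same_z0[OF C_dom[OF p(1)]] by auto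
    then show "z \<in> d.crossings" using d.in_crossings pl(1)[OF C_dom[OF p(1)]] p(2) by metis
  qed
  have ps: "d.positive z = positive z" if "z \<in> d.crossings" for z
  proof -
    from that obtain p q where p: "real_pair D p q" "plane_at D p = z" "label_at D p = Over"
      by (rule d.crossingsE)
    have dom: "fst p < n" "fst q < n" using C_dom C_sym sub[OF p(1)] by blast+
    have "double_preimage E p" using sub[OF p(1)] unfolding real_pair_def double_preimage_def by blast
    then have "label_at E p = Over" using lb[of p] p(3) by (auto split: if_splits)
    then show ?thesis
      using d.positive_iff[OF p(1,3)] positive_iff[OF sub[OF p(1)]] pl dom p(2) by auto
  qed
  \<comment> \<open>\<open>loops_switch\<close> puts the count for the cut chord equal to the lower
    of the two smoothings.\<close>
  have circ: "d.circles S = min (circles S) (circles (insert z0 S))" if "S \<subseteq> crossings - {z0}" for S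
  proof -
    have sm: "smoothed S = d.smoothed S"
      unfolding smoothed_def d.smoothed_def n using pl(1) n by auto
    have "z0 \<notin> S" using that by blast
    then show ?thesis
      using circles_switch(1)[OF coherent_io pq z0_def[symmetric], of S]
      unfolding d.circles_def rp sm n by auto
  qed
  have br: "d.bracket = state_sum (crossings - {z0}) positive d.circles"
    unfolding d.bracket_def cr by (intro ext state_sum_cong) (use ps cr in auto)
  have un: "{z \<in> crossings. positive z} = uniform True" "{z \<in> crossings. \<not> positive z} = uniform False"
    unfolding uniform_def by auto
  show False
  proof (rule virtualized_not_rotating[OF finite_crossings z0, of circles d.circles positive])
    show "circles (insert z S) = Suc (circles S) \<or> circles S = Suc (circles (insert z S))"
      if "S \<subseteq> crossings" "z \<in> crossings" "z \<notin> S" for S z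
      using coherent_step[OF coherent_io that(2,3)] .
    show "state_sum (crossings - {z0}) positive d.circles (\<i> * A) =
        \<kappa> * state_sum (crossings - {z0}) positive d.circles A" if "A \<noteq> 0" for A
      using assms(2)[OF that] unfolding br .
    show "Suc (circles (if positive z then {z \<in> crossings. positive z} - {z} else insert z {z \<in> crossings. positive z})) =
        circles {z \<in> crossings. positive z}" if "z \<in> crossings" for z
      unfolding un using adequate[OF that, of True] by simp
    show "Suc (circles (if \<not> positive z then {z \<in> crossings. \<not> positive z} - {z} else insert z {z \<in> crossings. \<not> positive z})) =
        circles {z \<in> crossings. \<not> positive z}" if "z \<in> crossings" for z
      unfolding un using adequate[OF that, of False] by simp
  qed (use circ in blast)
qed

section \<open>Source-sink orientations of classical diagrams\<close>

lemma cross_add: "cross v (x + y) = cross v x + cross v y" "cross (x + y) v = cross x v + cross y v"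
  and cross_diff: "cross v (x - y) = cross v x - cross v y" "cross (x - y) v = cross x v - cross y v"
  and cross_minus: "cross v (- x) = - cross v x" "cross (- x) v = - cross x v"
  and cross_scale: "cross v (a *\<^sub>R x) = a * cross v x" "cross (a *\<^sub>R x) v = a * cross x v"
  and cross_self: "cross v v = 0"
  by (simp_all add: cross_def algebra_simps)

lemma abs_cross_le: "\<bar>cross v w\<bar> \<le> norm v * norm w"
proof -
  have "cross v w = Im (cnj v * w)" by (simp add: cross_def)
  then show ?thesis by (metis abs_Im_le_cmod complex_mod_cnj norm_mult)
qed

lemma continuous_on_cross [continuous_intros]:
  "continuous_on S f \<Longrightarrow> continuous_on S g \<Longrightarrow> continuous_on S (\<lambda>x. cross (f x) (g x))"
  unfolding cross_def by (intro continuous_intros)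

section \<open>Local geometry of a strand\<close>

context diag
begin

text \<open>The mean value inequality for the curve minus its tangent at \<open>x\<close>, using
  continuity of the velocity. Both parameters are free, so that all chords near \<open>x\<close> are
  controlled, not only those starting at \<open>x\<close>.\<close>

lemma strand_estimate:
  assumes "i < n" "0 < \<kappa>"
  shows "\<exists>\<rho>>0. \<forall>y y'. \<bar>y - x\<bar> < \<rho> \<longrightarrow> \<bar>y' - x\<bar> < \<rho> \<longrightarrow>
    norm (curve D i y - curve D i y' - (y - y') *\<^sub>R velocity D (i, x)) \<le> \<kappa> * \<bar>y - y'\<bar>"
proof -
  let ?v = "velocity D (i, x)"
  have "isCont (\<lambda>y. velocity D (i, y)) x"
    using velocity_continuous[OF assms(1)] continuous_on_eq_continuous_at by blast
  then obtain \<rho> where \<rho>: "\<rho> > 0" "\<And>y. \<bar>y - x\<bar> < \<rho> \<Longrightarrow> norm (velocity D (i, y) - ?v) < \<kappa>"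
    using assms(2) unfolding continuous_at_eps_delta dist_norm by (metis real_norm_def)
  have "norm (curve D i y - curve D i y' - (y - y') *\<^sub>R ?v) \<le> \<kappa> * \<bar>y - y'\<bar>"
    if "\<bar>y - x\<bar> < \<rho>" "\<bar>y' - x\<bar> < \<rho>" for y y'
  proof -
    let ?f = "\<lambda>y. curve D i y - y *\<^sub>R ?v"
    have "norm (?f y - ?f y') \<le> \<kappa> * norm (y - y')"
    proof (rule differentiable_bound[of "ball x \<rho>"])
      fix z assume z: "z \<in> ball x \<rho>"
      have "(?f has_vector_derivative (velocity D (i, z) - ?v)) (at z)"
        by (auto intro!: derivative_eq_intros curve_deriv[OF assms(1)])
      then show "(?f has_derivative (\<lambda>h. h *\<^sub>R (velocity D (i, z) - ?v))) (at z within ball x \<rho>)"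
        unfolding has_vector_derivative_def by (rule has_derivative_at_withinI)
      have "norm (velocity D (i, z) - ?v) \<le> \<kappa>"
        using \<rho>(2)[of z] z by (simp add: dist_norm abs_minus_commute)
      then show "onorm (\<lambda>h. h *\<^sub>R (velocity D (i, z) - ?v)) \<le> \<kappa>"
        by (intro onorm_le) (metis abs_ge_zero mult.commute mult_left_mono norm_scaleR real_norm_def)
    qed (use that in \<open>auto simp: dist_norm abs_minus_commute\<close>)
    then show ?thesis by (simp add: algebra_simps)
  qed
  then show ?thesis using \<rho>(1) by blast
qed

definition trace :: "complex set" where
  "trace = (\<Union>i<n. range (curve D i))"

lemma traceI: "i < n \<Longrightarrow> curve D i y \<in> trace"
  unfolding trace_def by auto

lemma double_preimageI:
  "i < n \<Longrightarrow> j < n \<Longrightarrow> curve D i x = curve D j y \<Longrightarrow> \<not> same_point (i, x) (j, y) \<Longrightarrow> double_preimage D (i, x)"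
  unfolding double_preimage_def double_pair_def plane_at_def by auto

lemma curve_shift: "i < n \<Longrightarrow> curve D i (x + of_int k) = curve D i x"
  by (rule shift_int) (rule curve_period)

text \<open>Compactness: parameters that stay away from the preimages of \<open>z0\<close> keep a
  positive distance from \<open>z0\<close> in the plane.\<close>

lemma near_strands:
  assumes P: "finite P" "\<And>j y. j < n \<Longrightarrow> curve D j y = z0 \<Longrightarrow> \<exists>p\<in>P. same_point (j, y) p" and "\<rho> > 0"
  shows "\<exists>\<delta>>0. \<forall>z\<in>trace. norm (z - z0) < \<delta> \<longrightarrow> (\<exists>(j, x)\<in>P. j < n \<and> (\<exists>y. \<bar>y - x\<bar> < \<rho> \<and> z = curve D j y))"
proof -
  have "\<exists>\<delta>>0. \<forall>y. norm (curve D j y - z0) < \<delta> \<longrightarrow> (\<exists>(j', x)\<in>P. j' = j \<and> (\<exists>k. \<bar>y + of_int k - x\<bar> < \<rho>))"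
    if j: "j < n" for j
  proof -
    \<comment> \<open>The parameters of one period that stay at distance \<rho> from every translate
      of a point of \<open>P\<close>.\<close>
    define A where "A = {0..1} \<inter> (\<Inter>p\<in>P. \<Inter>k::int. {y. fst p = j \<longrightarrow> \<rho> \<le> \<bar>y + of_int k - snd p\<bar>})"
    have "closed {y::real. j' = j \<longrightarrow> \<rho> \<le> \<bar>y + of_int k - x\<bar>}" for j' x and k :: int
      by (cases "j' = j") (auto intro!: closed_Collect_le continuous_intros)
    then have "compact A"
      unfolding A_def by (intro compact_Int_closed closed_INT ballI) auto
    have pos: "0 < norm (curve D j y - z0)" if "y \<in> A" for y
    proof -
      have "curve D j y \<noteq> z0"
      proof
        assume "curve D j y = z0"
        then obtain p where p: "p \<in> P" "same_point (j, y) p" using P(2)[OF j] by blast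
        from p(2) obtain k where k: "p = (j, y + of_int k)" by (rule same_pointE)
        have "fst p = j \<longrightarrow> (\<forall>k. \<rho> \<le> \<bar>y + of_int k - snd p\<bar>)" using that p(1) unfolding A_def by blast
        then have "\<rho> \<le> \<bar>y + of_int k - (y + of_int k)\<bar>" unfolding k fst_conv snd_conv by blast
        then show False using assms(3) by simp
      qed
      then show ?thesis by simp
    qed
    have "\<exists>\<delta>>0. \<forall>y\<in>A. \<delta> \<le> norm (curve D j y - z0)"
    proof (cases "A = {}")
      case False
      have "continuous_on A (\<lambda>y. norm (curve D j y - z0))"
        by (intro continuous_intros curve_continuous[OF j])
      then obtain y0 where "y0 \<in> A" "\<forall>y\<in>A. norm (curve D j y0 - z0) \<le> norm (curve D j y - z0)"
        using continuous_attains_inf[OF \<open>compact A\<close> False] by blast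
      then show ?thesis using pos by blast
    qed (auto intro: exI[of _ 1])
    then obtain \<delta> where \<delta>: "\<delta> > 0" "\<And>y. y \<in> A \<Longrightarrow> \<delta> \<le> norm (curve D j y - z0)" by blast
    have "\<exists>(j', x)\<in>P. j' = j \<and> (\<exists>k. \<bar>y + of_int k - x\<bar> < \<rho>)" if "norm (curve D j y - z0) < \<delta>" for y
    proof (rule ccontr)
      assume no: "\<not> ?thesis"
      have fr: "frac y = y + of_int (- \<lfloor>y\<rfloor>)" by (simp add: frac_def)
      have "frac y \<in> A"
        unfolding A_def
      proof (intro IntI INT_I)
        show "frac y \<in> {0..1}" using frac_ge_0[of y] frac_lt_1[of y] by simp
        fix p k assume "p \<in> P"
        moreover have "\<forall>p\<in>P. fst p = j \<longrightarrow> (\<forall>k. \<rho> \<le> \<bar>y + of_int k - snd p\<bar>)"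
          using no by (auto simp: not_less split_beta)
        ultimately have "fst p = j \<longrightarrow> \<rho> \<le> \<bar>y + of_int (k - \<lfloor>y\<rfloor>) - snd p\<bar>" by blast
        then show "frac y \<in> {y. fst p = j \<longrightarrow> \<rho> \<le> \<bar>y + of_int k - snd p\<bar>}"
          unfolding fr by (simp add: algebra_simps)
      qed
      then show False using \<delta>(2)[of "frac y"] curve_shift[OF j, of y "- \<lfloor>y\<rfloor>"] that unfolding fr by simp
    qed
    then show ?thesis using \<delta>(1) by blast
  qed
  then have "\<forall>j\<in>{..<n}. \<exists>\<delta>. \<delta> > 0 \<and> (\<forall>y. norm (curve D j y - z0) < \<delta> \<longrightarrow>
      (\<exists>(j', x)\<in>P. j' = j \<and> (\<exists>k. \<bar>y + of_int k - x\<bar> < \<rho>)))" by simp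
  from bchoice[OF this] obtain \<delta> where \<delta>: "\<forall>j\<in>{..<n}. \<delta> j > 0 \<and> (\<forall>y. norm (curve D j y - z0) < \<delta> j \<longrightarrow>
      (\<exists>(j', x)\<in>P. j' = j \<and> (\<exists>k. \<bar>y + of_int k - x\<bar> < \<rho>)))" ..
  have n0: "0 < n" using vld unfolding virtual_link_diagram_def by blast
  define \<delta>0 where "\<delta>0 = Min (\<delta> ` {..<n})"
  have le: "\<delta>0 \<le> \<delta> j" if "j < n" for j unfolding \<delta>0_def using that by auto
  have "\<delta>0 > 0" unfolding \<delta>0_def using \<delta> n0 by (subst Min_gr_iff) auto
  moreover have "\<exists>(j, x)\<in>P. j < n \<and> (\<exists>y. \<bar>y - x\<bar> < \<rho> \<and> z = curve D j y)"
    if z: "z \<in> trace" "norm (z - z0) < \<delta>0" for z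
  proof -
    obtain j y where jy: "j < n" "z = curve D j y" using z(1) unfolding trace_def by auto
    have "norm (curve D j y - z0) < \<delta> j" using le[OF jy(1)] z(2) jy(2) by simp
    then have "\<exists>(j', x)\<in>P. j' = j \<and> (\<exists>k. \<bar>y + of_int k - x\<bar> < \<rho>)" using \<delta> jy(1) by simp
    then obtain x k where "(j, x) \<in> P" "\<bar>y + of_int k - x\<bar> < \<rho>" by auto
    then show ?thesis using curve_shift[OF jy(1), of y k] jy
      by (intro bexI[of _ "(j, x)"]) (auto intro!: exI[of _ "y + of_int k"])
  qed
  ultimately show ?thesis by blast
qed

text \<open>The cross product with \<open>v\<close> kills the tangential part of \<open>d\<close>,
  so only the error term remains, and half of the tangential part is bounded by \<open>d\<close>
  itself.\<close>

lemma direction_bound: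
  assumes v: "0 < norm v" and e: "norm (d - t *\<^sub>R v) \<le> \<kappa> * \<bar>t\<bar>" "2 * \<kappa> \<le> norm v" and d: "d = b *\<^sub>R u" "0 < b"
  shows "\<bar>cross v u\<bar> \<le> 2 * \<kappa> * norm u"
proof -
  have "cross v d = cross v (d - t *\<^sub>R v)" by (simp add: cross_diff cross_scale cross_self)
  then have "\<bar>cross v d\<bar> \<le> norm v * (\<kappa> * \<bar>t\<bar>)"
    using abs_cross_le[of v "d - t *\<^sub>R v"] e(1) v by (smt (verit) mult_left_mono)
  moreover have "norm v * \<bar>t\<bar> \<le> 2 * norm d"
  proof -
    have "norm (t *\<^sub>R v) \<le> norm d + norm (d - t *\<^sub>R v)"
      using norm_triangle_ineq4[of d "d - t *\<^sub>R v"] by simp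
    then have "\<bar>t\<bar> * norm v \<le> norm d + \<kappa> * \<bar>t\<bar>" using e(1) by simp
    moreover have "2 * (\<kappa> * \<bar>t\<bar>) \<le> norm v * \<bar>t\<bar>"
      using mult_right_mono[OF e(2), of "\<bar>t\<bar>"] by simp
    ultimately show ?thesis by (simp add: mult.commute)
  qed
  ultimately have "\<bar>cross v d\<bar> \<le> 2 * \<kappa> * norm d"
  proof (cases "t = 0")
    case True
    then have "d = 0" using e(1) by simp
    then show ?thesis by (simp add: cross_def)
  next
    case False
    have "0 \<le> \<kappa> * \<bar>t\<bar>" using e(1) norm_ge_zero order_trans by blast
    then have "0 \<le> \<kappa>" using False by (simp add: zero_le_mult_iff)
    then have "\<kappa> * (norm v * \<bar>t\<bar>) \<le> \<kappa> * (2 * norm d)"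
      using \<open>norm v * \<bar>t\<bar> \<le> 2 * norm d\<close> by (intro mult_left_mono)
    moreover have "norm v * (\<kappa> * \<bar>t\<bar>) = \<kappa> * (norm v * \<bar>t\<bar>)" by simp
    moreover have "\<kappa> * (2 * norm d) = 2 * \<kappa> * norm d" by simp
    ultimately show ?thesis using \<open>\<bar>cross v d\<bar> \<le> norm v * (\<kappa> * \<bar>t\<bar>)\<close> by linarith
  qed
  then have "b * \<bar>cross v u\<bar> \<le> b * (2 * \<kappa> * norm u)"
    using d by (simp add: cross_scale abs_mult mult.left_commute)
  then show ?thesis using d(2) by simp
qed

lemma strand_not_parallel:
  assumes i: "i < n" and c: "cross (velocity D (i, x)) u \<noteq> 0"
  shows "\<exists>\<rho>>0. \<forall>y y' u' b. \<bar>y - x\<bar> < \<rho> \<longrightarrow> \<bar>y' - x\<bar> < \<rho> \<longrightarrow> norm (u' - u) < \<rho> \<longrightarrow> b \<noteq> 0 \<longrightarrow>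
    curve D i y \<noteq> curve D i y' + b *\<^sub>R u'"
proof -
  let ?v = "velocity D (i, x)" and ?c = "\<bar>cross (velocity D (i, x)) u\<bar>"
  have v: "0 < norm ?v" using velocity_nz[of "(i, x)"] i by simp
  \<comment> \<open>The first bound is required by \<open>direction_bound\<close>. With the second
    one a chord along \<open>u'\<close> would have a cross product of at most a quarter of
    \<open>?c\<close>, and moving from \<open>u'\<close> to \<open>u\<close> costs at most half of
    \<open>?c\<close> by the choice of \<open>r\<close>; together this is less than
    \<open>?c\<close>.\<close>
  define \<kappa> where "\<kappa> = min (norm ?v / 2) (?c / (8 * (norm u + 1)))"
  have u1: "0 < norm u + 1" using norm_ge_zero[of u] by linarith
  have k: "0 < \<kappa>" "2 * \<kappa> \<le> norm ?v" "\<kappa> * (8 * (norm u + 1)) \<le> ?c"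
  proof -
    show "0 < \<kappa>" "2 * \<kappa> \<le> norm ?v" unfolding \<kappa>_def using v c u1 by auto
    have "\<kappa> \<le> ?c / (8 * (norm u + 1))" unfolding \<kappa>_def by simp
    then show "\<kappa> * (8 * (norm u + 1)) \<le> ?c" using u1 by (subst (asm) pos_le_divide_eq) auto
  qed
  obtain \<rho> where \<rho>: "\<rho> > 0" "\<And>y y'. \<bar>y - x\<bar> < \<rho> \<Longrightarrow> \<bar>y' - x\<bar> < \<rho> \<Longrightarrow>
    norm (curve D i y - curve D i y' - (y - y') *\<^sub>R ?v) \<le> \<kappa> * \<bar>y - y'\<bar>"
    using strand_estimate[OF i k(1), of x] by blast
  define r where "r = min \<rho> (min 1 (?c / (2 * norm ?v)))"
  have r: "r > 0" "r \<le> \<rho>" "r \<le> 1" "r * (2 * norm ?v) \<le> ?c"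
  proof -
    show "r > 0" "r \<le> \<rho>" "r \<le> 1" unfolding r_def using \<rho>(1) v c by auto
    have "r \<le> ?c / (2 * norm ?v)" unfolding r_def by simp
    then show "r * (2 * norm ?v) \<le> ?c" using v by (subst (asm) pos_le_divide_eq) auto
  qed
  have "curve D i y \<noteq> curve D i y' + b *\<^sub>R u'"
    if "\<bar>y - x\<bar> < r" "\<bar>y' - x\<bar> < r" "norm (u' - u) < r" "b \<noteq> 0" for y y' u' b
  proof
    assume eq: "curve D i y = curve D i y' + b *\<^sub>R u'"
    \<comment> \<open>\<open>direction_bound\<close> expects a positive factor; the sign of
      \<open>b\<close> is moved into the direction.\<close>
    define u'' where "u'' = sgn b *\<^sub>R u'"
    have nu: "norm u'' = norm u'" "\<bar>cross ?v u''\<bar> = \<bar>cross ?v u'\<bar>"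
      using that(4) unfolding u''_def by (auto simp: cross_scale sgn_if)
    have "b *\<^sub>R u' = \<bar>b\<bar> *\<^sub>R u''" unfolding u''_def by (simp add: sgn_if abs_if)
    then have "\<bar>cross ?v u'\<bar> \<le> 2 * \<kappa> * norm u'"
      unfolding nu[symmetric] using direction_bound[OF v \<rho>(2)[of y y'] k(2), of "\<bar>b\<bar>" u''] that r eq by simp
    moreover have "norm u' \<le> norm u + 1" using norm_triangle_ineq2[of u' u] that(3) r(3) by linarith
    then have "2 * \<kappa> * norm u' \<le> 2 * \<kappa> * (norm u + 1)" using k(1) by simp
    moreover have "?c \<le> \<bar>cross ?v u'\<bar> + norm ?v * r"
    proof -
      have "cross ?v u = cross ?v u' - cross ?v (u' - u)" by (simp add: cross_diff)
      moreover have "\<bar>cross ?v (u' - u)\<bar> \<le> norm ?v * r"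
        using abs_cross_le[of ?v "u' - u"] that(3) v by (smt (verit) mult_left_mono norm_ge_zero)
      ultimately show ?thesis by linarith
    qed
    moreover have "2 * (norm ?v * r) \<le> ?c" using r(4) by (simp add: mult.commute)
    ultimately have "?c \<le> 2 * (2 * \<kappa> * (norm u + 1))" by linarith
    moreover have "0 < \<kappa> * (norm u + 1)" using k(1) u1 by simp
    ultimately show False using k(3) c by (simp add: algebra_simps)
  qed
  then show ?thesis using r(1) by blast
qed

text \<open>Near a point that is not double the trace is a single short strand by
  \<open>near_strands\<close>, and this strand has no chord in a direction close to
  \<open>u\<close>. The conclusion is uniform in base point and direction, which makes the sides of
  the strand open and connected sets.\<close>

lemma simple_avoid:
  assumes i: "i < n" and simple: "\<not> double_preimage D (i, x)" and c: "cross (velocity D (i, x)) u \<noteq> 0"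
  shows "\<exists>r>0. \<forall>x' u' b. \<bar>x' - x\<bar> < r \<longrightarrow> norm (u' - u) < r \<longrightarrow> 0 < b \<longrightarrow> b < r \<longrightarrow>
    curve D i x' + b *\<^sub>R u' \<notin> trace"
proof -
  obtain \<rho> where \<rho>: "\<rho> > 0" "\<And>y y' u' b. \<bar>y - x\<bar> < \<rho> \<Longrightarrow> \<bar>y' - x\<bar> < \<rho> \<Longrightarrow> norm (u' - u) < \<rho> \<Longrightarrow>
      b \<noteq> 0 \<Longrightarrow> curve D i y \<noteq> curve D i y' + b *\<^sub>R u'"
    using strand_not_parallel[OF i c] by blast
  have "\<exists>p\<in>{(i, x)}. same_point (j, y) p" if "j < n" "curve D j y = curve D i x" for j y
    using simple double_preimageI[of i j x y] that i same_point_sym by auto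
  then obtain \<delta> where \<delta>: "\<delta> > 0" "\<And>z. z \<in> trace \<Longrightarrow> norm (z - curve D i x) < \<delta> \<Longrightarrow>
      \<exists>y. \<bar>y - x\<bar> < \<rho> \<and> z = curve D i y"
    using near_strands[of "{(i, x)}" "curve D i x" \<rho>] \<rho>(1) by auto
  have "isCont (curve D i) x" using curve_deriv[OF i] has_vector_derivative_continuous by blast
  then obtain \<eta> where \<eta>: "\<eta> > 0" "\<And>x'. \<bar>x' - x\<bar> < \<eta> \<Longrightarrow> norm (curve D i x' - curve D i x) < \<delta> / 2"
    using \<delta>(1) unfolding continuous_at_eps_delta dist_norm by (metis half_gt_zero real_norm_def)
  have u1: "0 < norm u + 1" using norm_ge_zero[of u] by linarith
  define r where "r = Min {\<rho>, \<eta>, 1, \<delta> / (2 * (norm u + 1))}"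
  have r: "r > 0" "r \<le> \<rho>" "r \<le> \<eta>" "r \<le> 1" "r \<le> \<delta> / (2 * (norm u + 1))"
    unfolding r_def using \<rho>(1) \<eta>(1) \<delta>(1) u1 by auto
  have "curve D i x' + b *\<^sub>R u' \<notin> trace"
    if "\<bar>x' - x\<bar> < r" "norm (u' - u) < r" "0 < b" "b < r" for x' u' b
  proof
    assume t: "curve D i x' + b *\<^sub>R u' \<in> trace"
    have "norm u' \<le> norm u + 1" using norm_triangle_ineq2[of u' u] that(2) r(4) by linarith
    then have "b * norm u' \<le> r * (norm u + 1)" using that(3,4) by (intro mult_mono) auto
    also have "\<dots> \<le> \<delta> / 2" using r(5) u1 by (simp add: field_simps)
    finally have "norm (b *\<^sub>R u') \<le> \<delta> / 2" using that(3) by simp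
    moreover have "norm (curve D i x' - curve D i x) < \<delta> / 2" using \<eta>(2) that(1) r(3) by simp
    moreover have "norm (curve D i x' + b *\<^sub>R u' - curve D i x) \<le> norm (curve D i x' - curve D i x) + norm (b *\<^sub>R u')"
      using norm_triangle_ineq[of "curve D i x' - curve D i x" "b *\<^sub>R u'"] by (simp add: algebra_simps)
    ultimately have "norm (curve D i x' + b *\<^sub>R u' - curve D i x) < \<delta>" by linarith
    then obtain y where "\<bar>y - x\<bar> < \<rho>" "curve D i x' + b *\<^sub>R u' = curve D i y" using \<delta>(2)[OF t] by blast
    then show False using \<rho>(2)[of y x' u' b] that r(2) by simp
  qed
  then show ?thesis using r(1) by blast
qed

section \<open>Total winding number on the two sides of a strand\<close>

definition wind :: "complex \<Rightarrow> complex" where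
  "wind z = (\<Sum>i<n. winding_number (curve D i) z)"

lemma loop_facts:
  assumes "i < n"
  shows "path (curve D i)" "valid_path (curve D i)" "pathfinish (curve D i) = pathstart (curve D i)"
    "path_image (curve D i) \<subseteq> trace"
proof -
  show "path (curve D i)" unfolding path_def by (rule curve_continuous[OF assms])
  show "valid_path (curve D i)" unfolding valid_path_def
    using C1_differentiable_on_subset[OF C1[OF assms]] by (simp add: C1_differentiable_imp_piecewise)
  show "pathfinish (curve D i) = pathstart (curve D i)"
    using curve_period[OF assms, of 0] unfolding pathfinish_def pathstart_def by simp
  show "path_image (curve D i) \<subseteq> trace" using assms unfolding path_image_def trace_def by auto
qed

lemma wind_constant:
  assumes "connected S" "S \<inter> trace = {}" "z \<in> S" "w \<in> S"
  shows "wind z = wind w"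
  unfolding wind_def
proof (rule sum.cong)
  fix i assume "i \<in> {..<n}"
  then have i: "i < n" by simp
  show "winding_number (curve D i) z = winding_number (curve D i) w"
    by (rule winding_number_eq[OF loop_facts(1,3)[OF i] assms(3,4,1)]) (use loop_facts(4)[OF i] assms(2) in blast)
qed simp

text \<open>On the side \<open>u\<close> of the point \<open>x\<close> of the \<open>i\<close>-th component the total winding number is \<open>w\<close>.\<close>

definition side_wind :: "nat \<Rightarrow> real \<Rightarrow> complex \<Rightarrow> complex \<Rightarrow> bool" where
  "side_wind i x u w \<longleftrightarrow> (\<exists>r>0. \<forall>x' u' b. \<bar>x' - x\<bar> < r \<longrightarrow> norm (u' - u) < r \<longrightarrow> 0 < b \<longrightarrow> b < r \<longrightarrow>
    curve D i x' + b *\<^sub>R u' \<notin> trace \<and> wind (curve D i x' + b *\<^sub>R u') = w)"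

text \<open>The nearby points on the side \<open>u\<close> form the image of a box, which is
  connected and misses the trace.\<close>

lemma side_wind_exists:
  assumes i: "i < n" and "\<not> double_preimage D (i, x)" "cross (velocity D (i, x)) u \<noteq> 0"
  shows "\<exists>w. side_wind i x u w"
proof -
  obtain r where r: "r > 0" "\<And>x' u' b. \<bar>x' - x\<bar> < r \<Longrightarrow> norm (u' - u) < r \<Longrightarrow> 0 < b \<Longrightarrow> b < r \<Longrightarrow>
    curve D i x' + b *\<^sub>R u' \<notin> trace" using simple_avoid[OF assms] by blast
  let ?f = "\<lambda>(x', u', b). curve D i x' + b *\<^sub>R u'"
  let ?B = "{x - r<..<x + r} \<times> ball u r \<times> {0<..<r}"
  have "continuous_on ?B ?f"
    unfolding split_beta
    by (intro continuous_intros continuous_on_compose2[OF curve_continuous[OF i, of UNIV]]) auto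
  moreover have "connected ?B"
    by (intro convex_connected convex_Times) auto
  ultimately have con: "connected (?f ` ?B)" by (rule connected_continuous_image)
  have B: "(x', u', b) \<in> ?B \<longleftrightarrow> \<bar>x' - x\<bar> < r \<and> norm (u' - u) < r \<and> 0 < b \<and> b < r" for x' u' b
    by (auto simp: dist_norm norm_minus_commute)
  have av: "?f ` ?B \<inter> trace = {}"
  proof -
    have "?f p \<notin> trace" if "p \<in> ?B" for p using that r(2) B by (cases p) auto
    then show ?thesis by blast
  qed
  have "wind (curve D i x' + b *\<^sub>R u') = wind (curve D i x + (r / 2) *\<^sub>R u)"
    if "\<bar>x' - x\<bar> < r" "norm (u' - u) < r" "0 < b" "b < r" for x' u' b
  proof (rule wind_constant[OF con av])
    have "(x', u', b) \<in> ?B" "(x, u, r / 2) \<in> ?B" unfolding B using that r(1) by auto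
    then show "curve D i x' + b *\<^sub>R u' \<in> ?f ` ?B" "curve D i x + (r / 2) *\<^sub>R u \<in> ?f ` ?B"
      using image_eqI[of _ ?f "(x', u', b)" ?B] image_eqI[of _ ?f "(x, u, r / 2)" ?B] by auto
  qed
  then show ?thesis unfolding side_wind_def using r by blast
qed

lemma side_wind_unique:
  assumes "side_wind i x u w" "side_wind i x u w'"
  shows "w = w'"
proof -
  obtain r where r: "r > 0" "\<And>x' u' b. \<bar>x' - x\<bar> < r \<Longrightarrow> norm (u' - u) < r \<Longrightarrow> 0 < b \<Longrightarrow> b < r \<Longrightarrow>
    wind (curve D i x' + b *\<^sub>R u') = w" using assms(1) unfolding side_wind_def by blast
  obtain r' where r': "r' > 0" "\<And>x' u' b. \<bar>x' - x\<bar> < r' \<Longrightarrow> norm (u' - u) < r' \<Longrightarrow> 0 < b \<Longrightarrow> b < r' \<Longrightarrow>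
    wind (curve D i x' + b *\<^sub>R u') = w'" using assms(2) unfolding side_wind_def by blast
  show ?thesis using r(2)[of x u "min r r' / 2"] r'(2)[of x u "min r r' / 2"] r(1) r'(1) by auto
qed

lemma side_wind_local:
  assumes "side_wind i x u w"
  shows "\<exists>r>0. \<forall>x' u'. \<bar>x' - x\<bar> < r \<longrightarrow> norm (u' - u) < r \<longrightarrow> side_wind i x' u' w"
proof -
  obtain r where r: "r > 0" "\<And>x' u' b. \<bar>x' - x\<bar> < r \<Longrightarrow> norm (u' - u) < r \<Longrightarrow> 0 < b \<Longrightarrow> b < r \<Longrightarrow>
    curve D i x' + b *\<^sub>R u' \<notin> trace \<and> wind (curve D i x' + b *\<^sub>R u') = w"
    using assms unfolding side_wind_def by blast
  have "side_wind i x' u' w" if h: "\<bar>x' - x\<bar> < r / 2" "norm (u' - u) < r / 2" for x' u'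
    unfolding side_wind_def
  proof (intro exI[of _ "r / 2"] conjI allI impI)
    fix x'' u'' b assume a: "\<bar>x'' - x'\<bar> < r / 2" "norm (u'' - u') < r / 2" "0 < b" "b < r / 2"
    have "norm (u'' - u) < r" using norm_triangle_ineq[of "u'' - u'" "u' - u"] a h by simp
    then have "curve D i x'' + b *\<^sub>R u'' \<notin> trace \<and> wind (curve D i x'' + b *\<^sub>R u'') = w"
      using r(2)[of x'' u'' b] a h by linarith
    then show "curve D i x'' + b *\<^sub>R u'' \<notin> trace" "wind (curve D i x'' + b *\<^sub>R u'') = w" by blast+
  qed (use r in simp)
  then show ?thesis using r(1) by (intro exI[of _ "r / 2"]) auto
qed

text \<open>By \<open>side_wind_local\<close> the value is locally constant along the path of points
  and directions.\<close>

lemma side_wind_path: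
  assumes cont: "continuous_on {0..1} \<xi>" "continuous_on {0..1} (u :: real \<Rightarrow> complex)"
    and ex: "\<And>t. t \<in> {0..1} \<Longrightarrow> \<exists>w. side_wind i (\<xi> t) (u t) w"
    and ends: "side_wind i (\<xi> 0) (u 0) w0" "side_wind i (\<xi> 1) (u 1) w1"
  shows "w0 = w1"
proof -
  define f where "f t = (THE w. side_wind i (\<xi> t) (u t) w)" for t
  have f: "f t = w" if "side_wind i (\<xi> t) (u t) w" for t w
    unfolding f_def using that side_wind_unique by blast
  have "f 0 = f 1"
  proof (rule connected_local_const[where A = "{0..1::real}"])
    show "\<forall>a\<in>{0..1}. \<forall>\<^sub>F b in at a within {0..1}. f a = f b"
    proof
      fix a :: real assume a: "a \<in> {0..1}"
      then obtain w where w: "side_wind i (\<xi> a) (u a) w" using ex by blast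
      then obtain r where r: "r > 0" "\<And>x' u'. \<bar>x' - \<xi> a\<bar> < r \<Longrightarrow> norm (u' - u a) < r \<Longrightarrow> side_wind i x' u' w"
        using side_wind_local by blast
      have "(\<xi> \<longlongrightarrow> \<xi> a) (at a within {0..1})" "(u \<longlongrightarrow> u a) (at a within {0..1})"
        using cont a unfolding continuous_on_def by blast+
      then have "\<forall>\<^sub>F b in at a within {0..1}. dist (\<xi> b) (\<xi> a) < r" "\<forall>\<^sub>F b in at a within {0..1}. dist (u b) (u a) < r"
        using tendstoD r(1) by blast+
      then show "\<forall>\<^sub>F b in at a within {0..1}. f a = f b"
      proof eventually_elim
        case (elim b)
        then have "side_wind i (\<xi> b) (u b) w" by (intro r(2)) (auto simp: dist_norm)
        then show ?case using f w by simp
      qed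
    qed
  qed auto
  then show ?thesis using f ends by simp
qed

end

section \<open>The jump of the winding number across a strand\<close>

lemma winding_number_slit:
  assumes "valid_path q" "u \<noteq> 0" and slit: "\<And>p. p \<in> path_image q \<Longrightarrow> - (p - z) / u \<notin> \<real>\<^sub>\<le>\<^sub>0"
  shows "winding_number q z = (Ln (- (pathfinish q - z) / u) - Ln (- (pathstart q - z) / u)) / (2 * pi * \<i>)"
proof -
  have z: "z \<notin> path_image q" using slit[of z] by auto
  \<comment> \<open>The path misses the ray from \<open>z\<close> in the direction \<open>u\<close>.
    With the branch cut of the logarithm rotated onto this ray, the logarithm is a primitive along
    the whole path.\<close>
  have "((\<lambda>w. 1 / (w - z)) has_contour_integral
      (Ln (- (pathfinish q - z) / u) - Ln (- (pathstart q - z) / u))) q"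
  proof (rule contour_integral_primitive[OF _ assms(1) order_refl])
    fix w assume w: "w \<in> path_image q"
    then have "w \<noteq> z" using z by auto
    then show "((\<lambda>w. Ln (- (w - z) / u)) has_field_derivative 1 / (w - z)) (at w within path_image q)"
      using slit[OF w] assms(2) by (auto intro!: derivative_eq_intros simp: field_simps)
  qed
  then show ?thesis using winding_number_valid_path[OF assms(1) z] contour_integral_unique by fastforce
qed

lemma Ln_neg: "Im q < 0 \<Longrightarrow> Ln (- q) = Ln q + \<i> * pi" "0 < Im q \<Longrightarrow> Ln (- q) = Ln q - \<i> * pi"
  using Ln_minus[of q] by (cases "q = 0"; simp)+

lemma winding_number_diff_tendsto:
  assumes "path q" "z0 \<notin> path_image q"
  shows "((\<lambda>b. winding_number q (z0 + b *\<^sub>R u) - winding_number q (z0 - b *\<^sub>R u)) \<longlongrightarrow> 0) (at_right 0)"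
proof -
  have c: "isCont (winding_number q) z0" using continuous_at_winding_number[OF assms] .
  have "((\<lambda>b. z0 + b *\<^sub>R u) \<longlongrightarrow> z0 + 0 *\<^sub>R u) (at_right 0)" "((\<lambda>b. z0 - b *\<^sub>R u) \<longlongrightarrow> z0 - 0 *\<^sub>R u) (at_right 0)"
    by (intro tendsto_intros)+
  then have "((\<lambda>b. winding_number q (z0 + b *\<^sub>R u)) \<longlongrightarrow> winding_number q z0) (at_right 0)"
    "((\<lambda>b. winding_number q (z0 - b *\<^sub>R u)) \<longlongrightarrow> winding_number q z0) (at_right 0)"
    using isCont_tendsto_compose[OF c] by simp_all
  from tendsto_diff[OF this] show ?thesis by simp
qed

context diag
begin

lemma winding_number_shifted:
  assumes i: "i < n" and z: "z \<notin> trace"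
  shows "winding_number (\<lambda>t. curve D i (s + t)) z = winding_number (curve D i) z"
proof -
  have "(\<lambda>t. curve D i (s + t)) = shiftpath (frac s) (curve D i)"
  proof
    fix t
    have "curve D i (s + t) = curve D i (frac s + t)"
      using curve_shift[OF i, of "frac s + t" "\<lfloor>s\<rfloor>"] by (simp add: frac_def algebra_simps)
    moreover have "curve D i (frac s + t - 1) = curve D i (frac s + t)"
      using curve_period[OF i, of "frac s + t - 1"] by simp
    ultimately show "curve D i (s + t) = shiftpath (frac s) (curve D i) t"
      by (simp add: shiftpath_def)
  qed
  moreover have "z \<notin> path_image (curve D i)" using loop_facts(4)[OF i] z by blast
  ultimately show ?thesis
    using winding_number_shiftpath[OF loop_facts(1)[OF i] _ loop_facts(3)[OF i], of z "frac s"]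
      frac_ge_0[of s] frac_lt_1[of s] by simp
qed

lemma valid_path_shifted: "i < n \<Longrightarrow> valid_path (\<lambda>t. curve D i (s + t))"
proof -
  assume i: "i < n"
  have "((\<lambda>t. curve D i (s + t)) has_vector_derivative velocity D (i, s + t)) (at t)" for t
  proof -
    have "((\<lambda>t. s + t) has_vector_derivative 1) (at t)" by (auto intro!: derivative_eq_intros)
    from vector_diff_chain_at[OF this curve_deriv[OF i]] show ?thesis by (simp add: o_def)
  qed
  moreover have "continuous_on {0..1} (\<lambda>t. velocity D (i, s + t))"
    by (rule continuous_on_compose2[OF velocity_continuous[OF i]]) (auto intro!: continuous_intros)
  ultimately have "(\<lambda>t. curve D i (s + t)) C1_differentiable_on {0..1}"
    unfolding C1_differentiable_on_def by (intro exI[of _ "\<lambda>t. velocity D (i, s + t)"]) blast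
  then show ?thesis unfolding valid_path_def by (rule C1_differentiable_imp_piecewise)
qed

text \<open>Compare the points z0 + bu and z0 - bu as b tends to 0. The other components and the
  part of the curve away from \<open>x\<close> contribute nothing to the difference in the limit.
  The short arc around \<open>x\<close> avoids the rays leading away from it on both sides, so both
  of its winding numbers are differences of logarithms, with opposite cuts, and the cuts account for
  exactly one turn.\<close>

lemma side_wind_jump:
  assumes i: "i < n" and simple: "\<not> double_preimage D (i, x)"
    and c: "0 < cross (velocity D (i, x)) u"
    and w: "side_wind i x u w" "side_wind i x (- u) w'"
  shows "w = w' + 1"
proof -
  let ?\<gamma> = "curve D i" and ?v = "velocity D (i, x)"
  define z0 where "z0 = ?\<gamma> x"
  have u0: "u \<noteq> 0" using c by (auto simp: cross_def)
  obtain \<rho>1 where \<rho>1: "\<rho>1 > 0" "\<And>y y' u' b. \<bar>y - x\<bar> < \<rho>1 \<Longrightarrow> \<bar>y' - x\<bar> < \<rho>1 \<Longrightarrow> norm (u' - u) < \<rho>1 \<Longrightarrow>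
      b \<noteq> 0 \<Longrightarrow> ?\<gamma> y \<noteq> ?\<gamma> y' + b *\<^sub>R u'"
    using strand_not_parallel[OF i, of x u] c by auto
  \<comment> \<open>Makes the error half of the main term, so that the ends of the short arc lie
    strictly on different sides of the line through \<open>z0\<close> in the direction
    \<open>u\<close>.\<close>
  define \<kappa> where "\<kappa> = cross ?v u / (2 * norm u)"
  have k: "\<kappa> > 0" "norm u * \<kappa> = cross ?v u / 2" unfolding \<kappa>_def using c u0 by auto
  obtain \<rho>2 where \<rho>2: "\<rho>2 > 0" "\<And>y y'. \<bar>y - x\<bar> < \<rho>2 \<Longrightarrow> \<bar>y' - x\<bar> < \<rho>2 \<Longrightarrow>
    norm (?\<gamma> y - ?\<gamma> y' - (y - y') *\<^sub>R ?v) \<le> \<kappa> * \<bar>y - y'\<bar>"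
    using strand_estimate[OF i k(1), of x] by blast
  define \<rho> where "\<rho> = min (min \<rho>1 \<rho>2) (1/2) / 2"
  have \<rho>: "0 < \<rho>" "\<rho> < \<rho>1" "\<rho> < \<rho>2" "\<rho> < 1/2" unfolding \<rho>_def using \<rho>1(1) \<rho>2(1) by auto
  have sgn: "\<bar>cross u (?\<gamma> y - z0) + (y - x) * cross ?v u\<bar> \<le> \<bar>y - x\<bar> * (cross ?v u / 2)" if "\<bar>y - x\<bar> < \<rho>2" for y
  proof -
    let ?e = "?\<gamma> y - z0 - (y - x) *\<^sub>R ?v"
    have "cross u (?\<gamma> y - z0) + (y - x) * cross ?v u = cross u ?e"
      by (simp add: cross_diff cross_scale cross_swap[of u ?v])
    moreover have "\<bar>cross u ?e\<bar> \<le> norm u * (\<kappa> * \<bar>y - x\<bar>)"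
    proof (rule order_trans[OF abs_cross_le mult_left_mono])
      show "norm ?e \<le> \<kappa> * \<bar>y - x\<bar>" using \<rho>2(2)[of y x] that \<rho>2(1) unfolding z0_def by simp
    qed simp
    moreover have "norm u * (\<kappa> * \<bar>y - x\<bar>) = \<bar>y - x\<bar> * (cross ?v u / 2)"
      unfolding k(2)[symmetric] by simp
    ultimately show ?thesis by metis
  qed
  have rc: "0 < \<rho> * cross ?v u" using \<rho>(1) c by simp
  have "\<bar>cross u (?\<gamma> (x + \<rho>) - z0) + \<rho> * cross ?v u\<bar> \<le> \<rho> * cross ?v u / 2"
    using sgn[of "x + \<rho>"] \<rho> by simp
  then have "cross u (?\<gamma> (x + \<rho>) - z0) < 0" using rc by linarith
  moreover have "\<bar>cross u (?\<gamma> (x - \<rho>) - z0) - \<rho> * cross ?v u\<bar> \<le> \<rho> * cross ?v u / 2"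
    using sgn[of "x - \<rho>"] \<rho> by simp
  then have "cross u (?\<gamma> (x - \<rho>) - z0) > 0" using rc by linarith
  moreover have Im_div: "Im (q / u) = cross u q / (norm u)\<^sup>2" for q
    by (simp add: Im_divide cross_def cmod_power2 mult.commute)
  ultimately have Im: "Im ((?\<gamma> (x + \<rho>) - z0) / u) < 0" "Im ((?\<gamma> (x - \<rho>) - z0) / u) > 0"
    using u0 by (simp_all add: divide_neg_pos)
  \<comment> \<open>The closed curve is restarted half a period before \<open>x\<close>, so that
    \<open>x\<close> is at the parameter 1/2 and the arc around it is an inner subpath.\<close>
  define g where "g t = ?\<gamma> (x - 1/2 + t)" for t
  have g: "valid_path g" unfolding g_def by (rule valid_path_shifted[OF i])
  have gp: "path g" using g by (rule valid_path_imp_path)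
  define \<alpha> \<beta> where "\<alpha> = 1/2 - \<rho>" and "\<beta> = 1/2 + \<rho>"
  have ab: "0 < \<alpha>" "\<alpha> < \<beta>" "\<beta> < 1" unfolding \<alpha>_def \<beta>_def using \<rho> by auto
  have not_z0: "z0 \<noteq> g t" if "t \<in> {0..\<alpha>} \<union> {\<beta>..1}" for t
  proof
    assume "z0 = g t"
    then have "?\<gamma> x = ?\<gamma> (x - 1/2 + t)" unfolding z0_def g_def .
    then have "same_point (i, x) (i, x - 1/2 + t)" using simple double_preimageI[OF i i] by blast
    then have "1/2 - t \<in> \<int>" unfolding same_point_def by simp
    then obtain k where k: "1/2 - t = of_int k" by (auto elim: Ints_cases)
    have "\<bar>real_of_int k\<bar> < 1" "real_of_int k \<noteq> 0" using k that \<rho> unfolding \<alpha>_def \<beta>_def by (auto simp: abs_if)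
    then show False by (simp flip: of_int_abs)
  qed
  define F where "F b = (\<Sum>j\<in>{..<n} - {i}. winding_number (curve D j) (z0 + b *\<^sub>R u) - winding_number (curve D j) (z0 - b *\<^sub>R u))" for b
  define G where "G q b = winding_number q (z0 + b *\<^sub>R u) - winding_number q (z0 - b *\<^sub>R u)" for q b
  have F0: "(F \<longlongrightarrow> 0) (at_right 0)"
    unfolding F_def
  proof (rule tendsto_null_sum)
    fix j assume j: "j \<in> {..<n} - {i}"
    have "z0 \<notin> path_image (curve D j)"
      using simple double_preimageI[OF i, of j x] j unfolding path_image_def z0_def same_point_def by auto
    then show "((\<lambda>b. winding_number (curve D j) (z0 + b *\<^sub>R u) - winding_number (curve D j) (z0 - b *\<^sub>R u)) \<longlongrightarrow> 0) (at_right 0)"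
      using winding_number_diff_tendsto loop_facts(1) j by blast
  qed
  have G1: "(G (subpath 0 \<alpha> g) \<longlongrightarrow> 0) (at_right 0)" and G2: "(G (subpath \<beta> 1 g) \<longlongrightarrow> 0) (at_right 0)"
  proof -
    have "z0 \<notin> path_image (subpath 0 \<alpha> g)" "z0 \<notin> path_image (subpath \<beta> 1 g)"
      using ab not_z0 unfolding path_image_subpath by fastforce+
    then show "(G (subpath 0 \<alpha> g) \<longlongrightarrow> 0) (at_right 0)" "(G (subpath \<beta> 1 g) \<longlongrightarrow> 0) (at_right 0)"
      unfolding G_def using ab by (auto intro!: winding_number_diff_tendsto path_subpath gp)
  qed
  define N where "N = subpath \<alpha> \<beta> g"
  have N: "valid_path N" "pathstart N = ?\<gamma> (x - \<rho>)" "pathfinish N = ?\<gamma> (x + \<rho>)"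
    unfolding N_def using ab valid_path_subpath[OF g] by (auto simp: g_def \<alpha>_def \<beta>_def)
  have Nim: "\<exists>y. \<bar>y - x\<bar> < \<rho>1 \<and> p = ?\<gamma> y" if "p \<in> path_image N" for p
  proof -
    from that obtain t where "t \<in> {\<alpha>..\<beta>}" "p = g t" using ab unfolding N_def by (auto simp: path_image_subpath)
    then show ?thesis unfolding g_def \<alpha>_def \<beta>_def using \<rho>
      by (intro exI[of _ "x - 1/2 + t"]) (auto simp: abs_if)
  qed
  \<comment> \<open>The sign \<open>s\<close> treats both sides at once. A point of the arc on the
    forbidden ray would differ from the curve point at \<open>x\<close> by a nonzero multiple of
    \<open>u\<close>.\<close>
  have slit: "- (p - (z0 + (s * b) *\<^sub>R u)) / (s *\<^sub>R u) \<notin> \<real>\<^sub>\<le>\<^sub>0" if "p \<in> path_image N" "0 < b" "s \<in> {1, -1 :: real}" for p b s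
  proof
    assume "- (p - (z0 + (s * b) *\<^sub>R u)) / (s *\<^sub>R u) \<in> \<real>\<^sub>\<le>\<^sub>0"
    then obtain l where l: "l \<le> 0" "- (p - (z0 + (s * b) *\<^sub>R u)) / (s *\<^sub>R u) = of_real l"
      by (auto simp: nonpos_Reals_def)
    have "s *\<^sub>R u \<noteq> 0" using u0 that(3) by auto
    then have "- (p - (z0 + (s * b) *\<^sub>R u)) = of_real l * (s *\<^sub>R u)"
      using l(2) by (simp add: divide_eq_eq)
    then have "p = z0 + (s * (b - l)) *\<^sub>R u"
      by (simp add: scaleR_conv_of_real algebra_simps)
    moreover from Nim[OF that(1)] obtain y where "\<bar>y - x\<bar> < \<rho>1" "p = ?\<gamma> y" by blast
    moreover have "s * (b - l) \<noteq> 0" using that l by auto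
    ultimately show False using \<rho>1(2)[of y x u "s * (b - l)"] \<rho>1(1) unfolding z0_def by simp
  qed
  let ?A = "\<lambda>s b. Ln (- (?\<gamma> (x + \<rho>) - (z0 + (s * b) *\<^sub>R u)) / (s *\<^sub>R u)) - Ln (- (?\<gamma> (x - \<rho>) - (z0 + (s * b) *\<^sub>R u)) / (s *\<^sub>R u))"
  have NA: "winding_number N (z0 + (s * b) *\<^sub>R u) = ?A s b / (2 * pi * \<i>)" if "0 < b" "s \<in> {1, -1}" for s b
    using winding_number_slit[OF N(1), of "s *\<^sub>R u" "z0 + (s * b) *\<^sub>R u"] slit[OF _ that] u0 that(2) unfolding N(2,3) by auto
  have lim: "(?A s \<longlongrightarrow> ?A s 0) (at_right 0)" if "s \<in> {1, -1}" for s
  proof -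
    have nz: "s *\<^sub>R u \<noteq> 0" using u0 that by auto
    have im: "- (q - (z0 + (s * 0) *\<^sub>R u)) / (s *\<^sub>R u) \<notin> \<real>\<^sub>\<le>\<^sub>0" if "Im ((q - z0) / u) \<noteq> 0" for q
    proof
      assume "- (q - (z0 + (s * 0) *\<^sub>R u)) / (s *\<^sub>R u) \<in> \<real>\<^sub>\<le>\<^sub>0"
      moreover have "- (q - (z0 + (s * 0) *\<^sub>R u)) / (s *\<^sub>R u) = - s *\<^sub>R ((q - z0) / u)"
        using \<open>s \<in> {1, -1}\<close> by (auto simp: diff_divide_distrib)
      ultimately show False using that \<open>s \<in> {1, -1}\<close> by (auto simp: complex_nonpos_Reals_iff)
    qed
    show ?thesis
      using im[of "?\<gamma> (x + \<rho>)"] im[of "?\<gamma> (x - \<rho>)"] Im nz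
      by (intro tendsto_intros) auto
  qed
  have GN: "(G N \<longlongrightarrow> ?A 1 0 / (2 * pi * \<i>) - ?A (-1) 0 / (2 * pi * \<i>)) (at_right 0)"
  proof (rule Lim_transform_eventually)
    show "((\<lambda>b. ?A 1 b / (2 * pi * \<i>) - ?A (-1) b / (2 * pi * \<i>)) \<longlongrightarrow>
        ?A 1 0 / (2 * pi * \<i>) - ?A (-1) 0 / (2 * pi * \<i>)) (at_right 0)"
      by (intro tendsto_intros lim) auto
    have eq: "G N b = ?A 1 b / (2 * pi * \<i>) - ?A (-1) b / (2 * pi * \<i>)" if b: "0 < b" for b
    proof -
      have e: "z0 + b *\<^sub>R u = z0 + (1 * b) *\<^sub>R u" "z0 - b *\<^sub>R u = z0 + (-1 * b) *\<^sub>R u" by simp_all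
      have s: "(1::real) \<in> {1, -1}" "(-1::real) \<in> {1, -1}" by auto
      show ?thesis unfolding G_def e NA[OF b s(1)] NA[OF b s(2)] ..
    qed
    show "\<forall>\<^sub>F b in at_right 0. ?A 1 b / (2 * pi * \<i>) - ?A (-1) b / (2 * pi * \<i>) = G N b"
      using eventually_at_right_less[of "0::real"] by (rule eventually_mono) (simp only: eq)
  qed
  \<comment> \<open>At b = 0 the two expressions differ only by a sign inside the logarithms. One
    end of the arc lies below the cut line and the other above, so their corrections of pi * i add
    up to a full turn.\<close>
  have "?A 1 0 / (2 * pi * \<i>) - ?A (-1) 0 / (2 * pi * \<i>) = 1"
  proof -
    let ?B = "(?\<gamma> (x + \<rho>) - z0) / u" and ?C = "(?\<gamma> (x - \<rho>) - z0) / u"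
    have "Ln (- ?B) = Ln ?B + \<i> * pi" "Ln (- ?C) = Ln ?C - \<i> * pi"
      using Im by (simp_all only: Ln_neg)
    moreover have "- (q - (z0 + (1 * 0) *\<^sub>R u)) / (1 *\<^sub>R u) = - ((q - z0) / u)"
      "- (q - (z0 + (- 1 * 0) *\<^sub>R u)) / (- 1 *\<^sub>R u) = (q - z0) / u" for q
      by (simp_all add: diff_divide_distrib)
    moreover have "((a + \<i> * pi) - (b - \<i> * pi)) / (2 * pi * \<i>) - (a - b) / (2 * pi * \<i>) = 1" for a b :: complex
      by (simp add: diff_divide_distrib[symmetric])
    ultimately show ?thesis by (simp only:)
  qed
  with GN have GN: "(G N \<longlongrightarrow> 1) (at_right 0)" by (simp only:)
  obtain r where r0: "r > 0" "\<And>x' u' b. \<bar>x' - x\<bar> < r \<Longrightarrow> norm (u' - u) < r \<Longrightarrow> 0 < b \<Longrightarrow> b < r \<Longrightarrow>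
    ?\<gamma> x' + b *\<^sub>R u' \<notin> trace \<and> wind (?\<gamma> x' + b *\<^sub>R u') = w" using w(1) unfolding side_wind_def by blast
  obtain r' where r0': "r' > 0" "\<And>x' u' b. \<bar>x' - x\<bar> < r' \<Longrightarrow> norm (u' - (- u)) < r' \<Longrightarrow> 0 < b \<Longrightarrow> b < r' \<Longrightarrow>
    ?\<gamma> x' + b *\<^sub>R u' \<notin> trace \<and> wind (?\<gamma> x' + b *\<^sub>R u') = w'" using w(2) unfolding side_wind_def by blast
  have r: "z0 + b *\<^sub>R u \<notin> trace \<and> wind (z0 + b *\<^sub>R u) = w" if "0 < b" "b < r" for b
    using r0(2)[of x u b] r0(1) that unfolding z0_def by simp
  have r': "z0 - b *\<^sub>R u \<notin> trace \<and> wind (z0 - b *\<^sub>R u) = w'" if "0 < b" "b < r'" for b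
    using r0'(2)[of x "- u" b] r0'(1) that unfolding z0_def by simp
  \<comment> \<open>For small b the sum equals w - w' exactly, while its limit comes from the short
    arc alone and is 1.\<close>
  have "\<forall>\<^sub>F b in at_right 0. F b + (G (subpath 0 \<alpha> g) b + G N b + G (subpath \<beta> 1 g) b) = w - w'"
    unfolding eventually_at_right_field
  proof (intro exI[of _ "min r r'"] conjI allI impI)
    fix b assume b: "0 < b" "b < min r r'"
    let ?p = "z0 + b *\<^sub>R u" and ?m = "z0 - b *\<^sub>R u"
    have t: "?p \<notin> trace" "?m \<notin> trace" "wind ?p = w" "wind ?m = w'" using r[of b] r'[of b] b by auto
    have spl: "winding_number ?\<gamma> z = winding_number (subpath 0 \<alpha> g) z + winding_number N z + winding_number (subpath \<beta> 1 g) z"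
      if z: "z \<notin> trace" for z
    proof -
      have zi: "z \<notin> path_image g" using z traceI[OF i] unfolding path_image_def g_def by blast
      have "winding_number ?\<gamma> z = winding_number (subpath 0 1 g) z"
        using winding_number_shifted[OF i z, of "x - 1/2"] unfolding g_def by simp
      also have "\<dots> = winding_number (subpath 0 \<alpha> g) z + winding_number (subpath \<alpha> 1 g) z"
        by (rule winding_number_subpath_combine[OF gp zi, symmetric]) (use ab in auto)
      also have "winding_number (subpath \<alpha> 1 g) z = winding_number N z + winding_number (subpath \<beta> 1 g) z"
        unfolding N_def by (rule winding_number_subpath_combine[OF gp zi, symmetric]) (use ab in auto)
      finally show ?thesis by simp
    qed
    have wi: "wind z = (\<Sum>j\<in>{..<n} - {i}. winding_number (curve D j) z) + winding_number ?\<gamma> z" for z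
      unfolding wind_def using i by (subst sum.remove[of _ i]) auto
    show "F b + (G (subpath 0 \<alpha> g) b + G N b + G (subpath \<beta> 1 g) b) = w - w'"
      using t(3,4) unfolding wi spl[OF t(1)] spl[OF t(2)] F_def G_def sum_subtractf by (simp add: algebra_simps)
  qed (use r0(1) r0'(1) in auto)
  moreover have "((\<lambda>b. F b + (G (subpath 0 \<alpha> g) b + G N b + G (subpath \<beta> 1 g) b)) \<longlongrightarrow> 0 + (0 + 1 + 0)) (at_right 0)"
    by (intro tendsto_add F0 G1 G2 GN)
  ultimately have "((\<lambda>b. w - w') \<longlongrightarrow> 0 + (0 + 1 + 0)) (at_right (0::real))"
    by (rule Lim_transform_eventually[rotated])
  then have "w - w' = 0 + (0 + 1 + 0)"
    by (intro tendsto_unique[OF _ tendsto_const]) auto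
  then show ?thesis by (simp add: algebra_simps)
qed

definition left_wind :: "nat \<Rightarrow> real \<Rightarrow> complex" where
  "left_wind i x = (THE w. side_wind i x (\<i> * velocity D (i, x)) w)"

lemma cross_rotate: "cross v (\<i> * v) = (norm v)\<^sup>2"
  unfolding cmod_power2 by (simp add: cross_def power2_eq_square)

text \<open>Every direction on the left can be deformed linearly to i times the velocity without
  becoming tangent, so the left side has one value; the right side follows from the jump.\<close>

lemma left_wind:
  assumes i: "i < n" and simple: "\<not> double_preimage D (i, x)"
    and c: "0 < cross (velocity D (i, x)) u"
  shows "side_wind i x u (left_wind i x)" "side_wind i x (- u) (left_wind i x - 1)"
proof -
  let ?v = "velocity D (i, x)"
  have v: "0 < norm ?v" using velocity_nz[of "(i, x)"] i by simp
  have ex: "\<exists>w. side_wind i x u' w" if "0 < cross ?v u'" for u'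
    using side_wind_exists[OF i simple] that by auto
  have "0 < cross ?v (\<i> * ?v)" unfolding cross_rotate using v by simp
  then obtain w0 where w0: "side_wind i x (\<i> * ?v) w0" using ex by blast
  have lw: "left_wind i x = w0" unfolding left_wind_def using w0 side_wind_unique by blast
  obtain w where w: "side_wind i x u w" using ex c by blast
  let ?u = "\<lambda>t. (1 - t) *\<^sub>R u + t *\<^sub>R (\<i> * ?v)"
  have "w = w0"
  proof (rule side_wind_path[where \<xi> = "\<lambda>_. x" and u = ?u])
    fix t :: real assume t: "t \<in> {0..1}"
    have "0 < (1 - t) * cross ?v u + t * (norm ?v)\<^sup>2"
    proof (cases "t = 0")
      case False
      then have "0 < t * (norm ?v)\<^sup>2" using t v by simp
      moreover have "0 \<le> (1 - t) * cross ?v u" using t c by simp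
      ultimately show ?thesis by linarith
    qed (use c in simp)
    then show "\<exists>w. side_wind i x (?u t) w"
      by (intro ex) (simp add: cross_add cross_scale cross_rotate)
  qed (use w w0 in \<open>auto intro!: continuous_intros\<close>)
  then show s: "side_wind i x u (left_wind i x)" using w lw by simp
  obtain w' where w': "side_wind i x (- u) w'"
    using side_wind_exists[OF i simple, of "- u"] c by (auto simp: cross_minus)
  show "side_wind i x (- u) (left_wind i x - 1)"
    using side_wind_jump[OF i simple c s w'] w' by simp
qed

lemma left_wind_gap:
  assumes i: "i < n" and st: "s \<le> t" "\<And>x. s \<le> x \<Longrightarrow> x \<le> t \<Longrightarrow> \<not> double_preimage D (i, x)"
  shows "left_wind i s = left_wind i t"
proof (rule side_wind_path[where \<xi> = "\<lambda>\<tau>. s + \<tau> * (t - s)" and u = "\<lambda>\<tau>. \<i> * velocity D (i, s + \<tau> * (t - s))"])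
  have sw: "side_wind i x (\<i> * velocity D (i, x)) (left_wind i x)" if "s \<le> x" "x \<le> t" for x
    by (rule left_wind(1)[OF i st(2)[OF that]]) (use velocity_nz[of "(i, x)"] i in \<open>simp add: cross_rotate\<close>)
  show "continuous_on {0..1} (\<lambda>\<tau>. \<i> * velocity D (i, s + \<tau> * (t - s)))"
    by (intro continuous_intros continuous_on_compose2[OF velocity_continuous[OF i]]) auto
  show "\<exists>w. side_wind i (s + \<tau> * (t - s)) (\<i> * velocity D (i, s + \<tau> * (t - s))) w" if "\<tau> \<in> {0..1}" for \<tau>
  proof -
    have "0 \<le> \<tau> * (t - s)" "\<tau> * (t - s) \<le> 1 * (t - s)" using that st(1) mult_right_mono[of \<tau> 1 "t - s"] by auto
    then have "side_wind i (s + \<tau> * (t - s)) (\<i> * velocity D (i, s + \<tau> * (t - s))) (left_wind i (s + \<tau> * (t - s)))"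
      by (intro sw) auto
    then show ?thesis by blast
  qed
  show "side_wind i (s + 0 * (t - s)) (\<i> * velocity D (i, s + 0 * (t - s))) (left_wind i s)"
    "side_wind i (s + 1 * (t - s)) (\<i> * velocity D (i, s + 1 * (t - s))) (left_wind i t)"
    using sw[of s] sw[of t] st(1) by auto
qed (auto intro!: continuous_intros)

text \<open>Lets the straight displacement in \<open>side_wind\<close> be replaced by a displacement
  along another strand: the secants of that strand converge to its tangent, and
  \<open>side_wind\<close> tolerates nearby directions.\<close>

lemma side_wind_along_strand:
  assumes j: "j < n" and "0 < r0" and s: "s \<in> {1, - 1}"
    and W: "\<And>b. 0 < b \<Longrightarrow> b < r0 \<Longrightarrow> wind (curve D i x + (curve D j (y + s * b) - curve D j y)) = W"
    and w: "side_wind i x (s *\<^sub>R velocity D (j, y)) w"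
  shows "w = W"
proof -
  let ?u = "velocity D (j, y)"
  obtain r where r: "r > 0" "\<And>x' u' b. \<bar>x' - x\<bar> < r \<Longrightarrow> norm (u' - s *\<^sub>R ?u) < r \<Longrightarrow> 0 < b \<Longrightarrow> b < r \<Longrightarrow>
    wind (curve D i x' + b *\<^sub>R u') = w" using w unfolding side_wind_def by blast
  obtain \<rho> where \<rho>: "\<rho> > 0" "\<And>y1 y2. \<bar>y1 - y\<bar> < \<rho> \<Longrightarrow> \<bar>y2 - y\<bar> < \<rho> \<Longrightarrow>
    norm (curve D j y1 - curve D j y2 - (y1 - y2) *\<^sub>R ?u) \<le> (r / 2) * \<bar>y1 - y2\<bar>"
    using strand_estimate[OF j, of "r / 2" y] r(1) by auto
  define b where "b = min (min r \<rho>) r0 / 2"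
  have b: "0 < b" "b < r" "b < \<rho>" "b < r0" unfolding b_def using r(1) \<rho>(1) assms(2) by auto
  let ?d = "curve D j (y + s * b) - curve D j y"
  define u' where "u' = (1 / b) *\<^sub>R ?d"
  have "norm (?d - (s * b) *\<^sub>R ?u) \<le> (r / 2) * b"
    using \<rho>(2)[of "y + s * b" y] b s \<rho>(1) by (auto simp: abs_mult)
  moreover have "b *\<^sub>R (u' - s *\<^sub>R ?u) = ?d - (s * b) *\<^sub>R ?u"
    unfolding u'_def using b(1) by (simp add: scaleR_diff_right mult.commute)
  ultimately have "b * norm (u' - s *\<^sub>R ?u) \<le> b * (r / 2)" using b(1) by (metis abs_of_pos mult.commute norm_scaleR)
  then have "norm (u' - s *\<^sub>R ?u) < r" using b(1) r(1) by simp
  then have "wind (curve D i x + b *\<^sub>R u') = w" using r(2)[of x u' b] r(1) b by simp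
  moreover have "b *\<^sub>R u' = ?d" unfolding u'_def using b(1) by simp
  ultimately show ?thesis using W[OF b(1,4)] by simp
qed

end

section \<open>Winding numbers around a crossing\<close>

lemma transversal_strands:
  assumes d: "norm (d - s *\<^sub>R v) \<le> \<kappa> * \<bar>s\<bar>" "norm (d - b *\<^sub>R u) \<le> \<kappa> * \<bar>b\<bar>"
    and k: "\<kappa> * (norm u + norm v) < \<bar>cross v u\<bar>"
  shows "b = 0"
proof (rule ccontr)
  assume b: "b \<noteq> 0"
  let ?e = "d - s *\<^sub>R v" and ?f = "d - b *\<^sub>R u" and ?c = "\<bar>cross v u\<bar>"
  \<comment> \<open>Crossing with \<open>v\<close> isolates \<open>b\<close> and crossing with
    \<open>u\<close> isolates \<open>s\<close>. Both are thus bounded by the errors, which are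
    \<kappa> times their own sizes, and \<kappa> is too small for that unless both vanish.\<close>
  have "b * cross v u = cross v (?e - ?f)" "s * cross v u = cross (?f - ?e) u"
    by (simp_all add: cross_diff cross_scale cross_self)
  then have "\<bar>b\<bar> * ?c \<le> norm v * norm (?e - ?f)" "\<bar>s\<bar> * ?c \<le> norm (?f - ?e) * norm u"
    using abs_cross_le[of v "?e - ?f"] abs_cross_le[of "?f - ?e" u] by (simp_all only: abs_mult[symmetric])
  then have bc: "\<bar>b\<bar> * ?c \<le> norm v * norm (?e - ?f)" "\<bar>s\<bar> * ?c \<le> norm u * norm (?e - ?f)"
    by (simp_all only: norm_minus_commute[of ?f ?e] mult.commute)
  have "norm (?e - ?f) \<le> \<kappa> * \<bar>s\<bar> + \<kappa> * \<bar>b\<bar>"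
    using norm_triangle_ineq4[of ?e ?f] d by linarith
  then have le: "(norm u + norm v) * norm (?e - ?f) \<le> (norm u + norm v) * (\<kappa> * \<bar>s\<bar> + \<kappa> * \<bar>b\<bar>)"
    by (intro mult_left_mono) auto
  have "(\<bar>s\<bar> + \<bar>b\<bar>) * ?c = \<bar>b\<bar> * ?c + \<bar>s\<bar> * ?c" by (rule distrib_right[THEN trans]) simp
  also have "\<dots> \<le> norm v * norm (?e - ?f) + norm u * norm (?e - ?f)" by (rule add_mono[OF bc])
  also have "\<dots> = (norm u + norm v) * norm (?e - ?f)" by (rule sym, rule distrib_right[THEN trans]) simp
  also note le
  also have "(norm u + norm v) * (\<kappa> * \<bar>s\<bar> + \<kappa> * \<bar>b\<bar>) = (\<bar>s\<bar> + \<bar>b\<bar>) * (\<kappa> * (norm u + norm v))"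
    by (simp add: distrib_left distrib_right mult_ac)
  finally have "(\<bar>s\<bar> + \<bar>b\<bar>) * ?c \<le> (\<bar>s\<bar> + \<bar>b\<bar>) * (\<kappa> * (norm u + norm v))" .
  then show False using k b by (simp add: mult_le_cancel_left_pos)
qed

context diag
begin

lemma curve_small:
  assumes "i < n" "0 < e"
  shows "\<exists>r>0. \<forall>t. \<bar>t\<bar> < r \<longrightarrow> norm (curve D i (x + t) - curve D i x) < e"
proof -
  have "isCont (curve D i) x" using curve_deriv[OF assms(1)] has_vector_derivative_continuous by blast
  then obtain r where r: "r > 0" "\<And>x'. \<bar>x' - x\<bar> < r \<Longrightarrow> norm (curve D i x' - curve D i x) < e"
    using assms(2) unfolding continuous_at_eps_delta dist_norm real_norm_def by blast
  then show ?thesis by (intro exI[of _ r]) (simp add: r(2))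
qed

text \<open>The sum of displacements along the two strands serves as curved coordinates at the
  crossing. A trace point off the axes would lie on one of the strands, and then one displacement
  would be a chord of both strands, contrary to \<open>transversal_strands\<close>.\<close>

lemma crossing_quadrants:
  assumes dp: "double_pair D (i, x) (j, y)"
  shows "\<exists>r>0. \<forall>a b. 0 < \<bar>a\<bar> \<longrightarrow> \<bar>a\<bar> < r \<longrightarrow> 0 < \<bar>b\<bar> \<longrightarrow> \<bar>b\<bar> < r \<longrightarrow>
    curve D i (x + a) + (curve D j (y + b) - curve D j y) \<notin> trace"
proof -
  let ?v = "velocity D (i, x)" and ?u = "velocity D (j, y)"
  have ij: "i < n" "j < n" and z: "curve D i x = curve D j y"
    using dp unfolding double_pair_def plane_at_def by auto
  have c: "cross ?v ?u \<noteq> 0" using transverse[OF dp] .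
  have v: "0 < norm ?v" "0 < norm ?u" using velocity_nz[of "(i, x)"] velocity_nz[of "(j, y)"] ij by auto
  \<comment> \<open>Half of the threshold in \<open>transversal_strands\<close>, for both orders of
    the two strands.\<close>
  define \<kappa> where "\<kappa> = \<bar>cross ?v ?u\<bar> / (2 * (norm ?u + norm ?v))"
  have "\<kappa> * (norm ?u + norm ?v) = \<bar>cross ?v ?u\<bar> / 2" 
  proof -
    have "c / (2 * t) * t = c / 2" if "t \<noteq> 0" for c t :: real using that by simp
    moreover have "norm ?u + norm ?v \<noteq> 0" using v by linarith
    ultimately show ?thesis unfolding \<kappa>_def by blast
  qed
  moreover have "0 < \<kappa>" unfolding \<kappa>_def using c v by (intro divide_pos_pos) (auto intro: add_pos_pos)
  ultimately have k: "0 < \<kappa>" "\<kappa> * (norm ?u + norm ?v) < \<bar>cross ?v ?u\<bar>"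
    "\<kappa> * (norm ?v + norm ?u) < \<bar>cross ?u ?v\<bar>"
    unfolding cross_swap[of ?u ?v] using c by (simp_all add: add.commute)
  obtain \<rho>1 where \<rho>1: "\<rho>1 > 0" "\<And>t t'. \<bar>t - x\<bar> < \<rho>1 \<Longrightarrow> \<bar>t' - x\<bar> < \<rho>1 \<Longrightarrow>
    norm (curve D i t - curve D i t' - (t - t') *\<^sub>R ?v) \<le> \<kappa> * \<bar>t - t'\<bar>"
    using strand_estimate[OF ij(1) k(1), of x] by blast
  obtain \<rho>2 where \<rho>2: "\<rho>2 > 0" "\<And>t t'. \<bar>t - y\<bar> < \<rho>2 \<Longrightarrow> \<bar>t' - y\<bar> < \<rho>2 \<Longrightarrow>
    norm (curve D j t - curve D j t' - (t - t') *\<^sub>R ?u) \<le> \<kappa> * \<bar>t - t'\<bar>"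
    using strand_estimate[OF ij(2) k(1), of y] by blast
  let ?P = "{(i, x), (j, y)}" and ?z = "curve D i x"
  have P: "\<exists>p\<in>?P. same_point (k, t) p" if "k < n" "curve D k t = ?z" for k t
  proof (cases "same_point (i, x) (k, t)")
    case False
    then have "double_pair D (i, x) (k, t)" using that ij unfolding double_pair_def plane_at_def by auto
    then show ?thesis using triple_free[OF dp] same_point_sym by blast
  qed (use same_point_sym in blast)
  obtain \<delta> where \<delta>: "\<delta> > 0" "\<And>w. w \<in> trace \<Longrightarrow> norm (w - ?z) < \<delta> \<Longrightarrow>
      (\<exists>t. \<bar>t - x\<bar> < min \<rho>1 \<rho>2 \<and> w = curve D i t) \<or> (\<exists>t. \<bar>t - y\<bar> < min \<rho>1 \<rho>2 \<and> w = curve D j t)"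
  proof -
    have "0 < min \<rho>1 \<rho>2" using \<rho>1(1) \<rho>2(1) by simp
    moreover have "finite ?P" by simp
    ultimately have "\<exists>\<delta>>0. \<forall>w\<in>trace. norm (w - ?z) < \<delta> \<longrightarrow>
        (\<exists>(k, s)\<in>?P. k < n \<and> (\<exists>t. \<bar>t - s\<bar> < min \<rho>1 \<rho>2 \<and> w = curve D k t))"
      using P by (intro near_strands)
    then obtain \<delta> where \<delta>: "\<delta> > 0" "\<forall>w\<in>trace. norm (w - ?z) < \<delta> \<longrightarrow>
        (\<exists>(k, s)\<in>?P. k < n \<and> (\<exists>t. \<bar>t - s\<bar> < min \<rho>1 \<rho>2 \<and> w = curve D k t))" by (elim exE conjE)
    show ?thesis
    proof (rule that[OF \<delta>(1)])
      fix w assume "w \<in> trace" "norm (w - ?z) < \<delta>"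
      then have "\<exists>(k, s)\<in>?P. k < n \<and> (\<exists>t. \<bar>t - s\<bar> < min \<rho>1 \<rho>2 \<and> w = curve D k t)" using \<delta>(2) by blast
      then show "(\<exists>t. \<bar>t - x\<bar> < min \<rho>1 \<rho>2 \<and> w = curve D i t) \<or> (\<exists>t. \<bar>t - y\<bar> < min \<rho>1 \<rho>2 \<and> w = curve D j t)"
        by (elim bexE) (auto simp del: min_less_iff_conj)
    qed
  qed
  obtain r1 where r1: "r1 > 0" "\<And>t. \<bar>t\<bar> < r1 \<Longrightarrow> norm (curve D i (x + t) - curve D i x) < \<delta> / 2"
    using curve_small[OF ij(1), of "\<delta> / 2" x] \<delta>(1) by auto
  obtain r2 where r2: "r2 > 0" "\<And>t. \<bar>t\<bar> < r2 \<Longrightarrow> norm (curve D j (y + t) - curve D j y) < \<delta> / 2"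
    using curve_small[OF ij(2), of "\<delta> / 2" y] \<delta>(1) by auto
  define r where "r = min (min r1 r2) (min \<rho>1 \<rho>2)"
  have r: "r > 0" "r \<le> r1" "r \<le> r2" "r \<le> \<rho>1" "r \<le> \<rho>2" unfolding r_def using r1(1) r2(1) \<rho>1(1) \<rho>2(1) by auto
  have "curve D i (x + a) + (curve D j (y + b) - curve D j y) \<notin> trace"
    if ab: "0 < \<bar>a\<bar>" "\<bar>a\<bar> < r" "0 < \<bar>b\<bar>" "\<bar>b\<bar> < r" for a b
  proof
    let ?w = "curve D i (x + a) + (curve D j (y + b) - curve D j y)"
    assume t: "?w \<in> trace"
    have "norm (?w - ?z) \<le> norm (curve D i (x + a) - curve D i x) + norm (curve D j (y + b) - curve D j y)"
      using norm_triangle_ineq[of "curve D i (x + a) - curve D i x" "curve D j (y + b) - curve D j y"]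
      by (simp add: algebra_simps)
    also have "\<dots> < \<delta>" using r1(2)[of a] r2(2)[of b] ab r by linarith
    finally consider t where "\<bar>t - x\<bar> < min \<rho>1 \<rho>2" "?w = curve D i t" | t where "\<bar>t - y\<bar> < min \<rho>1 \<rho>2" "?w = curve D j t"
      using \<delta>(2)[OF t] by blast
    then show False
    proof cases
      case 1
      let ?d = "curve D j (y + b) - curve D j y"
      have "?d = curve D i t - curve D i (x + a)" using 1(2) by (simp add: algebra_simps)
      then have "norm (?d - (t - (x + a)) *\<^sub>R ?v) \<le> \<kappa> * \<bar>t - (x + a)\<bar>"
        using \<rho>1(2)[of t "x + a"] 1(1) ab r by simp
      moreover have "norm (?d - b *\<^sub>R ?u) \<le> \<kappa> * \<bar>b\<bar>"
        using \<rho>2(2)[of "y + b" y] ab r by simp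
      ultimately have "b = 0" by (rule transversal_strands[OF _ _ k(2)])
      then show False using ab by simp
    next
      case 2
      let ?d = "curve D i (x + a) - curve D i x"
      have "?d = curve D j t - curve D j (y + b)" using 2(2) z by (simp add: algebra_simps)
      then have "norm (?d - (t - (y + b)) *\<^sub>R ?u) \<le> \<kappa> * \<bar>t - (y + b)\<bar>"
        using \<rho>2(2)[of t "y + b"] 2(1) ab r by simp
      moreover have "norm (?d - a *\<^sub>R ?v) \<le> \<kappa> * \<bar>a\<bar>"
        using \<rho>1(2)[of "x + a" x] ab r by simp
      ultimately have "a = 0" by (rule transversal_strands[OF _ _ k(3)])
      then show False using ab by simp
    qed
  qed
  then show ?thesis using r(1) by blast
qed

lemma velocity_cross_near:
  assumes "i < n" "0 < cross (velocity D (i, x)) u"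
  shows "\<exists>r>0. \<forall>t. \<bar>t\<bar> < r \<longrightarrow> 0 < cross (velocity D (i, x + t)) u"
proof -
  have "continuous_on UNIV (\<lambda>t. cross (velocity D (i, x + t)) u)"
    by (intro continuous_intros continuous_on_compose2[OF velocity_continuous[OF assms(1)]]) auto
  then have "isCont (\<lambda>t. cross (velocity D (i, x + t)) u) 0" by (simp add: continuous_on_eq_continuous_at)
  then have "((\<lambda>t. cross (velocity D (i, x + t)) u) \<longlongrightarrow> cross (velocity D (i, x)) u) (at 0)"
    unfolding isCont_def by simp
  then have "\<forall>\<^sub>F t in at 0. 0 < cross (velocity D (i, x + t)) u" by (rule order_tendstoD(1)[OF _ assms(2)])
  then obtain r where r: "r > 0" "\<And>t. t \<noteq> 0 \<Longrightarrow> \<bar>t\<bar> < r \<Longrightarrow> 0 < cross (velocity D (i, x + t)) u"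
    unfolding eventually_at by auto
  have "0 < cross (velocity D (i, x + t)) u" if "\<bar>t\<bar> < r" for t
    using r(2)[of t] that assms(2) by (cases "t = 0") auto
  then show ?thesis using r(1) by blast
qed

lemma double_isolated:
  assumes "i < n"
  shows "\<exists>r>0. \<forall>t. 0 < \<bar>t\<bar> \<longrightarrow> \<bar>t\<bar> < r \<longrightarrow> \<not> double_preimage D (i, x + t)"
proof -
  have dp: "double_preimage D p' \<longleftrightarrow> double_preimage D p" if "same_point p p'" for p p'
    using double_pair_same[OF _ that same_point_refl] double_pair_same[OF _ same_point_sym[OF that] same_point_refl]
    unfolding double_preimage_def by blast
  let ?A = "{z. x - 1/2 < z \<and> z < x + 1/2 \<and> double_preimage D (i, z)}"
  have "finite ?A"
  proof (rule finite_imageD)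
    show "finite ((\<lambda>z. rep (i, z)) ` ?A)"
      by (rule finite_subset[OF _ finite_double]) (use dp[OF same_point_rep] in auto)
    show "inj_on (\<lambda>z. rep (i, z)) ?A"
    proof (rule inj_onI)
      fix s t assume st: "s \<in> ?A" "t \<in> ?A" "rep (i, s) = rep (i, t)"
      then obtain k where k: "s - t = of_int k"
        by (auto simp: rep_eq_iff same_point_def elim: Ints_cases)
      then have "\<bar>real_of_int k\<bar> < 1" using st by (auto simp: abs_if)
      then show "s = t" using k by (simp flip: of_int_abs)
    qed
  qed
  then obtain d where d: "d > 0" "\<And>z. z \<in> ?A \<Longrightarrow> z \<noteq> x \<Longrightarrow> d \<le> dist x z"
    using finite_set_avoid[of ?A x] by blast
  have "\<not> double_preimage D (i, x + t)" if "0 < \<bar>t\<bar>" "\<bar>t\<bar> < min d (1/2)" for t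
  proof
    assume "double_preimage D (i, x + t)"
    moreover have "x - 1/2 < x + t" "x + t < x + 1/2" "x + t \<noteq> x" using that by auto
    ultimately have "d \<le> dist x (x + t)" using d(2)[of "x + t"] by blast
    then show False using that by (simp add: dist_norm)
  qed
  then show ?thesis using d(1) by (intro exI[of _ "min d (1/2)"]) auto
qed

text \<open>The trace leaves four quadrants with one winding number each. Every half-strand
  separates two neighbouring quadrants, with the left value exceeding the right one by one; reading
  the four half-strands in turn relates all of them to the same \<open>w\<close>.\<close>

lemma crossing_left_wind:
  assumes dp: "double_pair D (i, x) (j, y)" and c: "0 < cross (velocity D (i, x)) (velocity D (j, y))"
  shows "\<exists>r>0. \<exists>w. \<forall>t. 0 < t \<longrightarrow> t < r \<longrightarrow>
    left_wind i (x - t) = w \<and> left_wind i (x + t) = w - 1 \<and> left_wind j (y + t) = w \<and> left_wind j (y - t) = w - 1"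
proof -
  let ?v = "velocity D (i, x)" and ?u = "velocity D (j, y)"
  have ij: "i < n" "j < n" and z: "curve D i x = curve D j y"
    using dp unfolding double_pair_def plane_at_def by auto
  define \<Psi> where "\<Psi> a b = curve D i (x + a) + (curve D j (y + b) - curve D j y)" for a b
  obtain r1 where r1: "r1 > 0" "\<And>a b. 0 < \<bar>a\<bar> \<Longrightarrow> \<bar>a\<bar> < r1 \<Longrightarrow> 0 < \<bar>b\<bar> \<Longrightarrow> \<bar>b\<bar> < r1 \<Longrightarrow> \<Psi> a b \<notin> trace"
    using crossing_quadrants[OF dp] unfolding \<Psi>_def by blast
  obtain r2 where r2: "r2 > 0" "\<And>t. 0 < \<bar>t\<bar> \<Longrightarrow> \<bar>t\<bar> < r2 \<Longrightarrow> \<not> double_preimage D (i, x + t)"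
    using double_isolated[OF ij(1), of x] by blast
  obtain r3 where r3: "r3 > 0" "\<And>t. 0 < \<bar>t\<bar> \<Longrightarrow> \<bar>t\<bar> < r3 \<Longrightarrow> \<not> double_preimage D (j, y + t)"
    using double_isolated[OF ij(2), of y] by blast
  obtain r4 where r4: "r4 > 0" "\<And>t. \<bar>t\<bar> < r4 \<Longrightarrow> 0 < cross (velocity D (i, x + t)) ?u"
    using velocity_cross_near[OF ij(1) c] by blast
  have c': "0 < cross ?u (- ?v)" using c cross_swap[of ?u ?v] by (simp add: cross_minus)
  obtain r5 where r5: "r5 > 0" "\<And>t. \<bar>t\<bar> < r5 \<Longrightarrow> 0 < cross (velocity D (j, y + t)) (- ?v)"
    using velocity_cross_near[OF ij(2) c'] by blast
  define r where "r = Min {r1, r2, r3, r4, r5}"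
  have r: "r > 0" "r \<le> r1" "r \<le> r2" "r \<le> r3" "r \<le> r4" "r \<le> r5"
    unfolding r_def using r1(1) r2(1) r3(1) r4(1) r5(1) by auto
  define W where "W s t = wind (\<Psi> (s * (r / 2)) (t * (r / 2)))" for s t
  \<comment> \<open>The quadrant with signs \<open>s\<close> and \<open>t\<close> is the image of a
    square, hence connected, so the winding number in it is constant.\<close>
  have W: "wind (\<Psi> (s * a) (t * b)) = W s t"
    if st: "s \<in> {1, -1}" "t \<in> {1, -1}" and ab: "0 < a" "a < r" "0 < b" "b < r" for s t a b
  proof -
    let ?B = "{0<..<r} \<times> {0<..<r}" and ?f = "\<lambda>(a, b). \<Psi> (s * a) (t * b)"
    have "continuous_on ?B ?f"
      unfolding split_beta \<Psi>_def
      by (intro continuous_intros continuous_on_compose2[OF curve_continuous[OF ij(1), of UNIV]]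
          continuous_on_compose2[OF curve_continuous[OF ij(2), of UNIV]]) auto
    moreover have "connected ?B" by (intro convex_connected convex_Times) auto
    ultimately have con: "connected (?f ` ?B)" by (rule connected_continuous_image)
    have "?f ` ?B \<inter> trace = {}"
    proof -
      have "?f p \<notin> trace" if "p \<in> ?B" for p
      proof -
        obtain a b where p: "p = (a, b)" by force
        have "0 < \<bar>s * a\<bar>" "\<bar>s * a\<bar> < r1" "0 < \<bar>t * b\<bar>" "\<bar>t * b\<bar> < r1" using that st r p by auto
        then show ?thesis unfolding p using r1(2) by simp
      qed
      then show ?thesis by blast
    qed
    moreover have "\<Psi> (s * a) (t * b) \<in> ?f ` ?B" "\<Psi> (s * (r / 2)) (t * (r / 2)) \<in> ?f ` ?B"
      using ab r(1) image_eqI[of _ ?f "(a, b)" ?B] image_eqI[of _ ?f "(r / 2, r / 2)" ?B] by auto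
    ultimately show ?thesis unfolding W_def using wind_constant[OF con] by blast
  qed
  have I: "left_wind i (x + s * t) = W s 1" "left_wind i (x + s * t) - 1 = W s (- 1)"
    if s: "s \<in> {1, -1}" and t: "0 < t" "t < r" for s t
  proof -
    have a: "0 < \<bar>s * t\<bar>" "\<bar>s * t\<bar> < r" using s t by auto
    have "\<not> double_preimage D (i, x + s * t)" "0 < cross (velocity D (i, x + s * t)) ?u"
      using r2(2)[of "s * t"] r4(2)[of "s * t"] a r by auto
    from left_wind[OF ij(1) this]
    have sw: "side_wind i (x + s * t) (1 *\<^sub>R ?u) (left_wind i (x + s * t))"
      "side_wind i (x + s * t) (- 1 *\<^sub>R ?u) (left_wind i (x + s * t) - 1)" by simp_all
    have w: "wind (curve D i (x + s * t) + (curve D j (y + s' * b) - curve D j y)) = W s s'"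
      if "0 < b" "b < r" "s' \<in> {1, -1}" for b s'
      using W[OF s that(3) t that(1,2)] unfolding \<Psi>_def .
    show "left_wind i (x + s * t) = W s 1"
      by (rule side_wind_along_strand[OF ij(2) r(1) _ _ sw(1)]) (use w[of _ 1] in auto)
    show "left_wind i (x + s * t) - 1 = W s (- 1)"
      by (rule side_wind_along_strand[OF ij(2) r(1) _ _ sw(2)]) (use w[of _ "-1"] in auto)
  qed
  have J: "left_wind j (y + s * t) = W (- 1) s" "left_wind j (y + s * t) - 1 = W 1 s"
    if s: "s \<in> {1, -1}" and t: "0 < t" "t < r" for s t
  proof -
    have a: "0 < \<bar>s * t\<bar>" "\<bar>s * t\<bar> < r" using s t by auto
    have "\<not> double_preimage D (j, y + s * t)" "0 < cross (velocity D (j, y + s * t)) (- ?v)"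
      using r3(2)[of "s * t"] r5(2)[of "s * t"] a r by auto
    from left_wind[OF ij(2) this]
    have sw: "side_wind j (y + s * t) (- 1 *\<^sub>R ?v) (left_wind j (y + s * t))"
      "side_wind j (y + s * t) (1 *\<^sub>R ?v) (left_wind j (y + s * t) - 1)" by simp_all
    have w: "wind (curve D j (y + s * t) + (curve D i (x + s' * b) - curve D i x)) = W s' s"
      if "0 < b" "b < r" "s' \<in> {1, -1}" for b s'
    proof -
      have "curve D j (y + s * t) + (curve D i (x + s' * b) - curve D i x) = \<Psi> (s' * b) (s * t)"
        unfolding \<Psi>_def z by simp
      then show ?thesis using W[OF that(3) s that(1,2) t] by simp
    qed
    show "left_wind j (y + s * t) = W (- 1) s"
      by (rule side_wind_along_strand[OF ij(1) r(1) _ _ sw(1)]) (use w[of _ "-1"] in auto)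
    show "left_wind j (y + s * t) - 1 = W 1 s"
      by (rule side_wind_along_strand[OF ij(1) r(1) _ _ sw(2)]) (use w[of _ 1] in auto)
  qed
  have "left_wind i (x - t) = W (- 1) 1 \<and> left_wind i (x + t) = W (- 1) 1 - 1 \<and>
      left_wind j (y + t) = W (- 1) 1 \<and> left_wind j (y - t) = W (- 1) 1 - 1" if "0 < t" "t < r" for t
    using I[of "-1" t] I[of 1 t] J[of "-1" t] J[of 1 t] that by auto
  then show ?thesis using r(1) by blast
qed

text \<open>The floor gives a change of parity under \<open>w - 1\<close> for every complex
  \<open>w\<close>.\<close>

definition parity :: "complex \<Rightarrow> bool" where
  "parity w \<longleftrightarrow> even \<lfloor>Re w\<rfloor>"

lemma parity_minus_1: "parity (w - 1) = (\<not> parity w)"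
  unfolding parity_def by simp

lemma crossing_parity:
  assumes dp: "double_pair D (i, x) (j, y)"
  shows "\<exists>r>0. \<forall>t. 0 < t \<longrightarrow> t < r \<longrightarrow>
    parity (left_wind i (x - t)) \<noteq> parity (left_wind i (x + t)) \<and>
    parity (left_wind i (x + t)) \<noteq> parity (left_wind j (y + t))"
proof (cases "0 < cross (velocity D (i, x)) (velocity D (j, y))")
  case True
  from crossing_left_wind[OF dp True] obtain r w where r: "r > 0" and
    "\<And>t. 0 < t \<Longrightarrow> t < r \<Longrightarrow> left_wind i (x - t) = w \<and> left_wind i (x + t) = w - 1 \<and>
      left_wind j (y + t) = w \<and> left_wind j (y - t) = w - 1" by blast
  then show ?thesis using parity_minus_1[of w] by (intro exI[of _ r]) auto
next
  case False
  then have "0 < cross (velocity D (j, y)) (velocity D (i, x))"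
    using transverse[OF dp] cross_swap[of "velocity D (j, y)" "velocity D (i, x)"] by auto
  from crossing_left_wind[OF double_pair_sym[OF dp] this] obtain r w where r: "r > 0" and
    "\<And>t. 0 < t \<Longrightarrow> t < r \<Longrightarrow> left_wind j (y - t) = w \<and> left_wind j (y + t) = w - 1 \<and>
      left_wind i (x + t) = w \<and> left_wind i (x - t) = w - 1" by blast
  then show ?thesis using parity_minus_1[of w] by (intro exI[of _ r]) auto
qed

lemma left_wind_shift: "i < n \<Longrightarrow> left_wind i (x + 1) = left_wind i x"
proof -
  assume i: "i < n"
  have v: "velocity D (i, x + 1) = velocity D (i, x)"
    using velocity_same[OF _ same_point_shift[of i x 1]] i by simp
  have shift: "side_wind i (y + of_int k) u w" if sw: "side_wind i y u w" for y k u w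
  proof -
    obtain r where r: "r > 0" "\<And>x' u' b. \<bar>x' - y\<bar> < r \<Longrightarrow> norm (u' - u) < r \<Longrightarrow> 0 < b \<Longrightarrow> b < r \<Longrightarrow>
      curve D i x' + b *\<^sub>R u' \<notin> trace \<and> wind (curve D i x' + b *\<^sub>R u') = w"
      using sw unfolding side_wind_def by blast
    have "curve D i x' + b *\<^sub>R u' \<notin> trace \<and> wind (curve D i x' + b *\<^sub>R u') = w"
      if "\<bar>x' - (y + of_int k)\<bar> < r" "norm (u' - u) < r" "0 < b" "b < r" for x' u' b
      using r(2)[of "x' - of_int k" u' b] that curve_shift[OF i, of "x' - of_int k" k] by (simp add: algebra_simps)
    then show ?thesis unfolding side_wind_def using r(1) by blast
  qed
  have "side_wind i (x + 1) u w = side_wind i x u w" for u w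
    using shift[of x u w 1] shift[of "x + 1" u w "-1"] by auto
  then have "side_wind i (x + 1) = side_wind i x" by (intro ext)
  then show ?thesis unfolding left_wind_def v by simp
qed

text \<open>A value that also makes sense at a crossing, where no side has a single winding
  number.\<close>

definition wind_after :: "nat \<Rightarrow> real \<Rightarrow> complex" where
  "wind_after i x = (THE w. \<exists>r>0. \<forall>t. 0 < t \<longrightarrow> t < r \<longrightarrow> left_wind i (x + t) = w)"

lemma wind_after:
  assumes i: "i < n"
  shows "\<exists>r>0. \<forall>t. 0 < t \<longrightarrow> t < r \<longrightarrow> left_wind i (x + t) = wind_after i x"
proof -
  obtain r where r: "r > 0" "\<And>t. 0 < \<bar>t\<bar> \<Longrightarrow> \<bar>t\<bar> < r \<Longrightarrow> \<not> double_preimage D (i, x + t)"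
    using double_isolated[OF i, of x] by blast
  have const: "left_wind i (x + s) = left_wind i (x + t)" if "0 < s" "s \<le> t" "t < r" for s t
  proof (rule left_wind_gap[OF i])
    fix y assume "x + s \<le> y" "y \<le> x + t"
    then show "\<not> double_preimage D (i, y)" using r(2)[of "y - x"] that by simp
  qed (use that in simp)
  let ?w = "left_wind i (x + r / 2)"
  have "left_wind i (x + t) = ?w" if "0 < t" "t < r" for t
    using const[of t "r / 2"] const[of "r / 2" t] that r(1) by (cases "t \<le> r / 2") auto
  then have ex: "\<exists>r>0. \<forall>t. 0 < t \<longrightarrow> t < r \<longrightarrow> left_wind i (x + t) = ?w" using r(1) by blast
  moreover have "w = ?w" if w: "\<exists>r>0. \<forall>t. 0 < t \<longrightarrow> t < r \<longrightarrow> left_wind i (x + t) = w" for w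
  proof -
    obtain r1 where r1: "r1 > 0" "\<And>t. 0 < t \<Longrightarrow> t < r1 \<Longrightarrow> left_wind i (x + t) = w" using w by blast
    from ex obtain r2 where r2: "r2 > 0" "\<forall>t. 0 < t \<longrightarrow> t < r2 \<longrightarrow> left_wind i (x + t) = ?w"
      by (elim exE conjE)
    have m: "0 < min r1 r2 / 2" "min r1 r2 / 2 < r1" "min r1 r2 / 2 < r2" using r1(1) r2(1) by auto
    then have "left_wind i (x + min r1 r2 / 2) = ?w" using r2(2) by blast
    then show ?thesis using r1(2)[OF m(1,2)] by simp
  qed
  ultimately have "wind_after i x = ?w" unfolding wind_after_def by (rule the_equality)
  then show ?thesis using ex by simp
qed

text \<open>Colour the regions by the parity of the winding number. The colour on the left of a
  strand changes whenever the strand passes a crossing, and just after a crossing its two strands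
  have different colours on their left. In a classical diagram every double point carries a chord,
  so this is the source-sink condition.\<close>

lemma classical_coherent:
  assumes cl: "\<And>p. double_preimage D p \<Longrightarrow> label_at D p \<noteq> Virt"
  shows "\<exists>\<iota>. coherent n (real_pair D) \<iota>"
proof -
  let ?C = "real_pair D"
  have ch: "chorded ?C p \<longleftrightarrow> double_preimage D p" for p using real_preimage_iff cl by blast
  \<comment> \<open>On an outgoing germ this is the parity on the left, on an incoming germ its
    negation. At a crossing the parity has changed in passing, so the value just after it serves for
    both germs.\<close>
  define \<iota> where "\<iota> g = (if chorded ?C (fst g) then parity (wind_after (fst (fst g)) (snd (fst g)))
     else parity (left_wind (fst (fst g)) (snd (fst g))) = snd g)" for g :: germ
  \<comment> \<open>Both ends of a free segment are compared with an inner point \<open>m\<close>,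
    since the ends may be crossings.\<close>
  have mid: "\<iota> ((i, x), True) = parity (left_wind i m)" "\<iota> ((i, y), False) = (\<not> parity (left_wind i m))"
    if i: "i < n" and xy: "x < m" "m < y" and free: "\<And>z. x < z \<Longrightarrow> z < y \<Longrightarrow> \<not> chorded ?C (i, z)" for i x y m
  proof -
    have gap: "left_wind i s = left_wind i t" if "s \<le> t" "x < s \<or> x = s \<and> \<not> chorded ?C (i, x)"
      "t < y \<or> t = y \<and> \<not> chorded ?C (i, y)" for s t
    proof (rule left_wind_gap[OF i that(1)])
      fix z assume "s \<le> z" "z \<le> t"
      then have "z = x \<and> \<not> chorded ?C (i, x) \<or> z = y \<and> \<not> chorded ?C (i, y) \<or> x < z \<and> z < y"
        using that(2,3) by linarith
      then show "\<not> double_preimage D (i, z)" using free ch by blast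
    qed
    show "\<iota> ((i, x), True) = parity (left_wind i m)"
    proof (cases "chorded ?C (i, x)")
      case True
      obtain r where r: "r > 0" "\<And>t. 0 < t \<Longrightarrow> t < r \<Longrightarrow> left_wind i (x + t) = wind_after i x"
        using wind_after[OF i, of x] by blast
      define t where "t = min r (m - x) / 2"
      have t: "0 < t" "t < r" "t < m - x" unfolding t_def using r(1) xy by auto
      have "left_wind i (x + t) = left_wind i m" by (rule gap) (use t xy in auto)
      then show ?thesis unfolding \<iota>_def using True r(2)[OF t(1,2)] by simp
    next
      case False
      have "left_wind i x = left_wind i m" by (rule gap) (use False xy in auto)
      then show ?thesis unfolding \<iota>_def using False by simp
    qed
    show "\<iota> ((i, y), False) = (\<not> parity (left_wind i m))"
    proof (cases "chorded ?C (i, y)")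
      case True
      then obtain q where q: "double_pair D (i, y) q" using ch unfolding double_preimage_def by blast
      obtain r1 where r1: "r1 > 0" "\<And>t. 0 < t \<Longrightarrow> t < r1 \<Longrightarrow>
          parity (left_wind i (y - t)) \<noteq> parity (left_wind i (y + t))"
        using crossing_parity[of i y "fst q" "snd q"] q by auto
      obtain r where r: "r > 0" "\<And>t. 0 < t \<Longrightarrow> t < r \<Longrightarrow> left_wind i (y + t) = wind_after i y"
        using wind_after[OF i, of y] by blast
      define t where "t = Min {r, r1, y - m} / 2"
      have t: "0 < t" "t < r" "t < r1" "t < y - m" unfolding t_def using r(1) r1(1) xy by auto
      have "left_wind i m = left_wind i (y - t)" by (rule gap) (use t xy in auto)
      then show ?thesis unfolding \<iota>_def using True r(2)[OF t(1,2)] r1(2)[OF t(1,3)] by simp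
    next
      case False
      have "left_wind i m = left_wind i y" by (rule gap) (use False xy in auto)
      then show ?thesis unfolding \<iota>_def using False by simp
    qed
  qed
  have "coherent n ?C \<iota>"
    unfolding coherent_def
  proof (intro conjI allI impI)
    fix i x e assume i: "i < n"
    have "wind_after i (x + 1) = wind_after i x"
      unfolding wind_after_def using left_wind_shift[OF i, of "x + _"] by (simp add: algebra_simps)
    moreover have "chorded ?C (i, x + 1) = chorded ?C (i, x)"
      using C_ex_same[OF same_point_shift[of i x 1]] by simp
    ultimately show "\<iota> ((i, x + 1), e) = \<iota> ((i, x), e)"
      unfolding \<iota>_def using left_wind_shift[OF i, of x] by simp
  next
    fix i x y assume h: "i < n" "x < y" "\<forall>z. x < z \<and> z < y \<longrightarrow> \<not> chorded ?C (i, z)"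
    then have "x < (x + y) / 2" "(x + y) / 2 < y" by auto
    from mid[OF h(1) this] h(3) show "\<iota> ((i, x), True) \<noteq> \<iota> ((i, y), False)" by blast
  next
    fix p assume "\<not> chorded ?C p"
    then show "\<iota> (p, False) \<noteq> \<iota> (p, True)" unfolding \<iota>_def by auto
  next
    fix p q e e' assume C: "?C p q"
    obtain i x j y where pq: "p = (i, x)" "q = (j, y)" by force
    have ij: "i < n" "j < n" using C_dom[OF C] C_dom[OF C_sym[OF C]] pq by auto
    have chs: "chorded ?C p" "chorded ?C q" using C C_sym[OF C] chordedI[of ?C] by auto
    then show "\<iota> (p, False) = \<iota> (p, True)" unfolding \<iota>_def by simp
    obtain r1 where r1: "r1 > 0" "\<And>t. 0 < t \<Longrightarrow> t < r1 \<Longrightarrow>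
        parity (left_wind i (x + t)) \<noteq> parity (left_wind j (y + t))"
      using crossing_parity[of i x j y] real_pairD[OF C] pq by auto
    obtain r2 where r2: "r2 > 0" "\<And>t. 0 < t \<Longrightarrow> t < r2 \<Longrightarrow> left_wind i (x + t) = wind_after i x"
      using wind_after[OF ij(1), of x] by blast
    obtain r3 where r3: "r3 > 0" "\<And>t. 0 < t \<Longrightarrow> t < r3 \<Longrightarrow> left_wind j (y + t) = wind_after j y"
      using wind_after[OF ij(2), of y] by blast
    define t where "t = Min {r1, r2, r3} / 2"
    have t: "0 < t" "t < r1" "t < r2" "t < r3" unfolding t_def using r1(1) r2(1) r3(1) by auto
    show "\<iota> (p, e) \<noteq> \<iota> (q, e')"
      unfolding \<iota>_def using chs pq r1(2)[OF t(1,2)] r2(2)[OF t(1,3)] r3(2)[OF t(1,4)] by simp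
  qed
  then show ?thesis by blast
qed

end

section \<open>Replacing a tangle\<close>

text \<open>
  The germs \<open>G s\<close> belong to a tangle. Those with \<open>s \<in> In\<close> are met only by the relation \<open>S\<close> of the
  tangle, not by the relation \<open>B\<close> of the rest of the diagram.
\<close>

definition glue_rel :: "('v \<Rightarrow> 'v \<Rightarrow> bool) \<Rightarrow> ('s \<Rightarrow> 'v) \<Rightarrow> ('s \<Rightarrow> 's \<Rightarrow> bool) \<Rightarrow> 'v \<Rightarrow> 'v \<Rightarrow> bool" where
  "glue_rel B G S u v \<longleftrightarrow> B u v \<or> (\<exists>s t. S s t \<and> u = G s \<and> v = G t)"

locale tangle =
  fixes V :: "'v set" and B :: "'v \<Rightarrow> 'v \<Rightarrow> bool" and G :: "'s \<Rightarrow> 'v" and Nm In :: "'s set"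
  assumes fin: "finite V" and inj: "inj_on G Nm" and GV: "G ` Nm \<subseteq> V" and In: "In \<subseteq> Nm"
    and B: "B u v \<Longrightarrow> u \<notin> G ` In \<and> v \<notin> G ` In"
begin

lemma glue_S: "equivclp S s t \<Longrightarrow> equivclp (glue_rel B G S) (G s) (G t)"
  by (rule equivclp_map[where R = S]) (auto simp: glue_rel_def)

text \<open>If no component is closed inside the tangle, then only the connections between its ends
  matter to the rest of the diagram.\<close>

lemma ncls_glue_eq:
  assumes S: "\<And>s t. S s t \<Longrightarrow> s \<in> Nm \<and> t \<in> Nm" "\<And>s t. S' s t \<Longrightarrow> s \<in> Nm \<and> t \<in> Nm"
    and conn: "\<And>s. s \<in> In \<Longrightarrow> \<exists>e\<in>Nm - In. equivclp S s e" "\<And>s. s \<in> In \<Longrightarrow> \<exists>e\<in>Nm - In. equivclp S' s e"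
    and eq: "\<And>e e'. e \<in> Nm - In \<Longrightarrow> e' \<in> Nm - In \<Longrightarrow> equivclp S e e' \<longleftrightarrow> equivclp S' e e'"
  shows "ncls V (glue_rel B G S) = ncls V (glue_rel B G S')"
proof -
  \<comment> \<open>Moves an inner germ to an end of the tangle on the same component; ends stay
    where they are.\<close>
  define \<rho> where "\<rho> S s = (if s \<in> In then SOME e. e \<in> Nm - In \<and> equivclp S s e else s)" for S s
  define f where "f S v = (if v \<in> G ` In then G (\<rho> S (inv_into Nm G v)) else v)" for S v
  have fG: "f S (G s) = G (\<rho> S s)" if "s \<in> Nm" for S s
  proof (cases "s \<in> In")
    case False
    then have "G s \<notin> G ` In" using inj that In by (auto simp: inj_on_def)
    then show ?thesis using False unfolding f_def \<rho>_def by simp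
  qed (use inj that in \<open>simp add: f_def\<close>)
  have \<rho>: "\<rho> T s \<in> Nm - In \<and> equivclp T s (\<rho> T s)"
    if "s \<in> Nm" "\<And>s. s \<in> In \<Longrightarrow> \<exists>e\<in>Nm - In. equivclp T s e" for T s
  proof (cases "s \<in> In")
    case True
    then have "\<exists>e. e \<in> Nm - In \<and> equivclp T s e" using that(2) by blast
    from someI_ex[OF this] show ?thesis using True unfolding \<rho>_def by simp
  qed (use that(1) in \<open>simp add: \<rho>_def\<close>)
  note \<rho>0 = \<rho>[OF _ conn(1)] and \<rho>1 = \<rho>[OF _ conn(2)]
  have fV: "f T v \<in> V" if "v \<in> V" "\<And>s. s \<in> In \<Longrightarrow> \<exists>e\<in>Nm - In. equivclp T s e" for T v
  proof (cases "v \<in> G ` In")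
    case True
    then obtain s where s: "s \<in> In" "v = G s" by blast
    then show ?thesis using fG[of s T] \<rho>[of s T, OF _ that(2)] In GV by auto
  qed (use that(1) in \<open>simp add: f_def\<close>)
  have fB: "f T u = u" if "u \<notin> G ` In" for T u using that unfolding f_def by simp
  have gen: "equivclp (glue_rel B G T') (f T u) (f T v)"
    if R: "glue_rel B G T u v" and T: "\<And>s t. T s t \<Longrightarrow> s \<in> Nm \<and> t \<in> Nm"
      and c: "\<And>s. s \<in> In \<Longrightarrow> \<exists>e\<in>Nm - In. equivclp T s e"
      and e: "\<And>e e'. e \<in> Nm - In \<Longrightarrow> e' \<in> Nm - In \<Longrightarrow> equivclp T e e' \<Longrightarrow> equivclp T' e e'" for T T' u v
  proof -
    from R have "B u v \<or> (\<exists>s t. T s t \<and> u = G s \<and> v = G t)" unfolding glue_rel_def .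
    then show ?thesis
    proof
    assume "B u v"
    then show ?thesis using B[of u v] fB by (auto simp: glue_rel_def)
  next
    assume "\<exists>s t. T s t \<and> u = G s \<and> v = G t"
    then obtain s t where st: "T s t" "u = G s" "v = G t" by blast
    note s = \<rho>[of s T, OF _ c] and t = \<rho>[of t T, OF _ c]
    have "equivclp T (\<rho> T s) (\<rho> T t)"
      using s t T[OF st(1)] r_into_equivclp[of T, OF st(1)] by (meson equivclp_sym equivclp_trans)
    then have "equivclp T' (\<rho> T s) (\<rho> T t)" using e s t T[OF st(1)] by blast
    then show ?thesis using glue_S fG T[OF st(1)] st by metis
    qed
  qed
  have same: "equivclp (glue_rel B G T) (f T' (f T v)) v"
    if c: "\<And>s. s \<in> In \<Longrightarrow> \<exists>e\<in>Nm - In. equivclp T s e" for T T' v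
  proof (cases "v \<in> G ` In")
    case True
    then obtain s where s: "s \<in> In" "v = G s" by blast
    then have sN: "s \<in> Nm" using In by blast
    have r: "\<rho> T s \<in> Nm - In" "equivclp T s (\<rho> T s)" using \<rho>[OF sN c] by blast+
    then have "f T' (f T v) = G (\<rho> T s)" using fG[OF sN] fG[of "\<rho> T s" T'] s unfolding \<rho>_def[of T' "\<rho> T s"] by auto
    then show ?thesis using glue_S[OF r(2)] s equivclp_sym by metis
  qed (simp add: fB)
  have same': "equivclp (glue_rel B G T) (f T' (f T v)) v"
    if c: "\<And>s. s \<in> In \<Longrightarrow> \<exists>e\<in>Nm - In. equivclp T s e" for T T' v by (rule same[OF c])
  show ?thesis
    by (rule ncls_transfer[where f = "f S" and g = "f S'"])
       (use fV[OF _ conn(1)] fV[OF _ conn(2)] gen[OF _ S(1) conn(1), of _ _ S'] gen[OF _ S(2) conn(2), of _ _ S]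
          eq same[OF conn(1)] same[OF conn(2)] in blast)+
qed

text \<open>The closed component is a class of its own in the whole diagram. Joining it to an
  arbitrary end \<open>d\<close> costs exactly this class and leads back to
  \<open>ncls_glue_eq\<close>.\<close>

lemma ncls_glue_loop:
  assumes S: "\<And>s t. S s t \<Longrightarrow> s \<in> Nm \<and> t \<in> Nm" "\<And>s t. S' s t \<Longrightarrow> s \<in> Nm \<and> t \<in> Nm"
    and l: "l \<in> In" "\<And>e. e \<in> Nm - In \<Longrightarrow> \<not> equivclp S' l e" and d: "d \<in> Nm - In"
    and conn: "\<And>s. s \<in> In \<Longrightarrow> \<exists>e\<in>Nm - In. equivclp S s e"
      "\<And>s. s \<in> In \<Longrightarrow> equivclp S' s l \<or> (\<exists>e\<in>Nm - In. equivclp S' s e)"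
    and eq: "\<And>e e'. e \<in> Nm - In \<Longrightarrow> e' \<in> Nm - In \<Longrightarrow> equivclp S e e' \<longleftrightarrow> equivclp S' e e'"
  shows "ncls V (glue_rel B G S') = Suc (ncls V (glue_rel B G S))"
proof -
  let ?S = "add_pair S' l d"
  have glue: "add_pair (glue_rel B G S') (G l) (G d) = glue_rel B G ?S"
    unfolding add_pair_def glue_rel_def by (intro ext) blast
  \<comment> \<open>\<open>B\<close> does not meet inner germs, so the class of \<open>G l\<close>
    cannot leave the tangle.\<close>
  have closed: "v \<in> G ` {s \<in> Nm. equivclp S' l s}" if "equivclp (glue_rel B G S') (G l) v" for v
    using that
  proof (induction rule: equivclp_induct)
    case base
    then show ?case using l(1) In by auto
  next
    case (step y z)
    then obtain s where s: "s \<in> Nm" "equivclp S' l s" "y = G s" by blast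
    have sIn: "s \<in> In" using l(2) s by blast
    have "\<not> B y z" "\<not> B z y" using B[of y z] B[of z y] sIn s(3) by blast+
    then obtain s' t where st: "S' s' t" "y = G s' \<and> z = G t \<or> y = G t \<and> z = G s'"
      using step(2) unfolding glue_rel_def by blast
    have st': "s' \<in> Nm" "t \<in> Nm" using S(2)[OF st(1)] by auto
    have "equivclp S' s' t" using st(1) by blast
    then show ?case using st(2) s st' inj_onD[OF inj, of s s'] inj_onD[OF inj, of s t]
      by (auto intro: equivclp_trans equivclp_sym)
  qed
  have "\<not> equivclp (glue_rel B G S') (G l) (G d)"
  proof
    assume "equivclp (glue_rel B G S') (G l) (G d)"
    from closed[OF this] obtain s where "s \<in> Nm" "equivclp S' l s" "G d = G s" by blast
    then show False using l(2)[OF d] inj_onD[OF inj, of d s] d by auto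
  qed
  then have "ncls V (glue_rel B G S') = Suc (ncls V (glue_rel B G ?S))"
    unfolding glue[symmetric]
    by (intro ncls_add_pair) (use fin GV In l(1) d in \<open>auto simp: fin_cls_def\<close>)
  moreover have "ncls V (glue_rel B G ?S) = ncls V (glue_rel B G S)"
  proof (rule ncls_glue_eq)
    show "\<exists>e\<in>Nm - In. equivclp ?S s e" if "s \<in> In" for s
      using conn(2)[OF that] d unfolding equivclp_add_pair by (metis equivclp_refl)
    show "equivclp ?S e e' \<longleftrightarrow> equivclp S e e'" if "e \<in> Nm - In" "e' \<in> Nm - In" for e e'
      using eq[OF that] l(2)[OF that(1)] l(2)[OF that(2)] unfolding equivclp_add_pair by (metis equivclp_sym)
    show "?S s t \<Longrightarrow> s \<in> Nm \<and> t \<in> Nm" for s t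
      using S(2) l(1) In d unfolding add_pair_def by blast
  qed (use S conn in blast)+
  ultimately show ?thesis by simp
qed

end

section \<open>Deciding the connectivity of coded tangles\<close>

text \<open>In the list \<open>r\<close> the entry \<open>r ! s\<close> names the current class of \<open>s\<close>, as in union-find.\<close>

fun merge :: "(nat \<times> nat) list \<Rightarrow> nat list \<Rightarrow> nat list" where
  "merge [] r = r"
| "merge ((s, t) # ps) r = merge ps (map (\<lambda>x. if x = r ! s then r ! t else x) r)"

definition pairs_rel :: "(nat \<times> nat) list \<Rightarrow> nat \<Rightarrow> nat \<Rightarrow> bool" where
  "pairs_rel ps s t \<longleftrightarrow> (s, t) \<in> set ps"

text \<open>The starting list \<open>r\<close> is itself treated as a partition; with this
  generality each recursive call is an instance of the claim.\<close>

lemma merge_iff: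
  assumes "\<forall>(s, t)\<in>set ps. s < length r \<and> t < length r" "x < length r" "y < length r"
  shows "merge ps r ! x = merge ps r ! y \<longleftrightarrow>
    equivclp (\<lambda>u v. u < length r \<and> v < length r \<and> r ! u = r ! v \<or> (u, v) \<in> set ps) x y"
  using assms
proof (induction ps r rule: merge.induct)
  case (1 r)
  have "equivclp (\<lambda>u v. u < length r \<and> v < length r \<and> r ! u = r ! v) x y \<Longrightarrow> x = y \<or> r ! x = r ! y"
    by (induction rule: equivclp_induct) auto
  then show ?case using 1 by auto
next
  case (2 s t ps r)
  define r' where "r' = map (\<lambda>x. if x = r ! s then r ! t else x) r"
  have len: "length r' = length r" unfolding r'_def by simp
  have st: "s < length r" "t < length r" using 2(2) by auto
  have r': "r' ! u = (if r ! u = r ! s then r ! t else r ! u)" if "u < length r" for u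
    using that unfolding r'_def by simp
  let ?R = "\<lambda>u v. u < length r \<and> v < length r \<and> r ! u = r ! v \<or> (u, v) \<in> set ((s, t) # ps)"
  let ?R' = "\<lambda>u v. u < length r' \<and> v < length r' \<and> r' ! u = r' ! v \<or> (u, v) \<in> set ps"
  have "merge ps r' ! x = merge ps r' ! y \<longleftrightarrow> equivclp ?R' x y"
    using 2(1)[folded r'_def, of] 2(2-4) len by auto
  moreover have "equivclp ?R' = equivclp ?R"
  proof (rule equivclp_cong)
    fix u v assume "?R' u v"
    then show "equivclp ?R u v"
    proof
      assume h: "u < length r' \<and> v < length r' \<and> r' ! u = r' ! v"
      have a: "equivclp ?R x y" if "x < length r" "y < length r" "r ! x = r ! y" for x y using that by blast
      have b: "equivclp ?R s t" by (rule r_into_equivclp) simp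
      have c: "equivclp ?R x t" if "x < length r" "r ! x = r ! s" for x
        using a[OF that(1) st(1) that(2)] b by (rule equivclp_trans)
      have u: "u < length r" "v < length r" "r' ! u = r' ! v" using h len by auto
      consider "r ! u = r ! s" "r ! v = r ! s" | "r ! u = r ! s" "r ! v = r ! t" | "r ! u = r ! t" "r ! v = r ! s" | "r ! u = r ! v"
        using u(3) unfolding r'[OF u(1)] r'[OF u(2)] by (auto split: if_splits)
      then show ?thesis
      proof cases
        case 1
        show ?thesis by (rule a[OF u(1,2)]) (simp add: 1)
      next
        case 2
        show ?thesis by (rule equivclp_trans[OF c[OF u(1) 2(1)] a[OF st(2) u(2) 2(2)[symmetric]]])
      next
        case 3
        show ?thesis by (rule equivclp_trans[OF a[OF u(1) st(2) 3(1)] equivclp_sym[OF c[OF u(2) 3(2)]]])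
      next
        case 4
        show ?thesis by (rule a[OF u(1,2) 4])
      qed
    next
      assume "(u, v) \<in> set ps"
      then have "?R u v" by simp
      then show ?thesis by (rule r_into_equivclp)
    qed
  next
    fix u v assume R: "?R u v"
    have "?R' u v"
    proof (cases "(u, v) = (s, t)")
      case True
      then show ?thesis using st r' len by simp
    next
      case False
      then show ?thesis using R r' len by auto
    qed
    then show "equivclp ?R' u v" by (rule r_into_equivclp)
  qed
  ultimately show ?case unfolding r'_def by simp
qed

lemma pairs_rel_iff:
  assumes "\<forall>(s, t)\<in>set ps. s < M \<and> t < M" "x < M" "y < M"
  shows "equivclp (pairs_rel ps) x y \<longleftrightarrow> merge ps [0..<M] ! x = merge ps [0..<M] ! y"
proof -
  have "equivclp (pairs_rel ps) = equivclp (\<lambda>u v. u < M \<and> v < M \<and> [0..<M] ! u = [0..<M] ! v \<or> (u, v) \<in> set ps)"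
    by (rule equivclp_cong) (auto simp: pairs_rel_def)
  then show ?thesis using merge_iff[of ps "[0..<M]" x y] assms by simp
qed

text \<open>\<open>M\<close> is the number of germs and \<open>E\<close> lists the ends. The tests
  are bounded quantifiers over computed lists, so that concrete tangles can be decided by
  evaluation.\<close>

definition same_ends :: "nat \<Rightarrow> nat list \<Rightarrow> (nat \<times> nat) list \<Rightarrow> (nat \<times> nat) list \<Rightarrow> bool" where
  "same_ends M E ps qs \<longleftrightarrow> (let r = merge ps [0..<M]; r' = merge qs [0..<M] in
     \<forall>e\<in>set E. \<forall>e'\<in>set E. (r ! e = r ! e') = (r' ! e = r' ! e'))"

definition no_loop :: "nat \<Rightarrow> nat list \<Rightarrow> (nat \<times> nat) list \<Rightarrow> bool" where
  "no_loop M E ps \<longleftrightarrow> (let r = merge ps [0..<M] in \<forall>s\<in>set [0..<M]. \<exists>e\<in>set E. r ! s = r ! e)"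

definition one_loop :: "nat \<Rightarrow> nat list \<Rightarrow> (nat \<times> nat) list \<Rightarrow> bool" where
  "one_loop M E ps \<longleftrightarrow> (let r = merge ps [0..<M] in
     \<exists>l\<in>set [0..<M]. (\<forall>e\<in>set E. r ! l \<noteq> r ! e) \<and> (\<forall>s\<in>set [0..<M]. r ! s = r ! l \<or> (\<exists>e\<in>set E. r ! s = r ! e)))"

definition in_range :: "nat \<Rightarrow> (nat \<times> nat) list \<Rightarrow> bool" where
  "in_range M ps \<longleftrightarrow> (\<forall>(s, t)\<in>set ps. s < M \<and> t < M)"

lemma ncls_glue_decide:
  fixes M :: nat and G :: "nat \<Rightarrow> 'v"
  assumes tg: "tangle V B G {..<M} ({..<M} - set E)" and sub: "set E \<subseteq> {..<M}" and ne: "set E \<noteq> {}"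
    and rng: "in_range M ps" "in_range M qs" and ends: "same_ends M E ps qs" and ps: "no_loop M E ps"
  shows "no_loop M E qs \<Longrightarrow> ncls V (glue_rel B G (pairs_rel qs)) = ncls V (glue_rel B G (pairs_rel ps))"
    and "one_loop M E qs \<Longrightarrow> ncls V (glue_rel B G (pairs_rel qs)) = Suc (ncls V (glue_rel B G (pairs_rel ps)))"
proof -
  let ?In = "{..<M} - set E"
  interpret tangle V B G "{..<M}" ?In by (rule tg)
  have E: "{..<M} - ?In = set E" using sub by blast
  have S: "pairs_rel rs s t \<Longrightarrow> s \<in> {..<M} \<and> t \<in> {..<M}" if "in_range M rs" for rs s t
    using that unfolding in_range_def pairs_rel_def by auto
  note iff = pairs_rel_iff[OF rng(1)[unfolded in_range_def]] pairs_rel_iff[OF rng(2)[unfolded in_range_def]]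
  have EM: "e < M" if "e \<in> set E" for e using that sub by auto
  have IM: "s < M" if "s \<in> ?In" for s using that by auto
  have eq: "equivclp (pairs_rel ps) e e' \<longleftrightarrow> equivclp (pairs_rel qs) e e'" if "e \<in> {..<M} - ?In" "e' \<in> {..<M} - ?In" for e e'
    using that ends iff[of e e'] EM unfolding E same_ends_def Let_def by auto
  have conn: "\<exists>e\<in>{..<M} - ?In. equivclp (pairs_rel ps) s e" if "s \<in> ?In" for s
    using ps IM[OF that] iff(1)[OF IM[OF that] EM] unfolding no_loop_def E Let_def by fastforce
  show "ncls V (glue_rel B G (pairs_rel qs)) = ncls V (glue_rel B G (pairs_rel ps))" if nl: "no_loop M E qs"
  proof (rule ncls_glue_eq[symmetric])
    show "\<exists>e\<in>{..<M} - ?In. equivclp (pairs_rel qs) s e" if "s \<in> ?In" for s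
      using nl IM[OF that] iff(2)[OF IM[OF that] EM] unfolding no_loop_def E Let_def by fastforce
  qed (use S rng conn eq in blast)+
  show "ncls V (glue_rel B G (pairs_rel qs)) = Suc (ncls V (glue_rel B G (pairs_rel ps)))" if ol: "one_loop M E qs"
  proof -
    let ?r = "merge qs [0..<M]"
    obtain l where l: "l < M" "\<And>e. e \<in> set E \<Longrightarrow> ?r ! l \<noteq> ?r ! e"
      "\<And>s. s < M \<Longrightarrow> ?r ! s = ?r ! l \<or> (\<exists>e\<in>set E. ?r ! s = ?r ! e)"
      using ol unfolding one_loop_def Let_def by auto
    obtain d where d: "d \<in> set E" using ne by (cases E) auto
    show ?thesis
    proof (rule ncls_glue_loop[where l = l and d = d])
      show "l \<in> ?In" using l(1,2) E by blast
      show "\<not> equivclp (pairs_rel qs) l e" if "e \<in> {..<M} - ?In" for e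
        using that l(2) iff(2)[OF l(1) EM] unfolding E by blast
      show "equivclp (pairs_rel qs) s l \<or> (\<exists>e\<in>{..<M} - ?In. equivclp (pairs_rel qs) s e)" if "s \<in> ?In" for s
        using l(3)[OF IM[OF that]] iff(2)[OF IM[OF that] l(1)] iff(2)[OF IM[OF that] EM] unfolding E by blast
    qed (use S rng conn eq d E in blast)+
  qed
qed

text \<open>Described relative to the directions of the model arcs: \<open>Par\<close> respects both
  directions and \<open>Anti\<close> does not. The orientation of the link may run against the
  model, so these are not yet the oriented and unoriented smoothings. \<open>Thru\<close> is the
  virtual passage.\<close>

datatype smoothing = Par | Anti | Thru

fun chord_pairs :: "smoothing \<Rightarrow> nat \<Rightarrow> nat \<Rightarrow> (nat \<times> nat) list" where
  "chord_pairs Par p q = [(2 * p, 2 * q + 1), (2 * p + 1, 2 * q)]"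
| "chord_pairs Anti p q = [(2 * p, 2 * q), (2 * p + 1, 2 * q + 1)]"
| "chord_pairs Thru p q = [(2 * p, 2 * p + 1), (2 * q, 2 * q + 1)]"

text \<open>
  The position \<open>K * m + j\<close> is the \<open>j\<close>-th of the \<open>K\<close> marked positions of the \<open>m\<close>-th of the \<open>k\<close> arcs;
  the germs \<open>2 * p\<close> and \<open>2 * p + 1\<close> come before and after the position \<open>p\<close>.
\<close>

definition strand_pairs :: "nat \<Rightarrow> nat \<Rightarrow> (nat \<times> nat) list" where
  "strand_pairs k K = concat (map (\<lambda>m. map (\<lambda>j. (2 * (K * m + j) + 1, 2 * (K * m + j) + 2)) [0..<K - 1]) [0..<k])"

definition tangle_ends :: "nat \<Rightarrow> nat \<Rightarrow> nat list" where
  "tangle_ends k K = concat (map (\<lambda>m. [2 * (K * m), 2 * (K * m + (K - 1)) + 1]) [0..<k])"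

definition tangle_pairs :: "nat \<Rightarrow> nat \<Rightarrow> (nat \<times> nat \<times> smoothing) list \<Rightarrow> nat list \<Rightarrow> (nat \<times> nat) list" where
  "tangle_pairs k K chs rest = strand_pairs k K @ concat (map (\<lambda>(p, q, x). chord_pairs x p q) chs)
     @ map (\<lambda>p. (2 * p, 2 * p + 1)) rest"

text \<open>Each of the three arcs has three positions. Arcs 0 and 1 cross in their middle positions
  1 and 4; the curved arc 2 meets arc 0 at the last positions 2 and 8 and arc 1 at the first
  positions 3 and 6. Below, after the move, first and last are exchanged. Equal numbers of positions
  keep the codes of the ends the same.\<close>

definition R3_before :: "smoothing \<Rightarrow> smoothing \<Rightarrow> smoothing \<Rightarrow> (nat \<times> nat) list" where
  "R3_before x01 x02 x12 = tangle_pairs 3 3 [(1, 4, x01), (2, 8, x02), (3, 6, x12)] [0, 5, 7]"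

definition R3_after :: "smoothing \<Rightarrow> smoothing \<Rightarrow> smoothing \<Rightarrow> (nat \<times> nat) list" where
  "R3_after x01 x02 x12 = tangle_pairs 3 3 [(1, 4, x01), (0, 6, x02), (5, 8, x12)] [2, 3, 7]"

definition R2_after :: "smoothing \<Rightarrow> smoothing \<Rightarrow> (nat \<times> nat) list" where
  "R2_after x y = tangle_pairs 2 2 [(0, 2, x), (1, 3, y)] []"

definition R1_after :: "smoothing \<Rightarrow> (nat \<times> nat) list" where
  "R1_after x = tangle_pairs 1 2 [(0, 1, x)] []"

definition tangle_eq :: "nat \<Rightarrow> nat list \<Rightarrow> (nat \<times> nat) list \<Rightarrow> (nat \<times> nat) list \<Rightarrow> bool" where
  "tangle_eq M E ps qs \<longleftrightarrow> set E \<subseteq> {..<M} \<and> set E \<noteq> {} \<and> in_range M ps \<and> in_range M qs \<and>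
     same_ends M E ps qs \<and> no_loop M E ps \<and> no_loop M E qs"

definition tangle_loop :: "nat \<Rightarrow> nat list \<Rightarrow> (nat \<times> nat) list \<Rightarrow> (nat \<times> nat) list \<Rightarrow> bool" where
  "tangle_loop M E ps qs \<longleftrightarrow> set E \<subseteq> {..<M} \<and> set E \<noteq> {} \<and> in_range M ps \<and> in_range M qs \<and>
     same_ends M E ps qs \<and> no_loop M E ps \<and> one_loop M E qs"

locale coded_tangle =
  fixes V :: "'v set" and B :: "'v \<Rightarrow> 'v \<Rightarrow> bool" and G :: "nat \<Rightarrow> 'v" and k K :: nat
  assumes coded: "tangle V B G {..<2 * k * K} ({..<2 * k * K} - set (tangle_ends k K))"
begin

definition count :: "(nat \<times> nat) list \<Rightarrow> nat" where
  "count ps = ncls V (glue_rel B G (pairs_rel ps))"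

lemma count_eq: "tangle_eq (2 * k * K) (tangle_ends k K) ps qs \<Longrightarrow> count qs = count ps"
  unfolding count_def tangle_eq_def using ncls_glue_decide(1)[OF coded] by blast

lemma count_loop: "tangle_loop (2 * k * K) (tangle_ends k K) ps qs \<Longrightarrow> count qs = Suc (count ps)"
  unfolding count_def tangle_loop_def using ncls_glue_decide(2)[OF coded] by blast

end

definition R1_before :: "(nat \<times> nat) list" where
  "R1_before = tangle_pairs 1 2 [] [0, 1]"

definition R2_before :: "(nat \<times> nat) list" where
  "R2_before = tangle_pairs 2 2 [] [0, 1, 2, 3]"

text \<open>\<open>Par\<close> cuts the kink off as a separate circle; the other two leave an
  arc.\<close>

lemma R1_tangles:
  "tangle_eq 4 (tangle_ends 1 2) R1_before (R1_after Thru)"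
  "tangle_eq 4 (tangle_ends 1 2) R1_before (R1_after Anti)"
  "tangle_loop 4 (tangle_ends 1 2) R1_before (R1_after Par)"
  by code_simp+

text \<open>\<open>Anti Anti\<close> closes up the bigon. \<open>Par Anti\<close> and
  \<open>Anti Par\<close> have the same ends connected as it has, and these three states must cancel
  in the bracket.\<close>

lemma R2_tangles:
  "tangle_eq 8 (tangle_ends 2 2) R2_before (R2_after Thru Thru)"
  "tangle_eq 8 (tangle_ends 2 2) R2_before (R2_after Par Par)"
  "tangle_eq 8 (tangle_ends 2 2) (R2_after Par Anti) (R2_after Anti Par)"
  "tangle_loop 8 (tangle_ends 2 2) (R2_after Par Anti) (R2_after Anti Anti)"
  by code_simp+

text \<open>Of the eight states on each side, \<open>Par Par Par\<close>,
  \<open>Anti Par Anti\<close> and \<open>Anti Anti Par\<close> are the same before and after. Four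
  more realize one pattern, \<open>Par Anti Anti\<close> with an extra circle; the last one,
  \<open>Anti Par Par\<close>, realizes the corresponding pattern of the other side. The remaining
  facts treat triangles with virtual crossings.\<close>

lemma R3_tangles:
  "tangle_eq 18 (tangle_ends 3 3) (R3_before Par Par Anti) (R3_before Par Anti Par)"
  "tangle_eq 18 (tangle_ends 3 3) (R3_before Par Par Anti) (R3_before Anti Anti Anti)"
  "tangle_eq 18 (tangle_ends 3 3) (R3_before Par Par Anti) (R3_after Anti Par Par)"
  "tangle_loop 18 (tangle_ends 3 3) (R3_before Par Par Anti) (R3_before Par Anti Anti)"
  "tangle_eq 18 (tangle_ends 3 3) (R3_after Par Par Anti) (R3_after Par Anti Par)"
  "tangle_eq 18 (tangle_ends 3 3) (R3_after Par Par Anti) (R3_after Anti Anti Anti)"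
  "tangle_eq 18 (tangle_ends 3 3) (R3_after Par Par Anti) (R3_before Anti Par Par)"
  "tangle_loop 18 (tangle_ends 3 3) (R3_after Par Par Anti) (R3_after Par Anti Anti)"
  "tangle_eq 18 (tangle_ends 3 3) (R3_before Par Par Par) (R3_after Par Par Par)"
  "tangle_eq 18 (tangle_ends 3 3) (R3_before Anti Par Anti) (R3_after Anti Par Anti)"
  "tangle_eq 18 (tangle_ends 3 3) (R3_before Anti Anti Par) (R3_after Anti Anti Par)"
  "tangle_eq 18 (tangle_ends 3 3) (R3_before Thru Thru Thru) (R3_after Thru Thru Thru)"
  "tangle_eq 18 (tangle_ends 3 3) (R3_before Par Thru Thru) (R3_after Par Thru Thru)"
  "tangle_eq 18 (tangle_ends 3 3) (R3_before Anti Thru Thru) (R3_after Anti Thru Thru)"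
  "tangle_eq 18 (tangle_ends 3 3) (R3_before Thru Par Thru) (R3_after Thru Par Thru)"
  "tangle_eq 18 (tangle_ends 3 3) (R3_before Thru Anti Thru) (R3_after Thru Anti Thru)"
  "tangle_eq 18 (tangle_ends 3 3) (R3_before Thru Thru Par) (R3_after Thru Thru Par)"
  "tangle_eq 18 (tangle_ends 3 3) (R3_before Thru Thru Anti) (R3_after Thru Thru Anti)"
  by code_simp+

section \<open>Reidemeister moves on state sums\<close>

lemma state_sum_empty: "state_sum {} pos L A = (- (A\<^sup>2) - 1 / A\<^sup>2) ^ L {}"
  by (simp add: state_sum_def)

text \<open>The skein relation at \<open>z\<close>. The flag \<open>i\<close> chooses which
  smoothing is written first; in the moves it tells whether \<open>Par\<close> is the smoothing
  along the orientation.\<close>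

lemma state_sum_insert:
  assumes "finite X" "z \<notin> X"
  shows "state_sum (insert z X) pos L A =
    (if pos z = i then A else 1 / A) * state_sum X pos (\<lambda>S. L (if i then insert z S else S)) A +
    (if pos z = i then 1 / A else A) * state_sum X pos (\<lambda>S. L (if i then S else insert z S)) A"
proof -
  let ?d = "- (A\<^sup>2) - 1 / A\<^sup>2"
  let ?w = "\<lambda>S y. if (y \<in> S) = pos y then A else 1 / A"
  have dj: "Pow X \<inter> insert z ` Pow X = {}" using assms(2) by auto
  have inj: "inj_on (insert z) (Pow X)" using assms(2) by (auto simp: inj_on_def)
  have w: "(\<Prod>y\<in>X. ?w (insert z S) y) = (\<Prod>y\<in>X. ?w S y)" for S
    using assms(2) by (intro prod.cong) auto
  have "state_sum (insert z X) pos L A =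
      (\<Sum>S\<in>Pow X. (\<Prod>y\<in>insert z X. ?w S y) * ?d ^ L S) +
      (\<Sum>S\<in>insert z ` Pow X. (\<Prod>y\<in>insert z X. ?w S y) * ?d ^ L S)"
    unfolding state_sum_def Pow_insert by (rule sum.union_disjoint) (use assms(1) dj in auto)
  also have "(\<Sum>S\<in>insert z ` Pow X. (\<Prod>y\<in>insert z X. ?w S y) * ?d ^ L S) =
      (\<Sum>S\<in>Pow X. (\<Prod>y\<in>insert z X. ?w (insert z S) y) * ?d ^ L (insert z S))"
    by (subst sum.reindex[OF inj]) (simp add: o_def)
  also have "\<dots> = (if pos z then A else 1 / A) * state_sum X pos (\<lambda>S. L (insert z S)) A"
    unfolding state_sum_def sum_distrib_left
  proof (intro sum.cong refl)
    fix S
    have "(\<Prod>y\<in>insert z X. ?w (insert z S) y) = (if pos z then A else 1 / A) * (\<Prod>y\<in>X. ?w S y)"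
      unfolding prod.insert[OF assms] w by simp
    then show "(\<Prod>y\<in>insert z X. ?w (insert z S) y) * ?d ^ L (insert z S) =
        (if pos z then A else 1 / A) * ((\<Prod>y\<in>X. ?w S y) * ?d ^ L (insert z S))"
      by (simp only: mult.assoc)
  qed
  also have "(\<Sum>S\<in>Pow X. (\<Prod>y\<in>insert z X. ?w S y) * ?d ^ L S) = (if pos z then 1 / A else A) * state_sum X pos L A"
    unfolding state_sum_def sum_distrib_left
  proof (intro sum.cong refl)
    fix S assume "S \<in> Pow X"
    then have "z \<notin> S" using assms(2) by auto
    then show "(\<Prod>y\<in>insert z X. ?w S y) * ?d ^ L S = (if pos z then 1 / A else A) * ((\<Prod>y\<in>X. ?w S y) * ?d ^ L S)"
      using assms by simp
  qed
  finally show ?thesis by (cases i; cases "pos z") (simp_all add: add.commute)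
qed

text \<open>Expanding at the outer crossings one by one reduces a local move to the sums over the
  crossings inside the disc, for every fixed outer state \<open>S\<close>.\<close>

lemma state_sum_replace:
  assumes fin: "finite Xo" "finite X" "finite X'" and disj: "Xo \<inter> X = {}" "Xo \<inter> X' = {}"
    and pos: "\<And>z. z \<in> Xo \<Longrightarrow> pos z = pos' z"
    and eq: "\<And>S. S \<subseteq> Xo \<Longrightarrow> c * state_sum X pos (\<lambda>T. L (S \<union> T)) A = c' * state_sum X' pos' (\<lambda>T. L' (S \<union> T)) A"
  shows "c * state_sum (Xo \<union> X) pos L A = c' * state_sum (Xo \<union> X') pos' L' A"
  using fin(1) disj pos eq
proof (induction Xo arbitrary: L L' rule: finite_induct)
  case empty
  then show ?case using empty(4)[of "{}"] by simp
next
  case (insert z Xo)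
  have z: "z \<notin> Xo \<union> X" "z \<notin> Xo \<union> X'" using insert by auto
  have f: "finite (Xo \<union> X)" "finite (Xo \<union> X')" using insert(1) fin by auto
  have 1: "c * state_sum (Xo \<union> X) pos L A = c' * state_sum (Xo \<union> X') pos' L' A"
  proof (rule insert.IH)
    fix S assume "S \<subseteq> Xo"
    then show "c * state_sum X pos (\<lambda>T. L (S \<union> T)) A = c' * state_sum X' pos' (\<lambda>T. L' (S \<union> T)) A"
      by (intro insert.prems(4)) auto
  qed (use insert.prems in auto)
  have 2: "c * state_sum (Xo \<union> X) pos (\<lambda>S. L (insert z S)) A = c' * state_sum (Xo \<union> X') pos' (\<lambda>S. L' (insert z S)) A"
  proof (rule insert.IH)
    fix S assume "S \<subseteq> Xo"
    then show "c * state_sum X pos (\<lambda>T. L (insert z (S \<union> T))) A = c' * state_sum X' pos' (\<lambda>T. L' (insert z (S \<union> T))) A"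
      using insert.prems(4)[of "insert z S"] by auto
  qed (use insert.prems in auto)
  have p: "pos z = pos' z" using insert.prems by auto
  show ?case
    unfolding Un_insert_left state_sum_insert[OF f(1) z(1), of pos L A True] state_sum_insert[OF f(2) z(2), of pos' L' A True] p
    using 1 2 by (simp add: distrib_left mult.left_commute[of c] mult.left_commute[of c'])
qed

text \<open>With d the value of a circle, A d + 1/A is -A^3, and its mirror image is -1/A^3. The
  latter factor is moved to the left to avoid inverses.\<close>

lemma R1_sum:
  assumes A: "A \<noteq> 0" and L: "L {z} = (if i then Suc N else N)" "L {} = (if i then N else Suc N)"
  shows "(if pos z = i then 1 else (- (A ^ 3))) * state_sum {z} pos L A =
    (if pos z = i then (- (A ^ 3)) else 1) * (- (A\<^sup>2) - 1 / A\<^sup>2) ^ N"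
proof -
  let ?d = "- (A\<^sup>2) - 1 / A\<^sup>2"
  have "state_sum {z} pos L A = (if pos z = i then A else 1 / A) * ?d ^ Suc N + (if pos z = i then 1 / A else A) * ?d ^ N"
    using state_sum_insert[of "{}" z pos L A i] L by (simp add: state_sum_empty)
  also have "\<dots> = ((if pos z = i then A else 1 / A) * ?d + (if pos z = i then 1 / A else A)) * ?d ^ N"
    by (simp add: distrib_right)
  also have "(if pos z = i then A else 1 / A) * ?d + (if pos z = i then 1 / A else A) = (if pos z = i then - (A ^ 3) else - 1 / A ^ 3)"
    using A by (simp add: field_simps power2_eq_square power3_eq_cube)
  finally show ?thesis using A by simp
qed

text \<open>\<open>F\<close> is indexed by whether each crossing gets \<open>Par\<close>. Opposite
  types give \<open>Par Par\<close> the weight A * 1/A = 1, and the other three states combine to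
  the factor A^2 + 1/A^2 + d, which vanishes.\<close>

lemma R2_sum:
  assumes A: "A \<noteq> 0" and z: "z \<noteq> w" and pos: "(pos z = i) \<noteq> (pos w = j)"
    and L: "\<And>S. S \<subseteq> {z, w} \<Longrightarrow> L S = F ((z \<in> S) = i) ((w \<in> S) = j)"
    and F: "F True False = M" "F False True = M" "F False False = Suc M"
  shows "state_sum {z, w} pos L A = (- (A\<^sup>2) - 1 / A\<^sup>2) ^ F True True"
proof -
  let ?d = "- (A\<^sup>2) - 1 / A\<^sup>2"
  have 0: "state_sum {z, w} pos L A =
      (if pos z = i then A else 1 / A) * state_sum {w} pos (\<lambda>S. L (if i then insert z S else S)) A +
      (if pos z = i then 1 / A else A) * state_sum {w} pos (\<lambda>S. L (if i then S else insert z S)) A"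
    by (rule state_sum_insert) (use z in auto)
  have 1: "state_sum {w} pos L A =
      (if pos w = j then A else 1 / A) * state_sum {} pos (\<lambda>S. L (if j then insert w S else S)) A +
      (if pos w = j then 1 / A else A) * state_sum {} pos (\<lambda>S. L (if j then S else insert w S)) A" for L
    by (rule state_sum_insert) auto
  have "state_sum {z, w} pos L A =
     (if pos z = i then A else 1 / A) * ((if pos w = j then A else 1 / A) * ?d ^ F True True + (if pos w = j then 1 / A else A) * ?d ^ F True False) +
     (if pos z = i then 1 / A else A) * ((if pos w = j then A else 1 / A) * ?d ^ F False True + (if pos w = j then 1 / A else A) * ?d ^ F False False)"
    unfolding 0 1 state_sum_empty using z L by (cases i; cases j; simp)
  also have "\<dots> = ?d ^ F True True + (A\<^sup>2 + 1 / A\<^sup>2 + ?d) * ?d ^ M"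
    unfolding F using pos A by (auto simp: algebra_simps power2_eq_square)
  finally show ?thesis by simp
qed

text \<open>By the table of states the difference of the two sums is a single expression in the
  weights times the difference of the circle values to the powers \<open>b\<close> and
  \<open>c\<close>. That expression vanishes except for two of the eight weight patterns, which
  \<open>sg\<close> excludes; they belong to triangles whose arcs are stacked cyclically.\<close>

lemma R3_sum:
  fixes x y z x' y' z' :: 'z
  assumes A: "A \<noteq> 0" and z: "distinct [x, y, z]" "distinct [x', y', z']"
    and pos: "pos x = pos' x'" "pos y = pos' y'" "pos z = pos' z'"
    and sg: "\<not> ((pos y = j) = (pos z = l) \<and> (pos x = i) \<noteq> (pos y = j))"
    and L: "\<And>S. S \<subseteq> {x, y, z} \<Longrightarrow> L S = F ((x \<in> S) = i) ((y \<in> S) = j) ((z \<in> S) = l)"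
    and L': "\<And>S. S \<subseteq> {x', y', z'} \<Longrightarrow> L' S = F' ((x' \<in> S) = i) ((y' \<in> S) = j) ((z' \<in> S) = l)"
    and b: "F True True False = b" "F True False True = b" "F False False False = b" "F True False False = Suc b"
      "F' False True True = b"
    and c: "F' True True False = c" "F' True False True = c" "F' False False False = c" "F' True False False = Suc c"
      "F False True True = c"
    and e: "F True True True = F' True True True" "F False True False = F' False True False"
      "F False False True = F' False False True"
  shows "state_sum {x, y, z} pos L A = state_sum {x', y', z'} pos' L' A"
proof -
  let ?d = "- (A\<^sup>2) - 1 / A\<^sup>2"
  let ?w = "\<lambda>q b. if q = b then A else 1 / A"
  have ex: "state_sum {x, y, z} pos L A =
     ?w (pos x) i * (?w (pos y) j * (?w (pos z) l * ?d ^ F True True True + ?w (pos z) (\<not> l) * ?d ^ F True True False)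
       + ?w (pos y) (\<not> j) * (?w (pos z) l * ?d ^ F True False True + ?w (pos z) (\<not> l) * ?d ^ F True False False)) +
     ?w (pos x) (\<not> i) * (?w (pos y) j * (?w (pos z) l * ?d ^ F False True True + ?w (pos z) (\<not> l) * ?d ^ F False True False)
       + ?w (pos y) (\<not> j) * (?w (pos z) l * ?d ^ F False False True + ?w (pos z) (\<not> l) * ?d ^ F False False False))"
    if "distinct [x, y, z]" "\<forall>S. S \<subseteq> {x, y, z} \<longrightarrow> L S = F ((x \<in> S) = i) ((y \<in> S) = j) ((z \<in> S) = l)"
    for x y z :: 'z and pos L F
  proof -
    have 0: "state_sum {x, y, z} pos L A =
        (if pos x = i then A else 1 / A) * state_sum {y, z} pos (\<lambda>S. L (if i then insert x S else S)) A +
        (if pos x = i then 1 / A else A) * state_sum {y, z} pos (\<lambda>S. L (if i then S else insert x S)) A"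
      by (rule state_sum_insert) (use that(1) in auto)
    have 1: "state_sum {y, z} pos L A =
        (if pos y = j then A else 1 / A) * state_sum {z} pos (\<lambda>S. L (if j then insert y S else S)) A +
        (if pos y = j then 1 / A else A) * state_sum {z} pos (\<lambda>S. L (if j then S else insert y S)) A" for L
      by (rule state_sum_insert) (use that(1) in auto)
    have 2: "state_sum {z} pos L A =
        (if pos z = l then A else 1 / A) * state_sum {} pos (\<lambda>S. L (if l then insert z S else S)) A +
        (if pos z = l then 1 / A else A) * state_sum {} pos (\<lambda>S. L (if l then S else insert z S)) A" for L
      by (rule state_sum_insert) auto
    have ne: "x \<noteq> y" "y \<noteq> x" "x \<noteq> z" "z \<noteq> x" "y \<noteq> z" "z \<noteq> y" using that(1) by auto
    have L: "L {x, y, z} = F (True = i) (True = j) (True = l)" "L {x, y} = F (True = i) (True = j) (False = l)"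
      "L {x, z} = F (True = i) (False = j) (True = l)" "L {x} = F (True = i) (False = j) (False = l)"
      "L {y, z} = F (False = i) (True = j) (True = l)" "L {y} = F (False = i) (True = j) (False = l)"
      "L {z} = F (False = i) (False = j) (True = l)" "L {} = F (False = i) (False = j) (False = l)"
      using that(2) ne by auto
    show ?thesis unfolding 0 1 2 state_sum_empty
      by (cases i; cases j; cases l; simp add: L)
  qed
  \<comment> \<open>The coefficient with which the pattern \<open>b\<close> occurs before the move
    more often than after it. An unprimed weight belongs to \<open>Par\<close>, a primed one to
    \<open>Anti\<close>.\<close>
  have K: "wx * wy * wz' + wx * wy' * wz + ?d * (wx * wy' * wz') + wx' * wy' * wz' - wx' * wy * wz = 0"
    if "(wx, wx') = (if p then (A, 1 / A) else (1 / A, A))" "(wy, wy') = (if q then (A, 1 / A) else (1 / A, A))"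
      "(wz, wz') = (if r then (A, 1 / A) else (1 / A, A))" "\<not> (q = r \<and> p \<noteq> q)" for wx wx' wy wy' wz wz' and p q r :: bool
  proof -
    have w: "wx = (if p then A else 1 / A)" "wx' = (if p then 1 / A else A)" "wy = (if q then A else 1 / A)"
      "wy' = (if q then 1 / A else A)" "wz = (if r then A else 1 / A)" "wz' = (if r then 1 / A else A)"
      using that(1-3) by (auto split: if_splits)
    show ?thesis unfolding w using that(4) A
      by (cases p; cases q; cases r) (simp_all add: field_simps power2_eq_square)
  qed
  define wx wx' wy wy' wz wz' where "wx = ?w (pos' x') i" "wx' = ?w (pos' x') (\<not> i)" "wy = ?w (pos' y') j"
    "wy' = ?w (pos' y') (\<not> j)" "wz = ?w (pos' z') l" "wz' = ?w (pos' z') (\<not> l)"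
  note w = this
  have K0: "wx * wy * wz' + wx * wy' * wz + ?d * (wx * wy' * wz') + wx' * wy' * wz' - wx' * wy * wz = 0"
    by (rule K[of wx wx' "pos' x' = i" wy wy' "pos' y' = j" wz wz' "pos' z' = l"]) (use sg[unfolded pos] in \<open>auto simp: w\<close>)
  have ring: "wx * (wy * (wz * P + wz' * X) + wy' * (wz * X + wz' * (?d * X))) +
      wx' * (wy * (wz * Y + wz' * Q) + wy' * (wz * R + wz' * X)) =
    wx * (wy * (wz * P + wz' * Y) + wy' * (wz * Y + wz' * (?d * Y))) +
      wx' * (wy * (wz * X + wz' * Q) + wy' * (wz * R + wz' * Y))" for P Q R X Y
  proof -
    have "wx * (wy * (wz * P + wz' * X) + wy' * (wz * X + wz' * (d * X))) +
        wx' * (wy * (wz * Y + wz' * Q) + wy' * (wz * R + wz' * X)) -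
      (wx * (wy * (wz * P + wz' * Y) + wy' * (wz * Y + wz' * (d * Y))) +
        wx' * (wy * (wz * X + wz' * Q) + wy' * (wz * R + wz' * Y))) =
      (wx * wy * wz' + wx * wy' * wz + d * (wx * wy' * wz') + wx' * wy' * wz' - wx' * wy * wz) * (X - Y)" for d
      by (simp add: algebra_simps)
    from this[of ?d] show ?thesis unfolding K0 by simp
  qed
  have all: "\<forall>S. S \<subseteq> {x, y, z} \<longrightarrow> L S = F ((x \<in> S) = i) ((y \<in> S) = j) ((z \<in> S) = l)"
    "\<forall>S. S \<subseteq> {x', y', z'} \<longrightarrow> L' S = F' ((x' \<in> S) = i) ((y' \<in> S) = j) ((z' \<in> S) = l)"
    using L L' by blast+
  show ?thesis
    unfolding ex[of x y z L F pos, OF z(1) all(1)] ex[of x' y' z' L' F' pos', OF z(2) all(2)] pos b c e power_Suc w[symmetric] by (rule ring)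
qed

section \<open>Reparametrization and planar isotopy\<close>

lemma ncls_bij:
  assumes bij: "bij_betw f V V'"
    and R: "\<And>u v. R u v \<Longrightarrow> u \<in> V \<and> v \<in> V" "\<And>u v. R' u v \<Longrightarrow> u \<in> V' \<and> v \<in> V'"
    and iff: "\<And>u v. u \<in> V \<Longrightarrow> v \<in> V \<Longrightarrow> R u v \<longleftrightarrow> R' (f u) (f v)"
  shows "ncls V R = ncls V' R'"
proof (rule ncls_transfer[where f = f and g = "inv_into V f"])
  have inv: "inv_into V f v \<in> V" "f (inv_into V f v) = v" if "v \<in> V'" for v
    using that bij by (auto simp: bij_betw_def inv_into_into f_inv_into_f)
  show "f v \<in> V'" if "v \<in> V" for v using that bij bij_betwE by blast
  show "inv_into V f v \<in> V" if "v \<in> V'" for v using inv that by blast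
  show "equivclp R' (f u) (f v)" if "R u v" for u v using that R(1) iff by blast
  show "equivclp R (inv_into V f u) (inv_into V f v)" if "R' u v" for u v
    using that R(2)[OF that] inv iff by (metis r_into_equivclp)
  show "equivclp R (inv_into V f (f v)) v" if "v \<in> V" for v
    using that bij by (simp add: bij_betw_def)
  show "equivclp R' (f (inv_into V f v)) v" if "v \<in> V'" for v using inv that by simp
qed

lemma (in chords) smooth_rel_germs:
  assumes "smooth_rel n C Q u v"
  shows "u \<in> germs n \<and> v \<in> germs n"
  using assms by cases (auto simp: germs_def dest: C_dom C_sym)

text \<open>Common ground of reparametrization, where \<open>h\<close> is the identity, and of
  planar isotopy, where \<sigma> and \<phi> are. Only the signs of the crossings need a separate
  argument, so their preservation is assumed here.\<close>

locale diag_iso = d: diag D + d': diag D' for D D' +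
  fixes \<sigma> :: "nat \<Rightarrow> nat" and \<phi> :: "nat \<Rightarrow> real \<Rightarrow> real" and h :: "complex \<Rightarrow> complex"
  assumes n: "comps D' = comps D" and \<sigma>: "bij_betw \<sigma> {..<comps D} {..<comps D}"
    and mono: "\<And>i. i < comps D \<Longrightarrow> strict_mono (\<phi> i)" and surj: "\<And>i. i < comps D \<Longrightarrow> surj (\<phi> i)"
    and per: "\<And>i x. i < comps D \<Longrightarrow> \<phi> i (x + 1) = \<phi> i x + 1" and inj: "inj h"
    and plane: "\<And>i x. i < comps D \<Longrightarrow> curve D' i x = h (curve D (\<sigma> i) (\<phi> i x))"
    and lab: "\<And>i x. i < comps D \<Longrightarrow> double_preimage D' (i, x) \<Longrightarrow> label D' i x = label D (\<sigma> i) (\<phi> i x)"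
    and sign: "\<And>i x j y. i < comps D \<Longrightarrow> j < comps D \<Longrightarrow> double_pair D' (i, x) (j, y) \<Longrightarrow>
      0 < cross (velocity D' (i, x)) (velocity D' (j, y)) \<longleftrightarrow>
      0 < cross (velocity D (\<sigma> i, \<phi> i x)) (velocity D (\<sigma> j, \<phi> j y))"
begin

definition move :: "point \<Rightarrow> point" where
  "move p = (\<sigma> (fst p), \<phi> (fst p) (snd p))"

lemma move_dom: "fst p < comps D \<Longrightarrow> fst (move p) < comps D"
  unfolding move_def using \<sigma> bij_betwE by fastforce

lemma sigma_eq: "i < comps D \<Longrightarrow> j < comps D \<Longrightarrow> \<sigma> i = \<sigma> j \<longleftrightarrow> i = j"
  using \<sigma> unfolding bij_betw_def inj_on_def by auto

lemma phi_eq: "i < comps D \<Longrightarrow> \<phi> i x = \<phi> i y \<longleftrightarrow> x = y"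
  and phi_less: "i < comps D \<Longrightarrow> \<phi> i x < \<phi> i y \<longleftrightarrow> x < y"
  using mono strict_mono_eq strict_mono_less by blast+

lemma phi_shift: "i < comps D \<Longrightarrow> \<phi> i (x + of_int k) = \<phi> i x + of_int k"
  using d.shift_int[of "\<lambda>x. \<phi> i x - x" x k] per by (simp add: algebra_simps)

lemma move_surj:
  assumes "fst q < comps D"
  obtains p where "fst p < comps D" "move p = q"
proof -
  have "fst q \<in> \<sigma> ` {..<comps D}" using \<sigma> assms by (simp add: bij_betw_def)
  then obtain i where i: "i < comps D" "\<sigma> i = fst q" by auto
  obtain x where "\<phi> i x = snd q" using surj[OF i(1)] by (metis surjD)
  then have "move (i, x) = q" using i by (simp add: move_def)
  then show ?thesis using that[of "(i, x)"] i by simp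
qed

lemma move_same:
  assumes "fst p < comps D" "fst q < comps D"
  shows "same_point (move p) (move q) \<longleftrightarrow> same_point p q"
proof
  assume "same_point p q"
  then obtain k where "q = (fst p, snd p + of_int k)" using same_pointE by (metis prod.collapse)
  then show "same_point (move p) (move q)" unfolding move_def using phi_shift assms by (simp add: same_point_def)
next
  assume s: "same_point (move p) (move q)"
  then have f: "fst p = fst q" unfolding same_point_def move_def using sigma_eq assms by simp
  obtain k where "\<phi> (fst p) (snd p) - \<phi> (fst p) (snd q) = of_int k"
    using s f unfolding same_point_def move_def by (auto elim: Ints_cases)
  then have "\<phi> (fst p) (snd p) = \<phi> (fst p) (snd q + of_int k)" using phi_shift assms(1) by simp
  then have "snd p = snd q + of_int k" using phi_eq assms(1) by simp
  then show "same_point p q" using f unfolding same_point_def by simp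
qed

lemma plane_move: "fst p < comps D \<Longrightarrow> plane_at D' p = h (plane_at D (move p))"
  unfolding plane_at_def move_def using plane by simp

lemma double_move:
  "double_pair D' p q \<longleftrightarrow> fst p < comps D \<and> fst q < comps D \<and> double_pair D (move p) (move q)"
proof (cases "fst p < comps D \<and> fst q < comps D")
  case True
  then show ?thesis
    unfolding double_pair_def n
    using plane_move[of p] plane_move[of q] move_same[of p q] move_dom[of p] move_dom[of q] inj_eq[OF inj] by simp
qed (auto simp: double_pair_def n)

lemma label_move:
  assumes "double_pair D' p q"
  shows "label_at D' p = label_at D (move p)" "label_at D' q = label_at D (move q)"
proof -
  have "double_preimage D' p" "double_preimage D' q"
    using assms d'.double_pair_sym unfolding double_preimage_def by blast+
  moreover have "fst p < comps D" "fst q < comps D" using assms double_move by blast+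
  ultimately show "label_at D' p = label_at D (move p)" "label_at D' q = label_at D (move q)"
    using lab[of "fst p" "snd p"] lab[of "fst q" "snd q"] unfolding label_at_def move_def by simp_all
qed

lemma real_move:
  "real_pair D' p q \<longleftrightarrow> fst p < comps D \<and> fst q < comps D \<and> real_pair D (move p) (move q)"
  unfolding real_pair_def using double_move label_move by metis

lemma chorded_move:
  assumes "fst p < comps D"
  shows "chorded (real_pair D') p \<longleftrightarrow> chorded (real_pair D) (move p)"
proof
  assume "chorded (real_pair D) (move p)"
  then obtain q' where q': "real_pair D (move p) q'" unfolding chorded_def by blast
  then obtain q where "fst q < comps D" "move q = q'" using move_surj d.C_dom d.C_sym by metis
  then show "chorded (real_pair D') p" using q' assms real_move unfolding chorded_def by blast
qed (use real_move chorded_def in metis)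

definition move_germ :: "germ \<Rightarrow> germ" where
  "move_germ g = (move (fst g), snd g)"

lemma bij_move_germ: "bij_betw move_germ (germs (comps D)) (germs (comps D))"
  unfolding bij_betw_def
proof
  show "inj_on move_germ (germs (comps D))"
    unfolding inj_on_def move_germ_def move_def germs_def using sigma_eq phi_eq by (auto simp: prod_eq_iff)
  show "move_germ ` germs (comps D) = germs (comps D)"
  proof (intro equalityI subsetI)
    fix g assume "g \<in> germs (comps D)"
    then have "fst (fst g) < comps D" unfolding germs_def by simp
    then obtain p where "fst p < comps D" "move p = fst g" by (rule move_surj)
    then have "move_germ (p, snd g) = g" "(p, snd g) \<in> germs (comps D)"
      unfolding move_germ_def germs_def by (auto simp: prod_eq_iff)
    then show "g \<in> move_germ ` germs (comps D)" by (metis image_eqI)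
  qed (auto simp: move_germ_def germs_def move_dom)
qed

lemma smooth_move:
  assumes uv: "u \<in> germs (comps D)" "v \<in> germs (comps D)"
    and Q: "\<And>p. fst p < comps D \<Longrightarrow> Q' p = Q (move p)"
  shows "smooth_rel (comps D) (real_pair D') Q' u v \<longleftrightarrow> smooth_rel (comps D) (real_pair D) Q (move_germ u) (move_germ v)"
proof -
  let ?S' = "smooth_rel (comps D) (real_pair D') Q'" and ?S = "smooth_rel (comps D) (real_pair D) Q"
  show ?thesis
proof
  have free: "(\<forall>z. x < z \<and> z < y \<longrightarrow> \<not> chorded (real_pair D') (i, z)) \<longleftrightarrow>
      (\<forall>z. \<phi> i x < z \<and> z < \<phi> i y \<longrightarrow> \<not> chorded (real_pair D) (\<sigma> i, z))" if i: "i < comps D" for i x y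
  proof -
    have "chorded (real_pair D') (i, z) \<longleftrightarrow> chorded (real_pair D) (\<sigma> i, \<phi> i z)" for z
      using chorded_move[of "(i, z)"] i unfolding move_def by simp
    then show ?thesis using surj[OF i] phi_less[OF i] by (metis surjD)
  qed
  assume "?S' u v"
  then show "?S (move_germ u) (move_germ v)"
  proof cases
    case (period i x e)
    then show ?thesis using smooth_rel.period[of "\<sigma> i" "comps D"] per move_dom[of "(i, x)"]
      unfolding move_germ_def move_def by simp
  next
    case (seg i x y)
    have "?S ((\<sigma> i, \<phi> i x), True) ((\<sigma> i, \<phi> i y), False)"
      by (rule smooth_rel.seg) (use free[OF seg(3)] seg move_dom[of "(i, x)"] phi_less in \<open>auto simp: move_def\<close>)
    then show ?thesis unfolding move_germ_def move_def seg(1,2) by simp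
  next
    case (thr p)
    then show ?thesis using smooth_rel.thr[of "move p"] move_dom chorded_move unfolding move_germ_def by simp
  next
    case (ori p q)
    then show ?thesis using smooth_rel.ori[of "real_pair D" "move p" "move q" Q] real_move Q unfolding move_germ_def by simp
  next
    case (uno p q e)
    then show ?thesis using smooth_rel.uno[of "real_pair D" "move p" "move q" Q] real_move Q unfolding move_germ_def by simp
  qed
next
  have free: "(\<forall>z. x < z \<and> z < y \<longrightarrow> \<not> chorded (real_pair D') (i, z)) \<longleftrightarrow>
      (\<forall>z. \<phi> i x < z \<and> z < \<phi> i y \<longrightarrow> \<not> chorded (real_pair D) (\<sigma> i, z))" if i: "i < comps D" for i x y
  proof -
    have "chorded (real_pair D') (i, z) \<longleftrightarrow> chorded (real_pair D) (\<sigma> i, \<phi> i z)" for z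
      using chorded_move[of "(i, z)"] i unfolding move_def by simp
    then show ?thesis using surj[OF i] phi_less[OF i] by (metis surjD)
  qed
  obtain i x e j y e' where u: "u = ((i, x), e)" and v: "v = ((j, y), e')" by (metis prod.exhaust)
  have ij: "i < comps D" "j < comps D" using uv u v unfolding germs_def by auto
  assume "?S (move_germ u) (move_germ v)"
  then show "?S' u v"
  proof cases
    case (period k t e'')
    then have "\<sigma> j = \<sigma> i" "\<phi> j y = \<phi> i x + 1" "e' = e" unfolding u v move_germ_def move_def by auto
    then have "j = i" "y = x + 1" using sigma_eq ij per phi_eq[of i y "x + 1"] by auto
    then show ?thesis unfolding u v using smooth_rel.period[OF ij(1)] \<open>e' = e\<close> by simp
  next
    case (seg k s t)
    then have st: "\<sigma> j = \<sigma> i" "k = \<sigma> i" "s = \<phi> i x" "t = \<phi> j y" "e" "\<not> e'"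
      unfolding u v move_germ_def move_def by auto
    then have ji: "j = i" using sigma_eq ij by simp
    have "x < y" using seg st ji phi_less[OF ij(1)] by simp
    then show ?thesis unfolding u v using smooth_rel.seg[OF ij(1), of x y] free[OF ij(1), of x y] seg st ji by simp
  next
    case (thr p)
    then have "move (i, x) = move (j, y)" "\<not> chorded (real_pair D) (move (i, x))" "\<not> e" "e'"
      unfolding u v move_germ_def by auto
    moreover from this have "(i, x) = (j, y)" using sigma_eq phi_eq ij unfolding move_def by auto
    ultimately show ?thesis unfolding u v using smooth_rel.thr[of "(i, x)" "comps D" "real_pair D'"] ij chorded_move[of "(i, x)"] by simp
  next
    case (ori p q)
    then have "real_pair D' (i, x) (j, y)" "Q' (i, x)" "\<not> e" "e'"
      unfolding u v move_germ_def using real_move[of "(i, x)" "(j, y)"] ij Q by auto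
    then show ?thesis unfolding u v using smooth_rel.ori[of "real_pair D'"] by simp
  next
    case (uno p q e'')
    then have "real_pair D' (i, x) (j, y)" "\<not> Q' (i, x)" "e = e'"
      unfolding u v move_germ_def using real_move[of "(i, x)" "(j, y)"] ij Q by auto
    then show ?thesis unfolding u v using smooth_rel.uno[of "real_pair D'"] by simp
  qed
qed
qed

lemma circles_move: "d'.circles (h ` S) = d.circles S"
  unfolding d'.circles_def d.circles_def loops_def n
proof (rule ncls_bij[OF bij_move_germ])
  show "smooth_rel (comps D) (real_pair D') (d'.smoothed (h ` S)) u v \<Longrightarrow> u \<in> germs (comps D) \<and> v \<in> germs (comps D)" for u v
    using d'.smooth_rel_germs unfolding n .
  show "smooth_rel (comps D) (real_pair D) (d.smoothed S) u v \<Longrightarrow> u \<in> germs (comps D) \<and> v \<in> germs (comps D)" for u v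
    by (rule d.smooth_rel_germs)
  have Q: "d'.smoothed (h ` S) p = d.smoothed S (move p)" if "fst p < comps D" for p
    unfolding d'.smoothed_def d.smoothed_def n using that plane_move move_dom inj by (auto simp: inj_image_mem_iff)
  show "smooth_rel (comps D) (real_pair D') (d'.smoothed (h ` S)) u v \<longleftrightarrow>
      smooth_rel (comps D) (real_pair D) (d.smoothed S) (move_germ u) (move_germ v)"
    if "u \<in> germs (comps D)" "v \<in> germs (comps D)" for u v
    by (rule smooth_move) (use that Q in auto)
qed

lemma bracket_move: "d'.bracket = d.bracket"
proof
  fix A
  have cr: "d'.crossings = h ` d.crossings"
  proof (intro equalityI subsetI)
    fix z assume "z \<in> d'.crossings"
    then obtain p q where p: "real_pair D' p q" "plane_at D' p = z" by (rule d'.crossingsE)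
    then show "z \<in> h ` d.crossings" using real_move plane_move d.in_crossings by blast
  next
    fix z assume "z \<in> h ` d.crossings"
    then obtain w where w: "w \<in> d.crossings" "z = h w" by blast
    from w(1) obtain p' q' where p': "real_pair D p' q'" "plane_at D p' = w" by (rule d.crossingsE)
    obtain p where p: "fst p < comps D" "move p = p'" using move_surj d.C_dom[OF p'(1)] by metis
    obtain q where q: "fst q < comps D" "move q = q'" using move_surj d.C_dom[OF d.C_sym[OF p'(1)]] by metis
    have "real_pair D' p q" using real_move p q p' by simp
    then show "z \<in> d'.crossings" using d'.in_crossings plane_move[OF p(1)] p p'(2) w(2) by metis
  qed
  have pos: "d.positive z = d'.positive (h z)" if "z \<in> d.crossings" for z
  proof -
    have "h z \<in> d'.crossings" using that cr by blast
    then obtain p q where p: "real_pair D' p q" "plane_at D' p = h z" "label_at D' p = Over" by (rule d'.crossingsE)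
    have dom: "fst p < comps D" "fst q < comps D" and rp: "real_pair D (move p) (move q)" using real_move p(1) by auto
    have z: "plane_at D (move p) = z" using p(2) plane_move[OF dom(1)] inj by (simp add: inj_eq)
    have l: "label_at D (move p) = Over" using label_move(1)[OF d'.real_pairD[OF p(1)]] p(3) by simp
    show ?thesis
      using d'.positive_iff[OF p(1,3)] d.positive_iff[OF rp l] sign[of "fst p" "fst q" "snd p" "snd q"] dom p(2) z d'.real_pairD[OF p(1)]
      unfolding move_def by simp
  qed
  have "bij_betw h d.crossings d'.crossings"
    unfolding cr bij_betw_def using inj_on_subset[OF inj subset_UNIV] by simp
  then show "d'.bracket A = d.bracket A"
    unfolding d'.bracket_def d.bracket_def
    by (rule state_sum_reindex[symmetric]) (use circles_move pos in auto)
qed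

end

lemma reparametrized_bracket:
  assumes "diag D" "diag D'" "reparametrized D D'"
  shows "diag.bracket D' = diag.bracket D"
proof -
  interpret d: diag D by fact
  interpret d': diag D' by fact
  obtain \<sigma> \<phi> where n: "comps D' = comps D" and \<sigma>: "bij_betw \<sigma> {..<comps D} {..<comps D}"
    and der: "\<And>i x. i < comps D \<Longrightarrow> \<exists>d>0. (\<phi> i has_real_derivative d) (at x)"
    and per: "\<And>i x. i < comps D \<Longrightarrow> \<phi> i (x + 1) = \<phi> i x + 1"
    and cv: "\<And>i x. i < comps D \<Longrightarrow> curve D' i x = curve D (\<sigma> i) (\<phi> i x)"
    and lb: "\<And>i x. i < comps D \<Longrightarrow> double_preimage D' (i, x) \<Longrightarrow> label D' i x = label D (\<sigma> i) (\<phi> i x)"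
    using assms(3) unfolding reparametrized_def by blast
  have mono: "strict_mono (\<phi> i)" if "i < comps D" for i
    unfolding strict_mono_def using DERIV_pos_imp_increasing[of _ _ "\<phi> i"] der[OF that] by blast
  \<comment> \<open>The values at consecutive integers differ by one, so the intermediate value
    theorem reaches every real.\<close>
  have surj: "surj (\<phi> i)" if i: "i < comps D" for i
  proof -
    have cont: "continuous_on UNIV (\<phi> i)"
      using der[OF i] DERIV_isCont continuous_at_imp_continuous_on by metis
    have sh: "\<phi> i (0 + of_int k) = \<phi> i 0 + of_int k" for k
      using d.shift_int[of "\<lambda>x. \<phi> i x - x" 0 k] per[OF i] by (simp add: algebra_simps)
    have "\<exists>x. \<phi> i x = y" for y
    proof -
      define k where "k = \<lfloor>y - \<phi> i 0\<rfloor>"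
      have "\<phi> i (of_int k) \<le> y" "y \<le> \<phi> i (of_int (k + 1))"
        using sh[of k] sh[of "k + 1"] unfolding k_def by simp_all linarith+
      then show ?thesis
        using IVT'[of "\<phi> i" "of_int k" y "of_int (k + 1)"] continuous_on_subset[OF cont subset_UNIV] by auto
    qed
    then show ?thesis by (metis surjI)
  qed
  have \<sigma>dom: "\<sigma> i < comps D" if "i < comps D" for i using \<sigma> that bij_betwE by fastforce
  have vel: "\<exists>d>0. velocity D' (i, x) = d *\<^sub>R velocity D (\<sigma> i, \<phi> i x)" if i: "i < comps D" for i x
  proof -
    obtain d where d: "d > 0" "(\<phi> i has_real_derivative d) (at x)" using der[OF i] by blast
    have "((curve D (\<sigma> i) \<circ> \<phi> i) has_vector_derivative d *\<^sub>R velocity D (\<sigma> i, \<phi> i x)) (at x)"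
      by (rule vector_diff_chain_at) (use d d.curve_deriv[OF \<sigma>dom[OF i]] in \<open>auto simp: has_real_derivative_iff_has_vector_derivative\<close>)
    moreover have "curve D (\<sigma> i) \<circ> \<phi> i = curve D' i" using cv[OF i] by auto
    ultimately show ?thesis using d(1) unfolding velocity_def[of D'] by (auto simp: vector_derivative_at)
  qed
  interpret diag_iso D D' \<sigma> \<phi> "\<lambda>z. z"
  proof unfold_locales
    fix i x j y assume ij: "i < comps D" "j < comps D"
    obtain d d' where "d > 0" "d' > 0" "velocity D' (i, x) = d *\<^sub>R velocity D (\<sigma> i, \<phi> i x)"
      "velocity D' (j, y) = d' *\<^sub>R velocity D (\<sigma> j, \<phi> j y)" using vel ij by metis
    then show "0 < cross (velocity D' (i, x)) (velocity D' (j, y)) \<longleftrightarrow>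
      0 < cross (velocity D (\<sigma> i, \<phi> i x)) (velocity D (\<sigma> j, \<phi> j y))"
      by (simp add: cross_scale zero_less_mult_iff)
  qed (use n \<sigma> mono surj per cv lb in auto)
  show ?thesis by (rule bracket_move)
qed

text \<open>The real determinant; its sign tells whether a linear map preserves the orientation of
  the plane.\<close>

definition det2 :: "(complex \<Rightarrow> complex) \<Rightarrow> real" where
  "det2 L = cross (L 1) (L \<i>)"

lemma linear_complex: "linear L \<Longrightarrow> L v = Re v *\<^sub>R L 1 + Im v *\<^sub>R L \<i>"
proof -
  assume "linear L"
  moreover have "v = Re v *\<^sub>R 1 + Im v *\<^sub>R \<i>" by (simp add: complex_eq_iff)
  ultimately show ?thesis by (metis linear_add linear_scale)
qed

lemma cross_linear: "linear L \<Longrightarrow> cross (L v) (L w) = det2 L * cross v w"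
  unfolding linear_complex[of L v] linear_complex[of L w] det2_def
  by (simp add: cross_def algebra_simps)

lemma C1_diffeo_det:
  assumes h: "C1_diffeo h" and L: "(h has_derivative L) (at z)"
  shows "det2 L \<noteq> 0"
proof
  assume 0: "det2 L = 0"
  have lin: "linear L" using L has_derivative_linear by blast
  have bij: "bij h" and "C1_map (inv h)" using h unfolding C1_diffeo_def by auto
  then obtain M where M: "(inv h has_derivative M) (at (h z))" unfolding C1_map_def by blast
  have "(inv h \<circ> h has_derivative M \<circ> L) (at z)" by (rule diff_chain_at[OF L M])
  moreover have "inv h \<circ> h = id" using bij by (simp add: bij_is_inj)
  ultimately have "M \<circ> L = id" using has_derivative_unique has_derivative_id by metis
  then have ret: "M (L v) = v" for v by (metis comp_apply id_apply)
  have M0: "M 0 = 0" using M has_derivative_linear linear_0 by blast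
  have inj: "L v = 0 \<Longrightarrow> v = 0" for v using ret[of v] M0 by simp
  have c: "Re (L 1) * Im (L \<i>) = Im (L 1) * Re (L \<i>)" using 0 unfolding det2_def cross_def by simp
  \<comment> \<open>If the determinant vanishes, the rows of the matrix are proportional, so a
    vector orthogonal to either row is in the kernel.\<close>
  have "L (Complex (Re (L \<i>)) (- Re (L 1))) = 0" "L (Complex (Im (L \<i>)) (- Im (L 1))) = 0"
    unfolding linear_complex[OF lin, of "Complex _ _"] using c by (simp_all add: complex_eq_iff algebra_simps)
  then have "Complex (Re (L \<i>)) (- Re (L 1)) = 0" "Complex (Im (L \<i>)) (- Im (L 1)) = 0" using inj by blast+
  then have "L 1 = 0" by (simp add: complex_eq_iff)
  then show False using inj[of 1] by simp
qed

lemma sign_constant: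
  assumes "connected S" "continuous_on S g" "\<And>x. x \<in> S \<Longrightarrow> g x \<noteq> (0::real)" "x \<in> S" "y \<in> S" "0 < g x"
  shows "0 < g y"
proof (rule ccontr)
  assume "\<not> 0 < g y"
  moreover have "connected (g ` S)" by (rule connected_continuous_image[OF assms(2,1)])
  ultimately have "0 \<in> g ` S"
    using connectedD_interval[of "g ` S" "g y" "g x" 0, OF _ imageI imageI] assms(4-6) by (metis less_imp_le not_less)
  then obtain w where "w \<in> S" "g w = 0" by (metis imageE)
  then show False using assms(3)[of w] by simp
qed

lemma (in diag) velocity_image:
  assumes i: "i < n" and h: "(h has_derivative L) (at (curve D i x))"
  shows "((\<lambda>t. h (curve D i t)) has_vector_derivative L (velocity D (i, x))) (at x)"
proof -
  have "((h \<circ> curve D i) has_derivative (L \<circ> (\<lambda>t. t *\<^sub>R velocity D (i, x)))) (at x)"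
    by (rule diff_chain_at) (use h curve_deriv[OF i] in \<open>auto simp: has_vector_derivative_def\<close>)
  moreover have "L \<circ> (\<lambda>t. t *\<^sub>R velocity D (i, x)) = (\<lambda>t. t *\<^sub>R L (velocity D (i, x)))"
    using has_derivative_linear[OF h] by (auto simp: linear_scale)
  ultimately show ?thesis unfolding has_vector_derivative_def by (simp add: o_def)
qed

text \<open>Along the isotopy the derivative starts as the identity and never becomes singular, so
  its determinant stays positive and \<open>H 1\<close> preserves the signs of the
  crossings.\<close>

lemma planar_isotopic_bracket:
  assumes "diag D" "diag D'" "planar_isotopic D D'"
  shows "diag.bracket D' = diag.bracket D"
proof -
  interpret d: diag D by fact
  interpret d': diag D' by fact
  obtain H H' where n: "comps D' = comps D" and H0: "H 0 = id"
    and diffeo: "\<And>t. t \<in> {0..1} \<Longrightarrow> C1_diffeo (H t)"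
    and der: "\<And>t z. t \<in> {0..1} \<Longrightarrow> (H t has_derivative blinfun_apply (H' (t, z))) (at z)"
    and cont: "continuous_on ({0..1} \<times> UNIV) (H' :: real \<times> complex \<Rightarrow> complex \<Rightarrow>\<^sub>L complex)"
    and cv: "\<And>i x. i < comps D \<Longrightarrow> curve D' i x = H 1 (curve D i x)"
    and lb: "\<And>i x. i < comps D \<Longrightarrow> double_preimage D (i, x) \<Longrightarrow> label D' i x = label D i x"
    using assms(3) unfolding planar_isotopic_def ambient_isotopy_def by blast
  have inj: "inj (H 1)" using diffeo[of 1] unfolding C1_diffeo_def by (simp add: bij_is_inj)
  have det: "0 < det2 (H' (1, z))" for z
  proof (rule sign_constant[of "{0..1}" "\<lambda>t. det2 (H' (t, z))" 0])
    have "continuous_on {0..1} (\<lambda>t. H' (t, z))"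
      by (rule continuous_on_compose2[OF cont]) (auto intro!: continuous_intros)
    then show "continuous_on {0..1} (\<lambda>t. det2 (H' (t, z)))"
      unfolding det2_def by (intro continuous_intros)
    show "det2 (H' (t, z)) \<noteq> 0" if "t \<in> {0..1}" for t by (rule C1_diffeo_det[OF diffeo der]) (use that in auto)
    have "(id has_derivative H' (0, z)) (at z)" using der[of 0 z] H0 by simp
    then have "blinfun_apply (H' (0, z)) = id" using has_derivative_unique has_derivative_id by metis
    then show "0 < det2 (H' (0, z))" unfolding det2_def by (simp add: cross_def)
  qed auto
  have vel: "velocity D' (i, x) = H' (1, curve D i x) (velocity D (i, x))" if i: "i < comps D" for i x
  proof -
    have "((\<lambda>t. H 1 (curve D i t)) has_vector_derivative H' (1, curve D i x) (velocity D (i, x))) (at x)"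
      by (rule d.velocity_image[OF i der]) auto
    moreover have "(\<lambda>t. H 1 (curve D i t)) = curve D' i" using cv[OF i] by auto
    ultimately show ?thesis unfolding velocity_def[of D'] by (simp add: vector_derivative_at)
  qed
  have dp: "double_pair D' p q \<longleftrightarrow> double_pair D p q" for p q
    unfolding double_pair_def n plane_at_def using cv inj by (auto simp: inj_eq)
  interpret diag_iso D D' id "\<lambda>_ x. x" "H 1"
  proof unfold_locales
    fix i x j y assume ij: "i < comps D" "j < comps D" and pq: "double_pair D' (i, x) (j, y)"
    have "curve D i x = curve D j y" using pq unfolding dp unfolding double_pair_def plane_at_def by auto
    then have "velocity D' (i, x) = H' (1, curve D i x) (velocity D (i, x))"
      "velocity D' (j, y) = H' (1, curve D i x) (velocity D (j, y))" using vel ij by simp_all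
    moreover have "linear (H' (1, curve D i x))" by (rule has_derivative_linear[OF der]) simp
    ultimately show "0 < cross (velocity D' (i, x)) (velocity D' (j, y)) \<longleftrightarrow>
      0 < cross (velocity D (id i, x)) (velocity D (id j, y))"
      using det[of "curve D i x"] by (simp add: cross_linear zero_less_mult_iff)
  qed (use n cv inj lb dp in \<open>auto simp: strict_mono_def double_preimage_def\<close>)
  show ?thesis by (rule bracket_move)
qed

section \<open>Diagrams that meet a disc in arcs\<close>

text \<open>Any three points of the interval are mapped in order or in reverse order; comparing such
  triples relates the pair \<open>x\<close>, \<open>y\<close> to the pair of end points.\<close>

lemma mono_of_continuous_inj:
  fixes f :: "real \<Rightarrow> real"
  assumes ab: "a < b" and cont: "continuous_on {a..b} f" and inj: "inj_on f {a..b}"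
    and xy: "a \<le> x" "x < y" "y \<le> b"
  shows "f a < f b \<Longrightarrow> f x < f y" "\<not> f a < f b \<Longrightarrow> f y < f x"
proof -
  have mid: "f u < f v \<and> f v < f w \<or> f w < f v \<and> f v < f u" if "a \<le> u" "u < v" "v < w" "w \<le> b" for u v w
    using continuous_inj_imp_mono[of u v w f] that continuous_on_subset[OF cont] inj_on_subset[OF inj] by auto
  have ne: "f x \<noteq> f y" using inj_onD[OF inj, of x y] xy by auto
  have neab: "f a \<noteq> f b" using inj_onD[OF inj, of a b] ab by auto
  have "f x < f y \<longleftrightarrow> f a < f b"
  proof (cases "a < x")
    case True
    then show ?thesis
      using mid[of a x y] mid[of a x b] mid[of x y b] mid[of a y b] xy by (cases "y = b") auto
  next
    case False
    then have "x = a" using xy by simp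
    then show ?thesis using mid[of a y b] xy by (cases "y = b") auto
  qed
  then show "f a < f b \<Longrightarrow> f x < f y" "\<not> f a < f b \<Longrightarrow> f y < f x" using ne by auto
qed

text \<open>One side of a move in the model disc. The same \<open>K\<close> parameters are marked on
  every arc, the list \<open>chs\<close> gives the codes of the positions at which arcs meet, and
  \<open>rest\<close> the positions at which they do not.\<close>

locale arc_model =
  fixes k K :: nat and t :: "nat \<Rightarrow> real" and \<gamma> :: "nat \<Rightarrow> real \<Rightarrow> complex"
    and chs :: "(nat \<times> nat) list" and rest :: "nat list"
  assumes K0: "0 < K"
    and disc: "m < k \<Longrightarrow> s \<in> {-1..1} \<Longrightarrow> \<gamma> m s \<in> model_disc"
    and t_mono: "j < j' \<Longrightarrow> j' < K \<Longrightarrow> t j < t j'" and t_in: "j < K \<Longrightarrow> - 1 < t j \<and> t j < 1"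
    and model: "m < k \<Longrightarrow> m' < k \<Longrightarrow> s \<in> {-1..1} \<Longrightarrow> s' \<in> {-1..1} \<Longrightarrow>
      \<gamma> m s = \<gamma> m' s' \<longleftrightarrow> m = m' \<and> s = s' \<or> (\<exists>j<K. \<exists>j'<K. s = t j \<and> s' = t j' \<and>
        ((K * m + j, K * m' + j') \<in> set chs \<or> (K * m' + j', K * m + j) \<in> set chs))"
    and chs_lt: "(i, i') \<in> set chs \<Longrightarrow> i < k * K \<and> i' < k * K \<and> i \<noteq> i'"
    and rest: "set rest = {..<k * K} - (\<Union>(i, i')\<in>set chs. {i, i'})"

text \<open>A diagram that looks like the model inside \<open>h\<close> applied to the disc. Both
  sides of a move are instances of this locale with the same \<open>c\<close>, \<open>a\<close>,
  \<open>b\<close>, \<tau> and \<open>h\<close>.\<close>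

locale arcs = diag D + arc_model k K t \<gamma> chs rest for D k K t \<gamma> chs rest +
  fixes c :: "nat \<Rightarrow> nat" and a b :: "nat \<Rightarrow> real" and \<tau> :: "nat \<Rightarrow> real \<Rightarrow> real"
    and h :: "complex \<Rightarrow> complex"
  assumes arc: "m < k \<Longrightarrow> c m < comps D \<and> a m < b m"
    and tau: "m < k \<Longrightarrow> continuous_on {a m..b m} (\<tau> m) \<and> bij_betw (\<tau> m) {a m..b m} {-1..1}"
    and on_arc: "m < k \<Longrightarrow> x \<in> {a m..b m} \<Longrightarrow> curve D (c m) x = h (\<gamma> m (\<tau> m x))"
    and disj: "m < k \<Longrightarrow> m' < k \<Longrightarrow> x \<in> {a m..b m} \<Longrightarrow> x' \<in> {a m'..b m'} \<Longrightarrow>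
      same_point (c m, x) (c m', x') \<Longrightarrow> m = m' \<and> x = x'"
    and diffeo: "C1_diffeo h"
    and outside: "fst p < comps D \<Longrightarrow> (\<And>m x. m < k \<Longrightarrow> x \<in> {a m..b m} \<Longrightarrow> \<not> same_point p (c m, x)) \<Longrightarrow>
      plane_at D p \<notin> h ` model_disc"
begin

abbreviation C where "C \<equiv> real_pair D"

lemma inj_h: "inj h"
  using diffeo unfolding C1_diffeo_def by (simp add: bij_is_inj)

definition outer :: "point \<Rightarrow> bool" where
  "outer p \<longleftrightarrow> (\<forall>m<k. \<forall>x\<in>{a m..b m}. \<not> same_point p (c m, x))"

definition \<xi> :: "nat \<Rightarrow> real \<Rightarrow> real" where
  "\<xi> m = inv_into {a m..b m} (\<tau> m)"

definition mk :: "nat \<Rightarrow> point" where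
  "mk i = (c (i div K), \<xi> (i div K) (t (i mod K)))"

definition inc :: "nat \<Rightarrow> bool" where
  "inc m \<longleftrightarrow> \<tau> m (a m) < \<tau> m (b m)"

text \<open>Even codes lie before a position in the direction of the model arc. If the circle runs
  through the arc in the opposite direction, these are outgoing germs, hence the comparison with
  \<open>inc\<close>.\<close>

definition Gm :: "nat \<Rightarrow> germ" where
  "Gm s = (rep (mk (s div 2)), odd s = inc (s div 2 div K))"

text \<open>Inside the disc all positions are marked, whether crossings are there or not, so this
  set is the same before and after a move. Circles that own an arc have marked points anyway; the
  others receive the integer points.\<close>

definition T :: "point set" where
  "T = {p. fst p < n \<and> (outer p \<and> chorded C p \<or> (\<exists>i<k * K. same_point p (mk i)) \<or>
     (\<forall>m<k. fst p \<noteq> c m) \<and> snd p \<in> \<int>)}"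

lemma xi:
  assumes "m < k" "s \<in> {-1..1}"
  shows "\<xi> m s \<in> {a m..b m}" "\<tau> m (\<xi> m s) = s"
proof -
  have s: "s \<in> \<tau> m ` {a m..b m}" using assms tau[OF assms(1)] unfolding bij_betw_def by simp
  show "\<xi> m s \<in> {a m..b m}" "\<tau> m (\<xi> m s) = s"
    unfolding \<xi>_def using inv_into_into[OF s] f_inv_into_f[OF s] .
qed

lemma xi_tau: "m < k \<Longrightarrow> x \<in> {a m..b m} \<Longrightarrow> \<xi> m (\<tau> m x) = x"
  using tau[of m] unfolding \<xi>_def bij_betw_def by (auto intro!: inv_into_f_f)

lemma tau_in: "m < k \<Longrightarrow> x \<in> {a m..b m} \<Longrightarrow> \<tau> m x \<in> {-1..1}"
  using tau[of m] bij_betwE by blast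

lemma tau_mono:
  assumes "m < k" "a m \<le> x" "x < y" "y \<le> b m"
  shows "inc m \<Longrightarrow> \<tau> m x < \<tau> m y" "\<not> inc m \<Longrightarrow> \<tau> m y < \<tau> m x"
  using mono_of_continuous_inj[of "a m" "b m" "\<tau> m" x y] arc tau assms unfolding inc_def bij_betw_def by auto

lemma xi_mono:
  assumes "m < k" "s \<in> {-1..1}" "s' \<in> {-1..1}" "s < s'"
  shows "inc m \<Longrightarrow> \<xi> m s < \<xi> m s'" "\<not> inc m \<Longrightarrow> \<xi> m s' < \<xi> m s"
  using xi[OF assms(1,2)] xi[OF assms(1,3)] tau_mono[OF assms(1), of "\<xi> m s'" "\<xi> m s"]
    tau_mono[OF assms(1), of "\<xi> m s" "\<xi> m s'"] assms(4)
  by (force simp: not_less order_le_less)+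

lemma id_arc: "i < k * K \<Longrightarrow> i div K < k" and id_pos: "i mod K < K"
  using K0 by (auto simp: less_mult_imp_div_less)

lemma t_in': "j < K \<Longrightarrow> t j \<in> {-1..1}"
  using t_in[of j] by simp

lemma t_eq: "j < K \<Longrightarrow> j' < K \<Longrightarrow> t j = t j' \<longleftrightarrow> j = j'"
  using t_mono[of j j'] t_mono[of j' j] by (metis less_irrefl linorder_neqE_nat)

lemma mk_arc: "i < k * K \<Longrightarrow> fst (mk i) = c (i div K) \<and> snd (mk i) \<in> {a (i div K)..b (i div K)}"
  unfolding mk_def using xi(1)[OF id_arc t_in'[OF id_pos]] by simp

lemma mk_dom: "i < k * K \<Longrightarrow> fst (mk i) < n"
  using mk_arc arc id_arc by metis

lemma mk_not_outer: "i < k * K \<Longrightarrow> same_point p (mk i) \<Longrightarrow> \<not> outer p"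
  unfolding outer_def using mk_arc[of i] id_arc[of i] by (metis prod.collapse)

lemma mk_eq:
  assumes "i < k * K" "i' < k * K" "same_point (mk i) (mk i')"
  shows "i = i'"
proof -
  have *: "i div K = i' div K \<and> snd (mk i) = snd (mk i')"
    using disj[OF id_arc[OF assms(1)] id_arc[OF assms(2)], of "snd (mk i)" "snd (mk i')"]
      mk_arc[OF assms(1)] mk_arc[OF assms(2)] assms(3) by (metis prod.collapse)
  then have "\<tau> (i div K) (snd (mk i)) = \<tau> (i' div K) (snd (mk i'))" by simp
  then have "t (i mod K) = t (i' mod K)"
    unfolding mk_def using xi(2)[OF id_arc t_in'[OF id_pos]] assms(1,2) by simp
  then have "i mod K = i' mod K" using t_eq id_pos by blast
  then show ?thesis using * by (metis div_mult_mod_eq)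
qed

lemma plane_arc: "m < k \<Longrightarrow> x \<in> {a m..b m} \<Longrightarrow> plane_at D (c m, x) = h (\<gamma> m (\<tau> m x))"
  unfolding plane_at_def using on_arc by simp

lemma inner_disc:
  assumes "fst p < n" "\<not> outer p"
  shows "plane_at D p \<in> h ` model_disc"
proof -
  obtain m x where mx: "m < k" "x \<in> {a m..b m}" "same_point p (c m, x)" using assms(2) unfolding outer_def by blast
  have "plane_at D p = h (\<gamma> m (\<tau> m x))" using plane_at_same[OF assms(1) mx(3)] plane_arc mx by simp
  then show ?thesis using disc[OF mx(1) tau_in[OF mx(1,2)]] by simp
qed

lemma outer_disc: "fst p < n \<Longrightarrow> outer p \<Longrightarrow> plane_at D p \<notin> h ` model_disc"
  using outside unfolding outer_def by blast

lemma outer_double: "double_pair D p q \<Longrightarrow> outer p \<longleftrightarrow> outer q"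
  using inner_disc outer_disc unfolding double_pair_def by metis

lemma outer_same: "same_point p q \<Longrightarrow> outer p \<longleftrightarrow> outer q"
  unfolding outer_def using same_point_trans same_point_sym by meson

lemma gamma_mk: "i < k * K \<Longrightarrow> plane_at D (mk i) = h (\<gamma> (i div K) (t (i mod K)))"
  unfolding mk_def using plane_arc[OF id_arc xi(1)] xi(2) id_arc t_in'[OF id_pos] by simp

lemma id_eq: "K * (i div K) + i mod K = i"
  by simp

lemma chord_double:
  assumes "(i, i') \<in> set chs"
  shows "double_pair D (mk i) (mk i')"
proof -
  have i: "i < k * K" "i' < k * K" "i \<noteq> i'" using chs_lt[OF assms] by auto
  have "(K * (i div K) + i mod K, K * (i' div K) + i' mod K) \<in> set chs" unfolding id_eq by (rule assms)
  then have "\<gamma> (i div K) (t (i mod K)) = \<gamma> (i' div K) (t (i' mod K))"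
    using model[OF id_arc[OF i(1)] id_arc[OF i(2)] t_in'[OF id_pos] t_in'[OF id_pos]] id_pos by blast
  then have "plane_at D (mk i) = plane_at D (mk i')" using gamma_mk i by simp
  then show ?thesis unfolding double_pair_def using mk_dom mk_eq i by blast
qed

lemma inner_double:
  assumes "double_pair D p q" "\<not> outer p"
  shows "\<exists>i<k * K. \<exists>i'<k * K. same_point p (mk i) \<and> same_point q (mk i') \<and> ((i, i') \<in> set chs \<or> (i', i) \<in> set chs)"
proof -
  have pq: "fst p < n" "fst q < n" "\<not> same_point p q" "plane_at D p = plane_at D q"
    using assms(1) unfolding double_pair_def by auto
  obtain m x where mx: "m < k" "x \<in> {a m..b m}" "same_point p (c m, x)" using assms(2) unfolding outer_def by blast
  have "\<not> outer q" using outer_double assms by blast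
  then obtain m' x' where mx': "m' < k" "x' \<in> {a m'..b m'}" "same_point q (c m', x')" unfolding outer_def by blast
  have "h (\<gamma> m (\<tau> m x)) = h (\<gamma> m' (\<tau> m' x'))"
    using plane_at_same[OF pq(1) mx(3)] plane_at_same[OF pq(2) mx'(3)] pq(4) plane_arc mx mx' by simp
  then have "\<gamma> m (\<tau> m x) = \<gamma> m' (\<tau> m' x')" using inj_h by (simp add: inj_eq)
  moreover have "\<not> (m = m' \<and> \<tau> m x = \<tau> m' x')"
  proof
    assume *: "m = m' \<and> \<tau> m x = \<tau> m' x'"
    then have "x = x'" using xi_tau mx mx' by metis
    then show False using * mx(3) mx'(3) pq(3) same_point_sym same_point_trans by blast
  qed
  ultimately obtain j j' where j: "j < K" "j' < K" "\<tau> m x = t j" "\<tau> m' x' = t j'"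
    "(K * m + j, K * m' + j') \<in> set chs \<or> (K * m' + j', K * m + j) \<in> set chs"
    using model[OF mx(1) mx'(1) tau_in[OF mx(1,2)] tau_in[OF mx'(1,2)]] by blast
  have "mk (K * m + j) = (c m, x)" "mk (K * m' + j') = (c m', x')"
    unfolding mk_def using j K0 xi_tau[OF mx(1,2)] xi_tau[OF mx'(1,2)] by (simp_all add: j(3,4)[symmetric])
  moreover have "K * m + j < k * K" "K * m' + j' < k * K" using chs_lt j(5) by blast+
  ultimately show ?thesis using j(5) mx(3) mx'(3) by metis
qed

lemma T_marked: "marked n C T"
proof
  fix p q i
  show "p \<in> T \<Longrightarrow> fst p < n" unfolding T_def by simp
  show "q \<in> T" if "p \<in> T" "same_point p q"
  proof -
    have fq: "fst q = fst p" and d: "snd p - snd q \<in> \<int>" using that(2) unfolding same_point_def by auto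
    have "snd q \<in> \<int>" if "snd p \<in> \<int>" using Ints_diff[OF that d] by simp
    moreover have "same_point q (mk j)" if "same_point p (mk j)" for j
      using same_point_trans[OF same_point_sym[OF \<open>same_point p q\<close>] that] .
    ultimately show ?thesis using that(1) C_ex_same[OF that(2)] outer_same[OF that(2)] fq unfolding T_def by auto
  qed
  have "{p \<in> T. base p} \<subseteq> {p. base p \<and> chorded C p} \<union> (\<lambda>i. rep (mk i)) ` {..<k * K} \<union> (\<lambda>i. (i, 0)) ` {..<n}"
  proof
    fix p assume p: "p \<in> {p \<in> T. base p}"
    have "p = rep (mk i)" if "same_point p (mk i)" for i
      using that p by (metis (mono_tags) mem_Collect_eq rep_eq_iff rep_base)
    moreover have "p = (fst p, 0)" if "snd p \<in> \<int>"
      using that p unfolding base_def by (auto elim!: Ints_cases simp: prod_eq_iff)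
    ultimately show "p \<in> {p. base p \<and> chorded C p} \<union> (\<lambda>i. rep (mk i)) ` {..<k * K} \<union> (\<lambda>i. (i, 0)) ` {..<n}"
      using p unfolding T_def by blast
  qed
  then show "finite {p \<in> T. base p}" by (rule finite_subset) (simp add: C_fin)
  show "\<exists>x. (i, x) \<in> T" if "i < n"
  proof (cases "\<exists>m<k. i = c m")
    case True
    then obtain m where m: "m < k" "i = c m" by blast
    have "K * m < k * K" using m(1) K0 by (simp add: mult.commute)
    moreover have "fst (mk (K * m)) = i" unfolding mk_def using m K0 by simp
    ultimately have "mk (K * m) \<in> T" "mk (K * m) = (i, snd (mk (K * m)))"
      unfolding T_def using mk_dom[of "K * m"] same_point_refl by (blast, simp add: prod_eq_iff)
    then show ?thesis by metis
  next
    case False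
    then have "(i, 0) \<in> T" unfolding T_def using that by auto
    then show ?thesis by blast
  qed
  show "p \<in> T" if CP: "C p q"
  proof (cases "outer p")
    case False
    then obtain i where "i < k * K" "same_point p (mk i)" using inner_double[OF real_pairD[OF CP]] by blast
    then show ?thesis unfolding T_def using C_dom[OF CP] by blast
  qed (use that C_dom chordedI[of C] in \<open>auto simp: T_def\<close>)
qed

sublocale marked n C T by (rule T_marked)

lemma mk_T: "i < k * K \<Longrightarrow> mk i \<in> T"
  unfolding T_def using mk_dom by auto

lemma T_inside:
  assumes m: "m < k" and z: "z \<in> {a m..b m}" "(c m, z) \<in> T"
  shows "\<exists>j<K. z = \<xi> m (t j)"
proof -
  have "\<not> outer (c m, z)" unfolding outer_def using m z(1) same_point_refl by blast
  then obtain i where i: "i < k * K" "same_point (c m, z) (mk i)" using z(2) m unfolding T_def by auto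
  have "m = i div K \<and> z = snd (mk i)"
    using disj[OF m id_arc[OF i(1)] z(1), of "snd (mk i)"] mk_arc[OF i(1)] i(2) by (metis prod.collapse)
  then show ?thesis unfolding mk_def using id_pos by auto
qed

lemma div_mod_block: "j < K \<Longrightarrow> (K * m + j) div K = m" "j < K \<Longrightarrow> (K * m + j) mod K = j"
  using K0 by simp_all

text \<open>\<open>T\<close> meets an arc only in its positions, so neighbouring positions are
  consecutive marked points, in the order prescribed by the direction of the arc.\<close>

lemma nxt_mk:
  assumes m: "m < k" and j: "Suc j < K"
  shows "inc m \<Longrightarrow> nxt (rep (mk (K * m + j))) = rep (mk (Suc (K * m + j)))"
    "\<not> inc m \<Longrightarrow> nxt (rep (mk (Suc (K * m + j)))) = rep (mk (K * m + j))"
proof -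
  have c: "c m < n" using arc[OF m] by blast
  have mk: "mk (K * m + j) = (c m, \<xi> m (t j))" "mk (Suc (K * m + j)) = (c m, \<xi> m (t (Suc j)))"
    unfolding mk_def by (use K0 j div_mod_block[of j] div_mod_block[of "Suc j"] in simp_all)
  have tj: "t j \<in> {-1..1}" "t (Suc j) \<in> {-1..1}" "t j < t (Suc j)" using t_in' t_mono j by auto
  have lt: "K * m + j < k * K" "Suc (K * m + j) < k * K"
  proof -
    have "Suc (K * m + j) < K * Suc m" using j by simp
    also have "\<dots> \<le> K * k" by (rule mult_le_mono2) (use m in simp)
    finally show "Suc (K * m + j) < k * K" "K * m + j < k * K" by (simp_all add: mult.commute)
  qed
  have T: "(c m, \<xi> m (t j)) \<in> T" "(c m, \<xi> m (t (Suc j))) \<in> T" using mk_T lt mk by metis+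
  have no: "(c m, z) \<notin> T" if z: "z \<in> {a m..b m}" "t j < \<tau> m z" "\<tau> m z < t (Suc j)" for z
  proof
    assume "(c m, z) \<in> T"
    then obtain j' where j': "j' < K" "z = \<xi> m (t j')" using T_inside[OF m z(1)] by blast
    then have "t j < t j'" "t j' < t (Suc j)" using z(2,3) xi(2)[OF m t_in'[OF j'(1)]] by auto
    moreover have "j' \<le> j \<or> Suc j \<le> j'" by linarith
    ultimately show False using t_mono[of j' j] t_mono[of "Suc j" j'] j j' by (auto simp: le_less)
  qed
  note x = xi[OF m tj(1)] xi[OF m tj(2)]
  show "nxt (rep (mk (K * m + j))) = rep (mk (Suc (K * m + j)))" if inc: "inc m"
  proof -
    have "nx (c m) (\<xi> m (t j)) = \<xi> m (t (Suc j))"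
    proof (rule nx_unique[OF c xi_mono(1)[OF m tj inc] T(2)])
      fix z assume z: "\<xi> m (t j) < z" "z < \<xi> m (t (Suc j))"
      then have zi: "z \<in> {a m..b m}" using x by auto
      have "\<tau> m (\<xi> m (t j)) < \<tau> m z" "\<tau> m z < \<tau> m (\<xi> m (t (Suc j)))"
        using tau_mono(1)[OF m _ _ _ inc, of "\<xi> m (t j)" z] tau_mono(1)[OF m _ _ _ inc, of z "\<xi> m (t (Suc j))"] z zi x by auto
      then show "(c m, z) \<notin> T" using no[OF zi] x by simp
    qed
    then show ?thesis using nxt_rep[of "mk (K * m + j)"] c unfolding mk by (simp add: nxt_def)
  qed
  show "nxt (rep (mk (Suc (K * m + j)))) = rep (mk (K * m + j))" if inc: "\<not> inc m"
  proof -
    have "nx (c m) (\<xi> m (t (Suc j))) = \<xi> m (t j)"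
    proof (rule nx_unique[OF c xi_mono(2)[OF m tj inc] T(1)])
      fix z assume z: "\<xi> m (t (Suc j)) < z" "z < \<xi> m (t j)"
      then have zi: "z \<in> {a m..b m}" using x by auto
      have "\<tau> m (\<xi> m (t j)) < \<tau> m z" "\<tau> m z < \<tau> m (\<xi> m (t (Suc j)))"
        using tau_mono(2)[OF m _ _ _ inc, of z "\<xi> m (t j)"] tau_mono(2)[OF m _ _ _ inc, of "\<xi> m (t (Suc j))" z] z zi x by auto
      then show "(c m, z) \<notin> T" using no[OF zi] x by simp
    qed
    then show ?thesis using nxt_rep[of "mk (Suc (K * m + j))"] c unfolding mk by (simp add: nxt_def)
  qed
qed

lemma rep_mk_PT: "i < k * K \<Longrightarrow> rep (mk i) \<in> PT"
  using rep_PT mk_T by blast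

lemma Gm_VT: "s < 2 * k * K \<Longrightarrow> Gm s \<in> VT"
  unfolding Gm_def VT_def using rep_mk_PT[of "s div 2"] by auto

lemma Gm_inj: "inj_on Gm {..<2 * k * K}"
proof (rule inj_onI)
  fix s s' assume s: "s \<in> {..<2 * k * K}" "s' \<in> {..<2 * k * K}" and eq: "Gm s = Gm s'"
  then have "same_point (mk (s div 2)) (mk (s' div 2))" unfolding Gm_def by (simp add: rep_eq_iff)
  then have d: "s div 2 = s' div 2" using mk_eq[of "s div 2" "s' div 2"] s by auto
  then have "odd s = odd s'" using eq unfolding Gm_def by auto
  then show "s = s'" using d by presburger
qed

lemma along_Gm:
  assumes "m < k" "Suc j < K"
  shows "along (Gm (2 * (K * m + j) + 1)) = Gm (2 * (K * m + j) + 2)"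
proof -
  let ?i = "K * m + j"
  have dv: "?i div K = m" "Suc ?i div K = m" using assms K0
    using div_mod_block[of j] div_mod_block[of "Suc j"] by simp_all
  have lt: "Suc ?i < k * K"
  proof -
    have "Suc ?i < K * Suc m" using assms(2) by simp
    also have "\<dots> \<le> K * k" by (rule mult_le_mono2) (use assms(1) in simp)
    finally show ?thesis by (simp add: mult.commute)
  qed
  have "Gm (2 * ?i + 1) = (rep (mk ?i), inc m)" "Gm (2 * ?i + 2) = (rep (mk (Suc ?i)), \<not> inc m)"
    unfolding Gm_def using dv by simp_all
  then show ?thesis
    using nxt_mk[OF assms] prv_nxt[OF rep_mk_PT[OF lt]] unfolding along_def by (cases "inc m") simp_all
qed

lemma link_Gm_thru:
  assumes "i < k * K" "\<not> chorded C (mk i)"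
  shows "link Q (Gm (2 * i)) = Gm (2 * i + 1)" "link Q (Gm (2 * i + 1)) = Gm (2 * i)"
  using assms(2) C_ex_same[OF same_point_rep, of "mk i"] unfolding Gm_def link_def by auto

text \<open>If exactly one of the two arcs is traversed against its model direction, the smoothing
  along the orientation is \<open>Anti\<close> in the model.\<close>

definition parallel :: "(point \<Rightarrow> bool) \<Rightarrow> nat \<Rightarrow> nat \<Rightarrow> bool" where
  "parallel Q i i' \<longleftrightarrow> Q (mk i) = (inc (i div K) = inc (i' div K))"

lemma link_Gm_chord:
  assumes C: "C (mk i) (mk i')" and Q: "state Q"
  shows "link Q (Gm (2 * i)) = Gm (if parallel Q i i' then 2 * i' + 1 else 2 * i')"
    "link Q (Gm (2 * i + 1)) = Gm (if parallel Q i i' then 2 * i' else 2 * i' + 1)"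
proof -
  have C': "C (rep (mk i)) (rep (mk i'))" using C_per[OF C same_point_rep same_point_rep] .
  have "Q (rep (mk i)) = Q (mk i)" using Q same_point_rep unfolding state_def by metis
  then have l: "link Q (rep (mk i), e) = (rep (mk i'), if Q (mk i) then \<not> e else e)" for e
    using link_chord[OF C' rep_PT[OF T_C[OF C_sym[OF C]]]] by simp
  show "link Q (Gm (2 * i)) = Gm (if parallel Q i i' then 2 * i' + 1 else 2 * i')"
    "link Q (Gm (2 * i + 1)) = Gm (if parallel Q i i' then 2 * i' else 2 * i' + 1)"
    unfolding Gm_def parallel_def by (auto simp: l)
qed

definition smooth_type :: "(point \<Rightarrow> bool) \<Rightarrow> nat \<Rightarrow> nat \<Rightarrow> smoothing" where
  "smooth_type Q i i' = (if \<not> C (mk i) (mk i') then Thru else if parallel Q i i' then Par else Anti)"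

definition inner_pairs :: "(point \<Rightarrow> bool) \<Rightarrow> (nat \<times> nat) list" where
  "inner_pairs Q = tangle_pairs k K (map (\<lambda>(i, i'). (i, i', smooth_type Q i i')) chs) rest"

text \<open>The part of the finite graph outside the tangle. Edges between neighbouring positions of
  an arc are left to the tangle; an \<open>along\<close> edge that joins two ends, or an end to an
  outer germ, belongs to the rest.\<close>

definition rest_rel :: "(point \<Rightarrow> bool) \<Rightarrow> germ \<Rightarrow> germ \<Rightarrow> bool" where
  "rest_rel Q u v \<longleftrightarrow>
     u \<in> VT \<and> v = along u \<and> u \<notin> Gm ` ({..<2 * k * K} - set (tangle_ends k K)) \<and>
       v \<notin> Gm ` ({..<2 * k * K} - set (tangle_ends k K)) \<or>
     u \<in> VT - Gm ` {..<2 * k * K} \<and> v = link Q u"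

lemma chorded_mk:
  assumes "i < k * K" "chorded C (mk i)"
  shows "\<exists>i'. ((i, i') \<in> set chs \<or> (i', i) \<in> set chs) \<and> C (mk i) (mk i')"
proof -
  obtain q where q: "C (mk i) q" using assms(2) unfolding chorded_def by blast
  have "\<not> outer (mk i)" using mk_not_outer[OF assms(1)] same_point_refl by blast
  then obtain j j' where j: "j < k * K" "j' < k * K" "same_point (mk i) (mk j)" "same_point q (mk j')"
    "(j, j') \<in> set chs \<or> (j', j) \<in> set chs" using inner_double[OF real_pairD[OF q]] by blast
  have "i = j" using mk_eq assms(1) j by blast
  moreover have "C (mk i) (mk j')" using C_per[OF q same_point_refl j(4)] .
  ultimately show ?thesis using j(5) by blast
qed

lemma in_inner_pairs:
  "(u, v) \<in> set (inner_pairs Q) \<longleftrightarrow>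
    (\<exists>m<k. \<exists>j. Suc j < K \<and> u = 2 * (K * m + j) + 1 \<and> v = 2 * (K * m + j) + 2) \<or>
    (\<exists>(i, i')\<in>set chs. (u, v) \<in> set (chord_pairs (smooth_type Q i i') i i')) \<or>
    (\<exists>i\<in>set rest. u = 2 * i \<and> v = 2 * i + 1)"
proof -
  have "(u, v) \<in> set (strand_pairs k K) \<longleftrightarrow>
      (\<exists>m<k. \<exists>j. Suc j < K \<and> u = 2 * (K * m + j) + 1 \<and> v = 2 * (K * m + j) + 2)"
  proof
    assume "\<exists>m<k. \<exists>j. Suc j < K \<and> u = 2 * (K * m + j) + 1 \<and> v = 2 * (K * m + j) + 2"
    then obtain m j where mj: "m < k" "j < K - 1" "u = 2 * (K * m + j) + 1" "v = 2 * (K * m + j) + 2" by force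
    then show "(u, v) \<in> set (strand_pairs k K)" unfolding strand_pairs_def by (auto intro!: bexI[of _ m] image_eqI[of _ _ j])
  qed (auto simp: strand_pairs_def less_diff_conv)
  then show ?thesis unfolding inner_pairs_def tangle_pairs_def by auto
qed

lemma Gm_link:
  assumes i: "i < k * K" and Q: "state Q" and s: "s = 2 * i \<or> s = 2 * i + 1"
  shows "\<exists>s'<2 * k * K. link Q (Gm s) = Gm s' \<and> ((s, s') \<in> set (inner_pairs Q) \<or> (s', s) \<in> set (inner_pairs Q))"
proof (cases "\<exists>i'. (i, i') \<in> set chs \<or> (i', i) \<in> set chs")
  case False
  then have "i \<in> set rest" using rest i by auto
  moreover have "\<not> chorded C (mk i)" using chorded_mk[OF i] False by blast
  ultimately have "(2 * i, 2 * i + 1) \<in> set (inner_pairs Q)" "link Q (Gm (2 * i)) = Gm (2 * i + 1)"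
      "link Q (Gm (2 * i + 1)) = Gm (2 * i)"
    unfolding in_inner_pairs using link_Gm_thru[OF i] by blast+
  moreover have "2 * i + 1 < 2 * k * K" using i by simp
  ultimately show ?thesis using s by (metis Suc_eq_plus1 Suc_lessD)
next
  case True
  then obtain i' where i': "(i, i') \<in> set chs \<or> (i', i) \<in> set chs" by blast
  have lt: "i' < k * K" using chs_lt i' by blast
  show ?thesis
  proof (cases "C (mk i) (mk i')")
    case True
    have par: "parallel Q i' i = parallel Q i i'"
      using Q True unfolding parallel_def state_def by (metis (full_types))
    note l = link_Gm_chord[OF True Q]
    have C': "C (mk i') (mk i)" using C_sym[OF True] .
    define s' where "s' = (if s = 2 * i then if parallel Q i i' then 2 * i' + 1 else 2 * i' else if parallel Q i i' then 2 * i' else 2 * i' + 1)"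
    have "link Q (Gm s) = Gm s'" "s' < 2 * k * K" unfolding s'_def using s l lt by auto
    moreover have "(s, s') \<in> set (inner_pairs Q) \<or> (s', s) \<in> set (inner_pairs Q)"
      using i'
    proof
      assume ch: "(i, i') \<in> set chs"
      have "(s, s') \<in> set (chord_pairs (smooth_type Q i i') i i')"
        unfolding smooth_type_def s'_def using True s by (cases "parallel Q i i'") auto
      then show ?thesis unfolding in_inner_pairs using ch by blast
    next
      assume ch: "(i', i) \<in> set chs"
      have "(s', s) \<in> set (chord_pairs (smooth_type Q i' i) i' i)"
        unfolding smooth_type_def s'_def using C' s par by (cases "parallel Q i i'") auto
      then show ?thesis unfolding in_inner_pairs using ch by blast
    qed
    ultimately show ?thesis by blast
  next
    case False
    have "\<not> chorded C (mk i)"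
    proof
      assume "chorded C (mk i)"
      then obtain j where j: "(i, j) \<in> set chs \<or> (j, i) \<in> set chs" "C (mk i) (mk j)" using chorded_mk[OF i] by blast
      have "double_pair D (mk i) (mk i')" using i' chord_double double_pair_sym by blast
      then have "same_point (mk j) (mk i')" using triple_free[OF real_pairD[OF j(2)]] by blast
      then show False using False C_per[OF j(2) same_point_refl] by blast
    qed
    note l = link_Gm_thru[OF i this]
    have nC: "\<not> C (mk i') (mk i)" using False C_sym by blast
    define s' where "s' = (if s = 2 * i then 2 * i + 1 else 2 * i)"
    have "link Q (Gm s) = Gm s'" "s' < 2 * k * K" unfolding s'_def using s l i by auto
    moreover have "(s, s') \<in> set (inner_pairs Q) \<or> (s', s) \<in> set (inner_pairs Q)"
      using i'
    proof
      assume ch: "(i, i') \<in> set chs"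
      have "(s, s') \<in> set (chord_pairs (smooth_type Q i i') i i') \<or> (s', s) \<in> set (chord_pairs (smooth_type Q i i') i i')"
        unfolding smooth_type_def s'_def using False s by auto
      then show ?thesis unfolding in_inner_pairs using ch by blast
    next
      assume ch: "(i', i) \<in> set chs"
      have "(s, s') \<in> set (chord_pairs (smooth_type Q i' i) i' i) \<or> (s', s) \<in> set (chord_pairs (smooth_type Q i' i) i' i)"
        unfolding smooth_type_def s'_def using nC s by auto
      then show ?thesis unfolding in_inner_pairs using ch by blast
    qed
    ultimately show ?thesis by blast
  qed
qed

lemma link_leaves_tangle:
  assumes "u \<in> VT - Gm ` {..<2 * k * K}" "state Q"
  shows "link Q u \<notin> Gm ` {..<2 * k * K}"
proof
  assume "link Q u \<in> Gm ` {..<2 * k * K}"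
  then obtain s where s: "s < 2 * k * K" "link Q u = Gm s" by auto
  have "s div 2 < k * K" "s = 2 * (s div 2) \<or> s = 2 * (s div 2) + 1" using s(1) by auto
  then obtain s' where "s' < 2 * k * K" "link Q (Gm s) = Gm s'" using Gm_link[OF _ assms(2)] by blast
  moreover have "link Q (Gm s) = u" using link_link[OF _ assms(2), of u] assms(1) s(2) by simp
  ultimately show False using assms(1) by auto
qed

lemma coded_rest: "state Q \<Longrightarrow> coded_tangle VT (rest_rel Q) Gm k K"
proof unfold_locales
  fix u v assume Q: "state Q" and "rest_rel Q u v"
  then show "u \<notin> Gm ` ({..<2 * k * K} - set (tangle_ends k K)) \<and> v \<notin> Gm ` ({..<2 * k * K} - set (tangle_ends k K))"
    unfolding rest_rel_def using link_leaves_tangle[OF _ Q, of u] by auto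
qed (use finite_VT Gm_inj Gm_VT in auto)

lemma inner_germ:
  assumes "s \<in> {..<2 * k * K} - set (tangle_ends k K)"
  shows "\<exists>m<k. \<exists>j. Suc j < K \<and> (s = 2 * (K * m + j) + 1 \<or> s = 2 * (K * m + j) + 2)"
proof -
  let ?i = "s div 2"
  define m j where "m = ?i div K" "j = ?i mod K"
  have m: "m < k" using assms id_arc[of ?i] unfolding m_j_def by auto
  have j: "j < K" unfolding m_j_def by (rule id_pos)
  have i: "?i = K * m + j" unfolding m_j_def by simp
  have ends: "s \<noteq> 2 * (K * m)" "s \<noteq> 2 * (K * m + (K - 1)) + 1"
    using assms m unfolding tangle_ends_def by auto
  show ?thesis
  proof (cases "even s")
    case True
    then have s: "s = 2 * (K * m + j)" using i by auto
    then obtain j' where "j = Suc j'" using ends(1) by (cases j) auto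
    then show ?thesis using s m j by (intro exI[of _ m] conjI exI[of _ j']) auto
  next
    case False
    then have s: "s = 2 * (K * m + j) + 1" using i by (metis odd_two_times_div_two_succ)
    then have "Suc j < K" using ends(2) j by (cases "j = K - 1") auto
    then show ?thesis using s m by blast
  qed
qed

text \<open>The finite graph of the diagram is the rest with the coded tangle glued in; only the
  direction in which edges are listed differs.\<close>

lemma ncls_tangle:
  assumes Q: "state Q"
  shows "loops n C Q = coded_tangle.count VT (rest_rel Q) Gm (inner_pairs Q)"
proof -
  interpret ct: coded_tangle VT "rest_rel Q" Gm k K by (rule coded_rest[OF Q])
  let ?In = "{..<2 * k * K} - set (tangle_ends k K)"
  let ?R = "glue_rel (rest_rel Q) Gm (pairs_rel (inner_pairs Q))"
  have pair: "?R (Gm s) (Gm s')" if "(s, s') \<in> set (inner_pairs Q)" for s s'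
    using that unfolding glue_rel_def pairs_rel_def by blast
  have strand: "equivclp ?R (Gm s) (along (Gm s))" if s: "s \<in> ?In" for s
  proof -
    obtain m j where mj: "m < k" "Suc j < K" "s = 2 * (K * m + j) + 1 \<or> s = 2 * (K * m + j) + 2"
      using inner_germ[OF s] by blast
    have st: "(2 * (K * m + j) + 1, 2 * (K * m + j) + 2) \<in> set (inner_pairs Q)" unfolding in_inner_pairs using mj by blast
    have al: "along (Gm (2 * (K * m + j) + 1)) = Gm (2 * (K * m + j) + 2)" by (rule along_Gm[OF mj(1,2)])
    have "2 * (K * m + j) + 1 < 2 * k * K"
      using s mj(3) by auto
    then have al': "along (Gm (2 * (K * m + j) + 2)) = Gm (2 * (K * m + j) + 1)"
      using along_along[OF Gm_VT] al by metis
    show ?thesis using mj(3) pair[OF st] al al' by auto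
  qed
  have "ncls VT (tree_rel Q) = ncls VT ?R"
  proof (rule ncls_cong)
    fix u v assume R: "tree_rel Q u v"
    then have u: "u \<in> VT" and v: "v = along u \<or> v = link Q u" unfolding tree_rel_def by auto
    show "equivclp ?R u v"
    proof (cases "v = along u")
      case True
      consider "u \<in> Gm ` ?In" | "v \<in> Gm ` ?In" | "u \<notin> Gm ` ?In" "v \<notin> Gm ` ?In" by blast
      then show ?thesis
      proof cases
        case 1
        then show ?thesis using strand True by blast
      next
        case 2
        then have "equivclp ?R v (along v)" using strand by blast
        then show ?thesis using along_along[OF u] True equivclp_sym by metis
      next
        case 3
        then have "rest_rel Q u v" unfolding rest_rel_def using True u by blast
        then show ?thesis unfolding glue_rel_def by blast
      qed
    next
      case False
      then have v: "v = link Q u" using v by blast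
      show ?thesis
      proof (cases "u \<in> Gm ` {..<2 * k * K}")
        case True
        then obtain s where s: "s < 2 * k * K" "u = Gm s" by auto
        have "s div 2 < k * K" "s = 2 * (s div 2) \<or> s = 2 * (s div 2) + 1" using s(1) by auto
        then obtain s' where "link Q (Gm s) = Gm s'" "(s, s') \<in> set (inner_pairs Q) \<or> (s', s) \<in> set (inner_pairs Q)"
          using Gm_link[OF _ Q] by blast
        then show ?thesis using pair v s(2) by auto
      next
        case False
        then have "rest_rel Q u v" unfolding rest_rel_def using v u by blast
        then show ?thesis unfolding glue_rel_def by blast
      qed
    qed
  next
    fix u v assume "?R u v"
    then have "rest_rel Q u v \<or> (\<exists>s s'. (s, s') \<in> set (inner_pairs Q) \<and> u = Gm s \<and> v = Gm s')"
      unfolding glue_rel_def pairs_rel_def by blast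
    then show "equivclp (tree_rel Q) u v"
    proof
      assume "rest_rel Q u v"
      then have "tree_rel Q u v" unfolding rest_rel_def tree_rel_def by blast
      then show ?thesis by blast
    next
      assume "\<exists>s s'. (s, s') \<in> set (inner_pairs Q) \<and> u = Gm s \<and> v = Gm s'"
      then obtain s s' where ss: "(s, s') \<in> set (inner_pairs Q)" "u = Gm s" "v = Gm s'" by blast
      have al: "equivclp (tree_rel Q) (Gm (2 * (K * m + j) + 1)) (Gm (2 * (K * m + j) + 2))" if "m < k" "Suc j < K" for m j
      proof -
        have "2 * (K * m + j) + 1 < 2 * k * K"
        proof -
          have "Suc (K * m + j) < K * Suc m" using that(2) by simp
          also have "\<dots> \<le> K * k" by (rule mult_le_mono2) (use that(1) in simp)
          finally show ?thesis by (simp add: mult.commute)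
        qed
        then have "tree_rel Q (Gm (2 * (K * m + j) + 1)) (Gm (2 * (K * m + j) + 2))"
          unfolding tree_rel_def using along_Gm[OF that] Gm_VT by simp
        then show ?thesis by blast
      qed
      have lk: "equivclp (tree_rel Q) (Gm r) (link Q (Gm r))" if "r < 2 * k * K" for r
        using Gm_VT[OF that] unfolding tree_rel_def by blast
      from ss(1) consider (strand) m j where "m < k" "Suc j < K" "s = 2 * (K * m + j) + 1" "s' = 2 * (K * m + j) + 2"
        | (chord) i i' where "(i, i') \<in> set chs" "(s, s') \<in> set (chord_pairs (smooth_type Q i i') i i')"
        | (rest) i where "i \<in> set rest" "s = 2 * i" "s' = 2 * i + 1"
        unfolding in_inner_pairs by blast
      then show ?thesis
      proof cases
        case strand
        then show ?thesis using al ss by simp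
      next
        case chord
        have i: "i < k * K" "i' < k * K" using chs_lt chord(1) by blast+
        show ?thesis
        proof (cases "C (mk i) (mk i')")
          case True
          then show ?thesis
            using chord(2) link_Gm_chord[OF True Q] lk[of "2 * i"] lk[of "2 * i + 1"] i ss
            unfolding smooth_type_def by (cases "parallel Q i i'") auto
        next
          case False
          have "\<not> chorded C (mk i)" "\<not> chorded C (mk i')"
          proof -
            have *: "\<not> chorded C (mk r)" if r: "(r, r') \<in> set chs \<or> (r', r) \<in> set chs" "\<not> C (mk r) (mk r')" for r r'
            proof
              assume "chorded C (mk r)"
              then obtain q where q: "C (mk r) q" unfolding chorded_def by blast
              have "double_pair D (mk r) (mk r')" using r(1) chord_double double_pair_sym by blast
              then have "same_point q (mk r')" using triple_free[OF real_pairD[OF q]] by blast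
              then show False using r(2) C_per[OF q same_point_refl] by blast
            qed
            show "\<not> chorded C (mk i)" "\<not> chorded C (mk i')" using *[of i i'] *[of i' i] chord(1) False C_sym by blast+
          qed
          then show ?thesis
            using chord(2) link_Gm_thru[OF i(1)] link_Gm_thru[OF i(2)] lk[of "2 * i"] lk[of "2 * i'"] i ss False
            unfolding smooth_type_def by auto
        qed
      next
        case rest'': rest
        then have i: "i < k * K" and "\<not> (\<exists>i'. (i, i') \<in> set chs \<or> (i', i) \<in> set chs)" using rest by auto
        then have "\<not> chorded C (mk i)" using chorded_mk by blast
        then show ?thesis using link_Gm_thru[OF i] lk[of "2 * i"] i ss rest'' by simp
      qed
    qed
  qed
  then show ?thesis unfolding loops_VT[OF Q] ct.count_def .
qed

end

section \<open>Replacing the tangle in a disc\<close>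

context arcs
begin

definition inner :: "complex set" where
  "inner = {z. \<exists>(i, i')\<in>set chs. C (mk i) (mk i') \<and> z = plane_at D (mk i)}"

lemma mk_disc: "i < k * K \<Longrightarrow> plane_at D (mk i) \<in> h ` model_disc"
  using inner_disc[OF mk_dom mk_not_outer[OF _ same_point_refl]] .

lemma inner_in_disc: "inner \<subseteq> h ` model_disc"
  unfolding inner_def using mk_disc chs_lt by fastforce

lemma crossings_inner: "crossings \<inter> h ` model_disc = inner"
proof (intro equalityI subsetI)
  fix z assume z: "z \<in> crossings \<inter> h ` model_disc"
  then obtain p q where p: "C p q" "plane_at D p = z" by (blast elim: crossingsE)
  have "\<not> outer p" using outer_disc[OF C_dom[OF p(1)]] p(2) z by blast
  then obtain i i' where i: "i < k * K" "i' < k * K" "same_point p (mk i)" "same_point q (mk i')"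
    "(i, i') \<in> set chs \<or> (i', i) \<in> set chs" using inner_double[OF real_pairD[OF p(1)]] by blast
  have "C (mk i) (mk i')" using C_per[OF p(1) i(3,4)] .
  moreover from this have "C (mk i') (mk i)" by (rule C_sym)
  moreover have "z = plane_at D (mk i)" using p plane_at_same[OF C_dom[OF p(1)] i(3)] by simp
  moreover have "plane_at D (mk i) = plane_at D (mk i')" by (rule real_pair_plane) fact
  ultimately show "z \<in> inner" unfolding inner_def using i(5) by auto
next
  fix z assume "z \<in> inner"
  then show "z \<in> crossings \<inter> h ` model_disc" using inner_in_disc in_crossings unfolding inner_def by blast
qed

lemma compact_disc: "compact (h ` model_disc)"
proof (rule compact_continuous_image)
  obtain h' where h': "\<And>z. (h has_derivative blinfun_apply (h' z)) (at z)"
    using diffeo unfolding C1_diffeo_def C1_map_def by blast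
  show "continuous_on model_disc h"
    using has_derivative_continuous[OF h'] by (simp add: continuous_at_imp_continuous_on)
  have "model_disc = cbox (Complex (-1) (-1)) (Complex 1 1)"
    unfolding model_disc_def by (auto simp: in_cbox_complex_iff)
  then show "compact model_disc" by (metis compact_cbox)
qed

lemma outer_open: "i < n \<Longrightarrow> open {x. plane_at D (i, x) \<notin> h ` model_disc}"
  unfolding plane_at_def using curve_continuous[of i UNIV] compact_disc
  by (simp add: open_vimage[of "- h ` model_disc", unfolded vimage_def, simplified] compact_imp_closed open_Compl)

text \<open>A marked point that belongs to an arc is one of its positions, and both germs there
  carry codes.\<close>

lemma outer_germ:
  assumes "u \<in> VT - Gm ` {..<2 * k * K}"
  shows "outer (fst u)"
proof (rule ccontr)
  assume no: "\<not> outer (fst u)"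
  have u: "fst u \<in> T" "base (fst u)" using assms unfolding VT_def PT_def by auto
  from no obtain m where "m < k" "fst (fst u) = c m" unfolding outer_def same_point_def by auto
  then obtain i where i: "i < k * K" "same_point (fst u) (mk i)" using u(1) no unfolding T_def by blast
  have r: "fst u = rep (mk i)" using rep_eq_iff[of "fst u" "mk i"] i(2) rep_base[OF u(2)] by metis
  define s where "s = (if snd u = inc (i div K) then 2 * i + 1 else 2 * i)"
  have "u = Gm s" "s < 2 * k * K" unfolding s_def Gm_def using r i(1) by (auto simp: prod_eq_iff)
  then show False using assms by auto
qed

lemma inner_pairs_disc:
  assumes "S \<inter> h ` model_disc = {}"
  shows "inner_pairs (smoothed (S \<union> X)) = inner_pairs (smoothed X)"
proof -
  have "smooth_type (smoothed (S \<union> X)) i i' = smooth_type (smoothed X) i i'" if "(i, i') \<in> set chs" for i i'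
    using mk_disc[of i] chs_lt[OF that] assms unfolding smooth_type_def parallel_def smoothed_def by auto
  then show ?thesis unfolding inner_pairs_def by (auto intro!: arg_cong[where f = "\<lambda>l. tangle_pairs k K l rest"])
qed

lemma circles_tangle:
  assumes "S \<inter> h ` model_disc = {}"
  shows "circles (S \<union> X) = coded_tangle.count VT (rest_rel (smoothed (S \<union> X))) Gm (inner_pairs (smoothed X))"
  unfolding circles_def ncls_tangle[OF state_smoothed] inner_pairs_disc[OF assms] ..

end

locale local_pair = A: arcs D k K t \<gamma> chs rest c a b \<tau> h + B: arcs D' k K t \<gamma>' chs' rest' c a b \<tau> h
  for D D' k K t \<gamma> chs rest \<gamma>' chs' rest' c a b \<tau> h +
  assumes comps: "comps D' = comps D"
    and agree: "fst p < comps D \<Longrightarrow> A.outer p \<Longrightarrow>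
      plane_at D' p = plane_at D p \<and> (double_preimage D p \<longrightarrow> label_at D' p = label_at D p)"
begin

lemma double_iff: "A.outer p \<Longrightarrow> double_pair D' p q \<longleftrightarrow> double_pair D p q"
proof
  assume p: "A.outer p"
  show "double_pair D p q" if d: "double_pair D' p q"
    using d agree[of p] agree[of q] p B.outer_double[OF d] unfolding double_pair_def comps by metis
  show "double_pair D' p q" if d: "double_pair D p q"
    using d agree[of p] agree[of q] p A.outer_double[OF d] unfolding double_pair_def comps by metis
qed

lemma label_outer: "A.outer p \<Longrightarrow> double_pair D p q \<Longrightarrow> label_at D' p = label_at D p \<and> label_at D' q = label_at D q"
proof -
  assume o: "A.outer p" and d: "double_pair D p q"
  have "double_preimage D p" "double_preimage D q"
    unfolding double_preimage_def using d A.double_pair_sym[OF d] by blast+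
  moreover have "A.outer q" using A.outer_double[OF d] o by blast
  moreover have "fst p < comps D" "fst q < comps D" using d unfolding double_pair_def by auto
  ultimately show ?thesis using agree[of p] agree[of q] o by blast
qed

lemma real_outer: "A.outer p \<Longrightarrow> real_pair D' p q \<longleftrightarrow> real_pair D p q"
  unfolding real_pair_def using double_iff[of p q] label_outer[of p q] by auto

lemma chorded_outer: "A.outer p \<Longrightarrow> chorded (real_pair D') p \<longleftrightarrow> chorded (real_pair D) p"
  unfolding chorded_def using real_outer by blast

lemma same_T: "B.T = A.T"
  unfolding A.T_def B.T_def comps using chorded_outer by blast

lemma same_VT: "B.VT = A.VT" and same_along: "B.along = A.along"
proof -
  show "B.VT = A.VT" unfolding A.VT_def B.VT_def A.PT_def B.PT_def same_T ..
  have "B.nxt = A.nxt" unfolding A.nxt_def[abs_def] B.nxt_def[abs_def] A.nx_def B.nx_def same_T ..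
  moreover from this have "B.prv = A.prv" unfolding A.prv_def B.prv_def A.PT_def B.PT_def same_T by simp
  ultimately show "B.along = A.along" by (intro ext) (simp only: A.along_def B.along_def)
qed

lemma smoothed_outer:
  assumes "A.outer p" "X \<subseteq> h ` model_disc" "X' \<subseteq> h ` model_disc"
  shows "B.smoothed (S \<union> X') p = A.smoothed (S \<union> X) p"
  unfolding A.smoothed_def B.smoothed_def comps using agree[OF _ assms(1)] A.outer_disc[OF _ assms(1)] assms(2,3) by auto

text \<open>The marked points agree, and an outer germ sees the same partner and the same smoothing
  on both sides of the move: the crossings \<open>X\<close> and \<open>X'\<close> lie in the disc,
  and no outer point is mapped into it.\<close>

lemma same_rest:
  assumes X: "X \<subseteq> h ` model_disc" "X' \<subseteq> h ` model_disc"
  shows "B.rest_rel (B.smoothed (S \<union> X')) = A.rest_rel (A.smoothed (S \<union> X))"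
proof -
  have link: "B.link (B.smoothed (S \<union> X')) u = A.link (A.smoothed (S \<union> X)) u"
    if "u \<in> A.VT - A.Gm ` {..<2 * k * K}" for u
  proof -
    note o = A.outer_germ[OF that]
    have "B.partner (fst u) = A.partner (fst u)" unfolding A.partner_def B.partner_def real_outer[OF o] ..
    then show ?thesis unfolding A.link_def B.link_def chorded_outer[OF o] smoothed_outer[OF o X] by simp
  qed
  show ?thesis
    unfolding A.rest_rel_def[abs_def] B.rest_rel_def[abs_def] same_VT same_along using link by (auto simp: fun_eq_iff)
qed

text \<open>The image of the disc is compact, so an outer point has a neighbourhood of parameters
  that are outer too, and there the curves agree.\<close>

lemma velocity_outer:
  assumes "fst p < comps D" "A.outer p"
  shows "velocity D' p = velocity D p"
proof -
  let ?U = "{x. plane_at D (fst p, x) \<notin> h ` model_disc}"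
  have "curve D (fst p) x = curve D' (fst p) x" if "x \<in> ?U" for x
  proof -
    have "A.outer (fst p, x)" using that A.inner_disc[of "(fst p, x)"] assms(1) by auto
    then show ?thesis using agree[of "(fst p, x)"] assms(1) unfolding plane_at_def by simp
  qed
  moreover have "snd p \<in> ?U" using A.outer_disc[OF assms] by simp
  ultimately have "(curve D' (fst p) has_vector_derivative velocity D p) (at (snd p))"
    using has_vector_derivative_transform_within_open[OF _ A.outer_open[OF assms(1)]] A.curve_deriv[OF assms(1), of "snd p"]
    by (metis prod.collapse)
  then show ?thesis unfolding velocity_def[of D'] by (rule vector_derivative_at)
qed

lemma crossings_outer: "B.crossings - h ` model_disc = A.crossings - h ` model_disc"
proof -
  have o: "A.outer p" if "fst p < comps D" "plane_at D p \<notin> h ` model_disc \<or> plane_at D' p \<notin> h ` model_disc" for p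
    using A.inner_disc[OF that(1)] B.inner_disc[of p] that comps by metis
  show ?thesis
  proof (intro equalityI subsetI)
    fix z assume z: "z \<in> B.crossings - h ` model_disc"
    then obtain p q where p: "real_pair D' p q" "plane_at D' p = z" by (blast elim: B.crossingsE)
    have d: "fst p < comps D" using B.C_dom[OF p(1)] comps by simp
    then have op: "A.outer p" using o p(2) z by blast
    then have "real_pair D p q" "plane_at D p = z" using real_outer p agree[OF d] by auto
    then show "z \<in> A.crossings - h ` model_disc" using A.in_crossings z by blast
  next
    fix z assume z: "z \<in> A.crossings - h ` model_disc"
    then obtain p q where p: "real_pair D p q" "plane_at D p = z" by (blast elim: A.crossingsE)
    note d = A.C_dom[OF p(1)]
    then have op: "A.outer p" using o p(2) z by blast
    then have "real_pair D' p q" "plane_at D' p = z" using real_outer p agree[OF d] by auto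
    then show "z \<in> B.crossings - h ` model_disc" using B.in_crossings z by blast
  qed
qed

lemma positive_outer:
  assumes "z \<in> A.crossings - h ` model_disc"
  shows "A.positive z = B.positive z"
proof -
  from assms obtain p q where p: "real_pair D p q" "plane_at D p = z" "label_at D p = Over"
    by (blast elim: A.crossingsE)
  have d: "fst p < comps D" "fst q < comps D" using A.C_dom[OF p(1)] A.C_dom[OF A.C_sym[OF p(1)]] .
  have o: "A.outer p" using A.inner_disc[OF d(1)] p(2) assms by blast
  then have oq: "A.outer q" using A.outer_double[OF A.real_pairD[OF p(1)]] by blast
  have p': "real_pair D' p q" "plane_at D' p = z" "label_at D' p = Over"
    using real_outer[OF o] p agree[OF d(1) o] label_outer[OF o A.real_pairD[OF p(1)]] by auto
  show ?thesis
    using A.positive_iff[OF p(1,3)] B.positive_iff[OF p'(1,3)] p(2) p'(2)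
      velocity_outer[OF d(1) o] velocity_outer[OF d(2) oq] by simp
qed

text \<open>The hypothesis quantifies over every possible surrounding relation, so a move has to be
  checked on its tangle alone. The surroundings that actually occur are the \<open>rest_rel\<close>
  of the various outer states.\<close>

theorem local_bracket:
  assumes eq: "\<And>V R G. coded_tangle V R G k K \<Longrightarrow>
    x * state_sum A.inner A.positive (\<lambda>X. coded_tangle.count V R (G :: nat \<Rightarrow> germ) (A.inner_pairs (A.smoothed X))) z =
    x' * state_sum B.inner B.positive (\<lambda>X. coded_tangle.count V R G (B.inner_pairs (B.smoothed X))) z"
  shows "x * A.bracket z = x' * B.bracket z"
proof -
  let ?Xo = "A.crossings - h ` model_disc"
  have cA: "A.crossings = ?Xo \<union> A.inner" using A.crossings_inner by blast
  have cB: "B.crossings = ?Xo \<union> B.inner" using B.crossings_inner crossings_outer by blast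
  have fin: "finite A.inner" "finite B.inner"
    using A.crossings_inner B.crossings_inner A.finite_crossings B.finite_crossings by (metis finite_Int)+
  have "x * state_sum (?Xo \<union> A.inner) A.positive A.circles z = x' * state_sum (?Xo \<union> B.inner) B.positive B.circles z"
  proof (rule state_sum_replace)
    fix S assume "S \<subseteq> ?Xo"
    then have S: "S \<inter> h ` model_disc = {}" by blast
    let ?R = "A.rest_rel (A.smoothed (S \<union> {}))"
    have ct: "coded_tangle A.VT ?R A.Gm k K" by (rule A.coded_rest[OF A.state_smoothed])
    have A: "A.circles (S \<union> X) = coded_tangle.count A.VT ?R A.Gm (A.inner_pairs (A.smoothed X))"
      if "X \<subseteq> A.inner" for X
      using A.circles_tangle[OF S, of X] same_rest[of X "{}" S] same_rest[of "{}" "{}" S] that A.inner_in_disc by simp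
    have B: "B.circles (S \<union> X) = coded_tangle.count A.VT ?R A.Gm (B.inner_pairs (B.smoothed X))"
      if "X \<subseteq> B.inner" for X
      using B.circles_tangle[OF S, of X] same_rest[of "{}" X S] same_VT that B.inner_in_disc by simp
    have "state_sum A.inner A.positive (\<lambda>X. A.circles (S \<union> X)) z =
        state_sum A.inner A.positive (\<lambda>X. coded_tangle.count A.VT ?R A.Gm (A.inner_pairs (A.smoothed X))) z"
      by (rule state_sum_cong) (use A in auto)
    moreover have "state_sum B.inner B.positive (\<lambda>X. B.circles (S \<union> X)) z =
        state_sum B.inner B.positive (\<lambda>X. coded_tangle.count A.VT ?R A.Gm (B.inner_pairs (B.smoothed X))) z"
      by (rule state_sum_cong) (use B in auto)
    ultimately show "x * state_sum A.inner A.positive (\<lambda>X. A.circles (S \<union> X)) z =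
        x' * state_sum B.inner B.positive (\<lambda>X. B.circles (S \<union> X)) z" using eq[OF ct] by simp
  qed (use fin A.finite_crossings A.inner_in_disc B.inner_in_disc positive_outer in auto)
  then show ?thesis unfolding A.bracket_def B.bracket_def cA[symmetric] cB[symmetric] .
qed

end

section \<open>Orientations of the crossings in the disc\<close>

text \<open>The determinant of the derivative is continuous and without zeros on the connected
  plane.\<close>

lemma diffeo_orientation:
  assumes "C1_diffeo h" "(h has_derivative L) (at z)" "(h has_derivative L') (at z')" "0 < det2 L"
  shows "0 < det2 L'"
proof -
  obtain h' :: "complex \<Rightarrow> complex \<Rightarrow>\<^sub>L complex" where h': "\<And>z. (h has_derivative blinfun_apply (h' z)) (at z)"
    and cont: "continuous_on UNIV h'" using assms(1) unfolding C1_diffeo_def C1_map_def by blast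
  have L: "L = blinfun_apply (h' z)" "L' = blinfun_apply (h' z')"
    using has_derivative_unique[OF assms(2) h'] has_derivative_unique[OF assms(3) h'] by auto
  have "0 < det2 (blinfun_apply (h' z'))"
  proof (rule sign_constant[of UNIV "\<lambda>z. det2 (blinfun_apply (h' z))" z])
    show "continuous_on UNIV (\<lambda>z. det2 (blinfun_apply (h' z)))"
      unfolding det2_def cross_def using cont by (intro continuous_intros)
    show "det2 (blinfun_apply (h' z)) \<noteq> 0" for z using C1_diffeo_det[OF assms(1) h'] .
  qed (use assms(4) L in auto)
  then show ?thesis using L by simp
qed

lemma sign_mult4:
  fixes x y z w :: real
  assumes "x \<noteq> 0" "y \<noteq> 0" "z \<noteq> 0" "w \<noteq> 0"
  shows "0 < x * y * (z * w) \<longleftrightarrow> ((0 < x) = (0 < y)) = ((0 < z) = (0 < w))"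
proof -
  have *: "0 < u * v \<longleftrightarrow> (0 < u) = (0 < v)" if "u \<noteq> 0" "v \<noteq> 0" for u v :: real
    using that by (auto simp: zero_less_mult_iff)
  show ?thesis using *[of "x * y" "z * w"] *[of x y] *[of z w] assms by simp
qed

context arcs
begin

definition direct :: bool where
  "direct \<longleftrightarrow> (\<exists>z L. (h has_derivative L) (at z) \<and> 0 < det2 L)"

lemma direct_iff: "(h has_derivative L) (at z) \<Longrightarrow> 0 < det2 L \<longleftrightarrow> direct"
  unfolding direct_def using diffeo_orientation[OF diffeo] by blast

lemma smooth_type_chord:
  assumes "C (mk i) (mk i')"
  shows "smooth_type (smoothed S) i i' =
    (if (plane_at D (mk i) \<in> S) = (inc (i div K) = inc (i' div K)) then Par else Anti)"
  using assms C_dom[OF assms] unfolding smooth_type_def parallel_def smoothed_def by simp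

lemma plane_mk_eq:
  assumes "(i, i') \<in> set chs" "j < k * K" "plane_at D (mk i) = plane_at D (mk j)"
  shows "j = i \<or> j = i'"
proof (rule ccontr)
  assume j: "\<not> (j = i \<or> j = i')"
  have lt: "i < k * K" "i' < k * K" using chs_lt[OF assms(1)] by auto
  have "\<not> same_point (mk i) (mk j)" using mk_eq lt(1) assms(2) j by blast
  then have "double_pair D (mk i) (mk j)" unfolding double_pair_def using mk_dom lt(1) assms(2,3) by blast
  then have "same_point (mk i') (mk j)" using triple_free[OF chord_double[OF assms(1)]] by blast
  then show False using mk_eq lt(2) assms(2) j by blast
qed

text \<open>\<tau> is only known to be continuous. Since the model arc is a graph over its
  parameter, \<tau> is the first coordinate of the curve pulled back by \<open>h\<close>, hence
  differentiable, and the velocity is a multiple of the image of the tangent of the graph.\<close>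

lemma arc_velocity:
  assumes m: "m < k" and s: "- 1 < s" "s < 1"
    and graph: "\<And>s. s \<in> {-1..1} \<Longrightarrow> \<gamma> m s = Complex s (f s)"
    and f: "(f has_real_derivative f') (at s)" and L: "(h has_derivative L) (at (\<gamma> m s))"
  shows "\<exists>d. d \<noteq> 0 \<and> (0 < d \<longleftrightarrow> inc m) \<and> velocity D (c m, \<xi> m s) = d *\<^sub>R L (Complex 1 f')"
proof -
  have s1: "s \<in> {-1..1}" "-1 \<in> {-1..1::real}" "1 \<in> {-1..1::real}" using s by auto
  define x where "x = \<xi> m s"
  have x: "x \<in> {a m..b m}" "\<tau> m x = s" unfolding x_def using xi[OF m s1(1)] by auto
  have i: "a m < x" "x < b m"
    using xi_mono[OF m s1(2,1) s(1)] xi_mono[OF m s1(1,3) s(2)] xi(1)[OF m s1(2)] xi(1)[OF m s1(3)]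
    unfolding x_def by (cases "inc m"; force)+
  have cm: "c m < n" using arc[OF m] by blast
  obtain M where M: "(inv h has_derivative M) (at (h (\<gamma> m s)))"
    using diffeo unfolding C1_diffeo_def C1_map_def by blast
  \<comment> \<open>The velocity in the coordinates of the model disc.\<close>
  define w where "w = M (velocity D (c m, x))"
  have cx: "curve D (c m) x = h (\<gamma> m s)" using on_arc[OF m x(1)] x(2) by simp
  have "((\<lambda>y. inv h (curve D (c m) y)) has_vector_derivative w) (at x)"
    unfolding w_def by (rule velocity_image[OF cm]) (use M cx in simp)
  then have "((\<lambda>y. Complex (\<tau> m y) (f (\<tau> m y))) has_vector_derivative w) (at x)"
  proof (rule has_vector_derivative_transform_within_open)
    show "inv h (curve D (c m) y) = Complex (\<tau> m y) (f (\<tau> m y))" if "y \<in> {a m<..<b m}" for y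
      using on_arc[OF m, of y] that graph[OF tau_in[OF m, of y]] inj_h by (simp add: inv_f_f)
  qed (use i in auto)
  from bounded_linear.has_vector_derivative[OF bounded_linear_Re this]
    bounded_linear.has_vector_derivative[OF bounded_linear_Im this]
  have d: "(\<tau> m has_real_derivative Re w) (at x)" "((\<lambda>y. f (\<tau> m y)) has_real_derivative Im w) (at x)"
    by (simp_all add: has_real_derivative_iff_has_vector_derivative)
  have "((\<lambda>y. f (\<tau> m y)) has_real_derivative f' * Re w) (at x)"
    by (rule DERIV_chain2[OF _ d(1)]) (use f x(2) in simp)
  then have "Im w = f' * Re w" using d(2) DERIV_unique by blast
  then have w: "w = Re w *\<^sub>R Complex 1 f'" by (simp add: complex_eq_iff)
  have "(h \<circ> inv h has_derivative L \<circ> M) (at (h (\<gamma> m s)))"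
    by (rule diff_chain_at[OF M]) (use L inj_h in \<open>simp add: inv_f_f\<close>)
  moreover have "h \<circ> inv h = id" using diffeo unfolding C1_diffeo_def bij_def by (simp add: surj_iff)
  ultimately have "L \<circ> M = id" using has_derivative_unique has_derivative_id by metis
  then have "velocity D (c m, x) = L w" unfolding w_def by (metis comp_apply id_apply)
  also have "\<dots> = Re w *\<^sub>R L (Complex 1 f')"
    by (subst w) (rule linear_scale[OF has_derivative_linear[OF L]])
  finally have v: "velocity D (c m, x) = Re w *\<^sub>R L (Complex 1 f')" .
  then have w0: "Re w \<noteq> 0" using velocity_nz[of "(c m, x)"] cm by auto
  have step: "\<exists>y. x < y \<and> y \<le> b m \<and> (0 < e \<and> y < x + e)" if "0 < e" for e
    using i that by (intro exI[of _ "min (b m) (x + e / 2)"]) auto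
  \<comment> \<open>\<open>Re w\<close> is the derivative of \<tau>, nonzero because the curve is
    immersed; its sign must agree with the monotonicity of \<tau> just to the right of
    \<open>x\<close>.\<close>
  have "0 < Re w \<longleftrightarrow> inc m"
  proof
    assume "0 < Re w"
    from DERIV_pos_inc_right[OF d(1) this]
    obtain e where e: "e > 0" "\<forall>h>0. h < e \<longrightarrow> \<tau> m x < \<tau> m (x + h)" by blast
    obtain y where "x < y" "y \<le> b m" "y < x + e" using step[OF e(1)] by blast
    then show "inc m" using e(2)[rule_format, of "y - x"] tau_mono(2)[OF m, of x y] i by force
  next
    assume inc: "inc m"
    show "0 < Re w"
    proof (rule ccontr)
      assume "\<not> 0 < Re w"
      then have "Re w < 0" using w0 by simp
      from DERIV_neg_dec_right[OF d(1) this]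
      obtain e where e: "e > 0" "\<forall>h>0. h < e \<longrightarrow> \<tau> m x > \<tau> m (x + h)" by blast
      obtain y where "x < y" "y \<le> b m" "y < x + e" using step[OF e(1)] by blast
      then show False using e(2)[rule_format, of "y - x"] tau_mono(1)[OF m, of x y] i inc by force
    qed
  qed
  then show ?thesis using v w0 unfolding x_def by blast
qed

text \<open>The sign is a product of four: the directions of the two arcs, the orientation behaviour
  of \<open>h\<close>, the order of the slopes, and which strand is the upper one. Only the first
  three enter the cross product; exchanging the strands reverses it.\<close>

lemma chord_positive:
  assumes ch: "(i, i') \<in> set chs" and C: "C (mk i) (mk i')"
    and graph: "\<And>m s. m < k \<Longrightarrow> s \<in> {-1..1} \<Longrightarrow> \<gamma> m s = Complex s (f m s)"
    and f: "\<And>m s. m < k \<Longrightarrow> (f m has_real_derivative f' m s) (at s)"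
  shows "positive (plane_at D (mk i)) \<longleftrightarrow> (inc (i div K) = inc (i' div K)) =
    ((label_at D (mk i) = Over) = (direct = (f' (i div K) (t (i mod K)) < f' (i' div K) (t (i mod K)))))"
proof -
  define m m' s where "m = i div K" "m' = i' div K" "s = t (i mod K)"
  note d = this
  have lt: "i < k * K" "i' < k * K" using chs_lt[OF ch] by auto
  have m: "m < k" "m' < k" unfolding d using id_arc lt by auto
  have pl: "plane_at D (mk i) = plane_at D (mk i')" using chord_double[OF ch] unfolding double_pair_def by blast
  then have g: "\<gamma> m s = \<gamma> m' (t (i' mod K))" using gamma_mk[OF lt(1)] gamma_mk[OF lt(2)] inj_h unfolding d by (simp add: inj_eq)
  then have s': "t (i' mod K) = s"
    using graph[OF m(1), of s] graph[OF m(2), of "t (i' mod K)"] t_in'[OF id_pos] unfolding d by simp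
  have s: "- 1 < s" "s < 1" unfolding d using t_in[OF id_pos] by auto
  have mk: "mk i = (c m, \<xi> m s)" "mk i' = (c m', \<xi> m' s)" using s' unfolding mk_def d by simp_all
  obtain L where L: "(h has_derivative L) (at (\<gamma> m s))" using diffeo unfolding C1_diffeo_def C1_map_def by blast
  obtain e where e: "e \<noteq> 0" "0 < e \<longleftrightarrow> inc m" "velocity D (mk i) = e *\<^sub>R L (Complex 1 (f' m s))"
    using arc_velocity[OF m(1) s graph[OF m(1)] f[OF m(1)] L] unfolding mk by blast
  obtain e' where e': "e' \<noteq> 0" "0 < e' \<longleftrightarrow> inc m'" "velocity D (mk i') = e' *\<^sub>R L (Complex 1 (f' m' s))"
    using arc_velocity[OF m(2) s graph[OF m(2)] f[OF m(2)]] L g s' unfolding mk by auto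
  have lin: "linear L" using L by (rule has_derivative_linear)
  have cr: "cross (velocity D (mk i)) (velocity D (mk i')) = e * e' * (det2 L * (f' m' s - f' m s))"
    unfolding e(3) e'(3) by (simp add: cross_scale cross_linear[OF lin]) (simp add: cross_def)
  then have nz: "det2 L \<noteq> 0" "f' m' s - f' m s \<noteq> 0" using transverse[OF real_pairD[OF C]] by auto
  have sg: "0 < cross (velocity D (mk i)) (velocity D (mk i')) \<longleftrightarrow> (inc m = inc m') = (direct = (f' m s < f' m' s))"
    unfolding cr sign_mult4[OF e(1) e'(1) nz] e(2) e'(2) direct_iff[OF L] by simp
  show ?thesis
  proof (cases "label_at D (mk i) = Over")
    case True
    then show ?thesis using positive_iff[OF C True] sg unfolding d by simp
  next
    case False
    then have l: "label_at D (mk i') = Over" using real_pair_labels[OF C] by auto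
    have "cross (velocity D (mk i)) (velocity D (mk i')) \<noteq> 0" using transverse[OF real_pairD[OF C]] .
    then have "positive (plane_at D (mk i)) \<longleftrightarrow> \<not> 0 < cross (velocity D (mk i)) (velocity D (mk i'))"
      using positive_iff[OF C_sym[OF C] l] cross_swap[of "velocity D (mk i')" "velocity D (mk i)"] pl by auto
    then show ?thesis using sg False unfolding d by auto
  qed
qed

lemma real_chord:
  "(i, i') \<in> set chs \<Longrightarrow> C (mk i) (mk i') \<longleftrightarrow> label_at D (mk i) \<noteq> Virt"
  using labels[OF chord_double, of i i'] chord_double[of i i'] unfolding real_pair_def by auto

end

lemma local_move_pair:
  assumes lm: "local_move k \<alpha> \<beta> J D D'" and D: "virtual_link_diagram D" "virtual_link_diagram D'"
    and A: "arc_model k K t \<alpha> chs rest" and B: "arc_model k K t \<beta> chs' rest'"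
  obtains c a b \<tau> h where "local_pair D D' k K t \<alpha> chs rest \<beta> chs' rest' c a b \<tau> h"
    and "\<forall>m < k. J m = {c m} \<times> {a m..b m}"
proof -
  from lm obtain h c a b \<tau> where n: "comps D' = comps D" and h: "C1_diffeo h"
    and arc: "\<forall>m < k. c m < comps D \<and> a m < b m \<and> J m = {c m} \<times> {a m..b m} \<and>
           continuous_on {a m..b m} (\<tau> m) \<and> bij_betw (\<tau> m) {a m..b m} {-1..1} \<and>
           (\<forall>x \<in> {a m..b m}. curve D (c m) x = h (\<alpha> m (\<tau> m x)) \<and> curve D' (c m) x = h (\<beta> m (\<tau> m x)))"
    and disj: "\<forall>m < k. \<forall>m' < k. \<forall>p \<in> J m. \<forall>q \<in> J m'. same_point p q \<longrightarrow> m = m' \<and> p = q"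
    and out: "\<forall>p. fst p < comps D \<longrightarrow> (\<forall>m < k. \<forall>q \<in> J m. \<not> same_point p q) \<longrightarrow>
           plane_at D' p = plane_at D p \<and> plane_at D p \<notin> h ` model_disc \<and>
           (double_preimage D p \<longrightarrow> label_at D' p = label_at D p)"
    unfolding local_move_def by (elim conjE exE) (rule that)
  interpret A: arc_model k K t \<alpha> chs rest by fact
  interpret B: arc_model k K t \<beta> chs' rest' by fact
  have J: "J m = {c m} \<times> {a m..b m}" if "m < k" for m using arc that by blast
  have dj: "m = m' \<and> x = x'" if "m < k" "m' < k" "x \<in> {a m..b m}" "x' \<in> {a m'..b m'}" "same_point (c m, x) (c m', x')" for m m' x x'
    using disj[rule_format, of m m' "(c m, x)" "(c m', x')"] J that by simp
  have o: "plane_at D' p = plane_at D p \<and> plane_at D p \<notin> h ` model_disc \<and> (double_preimage D p \<longrightarrow> label_at D' p = label_at D p)"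
    if "fst p < comps D" "\<And>m x. m < k \<Longrightarrow> x \<in> {a m..b m} \<Longrightarrow> \<not> same_point p (c m, x)" for p
  proof (rule out[rule_format, OF that(1)])
    show "\<not> same_point p q" if "m < k" "q \<in> J m" for m q
      using \<open>\<And>m x. m < k \<Longrightarrow> x \<in> {a m..b m} \<Longrightarrow> \<not> same_point p (c m, x)\<close>[of m "snd q"] J[OF that(1)] that by auto
  qed
  have 1: "arcs D k K t \<alpha> chs rest c a b \<tau> h"
    by unfold_locales (use D arc h dj o in blast)+
  have 2: "arcs D' k K t \<beta> chs' rest' c a b \<tau> h"
  proof unfold_locales
    show "plane_at D' p \<notin> h ` model_disc"
      if "fst p < comps D'" "\<And>m x. m < k \<Longrightarrow> x \<in> {a m..b m} \<Longrightarrow> \<not> same_point p (c m, x)" for p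
      using o[of p] that n by metis
  qed (use D arc h dj n in auto)
  have "local_pair D D' k K t \<alpha> chs rest \<beta> chs' rest' c a b \<tau> h"
    using 1 2 n o unfolding local_pair_def local_pair_axioms_def arcs.outer_def[OF 1] by blast
  then show ?thesis using that J by blast
qed

section \<open>The model arcs\<close>

lemma ex_less_2: "(\<exists>j<2. P j) \<longleftrightarrow> P 0 \<or> P (1::nat)"
proof -
  have "j < 2 \<longleftrightarrow> j = 0 \<or> j = 1" for j :: nat by auto
  then show ?thesis by auto
qed

lemma ex_less_3: "(\<exists>j<3. P j) \<longleftrightarrow> P 0 \<or> P 1 \<or> P (2::nat)"
proof -
  have "j < 3 \<longleftrightarrow> j = 0 \<or> j = 1 \<or> j = 2" for j :: nat by auto
  then show ?thesis by auto
qed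

lemma bump_in: "s \<in> {-1..1} \<Longrightarrow> 0 \<le> (1 - s\<^sup>2)\<^sup>2 \<and> (1 - s\<^sup>2)\<^sup>2 \<le> (1::real)"
proof -
  assume "s \<in> {-1..1}"
  then have "s\<^sup>2 \<le> 1" by (simp add: abs_square_le_1 abs_le_iff)
  then show ?thesis using power_le_one[of "1 - s\<^sup>2" 2] by simp
qed

text \<open>The parameters of the crossings: the kink of move I meets itself where
  \<open>4 * (1 - s^2)^2 = 1\<close>, the arcs of move II meet where
  \<open>(1 - s^2)^2 = 1/2\<close>, and in move III the curved arc meets the two lines where s or -s
  equals \<open>(1 - s^2)^2\<close>.\<close>

definition r1 :: real where "r1 = sqrt (1 / 2)"
definition r2 :: real where "r2 = sqrt (1 - sqrt (1 / 2))"
definition r3 :: real where "r3 = (SOME r. 0 < r \<and> r < 1 \<and> r = (1 - r\<^sup>2)\<^sup>2)"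

definition two_times :: "real \<Rightarrow> nat \<Rightarrow> real" where
  "two_times r j = (if j = 0 then - r else r)"

definition three_times :: "real \<Rightarrow> nat \<Rightarrow> real" where
  "three_times r j = (if j = 0 then - r else if j = 1 then 0 else r)"

lemma two_times:
  assumes "0 < r" "r < 1"
  shows "j < j' \<Longrightarrow> j' < 2 \<Longrightarrow> two_times r j < two_times r j'" "- 1 < two_times r j \<and> two_times r j < 1"
  using assms unfolding two_times_def by auto

lemma three_times:
  assumes "0 < r" "r < 1"
  shows "j < j' \<Longrightarrow> j' < 3 \<Longrightarrow> three_times r j < three_times r j'" "- 1 < three_times r j \<and> three_times r j < 1"
  using assms unfolding three_times_def by auto

lemma r1: "0 < r1" "r1 < 1" "s\<^sup>2 = 1 / 2 \<longleftrightarrow> s = r1 \<or> s = - r1"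
proof -
  show "0 < r1" "r1 < 1" unfolding r1_def by simp_all
  have "r1\<^sup>2 = 1 / 2" unfolding r1_def by simp
  then show "s\<^sup>2 = 1 / 2 \<longleftrightarrow> s = r1 \<or> s = - r1" using power2_eq_iff[of s r1] by metis
qed

lemma r2: "0 < r2" "r2 < 1" "s \<in> {-1..1} \<Longrightarrow> (1 - s\<^sup>2)\<^sup>2 = 1 / 2 \<longleftrightarrow> s = - r2 \<or> s = r2"
proof -
  have q: "0 < sqrt (1 / 2)" "sqrt (1 / 2) < (1::real)" by simp_all
  then show "0 < r2" "r2 < 1" unfolding r2_def by simp_all
  assume "s \<in> {-1..1}"
  then have s: "0 \<le> 1 - s\<^sup>2" by (simp add: abs_square_le_1 abs_le_iff)
  have "r2\<^sup>2 = 1 - sqrt (1 / 2)" unfolding r2_def using q(2) by (simp add: order.strict_implies_order)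
  moreover have "(1 - s\<^sup>2)\<^sup>2 = 1 / 2 \<longleftrightarrow> 1 - s\<^sup>2 = sqrt (1 / 2)"
    using s real_sqrt_unique[of "1 - s\<^sup>2" "1 / 2"] real_sqrt_pow2[of "1 / 2"] by auto
  ultimately have "(1 - s\<^sup>2)\<^sup>2 = 1 / 2 \<longleftrightarrow> s\<^sup>2 = r2\<^sup>2" by auto
  then show "(1 - s\<^sup>2)\<^sup>2 = 1 / 2 \<longleftrightarrow> s = - r2 \<or> s = r2" using power2_eq_iff[of s r2] by metis
qed

lemma r3: "0 < r3" "r3 < 1" "s \<in> {-1..1} \<Longrightarrow> s = (1 - s\<^sup>2)\<^sup>2 \<longleftrightarrow> s = r3"
proof -
  have "\<exists>r. 0 \<le> r \<and> r \<le> 1 \<and> r - (1 - r\<^sup>2)\<^sup>2 = (0::real)"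
    by (rule IVT') (auto intro!: continuous_intros)
  then obtain r :: real where r: "0 \<le> r" "r \<le> 1" "r - (1 - r\<^sup>2)\<^sup>2 = 0" by blast
  from r(3) have "r = (1 - r\<^sup>2)\<^sup>2" by simp
  note r = r(1,2) this
  have "r \<noteq> 0" "r \<noteq> 1" using r(3) by (auto simp: power2_eq_square)
  then have "0 < r" "r < 1" using r(1,2) by simp_all
  then have "\<exists>r::real. 0 < r \<and> r < 1 \<and> r = (1 - r\<^sup>2)\<^sup>2" using r(3) by blast
  then have r3: "0 < r3 \<and> r3 < 1 \<and> r3 = (1 - r3\<^sup>2)\<^sup>2" unfolding r3_def by (rule someI_ex)
  then show "0 < r3" "r3 < 1" by auto
  assume s: "s \<in> {-1..1}"
  \<comment> \<open>On the unit interval the bump decreases while the identity increases, so they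
    meet once; a solution is nonnegative, being a square.\<close>
  have mono: "(1 - v\<^sup>2)\<^sup>2 \<le> (1 - u\<^sup>2)\<^sup>2" if "0 \<le> u" "u \<le> v" "v \<le> 1" for u v :: real
  proof -
    have "u\<^sup>2 \<le> v\<^sup>2" "v\<^sup>2 \<le> 1" using that by (auto simp: power_mono power_le_one)
    then show ?thesis by (intro power_mono) auto
  qed
  have "s = r3" if e: "s = (1 - s\<^sup>2)\<^sup>2"
  proof -
    have "0 \<le> s" by (subst e) simp
    then show ?thesis using mono[of s r3] mono[of r3 s] r3 s e by (cases "s \<le> r3") auto
  qed
  then show "s = (1 - s\<^sup>2)\<^sup>2 \<longleftrightarrow> s = r3" using r3 by auto
qed

lemma model_I_before: "arc_model 1 2 (two_times r1) (\<lambda>_ t. Complex t 0) [] [0, 1]"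
  by unfold_locales (use two_times[OF r1(1,2)] in \<open>auto simp: model_disc_def abs_le_iff\<close>)

lemma model_I_after:
  "arc_model 1 2 (two_times r1)
     (\<lambda>_ t. Complex (t - 4 * t * (1 - t\<^sup>2)\<^sup>2) ((1 - t\<^sup>2)\<^sup>2 / 2)) [(0, 1)] []"
proof unfold_locales
  fix m m' :: nat and s s' :: real
  assume m: "m < 1" "m' < 1" and s: "s \<in> {-1..1}" "s' \<in> {-1..1}"
  have sq: "0 \<le> 1 - s\<^sup>2" "0 \<le> 1 - s'\<^sup>2" using s by (auto simp: abs_square_le_1 abs_le_iff)
  have "s = s' \<or> s = r1 \<and> s' = - r1 \<or> s = - r1 \<and> s' = r1"
    if e: "(1 - s\<^sup>2)\<^sup>2 = (1 - s'\<^sup>2)\<^sup>2" "s - 4 * s * (1 - s\<^sup>2)\<^sup>2 = s' - 4 * s' * (1 - s'\<^sup>2)\<^sup>2"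
  proof -
    \<comment> \<open>Equal heights force equal or opposite parameters, and opposite ones with equal
      abscissa satisfy the equation of \<open>r1\<close> or vanish.\<close>
    have "1 - s\<^sup>2 = 1 - s'\<^sup>2" using e(1) sq by (metis power2_eq_iff_nonneg)
    then have "s = s' \<or> s' = - s" using power2_eq_iff[of s s'] by auto
    moreover have "s = s' \<or> s = r1 \<or> s = - r1" if s': "s' = - s"
    proof -
      have "2 * (s * (1 - 4 * (1 - s\<^sup>2)\<^sup>2)) = 0" using e(2) unfolding s' by (simp add: algebra_simps)
      then have "s = 0 \<or> (1 - s\<^sup>2)\<^sup>2 = (1 / 2)\<^sup>2" by (auto simp: power2_eq_square)
      then have "s = 0 \<or> 1 - s\<^sup>2 = 1 / 2" using power2_eq_iff_nonneg[of "1 - s\<^sup>2" "1 / 2"] sq by auto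
      then show ?thesis using r1(3)[of s] s' by auto
    qed
    ultimately show ?thesis by auto
  qed
  moreover have "1 - r1\<^sup>2 = 1 / 2" using r1(3)[of r1] by simp
  then have "4 * (1 - r1\<^sup>2)\<^sup>2 = 1" by (simp only:) (simp add: power2_eq_square)
  ultimately show "(Complex (s - 4 * s * (1 - s\<^sup>2)\<^sup>2) ((1 - s\<^sup>2)\<^sup>2 / 2) =
        Complex (s' - 4 * s' * (1 - s'\<^sup>2)\<^sup>2) ((1 - s'\<^sup>2)\<^sup>2 / 2)) \<longleftrightarrow>
       m = m' \<and> s = s' \<or> (\<exists>j<2. \<exists>j'<2. s = two_times r1 j \<and> s' = two_times r1 j' \<and>
         ((2 * m + j, 2 * m' + j') \<in> set [(0, 1)] \<or> (2 * m' + j', 2 * m + j) \<in> set [(0, 1)]))"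
    using m unfolding ex_less_2 two_times_def by auto
next
  fix m :: nat and s :: real
  assume s: "s \<in> {-1..1}"
  define p where "p = \<bar>s\<bar>"
  have p: "0 \<le> p" "p \<le> 1" "s\<^sup>2 = p\<^sup>2" using s unfolding p_def by auto
  \<comment> \<open>For the disc bound, \<open>4 * p * (1 - p^2)^2\<close> is the product of
    \<open>4 * p * (1 - p)\<close>, \<open>(1 - p) * (1 + p)\<close> and \<open>1 + p\<close>; the
    first two factors are at most 1.\<close>
  have "0 \<le> (2 * p - 1)\<^sup>2" by simp
  then have "4 * p * (1 - p) \<le> 1" by (simp add: power2_eq_square algebra_simps)
  moreover have "(1 - p) * (1 + p) \<le> 1" by (simp add: algebra_simps)
  ultimately have "(4 * p * (1 - p)) * ((1 - p) * (1 + p)) \<le> 1 * 1"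
    by (rule mult_mono) (use p in auto)
  then have "(4 * p * (1 - p)) * ((1 - p) * (1 + p)) * (1 + p) \<le> 1 * (1 + p)"
    by (intro mult_right_mono) (use p in auto)
  then have "4 * p * (1 - p\<^sup>2)\<^sup>2 \<le> 1 + p" by (simp add: power2_eq_square algebra_simps)
  moreover have "0 \<le> 4 * p * (1 - p\<^sup>2)\<^sup>2" using p by simp
  ultimately have "\<bar>p - 4 * p * (1 - p\<^sup>2)\<^sup>2\<bar> \<le> 1" using p by linarith
  moreover have "\<bar>p - 4 * p * (1 - p\<^sup>2)\<^sup>2\<bar> = \<bar>s - 4 * s * (1 - s\<^sup>2)\<^sup>2\<bar>"
    unfolding p(3) p_def by (cases "0 \<le> s") auto
  ultimately show "Complex (s - 4 * s * (1 - s\<^sup>2)\<^sup>2) ((1 - s\<^sup>2)\<^sup>2 / 2) \<in> model_disc"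
    unfolding model_disc_def using bump_in[OF s] by auto
qed (use two_times[OF r1(1,2)] in auto)

lemma model_II_before:
  "arc_model 2 2 (two_times r2) (\<lambda>m t. if m = 0 then Complex t 0 else Complex t (1/2)) [] [0, 1, 2, 3]"
  by unfold_locales (use two_times[OF r2(1,2)] in \<open>auto simp: model_disc_def abs_le_iff\<close>)

lemma model_II_after:
  "arc_model 2 2 (two_times r2)
     (\<lambda>m t. if m = 0 then Complex t 0 else Complex t (1/2 - (1 - t\<^sup>2)\<^sup>2)) [(0, 2), (1, 3)] []"
proof unfold_locales
  fix m m' :: nat and s s' :: real
  assume m: "m < 2" "m' < 2" and s: "s \<in> {-1..1}" "s' \<in> {-1..1}"
  define u u' where "u = (1 - s\<^sup>2)\<^sup>2" "u' = (1 - s'\<^sup>2)\<^sup>2"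
  note u = this
  have eq: "u = 1 / 2 \<longleftrightarrow> s = - r2 \<or> s = r2" "u' = 1 / 2 \<longleftrightarrow> s' = - r2 \<or> s' = r2" "s = s' \<longrightarrow> u = u'"
    unfolding u using r2(3)[OF s(1)] r2(3)[OF s(2)] by auto
  have ne: "- r2 \<noteq> r2" using r2(1) by simp
  have "m = 0 \<or> m = 1" "m' = 0 \<or> m' = 1" using m by auto
  then show "((if m = 0 then Complex s 0 else Complex s (1/2 - (1 - s\<^sup>2)\<^sup>2)) =
        (if m' = 0 then Complex s' 0 else Complex s' (1/2 - (1 - s'\<^sup>2)\<^sup>2))) \<longleftrightarrow>
       m = m' \<and> s = s' \<or> (\<exists>j<2. \<exists>j'<2. s = two_times r2 j \<and> s' = two_times r2 j' \<and>
         ((2 * m + j, 2 * m' + j') \<in> set [(0, 2), (1, 3)] \<or> (2 * m' + j', 2 * m + j) \<in> set [(0, 2), (1, 3)]))"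
    unfolding ex_less_2 two_times_def u[symmetric] using ne by (elim disjE) (use eq in auto)
next
  fix m :: nat and s :: real
  assume s: "s \<in> {-1..1}"
  show "(if m = 0 then Complex s 0 else Complex s (1/2 - (1 - s\<^sup>2)\<^sup>2)) \<in> model_disc"
  proof -
    have "\<bar>1 / 2 - (1 - s\<^sup>2)\<^sup>2\<bar> \<le> 1" using bump_in[OF s] by linarith
    then show ?thesis unfolding model_disc_def using s by auto
  qed
next
  show "set [] = {..<2 * 2} - (\<Union>(i, i')\<in>set [(0, 2), (1, 3)]. {i, i'::nat})" by auto
qed (use two_times[OF r2(1,2)] in auto)

text \<open>All three arcs are graphs over the same coordinate, so meeting points have equal
  parameters. What remains are the equations for 0, \<open>r3\<close> and
  \<open>- r3\<close>.\<close>

lemma model_III_before: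
  "arc_model 3 3 (three_times r3)
     (\<lambda>m t. if m = 0 then Complex t (t/2) else if m = 1 then Complex t (- t/2)
            else Complex t ((1 - t\<^sup>2)\<^sup>2 / 2)) [(1, 4), (2, 8), (3, 6)] [0, 5, 7]"
proof unfold_locales
  fix m m' :: nat and s s' :: real
  assume m: "m < 3" "m' < 3" and s: "s \<in> {-1..1}" "s' \<in> {-1..1}"
  define u u' where "u = (1 - s\<^sup>2)\<^sup>2" "u' = (1 - s'\<^sup>2)\<^sup>2"
  note u = this
  have m1: "- s \<in> {-1..1}" "- s' \<in> {-1..1}" using s by auto
  have eq: "s = u \<longleftrightarrow> s = r3" "- s = u \<longleftrightarrow> - s = r3" "s' = u' \<longleftrightarrow> s' = r3" "- s' = u' \<longleftrightarrow> - s' = r3"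
    "s = s' \<longrightarrow> u = u'"
    unfolding u using r3(3)[OF s(1)] r3(3)[OF s(2)] r3(3)[OF m1(1)] r3(3)[OF m1(2)] unfolding power2_minus by blast+
  have ne: "- r3 \<noteq> r3" "r3 \<noteq> 0" using r3(1) by auto
  have "m = 0 \<or> m = 1 \<or> m = 2" "m' = 0 \<or> m' = 1 \<or> m' = 2" using m by auto
  then show "((if m = 0 then Complex s (s/2) else if m = 1 then Complex s (- s/2) else Complex s ((1 - s\<^sup>2)\<^sup>2 / 2)) =
        (if m' = 0 then Complex s' (s'/2) else if m' = 1 then Complex s' (- s'/2) else Complex s' ((1 - s'\<^sup>2)\<^sup>2 / 2))) \<longleftrightarrow>
       m = m' \<and> s = s' \<or> (\<exists>j<3. \<exists>j'<3. s = three_times r3 j \<and> s' = three_times r3 j' \<and>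
         ((3 * m + j, 3 * m' + j') \<in> set [(1, 4), (2, 8), (3, 6)] \<or> (3 * m' + j', 3 * m + j) \<in> set [(1, 4), (2, 8), (3, 6)]))"
    unfolding ex_less_3 three_times_def u[symmetric] by (elim disjE; simp; smt (verit) eq ne)
next
  fix m :: nat and s :: real
  assume s: "s \<in> {-1..1}"
  show "(if m = 0 then Complex s (s/2) else if m = 1 then Complex s (- s/2) else Complex s ((1 - s\<^sup>2)\<^sup>2 / 2)) \<in> model_disc"
  proof -
    have "\<bar>(1 - s\<^sup>2)\<^sup>2 / 2\<bar> \<le> 1" using bump_in[OF s] by linarith
    then show ?thesis unfolding model_disc_def using s by auto
  qed
next
  show "set [0, 5, 7] = {..<3 * 3} - (\<Union>(i, i')\<in>set [(1, 4), (2, 8), (3, 6)]. {i, i'::nat})" by auto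
qed (use three_times[OF r3(1,2)] in auto)

lemma model_III_after:
  "arc_model 3 3 (three_times r3)
     (\<lambda>m t. if m = 0 then Complex t (t/2) else if m = 1 then Complex t (- t/2)
            else Complex t (- (1 - t\<^sup>2)\<^sup>2 / 2)) [(1, 4), (0, 6), (5, 8)] [2, 3, 7]"
proof unfold_locales
  fix m m' :: nat and s s' :: real
  assume m: "m < 3" "m' < 3" and s: "s \<in> {-1..1}" "s' \<in> {-1..1}"
  define u u' where "u = (1 - s\<^sup>2)\<^sup>2" "u' = (1 - s'\<^sup>2)\<^sup>2"
  note u = this
  have m1: "- s \<in> {-1..1}" "- s' \<in> {-1..1}" using s by auto
  have eq: "s = u \<longleftrightarrow> s = r3" "- s = u \<longleftrightarrow> - s = r3" "s' = u' \<longleftrightarrow> s' = r3" "- s' = u' \<longleftrightarrow> - s' = r3"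
    "s = s' \<longrightarrow> u = u'"
    unfolding u using r3(3)[OF s(1)] r3(3)[OF s(2)] r3(3)[OF m1(1)] r3(3)[OF m1(2)] unfolding power2_minus by blast+
  have ne: "- r3 \<noteq> r3" "r3 \<noteq> 0" using r3(1) by auto
  have "m = 0 \<or> m = 1 \<or> m = 2" "m' = 0 \<or> m' = 1 \<or> m' = 2" using m by auto
  then show "((if m = 0 then Complex s (s/2) else if m = 1 then Complex s (- s/2) else Complex s (- (1 - s\<^sup>2)\<^sup>2 / 2)) =
        (if m' = 0 then Complex s' (s'/2) else if m' = 1 then Complex s' (- s'/2) else Complex s' (- (1 - s'\<^sup>2)\<^sup>2 / 2))) \<longleftrightarrow>
       m = m' \<and> s = s' \<or> (\<exists>j<3. \<exists>j'<3. s = three_times r3 j \<and> s' = three_times r3 j' \<and>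
         ((3 * m + j, 3 * m' + j') \<in> set [(1, 4), (0, 6), (5, 8)] \<or> (3 * m' + j', 3 * m + j) \<in> set [(1, 4), (0, 6), (5, 8)]))"
    unfolding ex_less_3 three_times_def u[symmetric] by (elim disjE; simp; smt (verit) eq ne)
next
  fix m :: nat and s :: real
  assume s: "s \<in> {-1..1}"
  show "(if m = 0 then Complex s (s/2) else if m = 1 then Complex s (- s/2) else Complex s (- (1 - s\<^sup>2)\<^sup>2 / 2)) \<in> model_disc"
  proof -
    have "\<bar>- (1 - s\<^sup>2)\<^sup>2 / 2\<bar> \<le> 1" using bump_in[OF s] by linarith
    then show ?thesis unfolding model_disc_def using s by auto
  qed
next
  show "set [2, 3, 7] = {..<3 * 3} - (\<Union>(i, i')\<in>set [(1, 4), (0, 6), (5, 8)]. {i, i'::nat})" by auto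
qed (use three_times[OF r3(1,2)] in auto)

section \<open>Invariance of the bracket\<close>

text \<open>Rewriting \<open>1\<close> inside the parameters of the interpretations below would make their facts unusable.\<close>

declare One_nat_def [simp del]

text \<open>Powers on both sides avoid inverses, and make the relation symmetric and transitive
  without keeping track of the writhe.\<close>

definition proportional :: "diagram \<Rightarrow> diagram \<Rightarrow> bool" where
  "proportional D D' \<longleftrightarrow> (\<exists>a b :: nat. \<forall>w. w \<noteq> 0 \<longrightarrow>
     (- (w ^ 3)) ^ a * diag.bracket D w = (- (w ^ 3)) ^ b * diag.bracket D' w)"

lemma proportional_eq: "diag.bracket D' = diag.bracket D \<Longrightarrow> proportional D D'"
  unfolding proportional_def by (intro exI[of _ 0]) simp

lemma proportional_sym: "proportional D D' \<Longrightarrow> proportional D' D"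
  unfolding proportional_def by metis

lemma proportional_trans:
  assumes "proportional D D'" "proportional D' D''"
  shows "proportional D D''"
proof -
  from assms obtain a b a' b' :: nat where
    1: "\<And>w. w \<noteq> 0 \<Longrightarrow> (- (w ^ 3)) ^ a * diag.bracket D w = (- (w ^ 3)) ^ b * diag.bracket D' w" and
    2: "\<And>w. w \<noteq> 0 \<Longrightarrow> (- (w ^ 3)) ^ a' * diag.bracket D' w = (- (w ^ 3)) ^ b' * diag.bracket D'' w"
    unfolding proportional_def by blast
  have "(- (w ^ 3)) ^ (a + a') * diag.bracket D w = (- (w ^ 3)) ^ (b + b') * diag.bracket D'' w" if w: "w \<noteq> 0" for w
  proof -
    have "(- (w ^ 3)) ^ (a + a') * diag.bracket D w = (- (w ^ 3)) ^ a' * ((- (w ^ 3)) ^ a * diag.bracket D w)"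
      by (simp only: power_add mult_ac)
    also have "\<dots> = (- (w ^ 3)) ^ b * ((- (w ^ 3)) ^ a' * diag.bracket D' w)"
      unfolding 1[OF w] by (simp only: mult_ac)
    also have "\<dots> = (- (w ^ 3)) ^ (b + b') * diag.bracket D'' w"
      unfolding 2[OF w] by (simp only: power_add mult_ac)
    finally show ?thesis .
  qed
  then show ?thesis unfolding proportional_def by blast
qed

lemma move_I_proportional:
  assumes "virtual_link_diagram D" "virtual_link_diagram D'" "move_I D D'"
  shows "proportional D D'"
proof -
  let ?\<alpha> = "\<lambda>(_::nat) t. Complex t 0"
  let ?\<beta> = "\<lambda>(_::nat) t. Complex (t - 4 * t * (1 - t\<^sup>2)\<^sup>2) ((1 - t\<^sup>2)\<^sup>2 / 2)"
  obtain J where lm: "local_move 1 ?\<alpha> ?\<beta> J D D'" using assms(3) unfolding move_I_def by blast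
  obtain c a b \<tau> h where lp: "local_pair D D' 1 2 (two_times r1) ?\<alpha> [] [0, 1] ?\<beta> [(0, 1)] [] c a b \<tau> h"
    and "\<forall>m < 1. J m = {c m} \<times> {a m..b m}"
    by (rule local_move_pair[OF lm assms(1,2) model_I_before model_I_after]) (rule that)
  interpret local_pair D D' 1 2 "two_times r1" ?\<alpha> "[]" "[0, 1]" ?\<beta> "[(0, 1)]" "[]" c a b \<tau> h by (rule lp)
  let ?C = "real_pair D' (B.mk 0) (B.mk 1)" and ?z = "plane_at D' (B.mk 0)"
  have iA: "A.inner = {}" unfolding A.inner_def by simp
  have iB: "B.inner = (if ?C then {?z} else {})" unfolding B.inner_def by auto
  have pA: "A.inner_pairs Q = R1_before" for Q unfolding A.inner_pairs_def R1_before_def by simp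
  have pB: "B.inner_pairs Q = R1_after (B.smooth_type Q 0 1)" for Q unfolding B.inner_pairs_def R1_after_def by simp
  have st: "B.smooth_type (B.smoothed S) 0 1 = (if ?z \<in> S then Par else Anti)" if ?C for S
    using B.smooth_type_chord[OF that, of S] by simp
  have ct: "coded_tangle.count V R G (R1_after Thru) = coded_tangle.count V R G R1_before"
    "coded_tangle.count V R G (R1_after Anti) = coded_tangle.count V R G R1_before"
    "coded_tangle.count V R G (R1_after Par) = Suc (coded_tangle.count V R G R1_before)"
    if "coded_tangle V R (G :: nat \<Rightarrow> germ) 1 2" for V R G
    using coded_tangle.count_eq[OF that, of R1_before] coded_tangle.count_loop[OF that, of R1_before] R1_tangles
    by simp_all
  show ?thesis
  proof (cases ?C)
    case False
    have thru: "B.smooth_type Q 0 1 = Thru" for Q unfolding B.smooth_type_def using False by simp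
    have "1 * A.bracket w = 1 * B.bracket w" for w
      by (rule local_bracket) (use False in \<open>simp add: iA iB pA pB thru state_sum_empty ct\<close>)
    then show ?thesis by (intro proportional_eq) auto
  next
    case True
    let ?p = "B.positive ?z"
    \<comment> \<open>Both passages of the kink are on one arc, so \<open>Par\<close> is the
      smoothing along the orientation and splits off a circle. The sign of the kink only decides on
      which side the factor of \<open>R1_sum\<close> stands.\<close>
    have "(if ?p then - (w ^ 3) else 1) * A.bracket w = (if ?p then 1 else - (w ^ 3)) * B.bracket w" if w: "w \<noteq> 0" for w
    proof (rule local_bracket)
      fix V R and G :: "nat \<Rightarrow> germ" assume c: "coded_tangle V R G 1 2"
      show "(if ?p then - (w ^ 3) else 1) * state_sum A.inner A.positive (\<lambda>X. coded_tangle.count V R G (A.inner_pairs (A.smoothed X))) w =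
        (if ?p then 1 else - (w ^ 3)) * state_sum B.inner B.positive (\<lambda>X. coded_tangle.count V R G (B.inner_pairs (B.smoothed X))) w"
        using R1_sum[OF w, of "\<lambda>X. coded_tangle.count V R G (B.inner_pairs (B.smoothed X))" ?z True
            "coded_tangle.count V R G R1_before" B.positive] True
        by (simp add: iA iB pA pB st[OF True] state_sum_empty ct[OF c] split del: if_split)
    qed
    then have "\<forall>w. w \<noteq> 0 \<longrightarrow> (- (w ^ 3)) ^ (if ?p then 1 else 0) * A.bracket w = (- (w ^ 3)) ^ (if ?p then 0 else 1) * B.bracket w"
      by (cases ?p) simp_all
    then show ?thesis unfolding proportional_def by blast
  qed
qed

definition par :: "bool \<Rightarrow> smoothing" where
  "par x = (if x then Par else Anti)"

lemma move_II_proportional: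
  assumes "virtual_link_diagram D" "virtual_link_diagram D'" "move_II D D'"
  shows "proportional D D'"
proof -
  let ?\<alpha> = "\<lambda>(m::nat) t. if m = 0 then Complex t 0 else Complex t (1/2)"
  let ?\<beta> = "\<lambda>(m::nat) t. if m = 0 then Complex t 0 else Complex t (1/2 - (1 - t\<^sup>2)\<^sup>2)"
  let ?f = "\<lambda>(m::nat) t::real. if m = 0 then 0 else 1/2 - (1 - t\<^sup>2)\<^sup>2"
  let ?f' = "\<lambda>(m::nat) t::real. if m = 0 then 0 else 4 * t * (1 - t\<^sup>2)"
  obtain J s where lm: "local_move 2 ?\<alpha> ?\<beta> J D D'"
    and lab: "\<And>p. p \<in> J 0 \<Longrightarrow> double_preimage D' p \<Longrightarrow> label_at D' p = s"
    using assms(3) unfolding move_II_def by blast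
  obtain c a b \<tau> h where lp: "local_pair D D' 2 2 (two_times r2) ?\<alpha> [] [0, 1, 2, 3] ?\<beta> [(0, 2), (1, 3)] [] c a b \<tau> h"
    and J: "\<forall>m < 2. J m = {c m} \<times> {a m..b m}"
    by (rule local_move_pair[OF lm assms(1,2) model_II_before model_II_after]) (rule that)
  interpret local_pair D D' 2 2 "two_times r2" ?\<alpha> "[]" "[0, 1, 2, 3]" ?\<beta> "[(0, 2), (1, 3)]" "[]" c a b \<tau> h by (rule lp)
  define z w where "z = plane_at D' (B.mk 0)" "w = plane_at D' (B.mk 1)"
  note zw = this
  have ch: "(0, 2) \<in> set [(0::nat, 2::nat), (1, 3)]" "(1, 3) \<in> set [(0::nat, 2::nat), (1, 3)]" by auto
  have l: "label_at D' (B.mk i) = s" if "i = 0 \<or> i = 1" for i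
  proof (rule lab)
    have "i < 2 * 2" "i div 2 = 0" using that by auto
    then have "B.mk i \<in> {c 0} \<times> {a 0..b 0}" using B.mk_arc[of i] by (simp add: mem_Times_iff)
    then show "B.mk i \<in> J 0" using J by simp
    show "double_preimage D' (B.mk i)"
      unfolding double_preimage_def using that B.chord_double[OF ch(1)] B.chord_double[OF ch(2)] by blast
  qed
  have C: "real_pair D' (B.mk 0) (B.mk 2) \<longleftrightarrow> s \<noteq> Virt" "real_pair D' (B.mk 1) (B.mk 3) \<longleftrightarrow> s \<noteq> Virt"
    using B.real_chord[OF ch(1)] B.real_chord[OF ch(2)] l by auto
  have iA: "A.inner = {}" unfolding A.inner_def by simp
  have iB: "B.inner = (if s \<noteq> Virt then {z, w} else {})" unfolding B.inner_def zw using C by auto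
  have pA: "A.inner_pairs Q = R2_before" for Q unfolding A.inner_pairs_def R2_before_def by simp
  have pB: "B.inner_pairs Q = R2_after (B.smooth_type Q 0 2) (B.smooth_type Q 1 3)" for Q
    unfolding B.inner_pairs_def R2_after_def by simp
  have ct: "coded_tangle.count V R G (R2_after Thru Thru) = coded_tangle.count V R G R2_before"
    "coded_tangle.count V R G (R2_after Par Par) = coded_tangle.count V R G R2_before"
    "coded_tangle.count V R G (R2_after Anti Par) = coded_tangle.count V R G (R2_after Par Anti)"
    "coded_tangle.count V R G (R2_after Anti Anti) = Suc (coded_tangle.count V R G (R2_after Par Anti))"
    if "coded_tangle V R (G :: nat \<Rightarrow> germ) 2 2" for V R G
    using coded_tangle.count_eq[OF that, of R2_before] coded_tangle.count_eq[OF that, of "R2_after Par Anti"]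
      coded_tangle.count_loop[OF that, of "R2_after Par Anti"] R2_tangles
    by simp_all
  have "1 * A.bracket x = 1 * B.bracket x" if x: "x \<noteq> 0" for x
  proof (rule local_bracket)
    fix V R and G :: "nat \<Rightarrow> germ" assume c: "coded_tangle V R G 2 2"
    let ?L = "\<lambda>X. coded_tangle.count V R G (B.inner_pairs (B.smoothed X))"
    have "state_sum B.inner B.positive ?L x = (- (x\<^sup>2) - 1 / x\<^sup>2) ^ coded_tangle.count V R G R2_before"
    proof (cases "s = Virt")
      case True
      then have "B.smooth_type Q 0 2 = Thru" "B.smooth_type Q 1 3 = Thru" for Q
        unfolding B.smooth_type_def using C by auto
      then show ?thesis using True by (simp add: iB pB state_sum_empty ct[OF c])
    next
      case False
      then have Cs: "real_pair D' (B.mk 0) (B.mk 2)" "real_pair D' (B.mk 1) (B.mk 3)" using C by auto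
      define e where "e = (B.inc 0 = B.inc 1)"
      have graph: "?\<beta> m t = Complex t (?f m t)" for m t by simp
      have der: "(?f m has_real_derivative ?f' m t) (at t)" for m t
        by (cases "m = 0") (auto intro!: derivative_eq_intros simp: algebra_simps power2_eq_square)
      have d: "0 div 2 = (0::nat)" "2 div 2 = (1::nat)" "1 div 2 = (0::nat)" "3 div 2 = (1::nat)"
        "0 mod 2 = (0::nat)" "1 mod 2 = (1::nat)" by simp_all
      have r: "0 < r2" "r2\<^sup>2 < 1" using r2(1,2) by (auto simp: power_less_one_iff)
      \<comment> \<open>Arc 0 is horizontal, so the sign of the slope of arc 1 decides. The slopes
        at \<open>- r2\<close> and \<open>r2\<close> are opposite while arc 0 keeps its label, so
        \<open>Par\<close> is the A-smoothing at exactly one of the two crossings.\<close>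
      have pos: "B.positive z = (e = ((s = Over) = (B.direct = (0 < 4 * - r2 * (1 - r2\<^sup>2)))))"
        "B.positive w = (e = ((s = Over) = (B.direct = (0 < 4 * r2 * (1 - r2\<^sup>2)))))"
        using B.chord_positive[OF ch(1) Cs(1) graph der] B.chord_positive[OF ch(2) Cs(2) graph der] l
        unfolding zw e_def d two_times_def by (simp_all del: div_less)
      moreover have "0 < 4 * r2 * (1 - r2\<^sup>2)" using r by simp
      moreover from this have "\<not> 0 < 4 * - r2 * (1 - r2\<^sup>2)" by simp
      ultimately have opp: "(B.positive z = e) \<noteq> (B.positive w = e)" by auto
      have ne: "z \<noteq> w" using B.plane_mk_eq[OF ch(1), of 1] unfolding zw by auto
      have st: "B.smooth_type (B.smoothed S) 0 2 = par ((z \<in> S) = e)" "B.smooth_type (B.smoothed S) 1 3 = par ((w \<in> S) = e)" for S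
        using B.smooth_type_chord[OF Cs(1), of S] B.smooth_type_chord[OF Cs(2), of S] unfolding zw e_def par_def d by simp_all
      have "state_sum {z, w} B.positive ?L x =
        (- (x\<^sup>2) - 1 / x\<^sup>2) ^ (\<lambda>p q. coded_tangle.count V R G (R2_after (par p) (par q))) True True"
        by (rule R2_sum[OF x ne opp, where M = "coded_tangle.count V R G (R2_after Par Anti)"])
          (auto simp: pB st ct[OF c] par_def)
      then show ?thesis using False by (simp add: iB par_def ct[OF c])
    qed
    then show "1 * state_sum A.inner A.positive (\<lambda>X. coded_tangle.count V R G (A.inner_pairs (A.smoothed X))) x =
      1 * state_sum B.inner B.positive ?L x" by (simp add: iA pA state_sum_empty)
  qed
  then show ?thesis unfolding proportional_def by (intro exI[of _ 0]) simp
qed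

lemma one_sum:
  assumes "pos z = pos' z'" "\<And>S. L S = F ((z \<in> S) = i)" "\<And>S. L' S = F ((z' \<in> S) = i)"
  shows "state_sum {z} pos L A = state_sum {z'} pos' L' A"
  using state_sum_insert[of "{}" z pos L A i] state_sum_insert[of "{}" z' pos' L' A i] assms
  by (cases i) (simp_all add: state_sum_empty)

text \<open>The three crossings are matched by the pair of arcs that meet there. Labels, directions
  and the order of the slopes agree for matched crossings, hence so do the signs, and the claim
  reduces to \<open>R3_sum\<close> or, in the presence of virtual crossings, to a direct comparison
  of states.\<close>

lemma move_III_proportional:
  assumes "virtual_link_diagram D" "virtual_link_diagram D'" "move_III D D'"
  shows "proportional D D'"
proof -
  let ?\<alpha> = "\<lambda>(m::nat) t. if m = 0 then Complex t (t/2) else if m = 1 then Complex t (- t/2)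
            else Complex t ((1 - t\<^sup>2)\<^sup>2 / 2)"
  let ?\<beta> = "\<lambda>(m::nat) t. if m = 0 then Complex t (t/2) else if m = 1 then Complex t (- t/2)
            else Complex t (- (1 - t\<^sup>2)\<^sup>2 / 2)"
  let ?f = "\<lambda>(m::nat) t::real. if m = 0 then t/2 else if m = 1 then - t/2 else (1 - t\<^sup>2)\<^sup>2 / 2"
  let ?g = "\<lambda>(m::nat) t::real. if m = 0 then t/2 else if m = 1 then - t/2 else - (1 - t\<^sup>2)\<^sup>2 / 2"
  let ?f' = "\<lambda>(m::nat) t::real. if m = 0 then 1/2 else if m = 1 then - 1/2 else - (2 * t * (1 - t\<^sup>2))"
  let ?g' = "\<lambda>(m::nat) t::real. if m = 0 then 1/2 else if m = 1 then - 1/2 else 2 * t * (1 - t\<^sup>2)"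
  let ?cA = "[(1, 4), (2, 8), (3, 6)] :: (nat \<times> nat) list" and ?cB = "[(1, 4), (0, 6), (5, 8)] :: (nat \<times> nat) list"
  obtain J l where lm: "local_move 3 ?\<alpha> ?\<beta> J D D'" and ml: "move_III_labels l"
    and lab: "\<forall>m < 3. \<forall>m' < 3. m \<noteq> m' \<longrightarrow> (\<forall>p \<in> J m. \<forall>q \<in> J m'.
        (plane_at D p = plane_at D q \<longrightarrow> label_at D p = l m m') \<and>
        (plane_at D' p = plane_at D' q \<longrightarrow> label_at D' p = l m m'))"
    using assms(3) unfolding move_III_def by blast
  obtain c a b \<tau> h where lp: "local_pair D D' 3 3 (three_times r3) ?\<alpha> ?cA [0, 5, 7] ?\<beta> ?cB [2, 3, 7] c a b \<tau> h"
    and J: "\<forall>m < 3. J m = {c m} \<times> {a m..b m}"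
    by (rule local_move_pair[OF lm assms(1,2) model_III_before model_III_after]) (rule that)
  interpret local_pair D D' 3 3 "three_times r3" ?\<alpha> ?cA "[0, 5, 7]" ?\<beta> ?cB "[2, 3, 7]" c a b \<tau> h by (rule lp)
  have inJ: "A.mk i \<in> J (i div 3)" if "i < 9" for i
    using A.mk_arc[of i] J[rule_format, of "i div 3"] that by (simp add: mem_Times_iff less_mult_imp_div_less)
  have lA: "label_at D (A.mk i) = l (i div 3) (i' div 3)" if ch: "(i, i') \<in> set ?cA" for i i'
  proof -
    have "i < 9" "i' < 9" "i div 3 \<noteq> i' div 3" "i div 3 < 3" "i' div 3 < 3" using ch by auto
    moreover have "plane_at D (A.mk i) = plane_at D (A.mk i')"
      using A.chord_double[OF ch] unfolding double_pair_def by blast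
    ultimately show ?thesis using lab inJ by blast
  qed
  have lB: "label_at D' (A.mk i) = l (i div 3) (i' div 3)" if ch: "(i, i') \<in> set ?cB" for i i'
  proof -
    have "i < 9" "i' < 9" "i div 3 \<noteq> i' div 3" "i div 3 < 3" "i' div 3 < 3" using ch by auto
    moreover have "plane_at D' (A.mk i) = plane_at D' (A.mk i')"
      using B.chord_double[OF ch] unfolding double_pair_def by blast
    ultimately show ?thesis using lab inJ by blast
  qed
  have chA: "(1, 4) \<in> set ?cA" "(2, 8) \<in> set ?cA" "(3, 6) \<in> set ?cA"
    and chB: "(1, 4) \<in> set ?cB" "(0, 6) \<in> set ?cB" "(5, 8) \<in> set ?cB" by auto
  have d: "1 div 3 = (0::nat)" "2 div 3 = (0::nat)" "3 div 3 = (1::nat)" "4 div 3 = (1::nat)" "8 div 3 = (2::nat)"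
    "6 div 3 = (2::nat)" "0 div 3 = (0::nat)" "5 div 3 = (1::nat)"
    "0 mod 3 = (0::nat)" "1 mod 3 = (1::nat)" "2 mod 3 = (2::nat)" "3 mod 3 = (0::nat)" "5 mod 3 = (2::nat)" by simp_all
  note lAs = lA[OF chA(1), unfolded d] lA[OF chA(2), unfolded d] lA[OF chA(3), unfolded d]
  note lBs = lB[OF chB(1), unfolded d] lB[OF chB(2), unfolded d] lB[OF chB(3), unfolded d]
  note CA = A.real_chord[OF chA(1), unfolded lAs] A.real_chord[OF chA(2), unfolded lAs] A.real_chord[OF chA(3), unfolded lAs]
  note CB = B.real_chord[OF chB(1), unfolded lBs] B.real_chord[OF chB(2), unfolded lBs] B.real_chord[OF chB(3), unfolded lBs]
  define x y z where "x = plane_at D (A.mk 1)" "y = plane_at D (A.mk 2)" "z = plane_at D (A.mk 3)"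
  define x' y' z' where "x' = plane_at D' (A.mk 1)" "y' = plane_at D' (A.mk 0)" "z' = plane_at D' (A.mk 5)"
  note xyz = x_y_z_def x'_y'_z'_def
  define i j e where "i = (A.inc 0 = A.inc 1)" "j = (A.inc 0 = A.inc 2)" "e = (A.inc 1 = A.inc 2)"
  note ije = this
  have r: "0 < r3 * (1 - r3\<^sup>2)" using r3(1,2) by (simp add: power_less_one_iff)
  have graph: "?\<alpha> m t = Complex t (?f m t)" "?\<beta> m t = Complex t (?g m t)" for m t by simp_all
  have q: "((\<lambda>t::real. t / 2) has_real_derivative 1 / 2) (at t)"
    "((\<lambda>t::real. - t / 2) has_real_derivative - 1 / 2) (at t)"
    "((\<lambda>t::real. (1 - t\<^sup>2)\<^sup>2 / 2) has_real_derivative - (2 * t * (1 - t\<^sup>2))) (at t)"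
    "((\<lambda>t::real. - (1 - t\<^sup>2)\<^sup>2 / 2) has_real_derivative 2 * t * (1 - t\<^sup>2)) (at t)" for t
    by (auto intro!: derivative_eq_intros simp: field_simps power2_eq_square)
  have der: "(?f m has_real_derivative ?f' m t) (at t)" "(?g m has_real_derivative ?g' m t) (at t)" for m t
    by (cases "m = 0"; cases "m = 1"; simp only: if_True if_False simp_thms q)+
  \<comment> \<open>Each pair of arcs crosses with the same order of slopes before and after,
    although the crossings with arc 2 have moved.\<close>
  have sl: "(?f' 0 (three_times r3 1) < ?f' 1 (three_times r3 1)) = False"
    "(?f' 0 (three_times r3 2) < ?f' 2 (three_times r3 2)) = False"
    "(?f' 1 (three_times r3 0) < ?f' 2 (three_times r3 0)) = True"
    "(?g' 0 (three_times r3 1) < ?g' 1 (three_times r3 1)) = False"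
    "(?g' 0 (three_times r3 0) < ?g' 2 (three_times r3 0)) = False"
    "(?g' 1 (three_times r3 2) < ?g' 2 (three_times r3 2)) = True"
    by (simp add: three_times_def; (use r in linarith))+
  have posA: "A.positive x = (i = ((l 0 1 = Over) = (\<not> A.direct)))" if v: "l 0 1 \<noteq> Virt"
    using A.chord_positive[OF chA(1) CA(1)[THEN iffD2, OF v] graph(1) der(1)]
    unfolding xyz(1) ije(1) d lAs sl by simp
  have posA2: "A.positive y = (j = ((l 0 2 = Over) = (\<not> A.direct)))" if v: "l 0 2 \<noteq> Virt"
    using A.chord_positive[OF chA(2) CA(2)[THEN iffD2, OF v] graph(1) der(1)]
    unfolding xyz(2) ije(2) d lAs sl by simp
  have posA3: "A.positive z = (e = ((l 1 2 = Over) = A.direct))" if v: "l 1 2 \<noteq> Virt"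
    using A.chord_positive[OF chA(3) CA(3)[THEN iffD2, OF v] graph(1) der(1)]
    unfolding xyz(3) ije(3) d lAs sl by simp
  have posB: "B.positive x' = (i = ((l 0 1 = Over) = (\<not> A.direct)))" if v: "l 0 1 \<noteq> Virt"
    using B.chord_positive[OF chB(1) CB(1)[THEN iffD2, OF v] graph(2) der(2)]
    unfolding xyz(4) ije(1) d lBs sl by simp
  have posB2: "B.positive y' = (j = ((l 0 2 = Over) = (\<not> A.direct)))" if v: "l 0 2 \<noteq> Virt"
    using B.chord_positive[OF chB(2) CB(2)[THEN iffD2, OF v] graph(2) der(2)]
    unfolding xyz(5) ije(2) d lBs sl by simp
  have posB3: "B.positive z' = (e = ((l 1 2 = Over) = A.direct))" if v: "l 1 2 \<noteq> Virt"
    using B.chord_positive[OF chB(3) CB(3)[THEN iffD2, OF v] graph(2) der(2)]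
    unfolding xyz(6) ije(3) d lBs sl by simp
  note posA = posA posA2 posA3 and posB = posB posB2 posB3
  have iA: "A.inner = (if l 0 1 = Virt then {} else {x}) \<union> (if l 0 2 = Virt then {} else {y}) \<union> (if l 1 2 = Virt then {} else {z})"
    unfolding A.inner_def xyz using CA by auto
  have iB: "B.inner = (if l 0 1 = Virt then {} else {x'}) \<union> (if l 0 2 = Virt then {} else {y'}) \<union> (if l 1 2 = Virt then {} else {z'})"
    unfolding B.inner_def xyz using CB by auto
  have tA1: "A.smooth_type (A.smoothed S) 1 4 = (if l 0 1 = Virt then Thru else par ((x \<in> S) = i))" for S
  proof (cases "l 0 1 = Virt")
    case True
    then show ?thesis unfolding A.smooth_type_def using CA(1) by simp
  next
    case False
    then show ?thesis using A.smooth_type_chord[OF CA(1)[THEN iffD2, OF False], of S] unfolding xyz ije par_def d by simp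
  qed
  have tA2: "A.smooth_type (A.smoothed S) 2 8 = (if l 0 2 = Virt then Thru else par ((y \<in> S) = j))" for S
  proof (cases "l 0 2 = Virt")
    case True
    then show ?thesis unfolding A.smooth_type_def using CA(2) by simp
  next
    case False
    then show ?thesis using A.smooth_type_chord[OF CA(2)[THEN iffD2, OF False], of S] unfolding xyz ije par_def d by simp
  qed
  have tA3: "A.smooth_type (A.smoothed S) 3 6 = (if l 1 2 = Virt then Thru else par ((z \<in> S) = e))" for S
  proof (cases "l 1 2 = Virt")
    case True
    then show ?thesis unfolding A.smooth_type_def using CA(3) by simp
  next
    case False
    then show ?thesis using A.smooth_type_chord[OF CA(3)[THEN iffD2, OF False], of S] unfolding xyz ije par_def d by simp
  qed
  have tB1: "B.smooth_type (B.smoothed S) 1 4 = (if l 0 1 = Virt then Thru else par ((x' \<in> S) = i))" for S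
  proof (cases "l 0 1 = Virt")
    case True
    then show ?thesis unfolding B.smooth_type_def using CB(1) by simp
  next
    case False
    then show ?thesis using B.smooth_type_chord[OF CB(1)[THEN iffD2, OF False], of S] unfolding xyz ije par_def d by simp
  qed
  have tB2: "B.smooth_type (B.smoothed S) 0 6 = (if l 0 2 = Virt then Thru else par ((y' \<in> S) = j))" for S
  proof (cases "l 0 2 = Virt")
    case True
    then show ?thesis unfolding B.smooth_type_def using CB(2) by simp
  next
    case False
    then show ?thesis using B.smooth_type_chord[OF CB(2)[THEN iffD2, OF False], of S] unfolding xyz ije par_def d by simp
  qed
  have tB3: "B.smooth_type (B.smoothed S) 5 8 = (if l 1 2 = Virt then Thru else par ((z' \<in> S) = e))" for S
  proof (cases "l 1 2 = Virt")
    case True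
    then show ?thesis unfolding B.smooth_type_def using CB(3) by simp
  next
    case False
    then show ?thesis using B.smooth_type_chord[OF CB(3)[THEN iffD2, OF False], of S] unfolding xyz ije par_def d by simp
  qed
  note tA = tA1 tA2 tA3 and tB = tB1 tB2 tB3
  have pA: "A.inner_pairs Q = R3_before (A.smooth_type Q 1 4) (A.smooth_type Q 2 8) (A.smooth_type Q 3 6)" for Q
    unfolding A.inner_pairs_def R3_before_def by simp
  have pB: "B.inner_pairs Q = R3_after (B.smooth_type Q 1 4) (B.smooth_type Q 0 6) (B.smooth_type Q 5 8)" for Q
    unfolding B.inner_pairs_def R3_after_def by simp
  have dist: "distinct [x, y, z]" "distinct [x', y', z']"
    using A.plane_mk_eq[OF chA(1), of 2] A.plane_mk_eq[OF chA(1), of 3] A.plane_mk_eq[OF chA(2), of 3]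
      B.plane_mk_eq[OF chB(1), of 0] B.plane_mk_eq[OF chB(1), of 5] B.plane_mk_eq[OF chB(2), of 5]
    unfolding xyz by auto
  \<comment> \<open>Heights forbid the two cyclic patterns of over and under, which are the ones
    excluded in \<open>R3_sum\<close>. In the mixed move the single real crossing can be any of the
    three.\<close>
  consider (all) "l 0 1 \<noteq> Virt" "l 0 2 \<noteq> Virt" "l 1 2 \<noteq> Virt"
      "l 0 1 = Over \<Longrightarrow> l 1 2 = Over \<Longrightarrow> l 0 2 = Over" "l 0 1 \<noteq> Over \<Longrightarrow> l 1 2 \<noteq> Over \<Longrightarrow> l 0 2 \<noteq> Over"
    | (none) "l 0 1 = Virt" "l 0 2 = Virt" "l 1 2 = Virt"
    | (x) "l 0 1 \<noteq> Virt" "l 0 2 = Virt" "l 1 2 = Virt"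
    | (y) "l 0 1 = Virt" "l 0 2 \<noteq> Virt" "l 1 2 = Virt"
    | (z) "l 0 1 = Virt" "l 0 2 = Virt" "l 1 2 \<noteq> Virt"
  proof -
    note cases = that
    from ml show thesis
      unfolding move_III_labels_def
    proof (elim disjE exE conjE)
      fix height :: "nat \<Rightarrow> nat"
      assume "\<forall>m < 3. \<forall>m' < 3. m \<noteq> m' \<longrightarrow> l m m' = (if height m' < height m then Over else Under)"
      then have "l 0 1 = (if height 1 < height 0 then Over else Under)" "l 0 2 = (if height 2 < height 0 then Over else Under)"
        "l 1 2 = (if height 2 < height 1 then Over else Under)" by simp_all
      then show thesis by (intro cases(1)) (auto split: if_splits)
    next
      assume "\<forall>m < 3. \<forall>m' < 3. m \<noteq> m' \<longrightarrow> l m m' = Virt"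
      then show thesis by (intro cases(2)) simp_all
    next
      fix v assume v: "v < (3::nat)" and "\<forall>m < 3. \<forall>m' < 3. m \<noteq> m' \<longrightarrow> (l m m' = Virt \<longleftrightarrow> m = v \<or> m' = v)"
      then have "l 0 1 = Virt \<longleftrightarrow> v = 0 \<or> v = 1" "l 0 2 = Virt \<longleftrightarrow> v = 0 \<or> v = 2" "l 1 2 = Virt \<longleftrightarrow> v = 1 \<or> v = 2" by auto
      moreover have "v = 0 \<or> v = 1 \<or> v = 2" using v by auto
      ultimately show thesis using cases(3-5) by (elim disjE) simp_all
    qed
  qed
  note label_cases = this
  have "1 * A.bracket w = 1 * B.bracket w" if w: "w \<noteq> 0" for w
  proof (rule local_bracket)
    fix V R and G :: "nat \<Rightarrow> germ" assume ct: "coded_tangle V R G 3 3"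
    let ?n = "coded_tangle.count V R G"
    let ?L = "\<lambda>X. ?n (A.inner_pairs (A.smoothed X))" and ?L' = "\<lambda>X. ?n (B.inner_pairs (B.smoothed X))"
    have ce: "?n qs = ?n ps" if "tangle_eq 18 (tangle_ends 3 3) ps qs" for ps qs
      using coded_tangle.count_eq[OF ct, of ps qs] that by simp
    have cl: "?n qs = Suc (?n ps)" if "tangle_loop 18 (tangle_ends 3 3) ps qs" for ps qs
      using coded_tangle.count_loop[OF ct, of ps qs] that by simp
    note T = R3_tangles
    have "state_sum A.inner A.positive ?L w = state_sum B.inner B.positive ?L' w"
      using label_cases
    proof cases
      case all
      have "state_sum {x, y, z} A.positive ?L w = state_sum {x', y', z'} B.positive ?L' w"
      proof (rule R3_sum[OF w dist, where i = i and j = j and l = e and b = "?n (R3_before Par Par Anti)"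
            and c = "?n (R3_after Par Par Anti)"
            and F = "\<lambda>p q r. ?n (R3_before (par p) (par q) (par r))" and F' = "\<lambda>p q r. ?n (R3_after (par p) (par q) (par r))"])
        show "A.positive x = B.positive x'" "A.positive y = B.positive y'" "A.positive z = B.positive z'"
          using posA posB all by simp_all
        show "\<not> ((A.positive y = j) = (A.positive z = e) \<and> (A.positive x = i) \<noteq> (A.positive y = j))"
          using posA all by auto
        show "?n (R3_before (par True) (par False) (par True)) = ?n (R3_before Par Par Anti)"
          "?n (R3_before (par False) (par False) (par False)) = ?n (R3_before Par Par Anti)"
          "?n (R3_before (par True) (par False) (par False)) = Suc (?n (R3_before Par Par Anti))"
          "?n (R3_after (par False) (par True) (par True)) = ?n (R3_before Par Par Anti)"
          unfolding par_def using ce[OF T(1)] ce[OF T(2)] cl[OF T(4)] ce[OF T(3)] by simp_all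
        show "?n (R3_after (par True) (par False) (par True)) = ?n (R3_after Par Par Anti)"
          "?n (R3_after (par False) (par False) (par False)) = ?n (R3_after Par Par Anti)"
          "?n (R3_after (par True) (par False) (par False)) = Suc (?n (R3_after Par Par Anti))"
          "?n (R3_before (par False) (par True) (par True)) = ?n (R3_after Par Par Anti)"
          unfolding par_def using ce[OF T(5)] ce[OF T(6)] cl[OF T(8)] ce[OF T(7)] by simp_all
        show "?n (R3_before (par True) (par True) (par True)) = ?n (R3_after (par True) (par True) (par True))"
          "?n (R3_before (par False) (par True) (par False)) = ?n (R3_after (par False) (par True) (par False))"
          "?n (R3_before (par False) (par False) (par True)) = ?n (R3_after (par False) (par False) (par True))"
          unfolding par_def using ce[OF T(9)] ce[OF T(10)] ce[OF T(11)] by simp_all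
      qed (use all in \<open>simp_all add: pA pB tA tB, simp_all add: par_def\<close>)
      then show ?thesis using all by (simp add: iA iB insert_commute)
    next
      case none
      then show ?thesis by (simp add: iA iB state_sum_empty pA pB tA tB ce[OF T(12)])
    next
      case x
      have "state_sum {x} A.positive ?L w = state_sum {x'} B.positive ?L' w"
        by (rule one_sum[where i = i and F = "\<lambda>p. ?n (R3_before (par p) Thru Thru)"])
          (use posA posB x in \<open>simp_all add: pA pB tA tB par_def ce[OF T(13)] ce[OF T(14)]\<close>)
      then show ?thesis using x by (simp add: iA iB)
    next
      case y
      have "state_sum {y} A.positive ?L w = state_sum {y'} B.positive ?L' w"
        by (rule one_sum[where i = j and F = "\<lambda>p. ?n (R3_before Thru (par p) Thru)"])
          (use posA posB y in \<open>simp_all add: pA pB tA tB par_def ce[OF T(15)] ce[OF T(16)]\<close>)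
      then show ?thesis using y by (simp add: iA iB)
    next
      case z
      have "state_sum {z} A.positive ?L w = state_sum {z'} B.positive ?L' w"
        by (rule one_sum[where i = e and F = "\<lambda>p. ?n (R3_before Thru Thru (par p))"])
          (use posA posB z in \<open>simp_all add: pA pB tA tB par_def ce[OF T(17)] ce[OF T(18)]\<close>)
      then show ?thesis using z by (simp add: iA iB)
    qed
    then show "1 * state_sum A.inner A.positive ?L w = 1 * state_sum B.inner B.positive ?L' w" by simp
  qed
  then show ?thesis unfolding proportional_def by (intro exI[of _ 0]) simp
qed

lemma elementary_proportional:
  assumes "elementary_move D D'"
  shows "proportional D D'"
proof -
  have v: "virtual_link_diagram D" "virtual_link_diagram D'" using assms unfolding elementary_move_def by auto
  then have d: "diag D" "diag D'" by unfold_locales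
  show ?thesis
    using assms v d move_I_proportional move_II_proportional move_III_proportional
      proportional_eq[OF reparametrized_bracket] proportional_eq[OF planar_isotopic_bracket]
    unfolding elementary_move_def by blast
qed

lemma equivalent_proportional:
  assumes "equivalent_diagrams D D'"
  shows "proportional D D'"
  using assms unfolding equivalent_diagrams_def
proof (induction rule: equivclp_induct)
  case base
  show ?case by (rule proportional_eq) simp
next
  case (step y z)
  then show ?case using elementary_proportional proportional_sym proportional_trans by blast
qed

theorem corollary1p4:
  fixes D :: diagram
  assumes "v_alternating D"
  shows "\<not> (\<exists>C. classical_link_diagram C \<and> equivalent_diagrams D C)"
proof
  assume "\<exists>C. classical_link_diagram C \<and> equivalent_diagrams D C"
  then obtain C where C: "classical_link_diagram C" "equivalent_diagrams D C" by blast
  interpret C: diag C using C(1) unfolding classical_link_diagram_def by unfold_locales blast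
  have "\<exists>\<iota>. coherent (comps C) (real_pair C) \<iota>"
    by (rule C.classical_coherent) (use C(1) in \<open>auto simp: classical_link_diagram_def\<close>)
  then obtain \<kappa> where \<kappa>: "\<And>w. w \<noteq> 0 \<Longrightarrow> C.bracket (\<i> * w) = \<kappa> * C.bracket w"
    using C.coherent_rotate by blast
  obtain a b :: nat where ab: "\<And>w. w \<noteq> 0 \<Longrightarrow> (- (w ^ 3)) ^ a * diag.bracket D w = (- (w ^ 3)) ^ b * C.bracket w"
    using equivalent_proportional[OF C(2)] unfolding proportional_def by blast
  show False
  proof (rule v_alternating_not_rotating[OF assms, where \<kappa> = "(- \<i>) ^ b * \<kappa> / (- \<i>) ^ a"])
    fix w :: complex assume w: "w \<noteq> 0"
    let ?X = "- (w ^ 3)"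
    \<comment> \<open>Replacing \<open>w\<close> by \<open>\<i> * w\<close> multiplies
      \<open>- (w ^ 3)\<close> by -i. The powers on both sides therefore only change the constant,
      and the rotation property passes from the classical diagram to \<open>D\<close>.\<close>
    have "\<i> ^ 3 = - \<i>" by (simp add: power3_eq_cube)
    then have X: "- ((\<i> * w) ^ 3) = - \<i> * ?X" by (simp add: power_mult_distrib)
    have "(- \<i> * ?X) ^ a * diag.bracket D (\<i> * w) = (- \<i> * ?X) ^ b * C.bracket (\<i> * w)"
      by (rule ab[of "\<i> * w", unfolded X]) (use w in simp)
    then have "(- \<i>) ^ a * ?X ^ a * diag.bracket D (\<i> * w) = (- \<i>) ^ b * ?X ^ b * (\<kappa> * C.bracket w)"
      unfolding power_mult_distrib[of "- \<i>" ?X] \<kappa>[OF w] .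
    also have "\<dots> = (- \<i>) ^ b * \<kappa> * (?X ^ b * C.bracket w)" by (simp only: mult_ac)
    also have "\<dots> = (- \<i>) ^ b * \<kappa> * (?X ^ a * diag.bracket D w)" unfolding ab[OF w] ..
    finally have "?X ^ a * ((- \<i>) ^ a * diag.bracket D (\<i> * w)) = ?X ^ a * ((- \<i>) ^ b * \<kappa> * diag.bracket D w)"
      by (simp only: mult_ac)
    then have "(- \<i>) ^ a * diag.bracket D (\<i> * w) = (- \<i>) ^ b * \<kappa> * diag.bracket D w" using w by simp
    then show "diag.bracket D (\<i> * w) = (- \<i>) ^ b * \<kappa> / (- \<i>) ^ a * diag.bracket D w"
      by (simp add: field_simps)
  qed
qed

end
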